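(* Let $\mathcal{T}_h$ be a triangulation of a domain $\Omega\subset\mathbb{R}^2$ as described in the context, and let $V_h$ be the corresponding global finite element space of globally $C^1$ piecewise quintics built from the Argyris triangle. Let $u\in C^2(\Omega)\cap H^6(\mathcal{T}_h)$. There exists $\chi\in V_h$ such that for every $K\in\mathcal{T}_h$ and $0\le l\le 6$, $$|u-\chi|_{l,K}\le c\,h^{6-l}\,|u|_{6,\omega_K},\qquad h=\max_{K'\in\omega_K}h_{K'},$$ where $\omega_K$ is the collection of triangles that share a vertex with $K$ and $c$ is a constant independent of $u$ and of the mesh sizes.
   Context: $\mathcal{T}_h$ is a two-dimensional partition of $\Omega$ into triangles, or more precisely tri-sided cells: the peripheral cells (those having a side on $\partial\Omega$) may have one curved side, are convex, and contain a regular (straight-sided) triangle which is used to define the nodes. All triangles are shape-regular (minimum angle condition) and the mesh is locally quasi-uniform, i.e. diameters of adjacent triangles are commensurate. The cells are Lipschitz and starlike, in the sense that the set $S$ of points $\mathbf p$ of $K$ with $[\mathbf p,\mathbf x]\subset K$ for all $\mathbf x\in K$ has positive measure, and for some $\mathbf p\in S$ and constant $c_0>0$, $(\mathbf x-\mathbf p)\cdot\boldsymbol\nu\ge c_0\,\mathrm{diam}(K)$ for almost all $\mathbf x\in\partial K$, $\boldsymbol\nu$ being the unit outward normal. $h_K=\mathrm{diam}(K)$. Argyris triangle: $(K,\mathcal{P}_5(K),\Sigma_K)$, where $\mathcal{P}_5(K)$ is the space of polynomials of total degree at most $5$ and the 21 degrees of freedom are $$\Sigma_K=\{\partial^\alpha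 p(\mathbf a_{i,K}),\ i=1,2,3,\ |\alpha|\le 2;\quad \nabla p(\mathbf b_K^{ij})\cdot\mathbf n^{ij},\ 1\le i<j\le 3\},$$ where $\mathbf a_{i,K}$ are the vertices, $\mathbf b_K^{ij}$ are the midpoints of the edges and $\mathbf n^{ij}$ is a unit normal vector to the side $[\mathbf a_{i,K}\,\mathbf a_{j,K}]$ (for peripheral cells these are the vertices and sides of the contained straight triangle). $V_h$ is constructed as usual: it is spanned by the functions obtained by summing, for each node (vertex or edge midpoint) and each degree of freedom at that node, the local canonical (dual) basis functions over all cells containing the node, the normal direction at an edge midpoint being common to the two cells sharing the edge. The resulting functions are globally $C^1$ piecewise quintics. $H^m(\mathcal{T}_h)$ is the broken Sobolev space of functions whose restriction to each $K\in\mathcal{T}_h$ is in $H^m(K)$. $|v|_{l,K}^2=\sum_{|\alpha|=l}\|\partial^\alpha v\|_{L^2(K)}^2$ and $|v|_{l,\omega_K}^2=\sum_{K'\in\omega_K}|v|_{l,K'}^2$ (with $K\in\omega_K$).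
   Formalization: Ω is assumed to have no slits and not to touch itself at a boundary vertex (cells at each vertex form one fan), since otherwise common nodal values make the claim false; shape-regularity includes diam K ≤ κ·diam of the contained straight triangle, and c may depend on κ. *)

theory Defs
  imports "HOL-Analysis.Analysis"
begin

type_synonym pt = "real^2"
type_synonym mindex = "nat \<times> nat"

section \<open>Derivatives and Sobolev spaces in the plane\<close>

definition partial :: "2 \<Rightarrow> (pt \<Rightarrow> real) \<Rightarrow> pt \<Rightarrow> real" where
  "partial k f = (\<lambda>x. frechet_derivative f (at x) (axis k 1))"

definition grad :: "(pt \<Rightarrow> real) \<Rightarrow> pt \<Rightarrow> pt" where
  "grad f x = (\<chi> k. partial k f x)"

definition mderiv :: "mindex \<Rightarrow> (pt \<Rightarrow> real) \<Rightarrow> pt \<Rightarrow> real" where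
  "mderiv \<alpha> f = (partial 1 ^^ fst \<alpha>) ((partial 2 ^^ snd \<alpha>) f)"

definition mindices :: "nat \<Rightarrow> mindex set" where
  "mindices l = {\<alpha>. fst \<alpha> + snd \<alpha> = l}"

definition mindices_upto :: "nat \<Rightarrow> mindex set" where
  "mindices_upto m = {\<alpha>. fst \<alpha> + snd \<alpha> \<le> m}"

fun Ck_on :: "nat \<Rightarrow> pt set \<Rightarrow> (pt \<Rightarrow> real) \<Rightarrow> bool" where
  "Ck_on 0 U f \<longleftrightarrow> continuous_on U f"
| "Ck_on (Suc n) U f \<longleftrightarrow> (\<forall>x\<in>U. f differentiable (at x)) \<and> (\<forall>k. Ck_on n U (partial k f))"

definition test_function :: "pt set \<Rightarrow> (pt \<Rightarrow> real) \<Rightarrow> bool" where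
  "test_function U \<phi> \<longleftrightarrow>
     (\<forall>n. Ck_on n UNIV \<phi>) \<and> (\<exists>C. compact C \<and> C \<subseteq> U \<and> (\<forall>x. x \<notin> C \<longrightarrow> \<phi> x = 0))"

definition locally_integrable :: "pt set \<Rightarrow> (pt \<Rightarrow> real) \<Rightarrow> bool" where
  "locally_integrable U f \<longleftrightarrow> (\<forall>C. compact C \<and> C \<subseteq> U \<longrightarrow> set_integrable lebesgue C f)"

definition has_weak_deriv :: "pt set \<Rightarrow> mindex \<Rightarrow> (pt \<Rightarrow> real) \<Rightarrow> (pt \<Rightarrow> real) \<Rightarrow> bool" where
  "has_weak_deriv U \<alpha> f g \<longleftrightarrow> locally_integrable U f \<and> locally_integrable U g \<and>
     (\<forall>\<phi>. test_function U \<phi> \<longrightarrow>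
        (LINT x:U|lebesgue. f x * mderiv \<alpha> \<phi> x) =
        (- 1) ^ (fst \<alpha> + snd \<alpha>) * (LINT x:U|lebesgue. g x * \<phi> x))"

text \<open>A weak derivative is unique up to null sets, so the integrals below do not depend on the
  representative that is chosen.\<close>

definition weak_deriv :: "pt set \<Rightarrow> mindex \<Rightarrow> (pt \<Rightarrow> real) \<Rightarrow> pt \<Rightarrow> real" where
  "weak_deriv U \<alpha> f = (SOME g. has_weak_deriv U \<alpha> f g)"

definition square_integrable :: "pt set \<Rightarrow> (pt \<Rightarrow> real) \<Rightarrow> bool" where
  "square_integrable U f \<longleftrightarrow>
     set_borel_measurable lebesgue U f \<and> set_integrable lebesgue U (\<lambda>x. (f x)\<^sup>2)"

definition sobolev :: "nat \<Rightarrow> pt set \<Rightarrow> (pt \<Rightarrow> real) set" where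
  "sobolev m U = {f. \<forall>\<alpha>\<in>mindices_upto m. \<exists>g. has_weak_deriv U \<alpha> f g \<and> square_integrable U g}"

text \<open>Cells are closed sets; Sobolev spaces and seminorms on a cell refer to its interior.\<close>

definition sobolev_seminorm :: "nat \<Rightarrow> pt set \<Rightarrow> (pt \<Rightarrow> real) \<Rightarrow> real" where
  "sobolev_seminorm l K f =
     sqrt (\<Sum>\<alpha>\<in>mindices l. LINT x:interior K|lebesgue. (weak_deriv (interior K) \<alpha> f x)\<^sup>2)"

definition broken_sobolev :: "nat \<Rightarrow> pt set set \<Rightarrow> (pt \<Rightarrow> real) set" where
  "broken_sobolev m T = {f. \<forall>K\<in>T. f \<in> sobolev m (interior K)}"

section \<open>Geometry of a single cell\<close>

definition lipschitz_boundary :: "pt set \<Rightarrow> bool" where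
  "lipschitz_boundary K \<longleftrightarrow>
     (\<forall>x\<in>frontier K. \<exists>e e' r L. \<exists>f::real \<Rightarrow> real.
        norm e = 1 \<and> norm e' = 1 \<and> e \<bullet> e' = 0 \<and> r > 0 \<and> L-lipschitz_on UNIV f \<and>
        (\<forall>y\<in>ball x r. y \<in> K \<longleftrightarrow> y \<bullet> e \<le> f (y \<bullet> e')))"

text \<open>Sets of vanishing one-dimensional Hausdorff measure, i.e. of vanishing arc length when
  contained in the boundary of a Lipschitz cell.\<close>

definition H1_null :: "pt set \<Rightarrow> bool" where
  "H1_null N \<longleftrightarrow>
     (\<forall>\<epsilon>>0. \<exists>A :: nat \<Rightarrow> pt set. N \<subseteq> (\<Union>i. A i) \<and> (\<forall>i. bounded (A i)) \<and>
        summable (\<lambda>i. diameter (A i)) \<and> (\<Sum>i. diameter (A i)) < \<epsilon>)"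

text \<open>The unit vector \<open>\<nu>\<close> is the outward normal of \<open>K\<close> at the boundary point \<open>x\<close>: seen from \<open>x\<close>,
  the set \<open>K\<close> is to first order the half-plane opposite to \<open>\<nu>\<close>. In a local Lipschitz graph this
  says that the graph is differentiable at \<open>x\<close>.\<close>

definition outward_normal :: "pt set \<Rightarrow> pt \<Rightarrow> pt \<Rightarrow> bool" where
  "outward_normal K x \<nu> \<longleftrightarrow> norm \<nu> = 1 \<and>
     (\<forall>\<epsilon>>0. \<exists>\<delta>>0. \<forall>y. 0 < norm (y - x) \<and> norm (y - x) < \<delta> \<longrightarrow>
        ((y - x) \<bullet> \<nu> \<le> - \<epsilon> * norm (y - x) \<longrightarrow> y \<in> K) \<and>
        ((y - x) \<bullet> \<nu> \<ge> \<epsilon> * norm (y - x) \<longrightarrow> y \<notin> K))"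

definition star_centres :: "pt set \<Rightarrow> pt set" where
  "star_centres K = {p\<in>K. \<forall>x\<in>K. closed_segment p x \<subseteq> K}"

definition starlike_cell :: "real \<Rightarrow> pt set \<Rightarrow> bool" where
  "starlike_cell c0 K \<longleftrightarrow> emeasure lebesgue (star_centres K) > 0 \<and>
     (\<exists>p\<in>star_centres K. \<exists>N. H1_null N \<and>
        (\<forall>x\<in>frontier K - N. \<exists>\<nu>. outward_normal K x \<nu> \<and> (x - p) \<bullet> \<nu> \<ge> c0 * diameter K))"

definition vertex_angle :: "pt \<Rightarrow> pt \<Rightarrow> pt \<Rightarrow> real" where
  "vertex_angle a b c = arccos (((b - a) \<bullet> (c - a)) / (norm (b - a) * norm (c - a)))"

section \<open>Triangulations\<close>

text \<open>A mesh of a domain \<open>\<Omega>\<close> is a finite set \<open>T\<close> of closed cells together with a map \<open>vert\<close> that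
  assigns to each cell its three vertices; the straight triangle in \<open>K\<close> that carries the nodes is
  \<open>convex hull (vert K)\<close>.\<close>

text \<open>The second alternative is a peripheral cell: two straight sides, and a third, possibly
  curved, side that lies on the boundary of \<open>\<Omega>\<close>.\<close>

definition cell_shape :: "pt set \<Rightarrow> (pt set \<Rightarrow> pt set) \<Rightarrow> pt set \<Rightarrow> bool" where
  "cell_shape \<Omega> vert K \<longleftrightarrow>
     card (vert K) = 3 \<and> \<not> collinear (vert K) \<and>
     compact K \<and> convex K \<and> convex hull (vert K) \<subseteq> K \<and>
     (K = convex hull (vert K) \<or>
      (\<exists>a b c. vert K = {a, b, c} \<and>
         closed_segment a c \<union> closed_segment b c \<subseteq> frontier K \<and>
         frontier K - (closed_segment a c \<union> closed_segment b c) \<subseteq> frontier \<Omega>))"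

definition adjacent :: "(pt set \<Rightarrow> pt set) \<Rightarrow> pt set \<Rightarrow> pt set \<Rightarrow> bool" where
  "adjacent vert K K' \<longleftrightarrow> K \<noteq> K' \<and> card (vert K \<inter> vert K') = 2"

text \<open>The last clause says that the cells around a vertex form one fan, consecutive cells sharing
  an edge, so that \<open>\<Omega>\<close> does not touch itself at a boundary vertex; for a Lipschitz domain this is
  automatic. Without it a function in \<open>C\<^sup>2(\<Omega>)\<close> may have several boundary values
  at one boundary vertex.\<close>

definition conforming_mesh :: "pt set \<Rightarrow> pt set set \<Rightarrow> (pt set \<Rightarrow> pt set) \<Rightarrow> bool" where
  "conforming_mesh \<Omega> T vert \<longleftrightarrow>
     open \<Omega> \<and> connected \<Omega> \<and> \<Omega> \<noteq> {} \<and>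
     finite T \<and> closure \<Omega> = \<Union>T \<and> \<Omega> = interior (\<Union>T) \<and>
     (\<forall>K\<in>T. cell_shape \<Omega> vert K) \<and>
     (\<forall>K\<in>T. \<forall>K'\<in>T. K \<noteq> K' \<longrightarrow>
        interior K \<inter> interior K' = {} \<and> K \<inter> K' = convex hull (vert K \<inter> vert K')) \<and>
     (\<forall>a. \<forall>K\<in>T. \<forall>K'\<in>T. a \<in> vert K \<and> a \<in> vert K' \<longrightarrow>
        (K, K') \<in> {(L, L'). L \<in> T \<and> L' \<in> T \<and> a \<in> vert L \<inter> vert L' \<and> adjacent vert L L'}\<^sup>*)"

text \<open>\<open>\<theta>\<close> is the minimum angle, \<open>\<kappa>\<close> compares a (curved) cell with the straight triangle in it,
  \<open>\<gamma>\<close> is the local quasi-uniformity constant and \<open>c0\<close> the starlikeness constant.\<close>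

definition regular_mesh ::
  "real \<Rightarrow> real \<Rightarrow> real \<Rightarrow> real \<Rightarrow> pt set set \<Rightarrow> (pt set \<Rightarrow> pt set) \<Rightarrow> bool" where
  "regular_mesh \<theta> \<kappa> \<gamma> c0 T vert \<longleftrightarrow>
     (\<forall>K\<in>T. \<forall>a b c. vert K = {a, b, c} \<longrightarrow> vertex_angle a b c \<ge> \<theta>) \<and>
     (\<forall>K\<in>T. diameter K \<le> \<kappa> * diameter (convex hull (vert K))) \<and>
     (\<forall>K\<in>T. \<forall>K'\<in>T. adjacent vert K K' \<longrightarrow> diameter K \<le> \<gamma> * diameter K') \<and>
     (\<forall>K\<in>T. lipschitz_boundary K \<and> starlike_cell c0 K)"

definition patch :: "pt set set \<Rightarrow> (pt set \<Rightarrow> pt set) \<Rightarrow> pt set \<Rightarrow> pt set set" where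
  "patch T vert K = {K'\<in>T. vert K \<inter> vert K' \<noteq> {}}"

definition patch_size :: "pt set set \<Rightarrow> (pt set \<Rightarrow> pt set) \<Rightarrow> pt set \<Rightarrow> real" where
  "patch_size T vert K = Max (diameter ` patch T vert K)"

definition patch_seminorm ::
  "nat \<Rightarrow> pt set set \<Rightarrow> (pt set \<Rightarrow> pt set) \<Rightarrow> pt set \<Rightarrow> (pt \<Rightarrow> real) \<Rightarrow> real" where
  "patch_seminorm l T vert K f = sqrt (\<Sum>K'\<in>patch T vert K. (sobolev_seminorm l K' f)\<^sup>2)"

section \<open>The Argyris element\<close>

definition polys :: "nat \<Rightarrow> (pt \<Rightarrow> real) set" where
  "polys m = {p. \<exists>c :: mindex \<Rightarrow> real.
     p = (\<lambda>x. \<Sum>\<alpha>\<in>mindices_upto m. c \<alpha> * (x$1) ^ fst \<alpha> * (x$2) ^ snd \<alpha>)}"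

text \<open>An edge is represented by the set of its two end points.\<close>

definition edges :: "(pt set \<Rightarrow> pt set) \<Rightarrow> pt set \<Rightarrow> pt set set" where
  "edges vert K = {e. e \<subseteq> vert K \<and> card e = 2}"

definition edge_midpoint :: "pt set \<Rightarrow> pt" where
  "edge_midpoint e = (1/2) *\<^sub>R (\<Sum>a\<in>e. a)"

text \<open>The normal depends on the edge only, hence is common to the two cells that share it.\<close>

definition edge_normals ::
  "pt set set \<Rightarrow> (pt set \<Rightarrow> pt set) \<Rightarrow> (pt set \<Rightarrow> pt) \<Rightarrow> bool" where
  "edge_normals T vert nrm \<longleftrightarrow>
     (\<forall>K\<in>T. \<forall>a\<in>vert K. \<forall>b\<in>vert K. a \<noteq> b \<longrightarrow>
        norm (nrm {a, b}) = 1 \<and> nrm {a, b} \<bullet> (b - a) = 0)"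

datatype dof = Vertex_Dof pt mindex | Edge_Dof "pt set"

fun dof_value :: "(pt set \<Rightarrow> pt) \<Rightarrow> dof \<Rightarrow> (pt \<Rightarrow> real) \<Rightarrow> real" where
  "dof_value nrm (Vertex_Dof a \<alpha>) p = mderiv \<alpha> p a"
| "dof_value nrm (Edge_Dof e) p = grad p (edge_midpoint e) \<bullet> nrm e"

definition cell_dofs :: "(pt set \<Rightarrow> pt set) \<Rightarrow> pt set \<Rightarrow> dof set" where
  "cell_dofs vert K =
     {Vertex_Dof a \<alpha> | a \<alpha>. a \<in> vert K \<and> \<alpha> \<in> mindices_upto 2} \<union> Edge_Dof ` edges vert K"

definition local_basis ::
  "(pt set \<Rightarrow> pt set) \<Rightarrow> (pt set \<Rightarrow> pt) \<Rightarrow> pt set \<Rightarrow> dof \<Rightarrow> pt \<Rightarrow> real" where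
  "local_basis vert nrm K d =
     (if d \<in> cell_dofs vert K
      then THE p. p \<in> polys 5 \<and>
             (\<forall>d'\<in>cell_dofs vert K. dof_value nrm d' p = (if d' = d then 1 else 0))
      else (\<lambda>x. 0))"

definition mesh_dofs :: "pt set set \<Rightarrow> (pt set \<Rightarrow> pt set) \<Rightarrow> dof set" where
  "mesh_dofs T vert = (\<Union>K\<in>T. cell_dofs vert K)"

text \<open>The sum, over the cells containing the node, of the local basis functions, each extended by
  zero outside its cell; on the union of the mesh, the value at \<open>x\<close> is that of the local function
  of a cell containing \<open>x\<close>. On a common edge the local functions of both cells agree, so the choice
  of the cell is immaterial and the value is not counted twice.\<close>

definition global_basis ::
  "pt set set \<Rightarrow> (pt set \<Rightarrow> pt set) \<Rightarrow> (pt set \<Rightarrow> pt) \<Rightarrow> dof \<Rightarrow> pt \<Rightarrow> real" where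
  "global_basis T vert nrm d x =
     (if x \<in> \<Union>T then local_basis vert nrm (SOME K. K \<in> T \<and> x \<in> K) d x else 0)"

definition argyris_space ::
  "pt set set \<Rightarrow> (pt set \<Rightarrow> pt set) \<Rightarrow> (pt set \<Rightarrow> pt) \<Rightarrow> (pt \<Rightarrow> real) set" where
  "argyris_space T vert nrm =
     {v. \<exists>c :: dof \<Rightarrow> real. v = (\<lambda>x. \<Sum>d\<in>mesh_dofs T vert. c d * global_basis T vert nrm d x)}"

end

theory Submission
  imports Defs
begin

text \<open>
  The approximant is the Argyris interpolant of \<open>u\<close>: its degrees of freedom are the traces of the
  derivatives of \<open>u\<close> at the nodes, taken from inside a cell that contains the node. Two things make
  this work: these traces exist and do not depend on the cell, and on each cell \<open>K\<close> the interpolation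
  error of order \<open>l\<close> is at most a constant times \<open>diameter K ^ (6 - l)\<close> times the sixth order seminorm
  of \<open>u\<close>. The diameter and the seminorm of \<open>K\<close> are then bounded by those of its patch.

  The interior \<open>U\<close> of a cell is a bounded convex open set. There is a quintic
  \<open>q\<close> such that \<open>w = u - q\<close> and all its weak derivatives of order at most five have mean zero over \<open>U\<close>
  (\<open>moment_polynomial\<close>). The sixth derivatives of \<open>q\<close> vanish, so \<open>w\<close> and \<open>u\<close> have the same sixth order
  seminorm. A Poincare inequality (\<open>poincare_convex\<close>), applied once for each order, bounds every lower
  order seminorm of \<open>w\<close> by the sixth one with the correct power of the diameter. A Sobolev inequality
  in the plane (\<open>sobolev_sup_convex\<close>) turns this into pointwise bounds for the derivatives of order at
  most four. Hence the derivatives of order at most three are Lipschitz and have bounded traces on the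
  closed cell (\<open>jet_trace\<close>). Both inequalities come from Taylor formulas along segments that hold almost
  everywhere for weak derivatives (\<open>weak_taylor_1\<close>, \<open>weak_taylor_2\<close>). These formulas are dual to the
  classical ones for test functions and follow from Fubini's theorem and the fundamental lemma of the
  calculus of variations. All constants are explicit and depend on \<open>U\<close>
  only through the ratio of its area to the square of its diameter.

  The difference \<open>R\<close> of the interpolant and \<open>q\<close> is a quintic whose degrees
  of freedom are traces of \<open>w\<close>, hence small. In affine coordinates of the triangle its 21 coefficients
  are computed by explicit elimination, which shows at the same time that the element is unisolvent and
  that the coefficients are bounded by the scaled degrees of freedom (\<open>argyris_coefficient_bound\<close>). The
  element is not affine equivalent, since a normal derivative is not mapped to a normal derivative; but
  the tangential derivative at an edge midpoint is determined by the data at the two end points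
  (\<open>edge_hermite\<close>), and with it a normal derivative controls any transversal one
  (\<open>transversal_bound\<close>). So \<open>u\<close> minus the interpolant, which is \<open>w - R\<close>, has the desired bound.

  The interior points of an edge shared by two cells lie in \<open>\<Omega>\<close>
  (\<open>open_edge_in_domain\<close>), where \<open>u\<close> is twice continuously differentiable. Hence the two cells give the
  same normal derivative at the midpoint, and, by approaching an end point along the edge, the same
  traces there. Around a vertex this passes from cell to cell through the fan of cells that meet in it.
\<close>

section \<open>Calculus of partial derivatives\<close>

lemma partial_has_derivative:
  "(f has_derivative f') (at x) \<Longrightarrow> partial k f x = f' (axis k 1)"
  unfolding partial_def using frechet_derivative_at by metis

lemma pt_decomp: "(h::pt) = h$1 *\<^sub>R axis 1 1 + h$2 *\<^sub>R axis 2 1"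
  by (simp add: vec_eq_iff forall_2 axis_def)

lemma has_derivative_partials:
  assumes "f differentiable (at x)"
  shows "(f has_derivative (\<lambda>h. h$1 * partial 1 f x + h$2 * partial 2 f x)) (at x)"
proof -
  have f: "(f has_derivative frechet_derivative f (at x)) (at x)"
    using assms frechet_derivative_works by blast
  then interpret linear "frechet_derivative f (at x)"
    using has_derivative_linear by blast
  have "frechet_derivative f (at x) h = h$1 * partial 1 f x + h$2 * partial 2 f x" for h
    by (subst pt_decomp[of h]) (simp add: add scale partial_def)
  then have "frechet_derivative f (at x) = (\<lambda>h. h$1 * partial 1 f x + h$2 * partial 2 f x)"
    by blast
  then show ?thesis using f by simp
qed

lemma partial_cong:
  assumes "open U" "x \<in> U" "\<And>y. y \<in> U \<Longrightarrow> f y = g y" "f differentiable (at x)"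
  shows "partial k f x = partial k g x"
  using assms frechet_derivative_transform_within_open[of f x U g] by (simp add: partial_def)

lemma partial_const [simp]: "partial k (\<lambda>x. c) = (\<lambda>x. 0)"
  by (simp add: partial_def)

lemma partial_add:
  assumes "f differentiable (at x)" "g differentiable (at x)"
  shows "partial k (\<lambda>x. f x + g x) x = partial k f x + partial k g x"
  using has_derivative_add[OF assms[THEN has_derivative_partials]] exhaust_2[of k]
  by (auto simp: partial_has_derivative axis_def)

lemma partial_mult:
  assumes "f differentiable (at x)" "g differentiable (at x)"
  shows "partial k (\<lambda>x. f x * g x) x = partial k f x * g x + f x * partial k g x"
  using has_derivative_mult[OF assms[THEN has_derivative_partials]] exhaust_2[of k]
  by (auto simp: partial_has_derivative axis_def)

lemma partial_cmult:
  assumes "f differentiable (at x)"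
  shows "partial k (\<lambda>x. c * f x) x = c * partial k f x"
  using partial_mult[of "\<lambda>x. c" x f k] assms by simp

lemma partial_shift:
  assumes "f differentiable (at (x + h))"
  shows "partial k (\<lambda>x. f (x + h)) x = partial k f (x + h)"
    and "(\<lambda>x. f (x + h)) differentiable (at x)"
proof -
  have "((\<lambda>x. f (x + h)) has_derivative (\<lambda>d. d$1 * partial 1 f (x+h) + d$2 * partial 2 f (x+h))) (at x)"
    using has_derivative_partials[OF assms]
    by (rule has_derivative_compose[rotated]) (auto intro!: derivative_eq_intros)
  from partial_has_derivative[OF this, of k] show "partial k (\<lambda>x. f (x + h)) x = partial k f (x + h)"
    using exhaust_2[of k] by (auto simp: axis_def)
  show "(\<lambda>x. f (x + h)) differentiable (at x)"
    using \<open>(_ has_derivative _) (at x)\<close> differentiableI by blast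
qed

lemma Ck_on_subset: "Ck_on n U f \<Longrightarrow> V \<subseteq> U \<Longrightarrow> Ck_on n V f"
  by (induction n arbitrary: f) (auto intro: continuous_on_subset)

lemma Ck_on_imp_continuous: "Ck_on n U f \<Longrightarrow> continuous_on U f"
  by (cases n) (auto intro!: continuous_at_imp_continuous_on differentiable_imp_continuous_within)

lemma Ck_on_SucD: "Ck_on (Suc n) U f \<Longrightarrow> Ck_on n U f"
proof (induction n arbitrary: f)
  case 0 then show ?case using Ck_on_imp_continuous[OF 0] by simp
next
  case (Suc n)
  have "f differentiable (at x)" if "x \<in> U" for x using Suc.prems that by simp
  moreover have "Ck_on n U (partial k f)" for k using Suc.prems Suc.IH by simp
  ultimately show ?case by simp
qed

lemma Ck_on_cong:
  assumes "open U" "\<And>x. x \<in> U \<Longrightarrow> f x = g x" "Ck_on n U f"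
  shows "Ck_on n U g"
  using assms(2,3)
proof (induction n arbitrary: f g)
  case 0 then show ?case using continuous_on_eq[of U f g] by auto
next
  case (Suc n)
  have d: "f differentiable (at x)" if "x \<in> U" for x using Suc.prems(2) that by simp
  have g: "g differentiable (at x)" if "x \<in> U" for x
    using has_derivative_transform_within_open[OF has_derivative_partials[OF d[OF that]] assms(1) that]
      Suc.prems(1) differentiableI by blast
  have "Ck_on n U (partial k g)" for k
  proof (rule Suc.IH)
    show "Ck_on n U (partial k f)" using Suc.prems(2) by simp
    show "partial k f x = partial k g x" if "x \<in> U" for x
      using partial_cong[OF assms(1) that] Suc.prems(1) d[OF that] by blast
  qed
  with g show ?case by simp
qed

lemma Ck_on_const [simp]: "Ck_on n U (\<lambda>x. c)"
  by (induction n arbitrary: c) auto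

lemma Ck_on_add:
  assumes "open U" "Ck_on n U f" "Ck_on n U g"
  shows "Ck_on n U (\<lambda>x. f x + g x)"
  using assms(2,3)
proof (induction n arbitrary: f g)
  case 0 then show ?case by (simp add: continuous_on_add)
next
  case (Suc n)
  have "Ck_on n U (\<lambda>x. partial k f x + partial k g x)" for k
    using Suc by simp
  then have "Ck_on n U (partial k (\<lambda>x. f x + g x))" for k
    by (rule Ck_on_cong[OF assms(1), rotated]) (use Suc.prems in \<open>auto simp: partial_add\<close>)
  with Suc.prems show ?case by simp
qed

lemma Ck_on_mult:
  assumes "open U" "Ck_on n U f" "Ck_on n U g"
  shows "Ck_on n U (\<lambda>x. f x * g x)"
  using assms(2,3)
proof (induction n arbitrary: f g)
  case 0 then show ?case by (simp add: continuous_on_mult)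
next
  case (Suc n)
  have "Ck_on n U f" "Ck_on n U g" using Suc.prems Ck_on_SucD by blast+
  then have "Ck_on n U (\<lambda>x. partial k f x * g x + f x * partial k g x)" for k
    using Suc by (intro Ck_on_add assms(1)) auto
  then have "Ck_on n U (partial k (\<lambda>x. f x * g x))" for k
    by (rule Ck_on_cong[OF assms(1), rotated]) (use Suc.prems in \<open>auto simp: partial_mult\<close>)
  with Suc.prems show ?case by simp
qed

lemma Ck_on_diff:
  assumes "open U" "Ck_on n U f" "Ck_on n U g"
  shows "Ck_on n U (\<lambda>x. f x - g x)"
  using Ck_on_add[OF assms(1,2) Ck_on_mult[OF assms(1) Ck_on_const[of n U "-1"] assms(3)]] by simp

lemma partial_nth: "partial k (\<lambda>x. x$i) = (\<lambda>x. if k = i then 1 else 0)"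
proof
  fix x
  have "((\<lambda>x::pt. x$i) has_derivative (\<lambda>h. h$i)) (at x)"
    by (rule bounded_linear_imp_has_derivative[OF bounded_linear_vec_nth])
  from partial_has_derivative[OF this] show "partial k (\<lambda>x. x$i) x = (if k = i then 1 else 0)"
    by (simp add: axis_def)
qed

lemma Ck_on_nth: "Ck_on n U (\<lambda>x. x$i)"
proof (cases n)
  case 0 then show ?thesis by (auto intro!: continuous_intros)
next
  case (Suc m)
  have "(\<lambda>x::pt. x$i) differentiable (at x)" for x
    by (rule differentiableI[OF bounded_linear_imp_has_derivative[OF bounded_linear_vec_nth]])
  then show ?thesis using Suc by (simp add: partial_nth)
qed

lemma Ck_on_power:
  "open U \<Longrightarrow> Ck_on n U f \<Longrightarrow> Ck_on n U (\<lambda>x. f x ^ m)"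
  by (induction m) (auto intro: Ck_on_mult)

definition smooth :: "(pt \<Rightarrow> real) \<Rightarrow> bool" where "smooth f \<longleftrightarrow> (\<forall>n. Ck_on n UNIV f)"

lemma smooth_differentiable: "smooth f \<Longrightarrow> f differentiable (at x)"
  unfolding smooth_def by (drule spec[of _ "Suc 0"]) simp

lemma smooth_partial: "smooth f \<Longrightarrow> smooth (partial k f)"
  unfolding smooth_def by (metis Ck_on.simps(2))

lemma smooth_continuous: "smooth f \<Longrightarrow> continuous_on S f"
  using Ck_on_imp_continuous continuous_on_subset unfolding smooth_def by blast

lemma smooth_coinduct:
  assumes "f \<in> S" "\<And>f x. f \<in> S \<Longrightarrow> f differentiable (at x)" "\<And>f k. f \<in> S \<Longrightarrow> partial k f \<in> S"
  shows "smooth f"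
proof -
  have "Ck_on n UNIV f" for n
    using assms(1)
    by (induction n arbitrary: f)
      (auto intro!: assms(2,3) continuous_at_imp_continuous_on differentiable_imp_continuous_within)
  then show ?thesis by (simp add: smooth_def)
qed

lemma smooth_mult: "smooth f \<Longrightarrow> smooth g \<Longrightarrow> smooth (\<lambda>x. f x * g x)"
  and smooth_add: "smooth f \<Longrightarrow> smooth g \<Longrightarrow> smooth (\<lambda>x. f x + g x)"
  and smooth_diff: "smooth f \<Longrightarrow> smooth g \<Longrightarrow> smooth (\<lambda>x. f x - g x)"
  and smooth_const: "smooth (\<lambda>x. c)"
  unfolding smooth_def by (auto intro: Ck_on_mult Ck_on_add Ck_on_diff)

lemma smooth_shift: "smooth f \<Longrightarrow> smooth (\<lambda>x. f (x + h))"
proof (rule smooth_coinduct[of _ "{\<lambda>x. g (x + h) |g. smooth g}"])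
  fix f k assume "f \<in> {\<lambda>x. g (x + h) |g. smooth g}"
  then obtain g where g: "f = (\<lambda>x. g (x + h))" "smooth g" by blast
  have "partial k f = (\<lambda>x. partial k g (x + h))"
    using g partial_shift(1) smooth_differentiable by fastforce
  then show "partial k f \<in> {\<lambda>x. g (x + h) |g. smooth g}" using g smooth_partial by blast
qed (auto intro: partial_shift(2) smooth_differentiable)

text \<open>The mean value theorem applied twice expresses the mixed second difference through
\<open>partial l (partial k f)\<close>. The difference is symmetric in \<open>k\<close> and \<open>l\<close>, so the same number is also
expressed through \<open>partial k (partial l f)\<close>, and letting \<open>t\<close> tend to zero shows that partial
derivatives commute.\<close>

lemma mixed_second_difference:
  assumes f: "smooth f" and t: "t > 0"
  shows "\<exists>\<xi> \<eta>. 0 < \<xi> \<and> \<xi> < t \<and> 0 < \<eta> \<and> \<eta> < t \<and>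
    f (x + t *\<^sub>R axis k 1 + t *\<^sub>R axis l 1) - f (x + t *\<^sub>R axis k 1) - f (x + t *\<^sub>R axis l 1) + f x
      = t\<^sup>2 * partial l (partial k f) (x + \<xi> *\<^sub>R axis k 1 + \<eta> *\<^sub>R axis l 1)"
proof -
  have D: "((\<lambda>s. g (y + s *\<^sub>R axis j 1)) has_real_derivative partial j g (y + s *\<^sub>R axis j 1)) (at s)"
    if "smooth g" for g y j s
  proof -
    have "((\<lambda>s. g (y + s *\<^sub>R axis j 1)) has_derivative
      (\<lambda>d. (d *\<^sub>R axis j 1)$1 * partial 1 g (y + s *\<^sub>R axis j 1) + (d *\<^sub>R axis j 1)$2 * partial 2 g (y + s *\<^sub>R axis j 1))) (at s)"
      by (rule has_derivative_compose[OF _ has_derivative_partials[OF smooth_differentiable[OF that]]])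
        (auto intro!: derivative_eq_intros)
    moreover have "(\<lambda>d. (d *\<^sub>R axis j 1)$1 * partial 1 g (y + s *\<^sub>R axis j 1) + (d *\<^sub>R axis j 1)$2 * partial 2 g (y + s *\<^sub>R axis j 1))
      = (*) (partial j g (y + s *\<^sub>R axis j 1))"
      using exhaust_2[of j] by (auto simp: axis_def fun_eq_iff)
    ultimately show ?thesis by (simp add: has_field_derivative_def)
  qed
  let ?g = "\<lambda>s. f ((x + t *\<^sub>R axis l 1) + s *\<^sub>R axis k 1) - f (x + s *\<^sub>R axis k 1)"
  have "\<exists>\<xi>. 0 < \<xi> \<and> \<xi> < t \<and> ?g t - ?g 0 = (t - 0) * (partial k f ((x + t *\<^sub>R axis l 1) + \<xi> *\<^sub>R axis k 1) - partial k f (x + \<xi> *\<^sub>R axis k 1))"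
    by (intro MVT2[OF t] DERIV_diff D f)
  then obtain \<xi> where xi: "0 < \<xi>" "\<xi> < t" and 1: "?g t - ?g 0 = t * (partial k f ((x + t *\<^sub>R axis l 1) + \<xi> *\<^sub>R axis k 1) - partial k f (x + \<xi> *\<^sub>R axis k 1))"
    by auto
  let ?k = "\<lambda>s. partial k f ((x + \<xi> *\<^sub>R axis k 1) + s *\<^sub>R axis l 1)"
  have "\<exists>\<eta>. 0 < \<eta> \<and> \<eta> < t \<and> ?k t - ?k 0 = (t - 0) * partial l (partial k f) ((x + \<xi> *\<^sub>R axis k 1) + \<eta> *\<^sub>R axis l 1)"
    by (intro MVT2[OF t] D f smooth_partial)
  then obtain \<eta> where eta: "0 < \<eta>" "\<eta> < t" and 2: "?k t - ?k 0 = t * partial l (partial k f) ((x + \<xi> *\<^sub>R axis k 1) + \<eta> *\<^sub>R axis l 1)"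
    by auto
  have "?g t - ?g 0 = t * (?k t - ?k 0)" using 1 by (simp add: add_ac)
  then have "?g t - ?g 0 = t\<^sup>2 * partial l (partial k f) (x + \<xi> *\<^sub>R axis k 1 + \<eta> *\<^sub>R axis l 1)"
    unfolding 2 by (simp add: power2_eq_square)
  with xi eta show ?thesis by (intro exI[of _ \<xi>] exI[of _ \<eta>]) (simp add: add_ac)
qed

lemma partial_commute:
  assumes f: "smooth f"
  shows "partial k (partial l f) x = partial l (partial k f) x"
proof -
  define t where "t n = inverse (real (Suc n))" for n
  have t0: "t n > 0" for n by (simp add: t_def)
  have tl: "t \<longlonglongrightarrow> 0" unfolding t_def by (rule LIMSEQ_inverse_real_of_nat)
  have "\<exists>a b a' b'. 0 < a \<and> a < t n \<and> 0 < b \<and> b < t n \<and> 0 < a' \<and> a' < t n \<and> 0 < b' \<and> b' < t n \<and>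
     partial l (partial k f) (x + a *\<^sub>R axis k 1 + b *\<^sub>R axis l 1) =
     partial k (partial l f) (x + a' *\<^sub>R axis l 1 + b' *\<^sub>R axis k 1)" for n
  proof -
    obtain a b where 1: "0 < a" "a < t n" "0 < b" "b < t n"
      "f (x + t n *\<^sub>R axis k 1 + t n *\<^sub>R axis l 1) - f (x + t n *\<^sub>R axis k 1) - f (x + t n *\<^sub>R axis l 1) + f x
      = (t n)\<^sup>2 * partial l (partial k f) (x + a *\<^sub>R axis k 1 + b *\<^sub>R axis l 1)"
      using mixed_second_difference[OF f t0] by blast
    obtain a' b' where 2: "0 < a'" "a' < t n" "0 < b'" "b' < t n"
      "f (x + t n *\<^sub>R axis l 1 + t n *\<^sub>R axis k 1) - f (x + t n *\<^sub>R axis l 1) - f (x + t n *\<^sub>R axis k 1) + f x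
      = (t n)\<^sup>2 * partial k (partial l f) (x + a' *\<^sub>R axis l 1 + b' *\<^sub>R axis k 1)"
      using mixed_second_difference[OF f t0] by blast
    have "(t n)\<^sup>2 * partial l (partial k f) (x + a *\<^sub>R axis k 1 + b *\<^sub>R axis l 1)
      = (t n)\<^sup>2 * partial k (partial l f) (x + a' *\<^sub>R axis l 1 + b' *\<^sub>R axis k 1)"
      unfolding 1(5)[symmetric] 2(5)[symmetric] by (simp add: add_ac)
    then show ?thesis using 1(1-4) 2(1-4) t0[of n]
      by (intro exI[of _ a] exI[of _ b] exI[of _ a'] exI[of _ b']) auto
  qed
  then obtain a b a' b' where
    *: "\<And>n. 0 < a n \<and> a n < t n \<and> 0 < b n \<and> b n < t n \<and> 0 < a' n \<and> a' n < t n \<and> 0 < b' n \<and> b' n < t n \<and>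
     partial l (partial k f) (x + a n *\<^sub>R axis k 1 + b n *\<^sub>R axis l 1) =
     partial k (partial l f) (x + a' n *\<^sub>R axis l 1 + b' n *\<^sub>R axis k 1)"
    by metis
  have lim: "s \<longlonglongrightarrow> 0" if "\<And>n. 0 < s n" "\<And>n. s n < t n" for s
    by (rule tendsto_sandwich[OF _ _ tendsto_const tl]) (use that in \<open>auto intro!: always_eventually less_imp_le\<close>)
  have L: "(\<lambda>n. g (x + s n *\<^sub>R axis i 1 + r n *\<^sub>R axis j 1)) \<longlonglongrightarrow> g x"
    if "smooth g" "s \<longlonglongrightarrow> 0" "r \<longlonglongrightarrow> 0" for g s r and i j :: 2
  proof -
    have "(\<lambda>n. x + s n *\<^sub>R axis i 1 + r n *\<^sub>R axis j 1) \<longlonglongrightarrow> x + 0 *\<^sub>R axis i 1 + 0 *\<^sub>R axis j 1"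
      by (intro tendsto_intros that)
    moreover have "isCont g x"
      using smooth_continuous[OF that(1), of UNIV] by (simp add: continuous_on_eq_continuous_at)
    ultimately show ?thesis using isCont_tendsto_compose[of x g] by simp
  qed
  have "(\<lambda>n. partial l (partial k f) (x + a n *\<^sub>R axis k 1 + b n *\<^sub>R axis l 1)) \<longlonglongrightarrow> partial l (partial k f) x"
    by (intro L smooth_partial f lim) (use * in auto)
  moreover have "(\<lambda>n. partial k (partial l f) (x + a' n *\<^sub>R axis l 1 + b' n *\<^sub>R axis k 1)) \<longlonglongrightarrow> partial k (partial l f) x"
    by (intro L smooth_partial f lim) (use * in auto)
  ultimately show ?thesis using * LIMSEQ_unique by simp
qed

section \<open>Test functions\<close>

text \<open>The functions that arise when the flat function \<open>exp (- (1 / t))\<close> is differentiated: each derivative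
is again of this form with another polynomial, so that the family proves its own smoothness by
\<open>smooth_coinduct\<close>.\<close>

definition flat_exp :: "real poly \<Rightarrow> real \<Rightarrow> real" where
  "flat_exp p t = (if t \<le> 0 then 0 else poly p (1 / t) * exp (- (1 / t)))"

lemma flat_exp_tendsto_0: "(flat_exp p \<longlongrightarrow> 0) (at 0)"
proof -
  have "((\<lambda>s. \<Sum>i\<le>degree p. coeff p i * (s ^ i / exp s)) \<longlongrightarrow> (\<Sum>i\<le>degree p. coeff p i * 0)) at_top"
    by (intro tendsto_intros tendsto_power_div_exp_0)
  then have "((\<lambda>s. poly p s * exp (-s)) \<longlongrightarrow> 0) at_top"
    by (simp add: poly_altdef sum_distrib_left sum_distrib_right exp_minus divide_inverse mult_ac)
  from filterlim_compose[OF this filterlim_inverse_at_top_right]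
  have "((\<lambda>t. poly p (inverse t) * exp (- inverse t)) \<longlongrightarrow> 0) (at_right 0)" .
  then have "(flat_exp p \<longlongrightarrow> 0) (at_right 0)"
    by (rule Lim_transform_eventually)
      (auto simp: flat_exp_def eventually_at_right_field inverse_eq_divide intro!: exI[of _ 1])
  moreover have "(flat_exp p \<longlongrightarrow> 0) (at_left 0)"
    by (rule Lim_transform_eventually[OF tendsto_const])
      (auto simp: flat_exp_def eventually_at_left_field intro!: exI[of _ "-1"])
  ultimately show ?thesis by (simp add: filterlim_split_at)
qed

lemma DERIV_flat_exp:
  "(flat_exp p has_real_derivative flat_exp ([:0, 0, 1:] * (p - pderiv p)) t) (at t)"
proof (cases "t = 0")
  case True
  have "((\<lambda>h. flat_exp ([:0, 1:] * p) h) \<longlongrightarrow> 0) (at 0)" by (rule flat_exp_tendsto_0)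
  moreover have "flat_exp ([:0, 1:] * p) h = (flat_exp p (0 + h) - flat_exp p 0) / h" for h
    by (auto simp: flat_exp_def)
  ultimately show ?thesis using True by (simp add: DERIV_def flat_exp_def)
next
  case False
  show ?thesis
  proof (cases "t < 0")
    case True
    have "((\<lambda>x. 0::real) has_real_derivative 0) (at t)" by simp
    then have "(flat_exp p has_real_derivative 0) (at t)"
      by (rule has_field_derivative_transform_within_open[of _ _ _ "{..<0}"])
        (use True in \<open>auto simp: flat_exp_def\<close>)
    then show ?thesis using True by (simp add: flat_exp_def)
  next
    case 2: False
    with False have t: "t > 0" by simp
    have "((\<lambda>t. poly p (1 / t) * exp (- (1 / t))) has_real_derivative
       flat_exp ([:0, 0, 1:] * (p - pderiv p)) t) (at t)"
      using t by (auto intro!: derivative_eq_intros poly_DERIV[THEN DERIV_chain2]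
          simp: flat_exp_def field_simps power2_eq_square)
    then show ?thesis
      by (rule has_field_derivative_transform_within_open[of _ _ _ "{0<..}"])
        (use t in \<open>auto simp: flat_exp_def\<close>)
  qed
qed

lemma smooth_flat_exp_affine: "smooth (\<lambda>x. flat_exp p (c * (x$i) + a))"
proof (rule smooth_coinduct[of _ "{\<lambda>x. e * flat_exp p (c * (x$i) + a) |e p. True}"])
  have D: "((\<lambda>x. e * flat_exp p (c * (x$i) + a)) has_derivative
     (\<lambda>h. e * (flat_exp ([:0, 0, 1:] * (p - pderiv p)) (c * (x$i) + a) * (c * h$i)))) (at x)" for e p and x :: pt
    by (rule has_derivative_mult_right, rule has_derivative_compose[OF _ DERIV_flat_exp[unfolded has_field_derivative_def]])
      (intro has_derivative_add_const has_derivative_mult_right bounded_linear_imp_has_derivative[OF bounded_linear_vec_nth])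
  fix f assume "f \<in> {\<lambda>x::pt. e * flat_exp p (c * (x$i) + a) |e p. True}"
  then obtain e p where f: "f = (\<lambda>x. e * flat_exp p (c * (x$i) + a))" by blast
  show "f differentiable (at x)" for x unfolding f by (rule differentiableI[OF D])
  fix k
  have "partial k f = (\<lambda>x. (e * (if i = k then c else 0)) * flat_exp ([:0, 0, 1:] * (p - pderiv p)) (c * (x$i) + a))"
    unfolding f partial_has_derivative[OF D] by (auto simp: fun_eq_iff axis_def)
  then show "partial k f \<in> {\<lambda>x. e * flat_exp p (c * (x$i) + a) |e p. True}" by blast
qed (force intro: exI[of _ 1])

text \<open>A smooth function supported in the box of points at distance at least \<open>1 / n\<close> from the sides of
\<open>box a b\<close>. The functions are bounded by one and converge pointwise to the indicator of the box.\<close>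

definition box_bump :: "pt \<Rightarrow> pt \<Rightarrow> nat \<Rightarrow> pt \<Rightarrow> real" where
  "box_bump a b n x =
     flat_exp 1 (n * (x$1) + (- n * (a$1) - 1)) * flat_exp 1 (- n * (x$1) + (n * (b$1) - 1)) *
     (flat_exp 1 (n * (x$2) + (- n * (a$2) - 1)) * flat_exp 1 (- n * (x$2) + (n * (b$2) - 1)))"

lemma flat_exp_1_bounds: "0 \<le> flat_exp 1 t" "flat_exp 1 t \<le> 1"
  by (auto simp: flat_exp_def)

lemma test_function_iff:
  "test_function U \<phi> \<longleftrightarrow> smooth \<phi> \<and> (\<exists>C. compact C \<and> C \<subseteq> U \<and> (\<forall>x. x \<notin> C \<longrightarrow> \<phi> x = 0))"
  by (simp add: test_function_def smooth_def)

lemma box_bump_test_function: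
  assumes "n > 0" shows "test_function (box a b) (box_bump a b n)"
proof -
  let ?C = "cbox (a + (1 / n) *\<^sub>R 1) (b - (1 / n) *\<^sub>R 1) :: pt set"
  have "box_bump a b n x = 0" if "x \<notin> ?C" for x
  proof -
    have "x$1 < a$1 + 1/n \<or> x$1 > b$1 - 1/n \<or> x$2 < a$2 + 1/n \<or> x$2 > b$2 - 1/n"
      using that by (auto simp: mem_box_cart forall_2 not_le)
    then have "n * (x$1) + (- n * (a$1) - 1) \<le> 0 \<or> - n * (x$1) + (n * (b$1) - 1) \<le> 0 \<or>
       n * (x$2) + (- n * (a$2) - 1) \<le> 0 \<or> - n * (x$2) + (n * (b$2) - 1) \<le> 0"
      using assms by (auto simp: field_simps)
    then show ?thesis by (auto simp: box_bump_def flat_exp_def)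
  qed
  moreover have "?C \<subseteq> box a b"
    using assms by (auto simp: mem_box_cart forall_2 field_simps) (smt (verit, best) of_nat_0_less_iff mult_le_cancel_left_pos mult_less_cancel_left_pos)+
  moreover have "smooth (box_bump a b n)"
    unfolding box_bump_def[abs_def] by (intro smooth_mult smooth_flat_exp_affine)
  ultimately show ?thesis
    unfolding test_function_iff using compact_cbox by blast
qed

lemma flat_exp_1_tendsto_1:
  assumes "c > 0"
  shows "(\<lambda>n. flat_exp 1 (real n * c - 1)) \<longlonglongrightarrow> 1"
proof -
  have "filterlim (\<lambda>n. real n * c - 1) at_top sequentially"
    using assms by real_asymp
  then have *: "filterlim (\<lambda>n. 1 / (real n * c - 1)) (at_right 0) sequentially"
    using filterlim_compose[OF filterlim_inverse_at_right_top] by (simp add: inverse_eq_divide)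
  then have "(\<lambda>n. exp (- (1 / (real n * c - 1)))) \<longlonglongrightarrow> exp (- 0)"
    by (intro tendsto_intros) (simp add: filterlim_at)
  moreover have "eventually (\<lambda>n. real n * c - 1 > 0) sequentially"
    using assms by real_asymp
  then have "eventually (\<lambda>n. exp (- (1 / (real n * c - 1))) = flat_exp 1 (real n * c - 1)) sequentially"
    by eventually_elim (simp add: flat_exp_def)
  ultimately show ?thesis by (simp add: tendsto_cong)
qed

lemma box_bump_tendsto: "(\<lambda>n. box_bump a b n x) \<longlonglongrightarrow> indicator (box a b) x"
proof (cases "x \<in> box a b")
  case True
  then have "x$1 - a$1 > 0" "b$1 - x$1 > 0" "x$2 - a$2 > 0" "b$2 - x$2 > 0"
    by (auto simp: mem_box_cart)
  then have "(\<lambda>n. flat_exp 1 (real n * (x$1 - a$1) - 1) * flat_exp 1 (real n * (b$1 - x$1) - 1) *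
      (flat_exp 1 (real n * (x$2 - a$2) - 1) * flat_exp 1 (real n * (b$2 - x$2) - 1))) \<longlonglongrightarrow> 1 * 1 * (1 * 1)"
    by (intro tendsto_mult flat_exp_1_tendsto_1)
  then show ?thesis using True by (simp add: box_bump_def algebra_simps)
next
  case False
  then have "x$1 \<le> a$1 \<or> b$1 \<le> x$1 \<or> x$2 \<le> a$2 \<or> b$2 \<le> x$2"
    by (auto simp: mem_box_cart forall_2 not_less)
  then have "box_bump a b n x = 0" for n
    by (auto simp: box_bump_def flat_exp_def) (smt (verit, best) mult_left_mono of_nat_0_le_iff)+
  then show ?thesis using False by simp
qed

lemma box_bump_bounds: "0 \<le> box_bump a b n x" "box_bump a b n x \<le> 1"
  unfolding box_bump_def by (intro mult_nonneg_nonneg mult_le_one flat_exp_1_bounds)+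

lemma test_function_mono: "test_function U \<phi> \<Longrightarrow> U \<subseteq> V \<Longrightarrow> test_function V \<phi>"
  unfolding test_function_def by blast

lemma test_function_continuous: "test_function U \<phi> \<Longrightarrow> continuous_on S \<phi>"
  by (simp add: test_function_iff smooth_continuous)

lemma test_function_measurable: "test_function U \<phi> \<Longrightarrow> \<phi> \<in> borel_measurable borel"
  by (simp add: test_function_continuous borel_measurable_continuous_onI)

lemma test_function_outside: "test_function U \<phi> \<Longrightarrow> x \<notin> U \<Longrightarrow> \<phi> x = 0"
  unfolding test_function_def by blast

lemma test_function_partial:
  assumes "test_function U \<phi>" shows "test_function U (partial k \<phi>)"
proof -
  from assms obtain C where C: "smooth \<phi>" "compact C" "C \<subseteq> U" "\<And>x. x \<notin> C \<Longrightarrow> \<phi> x = 0"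
    unfolding test_function_iff by blast
  have "partial k \<phi> x = 0" if "x \<notin> C" for x
    using partial_cong[of "- C" x \<phi> "\<lambda>_. 0" k] C that smooth_differentiable
    by (simp add: compact_imp_closed open_Compl)
  then show ?thesis unfolding test_function_iff using C smooth_partial by blast
qed

lemma test_function_bounded:
  assumes "test_function U \<phi>" obtains B where "\<And>x. \<bar>\<phi> x\<bar> \<le> B"
proof -
  from assms obtain C where C: "smooth \<phi>" "compact C" "\<And>x. x \<notin> C \<Longrightarrow> \<phi> x = 0"
    unfolding test_function_iff by blast
  have "compact (\<phi> ` C)" using C smooth_continuous compact_continuous_image by blast
  then obtain B where B: "\<And>x. x \<in> C \<Longrightarrow> \<bar>\<phi> x\<bar> \<le> B"
    using compact_imp_bounded bounded_iff by (metis image_eqI real_norm_def)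
  have "\<bar>\<phi> x\<bar> \<le> max B 0" for x using B[of x] C(3)[of x] by (cases "x \<in> C") auto
  then show thesis using that by blast
qed

lemma test_function_shift:
  assumes "test_function V \<phi>" "\<And>x. x \<in> V \<Longrightarrow> x - h \<in> U"
  shows "test_function U (\<lambda>x. \<phi> (x + h))"
proof -
  from assms obtain C where C: "smooth \<phi>" "compact C" "C \<subseteq> V" "\<And>x. x \<notin> C \<Longrightarrow> \<phi> x = 0"
    unfolding test_function_iff by blast
  have "compact ((\<lambda>x. x - h) ` C)"
    using C(2) by (intro compact_continuous_image continuous_intros)
  moreover have "(\<lambda>x. x - h) ` C \<subseteq> U" using C(3) assms(2) by auto
  moreover have "\<phi> (x + h) = 0" if "x \<notin> (\<lambda>x. x - h) ` C" for x
    using that C(4)[of "x + h"] by (force simp: image_iff)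
  ultimately show ?thesis unfolding test_function_iff using C(1) smooth_shift by blast
qed

section \<open>The fundamental lemma of the calculus of variations\<close>

lemma AE_lborel_not_in:
  assumes "S \<in> sets borel" "negligible S"
  shows "AE x in lborel. x \<notin> S"
  using assms by (intro AE_not_in) (simp add: negligible_iff_null_sets null_sets_completion_iff)

lemma AE_eq_0_if_box_integrals_0:
  fixes F :: "pt \<Rightarrow> real"
  assumes F: "integrable lborel F" and 0: "integral\<^sup>L lborel F = 0"
    and box: "\<And>a b. (\<integral>x. indicator (box a b) x * F x \<partial>lborel) = 0"
  shows "AE x in lborel. F x = 0"
proof -
  have [measurable]: "F \<in> borel_measurable lborel" using F by simp
  have "(\<integral>x. indicator A x * F x \<partial>lborel) = 0" if "A \<in> sets borel" for A
  proof -
    have "sigma_sets UNIV (range (\<lambda>(a, b). box a b :: pt set)) = sets borel"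
      unfolding borel_eq_box by simp
    with that have A: "A \<in> sigma_sets UNIV (range (\<lambda>(a, b). box a b :: pt set))" by simp
    have "Int_stable (range (\<lambda>(a, b). box a b :: pt set))"
      by (auto simp: Int_stable_def box_Int_box)
    moreover have "range (\<lambda>(a, b). box a b :: pt set) \<subseteq> Pow UNIV" by simp
    ultimately show ?thesis using A
    proof (induction rule: sigma_sets_induct_disjoint)
      case (basic A) then show ?case using box by auto
    next
      case empty then show ?case by simp
    next
      case (compl A)
      then have [measurable]: "A \<in> sets borel" unfolding borel_eq_box by simp
      have "(\<integral>x. indicator (UNIV - A) x * F x \<partial>lborel) = (\<integral>x. F x - indicator A x * F x \<partial>lborel)"
        by (intro Bochner_Integration.integral_cong) (auto simp: indicator_def)
      also have "\<dots> = 0"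
        using F integrable_mult_indicator[of A lborel F] compl 0 by (subst Bochner_Integration.integral_diff) auto
      finally show ?case .
    next
      case (union A)
      then have [measurable]: "A i \<in> sets borel" for i unfolding borel_eq_box by auto
      have "set_integrable lborel (\<Union>i. A i) F"
        unfolding set_integrable_def using F by (intro integrable_mult_indicator) auto
      then have "(LINT x:(\<Union>i. A i)|lborel. F x) = (\<Sum>i. LINT x:A i|lborel. F x)"
        using union(1) by (intro lebesgue_integral_countable_add) (auto simp: disjoint_family_on_def)
      then show ?case using union(3) by (simp add: set_lebesgue_integral_def)
    qed
  qed
  then show ?thesis
    using density_unique_real[OF F, of "\<lambda>_. 0"] by (simp add: set_lebesgue_integral_def)
qed

text \<open>By dominated convergence along the bumps, \<open>F\<close> integrates to zero over every box that lies in a closed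
box inside \<open>V\<close>. Boxes generate the Borel sets, so \<open>F\<close> vanishes almost everywhere on each such closed
box, and countably many of them cover \<open>V\<close>.\<close>

theorem fundamental_lemma_variations:
  fixes F :: "pt \<Rightarrow> real"
  assumes V: "open V" and [measurable]: "F \<in> borel_measurable borel"
    and int: "\<And>a b. cbox a b \<subseteq> V \<Longrightarrow> integrable lborel (\<lambda>x. indicator (cbox a b) x * F x)"
    and test: "\<And>\<phi>. test_function V \<phi> \<Longrightarrow> (\<integral>x. F x * \<phi> x \<partial>lborel) = 0"
  shows "AE x in lborel. x \<in> V \<longrightarrow> F x = 0"
proof -
  have box: "(\<integral>x. indicator (box a b) x * F x \<partial>lborel) = 0" if ab: "cbox c d \<subseteq> V" "box a b \<subseteq> cbox c d" for a b c d
  proof -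
    have "(\<lambda>n. \<integral>x. F x * box_bump a b (Suc n) x \<partial>lborel) \<longlonglongrightarrow> (\<integral>x. indicator (box a b) x * F x \<partial>lborel)"
    proof (rule integral_dominated_convergence)
      show "integrable lborel (\<lambda>x. indicator (cbox c d) x * \<bar>F x\<bar>)"
        using integrable_abs[OF int[OF ab(1)]] by (simp add: abs_mult)
      show "AE x in lborel. (\<lambda>n. F x * box_bump a b (Suc n) x) \<longlonglongrightarrow> indicator (box a b) x * F x"
        using tendsto_mult_left[OF LIMSEQ_Suc[OF box_bump_tendsto]] by (simp add: mult.commute)
      show "AE x in lborel. norm (F x * box_bump a b (Suc n) x) \<le> indicator (cbox c d) x * \<bar>F x\<bar>" for n
      proof (rule AE_I2)
        fix x
        have "box_bump a b (Suc n) x = 0" if "x \<notin> cbox c d"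
          using that ab test_function_outside[OF box_bump_test_function[of "Suc n" a b]] by blast
        then show "norm (F x * box_bump a b (Suc n) x) \<le> indicator (cbox c d) x * \<bar>F x\<bar>"
          using box_bump_bounds[of a b "Suc n" x] by (auto simp: indicator_def abs_mult mult_left_le)
      qed
      show "(\<lambda>x. F x * box_bump a b (Suc n) x) \<in> borel_measurable lborel" for n
        using test_function_measurable[OF box_bump_test_function[of "Suc n" a b]] by simp
    qed simp
    moreover have "(\<integral>x. F x * box_bump a b (Suc n) x \<partial>lborel) = 0" for n
      using ab by (intro test test_function_mono[OF box_bump_test_function]) auto
    ultimately show ?thesis by (simp add: LIMSEQ_const_iff)
  qed
  have *: "AE x in lborel. x \<in> cbox c d \<longrightarrow> F x = 0" if cd: "cbox c d \<subseteq> V" for c d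
  proof -
    have eq: "(\<integral>x. indicator (box a b) x * (indicator (cbox c d) x * F x) \<partial>lborel) = 0" for a b
    proof -
      obtain a' b' where ab': "box a b \<inter> box c d = box a' b'" by (simp add: box_Int_box)
      have "negligible (cbox c d - box c d)" by (simp add: negligible_frontier_interval)
      then have "AE x in lborel. x \<notin> cbox c d - box c d"
        by (intro AE_lborel_not_in) auto
      then have "(\<integral>x. indicator (box a b) x * (indicator (cbox c d) x * F x) \<partial>lborel)
          = (\<integral>x. indicator (box a' b') x * F x \<partial>lborel)"
        by (intro integral_cong_AE; (measurable)?)
          (auto elim!: eventually_mono simp: ab'[symmetric] indicator_def box_subset_cbox[THEN subsetD])
      also have "\<dots> = 0"
        using ab' box_subset_cbox[of c d] by (intro box[OF cd]) auto
      finally show ?thesis .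
    qed
    have "AE x in lborel. indicator (cbox c d) x * F x = 0"
    proof (rule AE_eq_0_if_box_integrals_0)
      have "negligible (cbox c d - box c d)" by (simp add: negligible_frontier_interval)
      then have "AE x in lborel. x \<notin> cbox c d - box c d"
        by (intro AE_lborel_not_in) auto
      then have "(\<integral>x. indicator (cbox c d) x * F x \<partial>lborel) = (\<integral>x. indicator (box c d) x * (indicator (cbox c d) x * F x) \<partial>lborel)"
        by (intro integral_cong_AE; (measurable)?)
          (auto elim!: eventually_mono simp: indicator_def)
      then show "(\<integral>x. indicator (cbox c d) x * F x \<partial>lborel) = 0" using eq by simp
    qed (use int[OF cd] eq in auto)
    then show ?thesis by eventually_elim (auto simp: indicator_def)
  qed
  obtain D where D: "countable D" "\<And>X. X \<in> D \<Longrightarrow> \<exists>a b. X = cbox a b" "\<Union>D = V" "D \<subseteq> Pow V"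
    using open_countable_Union_open_cbox[OF V] by metis
  have "AE x in lborel. \<forall>X\<in>D. x \<in> X \<longrightarrow> F x = 0"
    unfolding AE_ball_countable[OF D(1)]
  proof
    fix X assume "X \<in> D"
    then obtain c d where "X = cbox c d" "X \<subseteq> V" using D by blast
    then show "AE x in lborel. x \<in> X \<longrightarrow> F x = 0" using * by simp
  qed
  then show ?thesis by eventually_elim (use D(3) in blast)
qed

section \<open>Integration by parts\<close>

lemma nn_integral_lborel_shift:
  fixes f :: "'a::euclidean_space \<Rightarrow> ennreal"
  assumes [measurable]: "f \<in> borel_measurable borel"
  shows "(\<integral>\<^sup>+x. f (x + h) \<partial>lborel) = (\<integral>\<^sup>+x. f x \<partial>lborel)"
  by (subst (2) lborel_distr_plus[symmetric, of h]) (simp add: nn_integral_distr add.commute)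

lemma integral_lborel_shift:
  fixes f :: "'a::euclidean_space \<Rightarrow> real"
  assumes [measurable]: "f \<in> borel_measurable borel"
  shows "(\<integral>x. f (x + h) \<partial>lborel) = (\<integral>x. f x \<partial>lborel)"
  by (subst (2) lborel_distr_plus[symmetric, of h]) (simp add: integral_distr add.commute)

lemma integrable_lborel_shift:
  fixes f :: "'a::euclidean_space \<Rightarrow> real"
  assumes "integrable lborel f"
  shows "integrable lborel (\<lambda>x. f (x + h))"
proof -
  have [measurable]: "f \<in> borel_measurable borel" using assms by simp
  show ?thesis
    using assms nn_integral_lborel_shift[of "\<lambda>x. ennreal (norm (f x))" h]
    by (auto simp: integrable_iff_bounded)
qed

lemma AE_lborel_shift:
  fixes P :: "'a::euclidean_space \<Rightarrow> bool"
  assumes "AE x in lborel. P x" and [measurable]: "Measurable.pred borel P"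
  shows "AE x in lborel. P (x + h)"
proof -
  have "AE x in distr lborel borel ((+) h). P x" using assms(1) by (subst lborel_distr_plus)
  then show ?thesis by (subst (asm) AE_distr_iff) (auto simp: add.commute)
qed

definition dir_deriv :: "pt \<Rightarrow> (pt \<Rightarrow> real) \<Rightarrow> pt \<Rightarrow> real" where
  "dir_deriv h f x = h$1 * partial 1 f x + h$2 * partial 2 f x"

lemma dir_deriv_axis: "dir_deriv (axis k 1) f = partial k f"
  using exhaust_2[of k] by (auto simp: dir_deriv_def axis_def fun_eq_iff)

lemma DERIV_along_line:
  assumes "f differentiable (at (x + s *\<^sub>R h))"
  shows "((\<lambda>s. f (x + s *\<^sub>R h)) has_real_derivative dir_deriv h f (x + s *\<^sub>R h)) (at s)"
proof -
  have "((\<lambda>s. f (x + s *\<^sub>R h)) has_derivative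
    (\<lambda>d. (d *\<^sub>R h)$1 * partial 1 f (x + s *\<^sub>R h) + (d *\<^sub>R h)$2 * partial 2 f (x + s *\<^sub>R h))) (at s)"
    using has_derivative_partials[OF assms]
    by (rule has_derivative_compose[rotated]) (auto intro!: derivative_eq_intros)
  then show ?thesis
    by (rule has_derivative_imp_has_field_derivative) (simp add: dir_deriv_def algebra_simps)
qed

lemma integrable_continuous_compact_support:
  fixes g :: "pt \<Rightarrow> real"
  assumes "continuous_on UNIV g" "compact C" "\<And>x. x \<notin> C \<Longrightarrow> g x = 0"
  shows "integrable lborel g"
proof -
  have "integrable lborel (\<lambda>x. indicator C x *\<^sub>R g x)"
    using assms continuous_on_subset[OF assms(1)] by (intro borel_integrable_compact) auto
  also have "(\<lambda>x. indicator C x *\<^sub>R g x) = g" using assms(3) by (force simp: indicator_def)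
  finally show ?thesis .
qed

lemma partial_outside_support:
  assumes "compact C" "\<And>x. x \<notin> C \<Longrightarrow> F x = 0" "x \<notin> C"
  shows "partial k F x = 0"
  using partial_cong[of "- C" x "\<lambda>_. 0" F k] assms by (simp add: compact_imp_closed open_Compl)

text \<open>The integral of a difference quotient vanishes because Lebesgue measure is invariant under
translations, and the quotients converge boundedly to the partial derivative.\<close>

lemma integral_partial_eq_0:
  assumes F: "\<And>x. F differentiable (at x)" and cont: "continuous_on UNIV (partial k F)"
    and C: "compact C" "\<And>x. x \<notin> C \<Longrightarrow> F x = 0"
  shows "(\<integral>x. partial k F x \<partial>lborel) = 0"
proof -
  have Fc: "continuous_on UNIV F"
    using F by (intro continuous_at_imp_continuous_on ballI differentiable_imp_continuous_within)
  have [measurable]: "F \<in> borel_measurable borel" "partial k F \<in> borel_measurable borel"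
    using Fc cont by (auto intro: borel_measurable_continuous_onI)
  have Fi: "integrable lborel F" using integrable_continuous_compact_support[OF Fc C] .
  have pC: "partial k F x = 0" if "x \<notin> C" for x using partial_outside_support[OF C that] .
  have "bounded (partial k F ` C)"
    using C(1) cont continuous_on_subset compact_continuous_image compact_imp_bounded by blast
  then obtain B where "\<And>x. x \<in> C \<Longrightarrow> \<bar>partial k F x\<bar> \<le> B" unfolding bounded_iff by auto
  then have B: "\<bar>partial k F x\<bar> \<le> max B 0" for x using pC[of x] by (cases "x \<in> C") force+
  obtain R where R: "\<And>x. x \<in> C \<Longrightarrow> norm x \<le> R"
    using C(1) compact_imp_bounded bounded_iff by metis
  define e :: pt where "e = axis k 1"
  define t where "t n = inverse (real (Suc n))" for n
  have t: "0 < t n" "t n \<le> 1" for n by (auto simp: t_def inverse_le_1_iff)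
  have tl: "filterlim t (at 0) sequentially"
    unfolding filterlim_at using LIMSEQ_inverse_real_of_nat t(1) by (auto simp: t_def[abs_def])
  define D where "D n x = (F (x + t n *\<^sub>R e) - F x) / t n" for n x
  have "(\<lambda>n. \<integral>x. D n x \<partial>lborel) \<longlonglongrightarrow> (\<integral>x. partial k F x \<partial>lborel)"
  proof (rule integral_dominated_convergence)
    show "integrable lborel (\<lambda>x. max B 0 * indicator (cball (0::pt) (R + 1)) x)"
      using emeasure_lborel_cball_finite[of "0::pt" "R+1"]
      by (intro integrable_mult_right integrable_real_indicator) (auto simp: less_top)
    show "AE x in lborel. (\<lambda>n. D n x) \<longlonglongrightarrow> partial k F x"
    proof (rule AE_I2)
      fix x
      have "((\<lambda>s. F (x + s *\<^sub>R e)) has_real_derivative partial k F x) (at 0)"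
        using DERIV_along_line[of F x 0 e] F by (simp add: e_def dir_deriv_axis)
      then have "(\<lambda>s. (F (x + s *\<^sub>R e) - F x) / s) \<midarrow>0\<rightarrow> partial k F x"
        by (simp add: DERIV_def)
      from filterlim_compose[OF this tl] show "(\<lambda>n. D n x) \<longlonglongrightarrow> partial k F x"
        by (simp add: D_def)
    qed
    show "AE x in lborel. norm (D n x) \<le> max B 0 * indicator (cball 0 (R + 1)) x" for n
    proof (rule AE_I2)
      fix x
      show "norm (D n x) \<le> max B 0 * indicator (cball 0 (R + 1)) x"
      proof (cases "norm x \<le> R + 1")
        case True
        have "((\<lambda>s. F (x + s *\<^sub>R e)) has_real_derivative partial k F (x + s *\<^sub>R e)) (at s)" for s
          using DERIV_along_line[of F x s e] F by (simp add: e_def dir_deriv_axis)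
        from MVT2[OF t(1)[of n] this] obtain z where
          "F (x + t n *\<^sub>R e) - F (x + 0 *\<^sub>R e) = (t n - 0) * partial k F (x + z *\<^sub>R e)" by blast
        then have "D n x = partial k F (x + z *\<^sub>R e)" using t(1)[of n] by (simp add: D_def)
        then show ?thesis using B True by simp
      next
        case False
        have "norm (t n *\<^sub>R e) \<le> 1" using t[of n] by (simp add: e_def)
        then have "R < norm (x + t n *\<^sub>R e)" using False norm_diff_ineq[of x "t n *\<^sub>R e"] by linarith
        then have "F (x + t n *\<^sub>R e) = 0" "F x = 0" using R C(2) False by fastforce+
        then show ?thesis by (simp add: D_def)
      qed
    qed
    show "(\<lambda>x. D n x) \<in> borel_measurable lborel" for n unfolding D_def by measurable
  qed simp
  moreover have "(\<integral>x. D n x \<partial>lborel) = 0" for n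
    using Fi by (simp add: D_def integrable_lborel_shift integral_lborel_shift)
  ultimately show ?thesis by (simp add: LIMSEQ_const_iff)
qed

text \<open>Extension by zero, so that functions on different open sets can be integrated over the whole plane
and translated freely.\<close>

definition zext :: "pt set \<Rightarrow> (pt \<Rightarrow> real) \<Rightarrow> pt \<Rightarrow> real" where
  "zext U f x = (if x \<in> U then f x else 0)"

lemma continuous_on_zext_mult_test:
  assumes U: "open U" and f: "continuous_on U f" and \<phi>: "test_function U \<phi>"
  shows "continuous_on UNIV (\<lambda>x. zext U f x * \<phi> x)"
proof -
  from \<phi> obtain C where C: "smooth \<phi>" "compact C" "C \<subseteq> U" "\<And>x. x \<notin> C \<Longrightarrow> \<phi> x = 0"
    unfolding test_function_iff by blast
  have "continuous_on U (\<lambda>x. zext U f x * \<phi> x)"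
    using continuous_on_mult[OF f smooth_continuous[OF C(1)]]
    by (rule continuous_on_eq) (simp add: zext_def)
  moreover have "continuous_on (- C) (\<lambda>x. zext U f x * \<phi> x)"
    by (rule continuous_on_eq[OF continuous_on_const[of _ 0]]) (simp add: C)
  ultimately have "continuous_on (U \<union> - C) (\<lambda>x. zext U f x * \<phi> x)"
    using U C(2) by (intro continuous_on_open_Un) (auto simp: compact_imp_closed open_Compl)
  moreover have "U \<union> - C = UNIV" using C(3) by blast
  ultimately show ?thesis by simp
qed

lemma integrable_zext_mult_test:
  assumes U: "open U" and f: "continuous_on U f" and \<phi>: "test_function U \<phi>"
  shows "integrable lborel (\<lambda>x. zext U f x * \<phi> x)"
proof -
  from \<phi> obtain C where C: "compact C" "\<And>x. x \<notin> C \<Longrightarrow> \<phi> x = 0"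
    unfolding test_function_iff by blast
  show ?thesis
    by (rule integrable_continuous_compact_support[OF continuous_on_zext_mult_test[OF assms] C(1)]) (simp add: C)
qed

text \<open>A first order weak derivative. In contrast to \<open>has_weak_deriv\<close>, the functions live on the whole plane,
and the integrals use the Borel measure \<open>lborel\<close>.\<close>

definition weak_partial :: "pt set \<Rightarrow> 2 \<Rightarrow> (pt \<Rightarrow> real) \<Rightarrow> (pt \<Rightarrow> real) \<Rightarrow> bool" where
  "weak_partial U k f g \<longleftrightarrow>
     (\<forall>\<phi>. test_function U \<phi> \<longrightarrow> (\<integral>x. f x * partial k \<phi> x \<partial>lborel) = - (\<integral>x. g x * \<phi> x \<partial>lborel))"

lemma weak_partial_classical:
  assumes U: "open U" and f: "\<And>x. x \<in> U \<Longrightarrow> f differentiable (at x)" "continuous_on U (partial k f)"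
  shows "weak_partial U k (zext U f) (zext U (partial k f))"
  unfolding weak_partial_def
proof (intro allI impI)
  fix \<phi> assume \<phi>: "test_function U \<phi>"
  then obtain C where C: "smooth \<phi>" "compact C" "C \<subseteq> U" "\<And>x. x \<notin> C \<Longrightarrow> \<phi> x = 0"
    unfolding test_function_iff by blast
  have fc: "continuous_on U f"
    using f(1) by (intro continuous_at_imp_continuous_on ballI differentiable_imp_continuous_within)
  define F where "F = (\<lambda>x. zext U f x * \<phi> x)"
  let ?D = "\<lambda>x. zext U (partial k f) x * \<phi> x + zext U f x * partial k \<phi> x"
  have 1: "F differentiable (at x) \<and> partial k F x = ?D x" for x
  proof (cases "x \<in> U")
    case True
    have eq: "f y * \<phi> y = F y" if "y \<in> U" for y using that by (simp add: F_def zext_def)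
    have d: "(\<lambda>y. f y * \<phi> y) differentiable (at x)"
      using f(1)[OF True] smooth_differentiable[OF C(1)] by simp
    have "F differentiable (at x)"
      using has_derivative_transform_within_open[OF has_derivative_partials[OF d] U True eq] differentiableI by blast
    moreover have "partial k F x = partial k (\<lambda>y. f y * \<phi> y) x"
      using partial_cong[OF U True eq d] by simp
    ultimately show ?thesis
      using True partial_mult[OF f(1)[OF True] smooth_differentiable[OF C(1)]] by (simp add: zext_def)
  next
    case False
    with C have x: "x \<in> - C" "open (- C)" by (auto simp: compact_imp_closed open_Compl)
    have eq: "0 = F y" if "y \<in> - C" for y using that C by (simp add: F_def)
    have "F differentiable (at x)"
      using has_derivative_transform_within_open[OF has_derivative_const[of 0 "at x"] x(2,1), of F, OF eq] differentiableI by blast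
    moreover have "partial k F x = 0" using partial_cong[OF x(2,1) eq] by simp
    ultimately show ?thesis
      using False by (simp add: zext_def)
  qed
  then have D: "partial k F = ?D" by blast
  note i = integrable_zext_mult_test[OF U f(2) \<phi>] integrable_zext_mult_test[OF U fc test_function_partial[OF \<phi>, of k]]
  have "(\<integral>x. partial k F x \<partial>lborel) = 0"
  proof (rule integral_partial_eq_0)
    show "continuous_on UNIV (partial k F)"
      unfolding D by (intro continuous_on_add continuous_on_zext_mult_test U fc f(2) \<phi> test_function_partial)
    show "compact C" by fact
    show "F x = 0" if "x \<notin> C" for x using that C by (simp add: F_def)
  qed (use 1 in blast)
  then show "(\<integral>x. zext U f x * partial k \<phi> x \<partial>lborel) = - (\<integral>x. zext U (partial k f) x * \<phi> x \<partial>lborel)"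
    unfolding D using i by simp
qed

section \<open>Taylor formulas with weak derivatives\<close>

text \<open>Square integrable Borel functions that vanish outside \<open>U\<close>. The last convention makes every statement
on translates \<open>f (x + h)\<close> meaningful for all \<open>x\<close>.\<close>

definition L2_on :: "pt set \<Rightarrow> (pt \<Rightarrow> real) \<Rightarrow> bool" where
  "L2_on U f \<longleftrightarrow> f \<in> borel_measurable borel \<and> (\<forall>x. x \<notin> U \<longrightarrow> f x = 0) \<and> integrable lborel (\<lambda>x. (f x)\<^sup>2)"

definition weak_dir :: "pt set \<Rightarrow> pt \<Rightarrow> (pt \<Rightarrow> real) \<Rightarrow> (pt \<Rightarrow> real) \<Rightarrow> bool" where
  "weak_dir U h f g \<longleftrightarrow>
     (\<forall>\<phi>. test_function U \<phi> \<longrightarrow> (\<integral>x. f x * dir_deriv h \<phi> x \<partial>lborel) = - (\<integral>x. g x * \<phi> x \<partial>lborel))"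

lemma L2_on_measurable: "L2_on U f \<Longrightarrow> f \<in> borel_measurable borel"
  by (simp add: L2_on_def)

lemma L2_on_integrable:
  assumes "L2_on U f" "open U" "bounded U"
  shows "integrable lborel f"
proof (rule Bochner_Integration.integrable_bound)
  have "emeasure lborel U < \<infinity>" using assms emeasure_bounded_finite by blast
  then show "integrable lborel (\<lambda>x. indicator U x + (f x)\<^sup>2)"
    using assms by (intro Bochner_Integration.integrable_add integrable_real_indicator) (auto simp: L2_on_def)
  have "\<bar>r\<bar> \<le> 1 + r\<^sup>2" for r :: real
    using zero_le_power2[of "\<bar>r\<bar> - 1"] abs_ge_zero[of r] by (simp add: power2_diff)
  then show "AE x in lborel. norm (f x) \<le> norm (indicator U x + (f x)\<^sup>2)"
    using assms(1) by (intro AE_I2) (auto simp: L2_on_def indicator_def)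
qed (use assms in \<open>simp add: L2_on_def\<close>)

lemma L2_on_add:
  assumes "L2_on U f" "L2_on U g"
  shows "L2_on U (\<lambda>x. f x + g x)"
proof -
  have [measurable]: "f \<in> borel_measurable borel" "g \<in> borel_measurable borel"
    using assms by (auto simp: L2_on_def)
  have "integrable lborel (\<lambda>x. (f x + g x)\<^sup>2)"
  proof (rule Bochner_Integration.integrable_bound)
    show "integrable lborel (\<lambda>x. 2 * (f x)\<^sup>2 + 2 * (g x)\<^sup>2)" using assms by (auto simp: L2_on_def)
    have "(a + b)\<^sup>2 \<le> 2 * a\<^sup>2 + 2 * b\<^sup>2" for a b :: real
      using zero_le_power2[of "a - b"] by (simp add: power2_eq_square algebra_simps)
    then show "AE x in lborel. norm ((f x + g x)\<^sup>2) \<le> norm (2 * (f x)\<^sup>2 + 2 * (g x)\<^sup>2)" by simp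
  qed measurable
  then show ?thesis using assms by (auto simp: L2_on_def)
qed

lemma L2_on_cmult: "L2_on U f \<Longrightarrow> L2_on U (\<lambda>x. c * f x)"
  by (auto simp: L2_on_def power_mult_distrib)

lemma integrable_mult_test:
  assumes "integrable lborel f" "test_function U \<phi>"
  shows "integrable lborel (\<lambda>x. f x * \<phi> x)"
proof -
  obtain B where B: "\<And>x. \<bar>\<phi> x\<bar> \<le> B" using test_function_bounded[OF assms(2)] by blast
  have [measurable]: "f \<in> borel_measurable borel" "\<phi> \<in> borel_measurable borel"
    using assms test_function_measurable by auto
  show ?thesis
    using B by (intro Bochner_Integration.integrable_bound[OF integrable_mult_left[OF integrable_abs[OF assms(1)], of B]])
      (auto simp: abs_mult intro!: AE_I2 mult_left_mono intro: order_trans[OF _ abs_ge_self])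
qed

lemma weak_partial_add:
  assumes "weak_partial U k f f'" "weak_partial U k g g'"
    and "integrable lborel f" "integrable lborel f'" "integrable lborel g" "integrable lborel g'"
  shows "weak_partial U k (\<lambda>x. f x + g x) (\<lambda>x. f' x + g' x)"
  unfolding weak_partial_def
proof (intro allI impI)
  fix \<phi> assume \<phi>: "test_function U \<phi>"
  show "(\<integral>x. (f x + g x) * partial k \<phi> x \<partial>lborel) = - (\<integral>x. (f' x + g' x) * \<phi> x \<partial>lborel)"
    using assms(1,2)[unfolded weak_partial_def, rule_format, OF \<phi>]
      assms(3-)[THEN integrable_mult_test[OF _ \<phi>]] assms(3-)[THEN integrable_mult_test[OF _ test_function_partial[OF \<phi>]]]
    by (simp add: distrib_right)
qed

lemma weak_partial_cmult:
  assumes "weak_partial U k f f'"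
  shows "weak_partial U k (\<lambda>x. c * f x) (\<lambda>x. c * f' x)"
  using assms unfolding weak_partial_def by (simp add: mult.assoc)

lemma weak_dirI:
  assumes "weak_partial U 1 f g1" "weak_partial U 2 f g2"
    and "integrable lborel f" "integrable lborel g1" "integrable lborel g2"
  shows "weak_dir U h f (\<lambda>x. h$1 * g1 x + h$2 * g2 x)"
  unfolding weak_dir_def
proof (intro allI impI)
  fix \<phi> assume \<phi>: "test_function U \<phi>"
  note i = assms(3-)[THEN integrable_mult_test[OF _ \<phi>]] assms(3-)[THEN integrable_mult_test[OF _ test_function_partial[OF \<phi>]]]
  have "(\<integral>x. f x * dir_deriv h \<phi> x \<partial>lborel) = (\<integral>x. h$1 * (f x * partial 1 \<phi> x) + h$2 * (f x * partial 2 \<phi> x) \<partial>lborel)"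
    by (simp add: dir_deriv_def algebra_simps)
  also have "\<dots> = - (\<integral>x. h$1 * (g1 x * \<phi> x) + h$2 * (g2 x * \<phi> x) \<partial>lborel)"
    using i assms(1,2)[unfolded weak_partial_def, rule_format, OF \<phi>] by simp
  also have "\<dots> = - (\<integral>x. (h$1 * g1 x + h$2 * g2 x) * \<phi> x \<partial>lborel)" by (simp add: algebra_simps)
  finally show "(\<integral>x. f x * dir_deriv h \<phi> x \<partial>lborel) = \<dots>" .
qed

text \<open>The bound \<open>c\<close> on the slices makes \<open>G\<close> integrable on the product of the unit interval and the plane.\<close>

lemma Fubini_unit_interval:
  fixes G :: "real \<Rightarrow> pt \<Rightarrow> real"
  assumes [measurable]: "case_prod G \<in> borel_measurable (borel \<Otimes>\<^sub>M borel)"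
    and i: "\<And>s. integrable lborel (G s)" and c: "\<And>s. (\<integral>x. \<bar>G s x\<bar> \<partial>lborel) \<le> c * indicator {0..1} s"
  shows "(\<integral>x. (\<integral>s. G s x \<partial>lborel) \<partial>lborel) = (\<integral>s. (\<integral>x. G s x \<partial>lborel) \<partial>lborel)"
    and "integrable lborel (\<lambda>x. \<integral>s. G s x \<partial>lborel)"
proof -
  have m [measurable]: "case_prod G \<in> borel_measurable (lborel \<Otimes>\<^sub>M lborel)" by simp
  have "integrable lborel (\<lambda>s. \<integral>x. norm (case_prod G (s, x)) \<partial>lborel)"
  proof (rule Bochner_Integration.integrable_bound)
    show "integrable lborel (\<lambda>s::real. c * indicator {0..1} s)" by simp
    show "AE s in lborel. norm (\<integral>x. norm (case_prod G (s, x)) \<partial>lborel) \<le> norm (c * indicator {0..1} s)"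
      using c by (auto intro!: AE_I2 order_trans[OF _ abs_ge_self])
  qed measurable
  then have I: "integrable (lborel \<Otimes>\<^sub>M lborel) (case_prod G)"
    using i by (intro lborel_pair.Fubini_integrable m) auto
  show "(\<integral>x. (\<integral>s. G s x \<partial>lborel) \<partial>lborel) = (\<integral>s. (\<integral>x. G s x \<partial>lborel) \<partial>lborel)"
    using lborel_pair.Fubini_integral[OF I] by simp
  show "integrable lborel (\<lambda>x. \<integral>s. G s x \<partial>lborel)"
    using lborel_pair.integrable_snd[OF I] by simp
qed

text \<open>The duality behind the Taylor formulas. If differentiating \<open>f\<close> into \<open>k\<close> is transposed to passing from
\<open>\<phi>\<close> to \<open>\<Phi>\<close>, for all translates of \<open>\<phi>\<close> along the segment from \<open>0\<close> to \<open>h\<close>, then averaging over the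
translates with weight \<open>m\<close> moves the average from the test function to \<open>k\<close>. Fubini's theorem exchanges
the average with the integral, and a translation carries \<open>x - s *\<^sub>R h\<close> to \<open>x\<close>.\<close>

lemma shifted_pairing_Fubini:
  assumes f: "integrable lborel f" and k: "integrable lborel k"
    and \<phi>: "test_function V \<phi>" and \<Phi>: "test_function V' \<Phi>"
    and m [measurable]: "m \<in> borel_measurable borel" and m1: "\<And>s. 0 \<le> s \<Longrightarrow> s \<le> 1 \<Longrightarrow> \<bar>m s\<bar> \<le> 1"
    and eq: "\<And>s. 0 \<le> s \<Longrightarrow> s \<le> 1 \<Longrightarrow> (\<integral>x. f x * \<Phi> (x - s *\<^sub>R h) \<partial>lborel) = (\<integral>x. k x * \<phi> (x - s *\<^sub>R h) \<partial>lborel)"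
  shows "(\<integral>x. f x * (\<integral>s. indicator {0..1} s * (m s * \<Phi> (x - s *\<^sub>R h)) \<partial>lborel) \<partial>lborel)
       = (\<integral>x. (\<integral>s. indicator {0..1} s * (m s * k (x + s *\<^sub>R h)) \<partial>lborel) * \<phi> x \<partial>lborel)"
    and "integrable lborel (\<lambda>x. \<integral>s. indicator {0..1} s * (m s * k (x + s *\<^sub>R h)) \<partial>lborel)"
proof -
  have [measurable]: "f \<in> borel_measurable borel" "k \<in> borel_measurable borel"
     "\<phi> \<in> borel_measurable borel" "\<Phi> \<in> borel_measurable borel"
    using f k \<phi> \<Phi> test_function_measurable by auto
  obtain B where B: "\<And>x. \<bar>\<phi> x\<bar> \<le> B" using test_function_bounded[OF \<phi>] by blast
  obtain B' where B': "\<And>x. \<bar>\<Phi> x\<bar> \<le> B'" using test_function_bounded[OF \<Phi>] by blast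
  have B0: "0 \<le> B" "0 \<le> B'" using B[of 0] B'[of 0] by linarith+
  let ?I = "indicator {0..1} :: real \<Rightarrow> real"
  let ?G = "\<lambda>s x. f x * (?I s * (m s * \<Phi> (x - s *\<^sub>R h)))"
  let ?K = "\<lambda>s x. ?I s * (m s * k (x + s *\<^sub>R h))"
  let ?L = "\<lambda>s x. ?K s x * \<phi> x"
  have bI: "\<bar>?I s * (m s * r)\<bar> \<le> ?I s * \<bar>r\<bar>" for s r
    using m1[of s] by (auto simp: indicator_def abs_mult mult_left_le_one_le)
  have bG: "\<bar>?G s x\<bar> \<le> (B' * ?I s) * \<bar>f x\<bar>" for s x
  proof -
    have "\<bar>?G s x\<bar> \<le> \<bar>f x\<bar> * (?I s * \<bar>\<Phi> (x - s *\<^sub>R h)\<bar>)"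
      using bI by (simp add: abs_mult[of "f x"] mult_left_mono)
    also have "\<dots> \<le> \<bar>f x\<bar> * (?I s * B')" by (intro mult_left_mono B') auto
    finally show ?thesis by (simp add: mult_ac)
  qed
  have iG: "integrable lborel (?G s)" for s
    by (rule Bochner_Integration.integrable_bound[OF integrable_mult_right[OF integrable_abs[OF f], of "B' * ?I s"]])
       (use bG B0 in \<open>auto simp: abs_mult\<close>)
  have F1: "(\<integral>x. (\<integral>s. ?G s x \<partial>lborel) \<partial>lborel) = (\<integral>s. (\<integral>x. ?G s x \<partial>lborel) \<partial>lborel)"
  proof (rule Fubini_unit_interval(1)[OF _ iG])
    show "(\<integral>x. \<bar>?G s x\<bar> \<partial>lborel) \<le> (B' * (\<integral>x. \<bar>f x\<bar> \<partial>lborel)) * ?I s" for s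
    proof -
      have "(\<integral>x. \<bar>?G s x\<bar> \<partial>lborel) \<le> (\<integral>x. (B' * ?I s) * \<bar>f x\<bar> \<partial>lborel)"
        using bG iG f by (intro integral_mono) auto
      then show ?thesis by (simp add: mult_ac)
    qed
  qed measurable
  have iK: "integrable lborel (?K s)" and cK: "(\<integral>x. \<bar>?K s x\<bar> \<partial>lborel) \<le> (\<integral>x. \<bar>k x\<bar> \<partial>lborel) * ?I s" for s
  proof -
    have ks: "integrable lborel (\<lambda>x. k (x + s *\<^sub>R h))" using integrable_lborel_shift[OF k] .
    then show iK: "integrable lborel (?K s)" by simp
    have "(\<integral>x. \<bar>?K s x\<bar> \<partial>lborel) \<le> (\<integral>x. ?I s * \<bar>k (x + s *\<^sub>R h)\<bar> \<partial>lborel)"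
      using bI iK ks by (intro integral_mono) auto
    also have "\<dots> = ?I s * (\<integral>x. \<bar>k x\<bar> \<partial>lborel)"
      using integral_lborel_shift[of "\<lambda>x. \<bar>k x\<bar>"] by simp
    finally show "(\<integral>x. \<bar>?K s x\<bar> \<partial>lborel) \<le> (\<integral>x. \<bar>k x\<bar> \<partial>lborel) * ?I s" by (simp add: mult.commute)
  qed
  show "integrable lborel (\<lambda>x. \<integral>s. ?K s x \<partial>lborel)"
    by (rule Fubini_unit_interval(2)[OF _ iK cK]) measurable
  have iL: "integrable lborel (?L s)" for s using integrable_mult_test[OF iK \<phi>] .
  have F2: "(\<integral>x. (\<integral>s. ?L s x \<partial>lborel) \<partial>lborel) = (\<integral>s. (\<integral>x. ?L s x \<partial>lborel) \<partial>lborel)"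
  proof (rule Fubini_unit_interval(1)[OF _ iL])
    show "(\<integral>x. \<bar>?L s x\<bar> \<partial>lborel) \<le> (B * (\<integral>x. \<bar>k x\<bar> \<partial>lborel)) * ?I s" for s
    proof -
      have "(\<integral>x. \<bar>?L s x\<bar> \<partial>lborel) \<le> (\<integral>x. \<bar>?K s x\<bar> * B \<partial>lborel)"
        using B iL iK by (intro integral_mono) (auto simp: abs_mult[of _ "\<phi> _"] intro!: mult_left_mono integrable_abs[OF iL, unfolded abs_mult[of _ "\<phi> _"]])
      also have "\<dots> \<le> ((\<integral>x. \<bar>k x\<bar> \<partial>lborel) * ?I s) * B" using cK[of s] B0 by (simp add: mult_right_mono)
      finally show ?thesis by (simp add: mult_ac)
    qed
  qed measurable
  have "(\<integral>x. f x * (\<integral>s. ?I s * (m s * \<Phi> (x - s *\<^sub>R h)) \<partial>lborel) \<partial>lborel) = (\<integral>x. (\<integral>s. ?G s x \<partial>lborel) \<partial>lborel)"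
    by simp
  also note F1
  also have "(\<integral>s. (\<integral>x. ?G s x \<partial>lborel) \<partial>lborel) = (\<integral>s. (\<integral>x. ?L s x \<partial>lborel) \<partial>lborel)"
  proof (rule Bochner_Integration.integral_cong[OF refl])
    fix s :: real
    show "(\<integral>x. ?G s x \<partial>lborel) = (\<integral>x. ?L s x \<partial>lborel)"
    proof (cases "s \<in> {0..1}")
      case True
      have "(\<integral>x. ?G s x \<partial>lborel) = m s * (\<integral>x. f x * \<Phi> (x - s *\<^sub>R h) \<partial>lborel)"
        using True by (subst integral_mult_right_zero[symmetric]) (simp add: mult_ac)
      also have "\<dots> = m s * (\<integral>x. k x * \<phi> (x - s *\<^sub>R h) \<partial>lborel)" using eq True by simp
      also have "(\<integral>x. k x * \<phi> (x - s *\<^sub>R h) \<partial>lborel) = (\<integral>x. k (x + s *\<^sub>R h) * \<phi> x \<partial>lborel)"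
        using integral_lborel_shift[of "\<lambda>x. k x * \<phi> (x - s *\<^sub>R h)" "s *\<^sub>R h"] by simp
      also have "m s * (\<integral>x. k (x + s *\<^sub>R h) * \<phi> x \<partial>lborel) = (\<integral>x. ?L s x \<partial>lborel)"
        using True by (subst integral_mult_right_zero[symmetric]) (simp add: mult_ac)
      finally show ?thesis .
    qed simp
  qed
  also note F2[symmetric]
  finally show "(\<integral>x. f x * (\<integral>s. ?I s * (m s * \<Phi> (x - s *\<^sub>R h)) \<partial>lborel) \<partial>lborel)
       = (\<integral>x. (\<integral>s. ?K s x \<partial>lborel) * \<phi> x \<partial>lborel)" by simp
qed

lemma integrable_indicator_mult:
  fixes f :: "'a \<Rightarrow> real"
  assumes "integrable M f" "A \<in> sets M"
  shows "integrable M (\<lambda>x. indicator A x * f x)"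
  using integrable_mult_indicator[OF assms(2,1)] by simp

lemma smooth_dir_deriv: "smooth \<phi> \<Longrightarrow> smooth (dir_deriv h \<phi>)"
  unfolding dir_deriv_def[abs_def] by (intro smooth_add smooth_mult smooth_const smooth_partial)

lemma test_function_uminus_dir_deriv:
  assumes "test_function U \<phi>" shows "test_function U (\<lambda>x. - dir_deriv h \<phi> x)"
proof -
  from assms obtain C where C: "smooth \<phi>" "compact C" "C \<subseteq> U" "\<And>x. x \<notin> C \<Longrightarrow> \<phi> x = 0"
    unfolding test_function_iff by blast
  have "smooth (\<lambda>x. - dir_deriv h \<phi> x)"
    using smooth_mult[OF smooth_const[of "-1"] smooth_dir_deriv[OF C(1)]] by simp
  then show ?thesis unfolding test_function_iff
    using C partial_outside_support[OF C(2,4)] by (intro conjI exI[of _ C]) (auto simp: dir_deriv_def)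
qed

lemma dir_deriv_shift:
  "smooth \<phi> \<Longrightarrow> dir_deriv h (\<lambda>x. \<phi> (x - a)) x = dir_deriv h \<phi> (x - a)"
  using partial_shift(1)[of \<phi> x "- a"] smooth_differentiable by (simp add: dir_deriv_def)

lemma DERIV_backward_line:
  assumes "smooth \<phi>"
  shows "((\<lambda>s. \<phi> (x - s *\<^sub>R h)) has_real_derivative - dir_deriv h \<phi> (x - s *\<^sub>R h)) (at s)"
  using DERIV_along_line[of \<phi> x s "- h"] smooth_differentiable[OF assms] by (simp add: dir_deriv_def)

lemma integral_unit_interval_FTC:
  assumes "\<And>s. (F has_real_derivative f s) (at s)" "continuous_on UNIV f"
  shows "(\<integral>s. indicator {0..1} s * f s \<partial>lborel) = F 1 - F (0::real)"
  using integral_FTC_Icc_real[of 0 1 F f] assms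
  by (simp add: continuous_on_eq_continuous_at mult.commute)

text \<open>A function supported in the overlap of \<open>U\<close> and \<open>U - h\<close> may be moved by any fraction of \<open>h\<close> without
leaving \<open>U\<close>; this is where convexity is used.\<close>

lemma test_along_segment:
  assumes "convex U" "test_function {x \<in> U. x + h \<in> U} \<phi>" "0 \<le> s" "s \<le> 1"
  shows "test_function U (\<lambda>x. \<phi> (x - s *\<^sub>R h))"
proof -
  have "x - - (s *\<^sub>R h) \<in> U" if "x \<in> {x \<in> U. x + h \<in> U}" for x
  proof -
    have "(1 - s) *\<^sub>R x + s *\<^sub>R (x + h) \<in> U" using that assms by (intro convexD) auto
    then show ?thesis by (simp add: algebra_simps)
  qed
  from test_function_shift[OF assms(2) this] show ?thesis by simp
qed

lemma weak_dir_shifted_test: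
  assumes "convex U" "test_function {x \<in> U. x + h \<in> U} \<phi>" "0 \<le> s" "s \<le> 1" "weak_dir U h f k"
  shows "(\<integral>x. f x * - dir_deriv h \<phi> (x - s *\<^sub>R h) \<partial>lborel) = (\<integral>x. k x * \<phi> (x - s *\<^sub>R h) \<partial>lborel)"
proof -
  have "smooth \<phi>" using assms(2) test_function_iff by blast
  then show ?thesis
    using assms(5)[unfolded weak_dir_def, rule_format, OF test_along_segment[OF assms(1-4)]]
    by (simp add: dir_deriv_shift)
qed

lemma continuous_on_backward_line:
  assumes "smooth \<phi>" shows "continuous_on S (\<lambda>s. \<phi> (x - s *\<^sub>R h))"
  by (rule continuous_on_compose2[OF smooth_continuous[OF assms, of UNIV]]) (auto intro!: continuous_intros)

lemma open_overlap:
  assumes "open (U :: pt set)" shows "open {x \<in> U. x + h \<in> U}"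
proof -
  have "{x \<in> U. x + h \<in> U} = U \<inter> (\<lambda>x. x + h) -` U" by auto
  then show ?thesis using assms by (auto intro!: open_Int open_vimage continuous_intros)
qed

text \<open>Tested against \<open>\<phi>\<close>, the difference \<open>f (x + h) - f x\<close> becomes \<open>f\<close> tested against \<open>\<phi> (x - h) - \<phi> x\<close>.
The fundamental theorem of calculus writes this as an integral of derivatives of \<open>\<phi>\<close> along the
segment, and \<open>shifted_pairing_Fubini\<close> moves the derivatives onto \<open>f\<close>.\<close>

theorem weak_taylor_1:
  assumes U: "open U" "convex U" "bounded U" and f: "L2_on U f" and k: "L2_on U k" and w: "weak_dir U h f k"
  shows "AE x in lborel. x \<in> {x \<in> U. x + h \<in> U} \<longrightarrow>
    f (x + h) - f x = (\<integral>s. indicator {0..1} s * k (x + s *\<^sub>R h) \<partial>lborel)"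
proof -
  let ?V = "{x \<in> U. x + h \<in> U}"
  let ?I = "\<lambda>x. \<integral>s. indicator {0..1} s * (1 * k (x + s *\<^sub>R h)) \<partial>lborel"
  note i = L2_on_integrable[OF f U(1,3)] L2_on_integrable[OF k U(1,3)]
  have [measurable]: "f \<in> borel_measurable borel" "k \<in> borel_measurable borel"
    using f k by (auto simp: L2_on_def)
  have test0: "test_function ?V (\<lambda>_. 0)"
    unfolding test_function_iff using smooth_const by (intro conjI exI[of _ "{}"]) auto
  have iI: "integrable lborel ?I"
    by (rule shifted_pairing_Fubini(2)[OF i test0 test0, of "\<lambda>_. 1"]) auto
  have "AE x in lborel. x \<in> ?V \<longrightarrow> f (x + h) - f x - ?I x = 0"
  proof (rule fundamental_lemma_variations[OF open_overlap[OF U(1)]])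
    have int: "integrable lborel (\<lambda>x. f (x + h) - f x - ?I x)"
      using i iI by (intro Bochner_Integration.integrable_diff integrable_lborel_shift)
    show "integrable lborel (\<lambda>x. indicator (cbox a b) x * (f (x + h) - f x - ?I x))" for a b
      by (rule integrable_indicator_mult[OF int]) simp
    show "(\<lambda>x. f (x + h) - f x - ?I x) \<in> borel_measurable borel" using int by simp
    fix \<phi> assume \<phi>: "test_function ?V \<phi>"
    then have sm: "smooth \<phi>" using test_function_iff by blast
    let ?\<Phi> = "\<lambda>x. - dir_deriv h \<phi> x"
    have 1: "(\<integral>x. f x * (\<integral>s. indicator {0..1} s * (1 * ?\<Phi> (x - s *\<^sub>R h)) \<partial>lborel) \<partial>lborel)
       = (\<integral>x. ?I x * \<phi> x \<partial>lborel)"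
      by (rule shifted_pairing_Fubini(1)[OF i \<phi> test_function_uminus_dir_deriv[OF \<phi>], of "\<lambda>_. 1"])
        (use weak_dir_shifted_test[OF U(2) \<phi> _ _ w] in auto)
    have 2: "(\<integral>s. indicator {0..1} s * (1 * ?\<Phi> (x - s *\<^sub>R h)) \<partial>lborel) = \<phi> (x - h) - \<phi> x" for x
      using integral_unit_interval_FTC[OF DERIV_backward_line[OF sm, of x h]]
        continuous_on_backward_line[OF smooth_dir_deriv[OF sm], where S=UNIV and x=x and h=h]
      by (simp add: continuous_on_minus)
    have sh: "test_function U (\<lambda>x. \<phi> (x - h))" "test_function U \<phi>"
      using test_along_segment[OF U(2) \<phi>, of 1] test_along_segment[OF U(2) \<phi>, of 0] by auto
    have 3: "(\<integral>x. f x * \<phi> (x - h) \<partial>lborel) = (\<integral>x. f (x + h) * \<phi> x \<partial>lborel)"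
      using integral_lborel_shift[of "\<lambda>x. f x * \<phi> (x - h)" h] test_function_measurable[OF \<phi>] by simp
    note j = integrable_mult_test[OF i(1) sh(1)] integrable_mult_test[OF i(1) \<phi>]
      integrable_mult_test[OF integrable_lborel_shift[OF i(1)] \<phi>] integrable_mult_test[OF iI \<phi>]
    have "(\<integral>x. f x * (\<phi> (x - h) - \<phi> x) \<partial>lborel) = (\<integral>x. f (x + h) * \<phi> x \<partial>lborel) - (\<integral>x. f x * \<phi> x \<partial>lborel)"
      using j 3 by (simp add: right_diff_distrib)
    with 1[unfolded 2] have 4: "(\<integral>x. ?I x * \<phi> x \<partial>lborel) = (\<integral>x. f (x + h) * \<phi> x \<partial>lborel) - (\<integral>x. f x * \<phi> x \<partial>lborel)"
      by simp
    have "(\<integral>x. (f (x + h) - f x - ?I x) * \<phi> x \<partial>lborel) =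
      (\<integral>x. f (x + h) * \<phi> x - f x * \<phi> x - ?I x * \<phi> x \<partial>lborel)" by (simp only: left_diff_distrib)
    also have "\<dots> = (\<integral>x. f (x + h) * \<phi> x \<partial>lborel) - (\<integral>x. f x * \<phi> x \<partial>lborel) - (\<integral>x. ?I x * \<phi> x \<partial>lborel)"
      using j by simp
    also have "\<dots> = 0" using 4 by simp
    finally show "(\<integral>x. (f (x + h) - f x - ?I x) * \<phi> x \<partial>lborel) = 0" .
  qed
  then show ?thesis by simp
qed

text \<open>Expansion about the point \<open>x + h\<close>, to be read as an expression for \<open>f x\<close> through values elsewhere. The
proof is that of \<open>weak_taylor_1\<close> with weight \<open>s\<close>; the corresponding identity for the test function is
an integration by parts in \<open>s\<close>. The weight \<open>s\<close> in the remainder compensates the concentration of the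
points \<open>x + s *\<^sub>R h\<close> near \<open>x\<close> when one integrates over \<open>h\<close>.\<close>

theorem weak_taylor_2:
  assumes U: "open U" "convex U" "bounded U" and f: "L2_on U f" and k: "L2_on U k" and kk: "L2_on U kk"
    and w: "weak_dir U h f k" "weak_dir U h k kk"
  shows "AE x in lborel. x \<in> {x \<in> U. x + h \<in> U} \<longrightarrow>
    f x = f (x + h) - k (x + h) + (\<integral>s. indicator {0..1} s * (s * kk (x + s *\<^sub>R h)) \<partial>lborel)"
proof -
  let ?V = "{x \<in> U. x + h \<in> U}"
  let ?I = "\<lambda>x. \<integral>s. indicator {0..1} s * (s * kk (x + s *\<^sub>R h)) \<partial>lborel"
  note i = L2_on_integrable[OF f U(1,3)] L2_on_integrable[OF kk U(1,3)]
  note ik = L2_on_integrable[OF k U(1,3)]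
  have [measurable]: "f \<in> borel_measurable borel" "k \<in> borel_measurable borel" "kk \<in> borel_measurable borel"
    using f k kk by (auto simp: L2_on_def)
  have test0: "test_function ?V (\<lambda>_. 0)"
    unfolding test_function_iff using smooth_const by (intro conjI exI[of _ "{}"]) auto
  have iI: "integrable lborel ?I"
    by (rule shifted_pairing_Fubini(2)[OF i test0 test0, of "\<lambda>s. s"]) auto
  have "AE x in lborel. x \<in> ?V \<longrightarrow> f (x + h) - k (x + h) - f x + ?I x = 0"
  proof (rule fundamental_lemma_variations[OF open_overlap[OF U(1)]])
    have int: "integrable lborel (\<lambda>x. f (x + h) - k (x + h) - f x + ?I x)"
      using i iI ik by (intro Bochner_Integration.integrable_diff Bochner_Integration.integrable_add integrable_lborel_shift)
    show "integrable lborel (\<lambda>x. indicator (cbox a b) x * (f (x + h) - k (x + h) - f x + ?I x))" for a b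
      by (rule integrable_indicator_mult[OF int]) simp
    show "(\<lambda>x. f (x + h) - k (x + h) - f x + ?I x) \<in> borel_measurable borel" using int by simp
    fix \<phi> assume \<phi>: "test_function ?V \<phi>"
    then have sm: "smooth \<phi>" using test_function_iff by blast
    define \<Phi> where "\<Phi> = (\<lambda>x. - dir_deriv h \<phi> x)"
    have \<Phi>: "test_function ?V \<Phi>" unfolding \<Phi>_def by (rule test_function_uminus_dir_deriv[OF \<phi>])
    then have smP: "smooth \<Phi>" using test_function_iff by blast
    let ?\<Psi> = "\<lambda>x. - dir_deriv h \<Phi> x"
    have eq2: "(\<integral>x. k x * \<Phi> (x - s *\<^sub>R h) \<partial>lborel) = (\<integral>x. kk x * \<phi> (x - s *\<^sub>R h) \<partial>lborel)" if "0 \<le> s" "s \<le> 1" for s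
      using weak_dir_shifted_test[OF U(2) \<phi> that w(2)] by (simp add: \<Phi>_def)
    have eq1: "(\<integral>x. f x * ?\<Psi> (x - s *\<^sub>R h) \<partial>lborel) = (\<integral>x. k x * \<Phi> (x - s *\<^sub>R h) \<partial>lborel)" if "0 \<le> s" "s \<le> 1" for s
      using weak_dir_shifted_test[OF U(2) \<Phi> that w(1)] by simp
    have eq0: "(\<integral>x. f x * \<Phi> (x - s *\<^sub>R h) \<partial>lborel) = (\<integral>x. k x * \<phi> (x - s *\<^sub>R h) \<partial>lborel)" if "0 \<le> s" "s \<le> 1" for s
      using weak_dir_shifted_test[OF U(2) \<phi> that w(1)] by (simp add: \<Phi>_def)
    have 1: "(\<integral>x. f x * (\<integral>s. indicator {0..1} s * (s * ?\<Psi> (x - s *\<^sub>R h)) \<partial>lborel) \<partial>lborel)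
       = (\<integral>x. ?I x * \<phi> x \<partial>lborel)"
      by (rule shifted_pairing_Fubini(1)[OF i \<phi> test_function_uminus_dir_deriv[OF \<Phi>], of "\<lambda>s. s"])
        (use eq1 eq2 in auto)
    have 2: "(\<integral>s. indicator {0..1} s * (s * ?\<Psi> (x - s *\<^sub>R h)) \<partial>lborel) = \<Phi> (x - h) - \<phi> (x - h) + \<phi> x" for x
    proof -
      \<comment> \<open>the primitive found by integrating \<open>s * ?\<Psi>\<close> by parts\<close>
      have "((\<lambda>s. s * \<Phi> (x - s *\<^sub>R h) - \<phi> (x - s *\<^sub>R h)) has_real_derivative s * ?\<Psi> (x - s *\<^sub>R h)) (at s)" for s
        by (rule DERIV_cong[OF DERIV_diff[OF DERIV_mult[OF DERIV_ident DERIV_backward_line[OF smP]] DERIV_backward_line[OF sm]]])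
          (simp add: \<Phi>_def)
      moreover have "continuous_on UNIV (\<lambda>s. s * ?\<Psi> (x - s *\<^sub>R h))"
        using continuous_on_backward_line[OF smooth_dir_deriv[OF smP], where S=UNIV and x=x and h=h]
        by (intro continuous_intros)
      ultimately show ?thesis
        by (subst integral_unit_interval_FTC) auto
    qed
    have sh: "test_function U (\<lambda>x. \<phi> (x - h))" "test_function U (\<lambda>x. \<Phi> (x - h))"
      using test_along_segment[OF U(2) \<phi>, of 1] test_along_segment[OF U(2) \<Phi>, of 1] by auto
    have 3: "(\<integral>x. g x * \<phi> (x - h) \<partial>lborel) = (\<integral>x. g (x + h) * \<phi> x \<partial>lborel)"
      if [measurable]: "g \<in> borel_measurable borel" for g :: "pt \<Rightarrow> real"
      using integral_lborel_shift[of "\<lambda>x. g x * \<phi> (x - h)" h] test_function_measurable[OF \<phi>] by simp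
    note j = integrable_mult_test[OF i(1) sh(1)] integrable_mult_test[OF i(1) sh(2)] integrable_mult_test[OF i(1) \<phi>]
      integrable_mult_test[OF integrable_lborel_shift[OF i(1)] \<phi>] integrable_mult_test[OF iI \<phi>]
      integrable_mult_test[OF integrable_lborel_shift[OF ik] \<phi>]
    have "(\<integral>x. f x * (\<Phi> (x - h) - \<phi> (x - h) + \<phi> x) \<partial>lborel) = (\<integral>x. f x * \<Phi> (x - h) \<partial>lborel) - (\<integral>x. f x * \<phi> (x - h) \<partial>lborel) + (\<integral>x. f x * \<phi> x \<partial>lborel)"
      using j by (simp add: right_diff_distrib distrib_left)
    also have "(\<integral>x. f x * \<Phi> (x - h) \<partial>lborel) = (\<integral>x. k (x + h) * \<phi> x \<partial>lborel)"
      using eq0[of 1] 3[of k] by simp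
    also have "(\<integral>x. f x * \<phi> (x - h) \<partial>lborel) = (\<integral>x. f (x + h) * \<phi> x \<partial>lborel)" using 3[of f] by simp
    finally have 4: "(\<integral>x. ?I x * \<phi> x \<partial>lborel) = (\<integral>x. k (x + h) * \<phi> x \<partial>lborel) - (\<integral>x. f (x + h) * \<phi> x \<partial>lborel) + (\<integral>x. f x * \<phi> x \<partial>lborel)"
      using 1[unfolded 2] by simp
    have "(\<integral>x. (f (x + h) - k (x + h) - f x + ?I x) * \<phi> x \<partial>lborel) =
      (\<integral>x. f (x + h) * \<phi> x - k (x + h) * \<phi> x - f x * \<phi> x + ?I x * \<phi> x \<partial>lborel)" by (simp only: left_diff_distrib distrib_right)
    also have "\<dots> = (\<integral>x. f (x + h) * \<phi> x \<partial>lborel) - (\<integral>x. k (x + h) * \<phi> x \<partial>lborel) - (\<integral>x. f x * \<phi> x \<partial>lborel) + (\<integral>x. ?I x * \<phi> x \<partial>lborel)"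
      using j by simp
    also have "\<dots> = 0" using 4 by simp
    finally show "(\<integral>x. (f (x + h) - k (x + h) - f x + ?I x) * \<phi> x \<partial>lborel) = 0" .
  qed
  then show ?thesis by eventually_elim auto
qed

section \<open>Poincare and Sobolev inequalities on convex sets\<close>

text \<open>Jensen's inequality on the unit interval, in a form in which the right hand side may be infinite.\<close>

lemma square_integral_unit_interval_le:
  fixes g :: "real \<Rightarrow> real"
  assumes [measurable]: "g \<in> borel_measurable borel"
  shows "ennreal ((\<integral>s. indicator {0..1} s * g s \<partial>lborel)\<^sup>2) \<le> (\<integral>\<^sup>+s. ennreal (indicator {0..1} s * (g s)\<^sup>2) \<partial>lborel)"
proof (cases "integrable lborel (\<lambda>s. indicator {0..1} s * (g s)\<^sup>2)")
  case True
  have i1: "integrable lborel (indicator {0..1} :: real \<Rightarrow> real)" by simp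
  have "\<bar>r\<bar> \<le> 1 + r\<^sup>2" for r :: real
    using zero_le_power2[of "\<bar>r\<bar> - 1"] abs_ge_zero[of r] by (simp add: power2_diff)
  then have i: "integrable lborel (\<lambda>s. indicator {0..1} s * g s)"
    by (intro Bochner_Integration.integrable_bound[OF Bochner_Integration.integrable_add[OF i1 True]])
      (auto simp: indicator_def)
  define c where "c = (\<integral>s. indicator {0..1} s * g s \<partial>lborel)"
  have "0 \<le> (\<integral>s. indicator {0..1} s * (g s - c)\<^sup>2 \<partial>lborel)" by (intro integral_nonneg_AE AE_I2) auto
  also have "\<dots> = (\<integral>s. indicator {0..1} s * (g s)\<^sup>2 - 2 * c * (indicator {0..1} s * g s) + c\<^sup>2 * indicator {0..1} s \<partial>lborel)"
    by (intro Bochner_Integration.integral_cong) (auto simp: indicator_def power2_diff)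
  also have "\<dots> = (\<integral>s. indicator {0..1} s * (g s)\<^sup>2 \<partial>lborel) - 2 * c * c + c\<^sup>2"
    using True i i1 by (simp add: c_def[symmetric])
  finally have "c\<^sup>2 \<le> (\<integral>s. indicator {0..1} s * (g s)\<^sup>2 \<partial>lborel)" by (simp add: power2_eq_square)
  also have "ennreal \<dots> = (\<integral>\<^sup>+s. ennreal (indicator {0..1} s * (g s)\<^sup>2) \<partial>lborel)"
    by (rule nn_integral_eq_integral[OF True, symmetric]) simp
  finally show ?thesis by (simp add: c_def ennreal_leI)
next
  case False
  then have "(\<integral>\<^sup>+s. ennreal (indicator {0..1} s * (g s)\<^sup>2) \<partial>lborel) = \<infinity>"
    by (subst (asm) integrable_iff_bounded) (auto simp: less_top[symmetric])
  then show ?thesis by simp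
qed

text \<open>The translation estimate of Sobolev theory: square \<open>weak_taylor_1\<close>, and use that each point of the
segment contributes the same integral, by translation invariance.\<close>

lemma translation_energy_le:
  assumes U: "open U" "convex U" "bounded U" and f: "L2_on U f" and k: "L2_on U k" and w: "weak_dir U h f k"
  shows "(\<integral>\<^sup>+x. indicator {x \<in> U. x + h \<in> U} x * ennreal ((f (x + h) - f x)\<^sup>2) \<partial>lborel)
     \<le> ennreal (\<integral>x. (k x)\<^sup>2 \<partial>lborel)"
proof -
  have [measurable]: "f \<in> borel_measurable borel" "k \<in> borel_measurable borel"
    using f k by (auto simp: L2_on_def)
  let ?V = "{x \<in> U. x + h \<in> U}"
  have "(\<integral>\<^sup>+x. indicator ?V x * ennreal ((f (x + h) - f x)\<^sup>2) \<partial>lborel)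
     \<le> (\<integral>\<^sup>+x. (\<integral>\<^sup>+s. ennreal (indicator {0..1} s * (k (x + s *\<^sub>R h))\<^sup>2) \<partial>lborel) \<partial>lborel)"
    using weak_taylor_1[OF assms]
  proof (intro nn_integral_mono_AE, eventually_elim)
    fix x assume x: "x \<in> ?V \<longrightarrow> f (x + h) - f x = (\<integral>s. indicator {0..1} s * k (x + s *\<^sub>R h) \<partial>lborel)"
    show "indicator ?V x * ennreal ((f (x + h) - f x)\<^sup>2) \<le> (\<integral>\<^sup>+s. ennreal (indicator {0..1} s * (k (x + s *\<^sub>R h))\<^sup>2) \<partial>lborel)"
    proof (cases "x \<in> ?V")
      case True
      then show ?thesis
        using x square_integral_unit_interval_le[of "\<lambda>s. k (x + s *\<^sub>R h)"] by simp
    next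
      case False
      then have "indicator ?V x = (0::ennreal)" by (rule indicator_simps(2))
      then show ?thesis by (simp only: mult_zero_left zero_le)
    qed
  qed
  also have "\<dots> = (\<integral>\<^sup>+s. (\<integral>\<^sup>+x. ennreal (indicator {0..1} s * (k (x + s *\<^sub>R h))\<^sup>2) \<partial>lborel) \<partial>lborel)"
    by (rule lborel_pair.Fubini') measurable
  also have "\<dots> = (\<integral>\<^sup>+s. (\<integral>\<^sup>+x. ennreal ((k x)\<^sup>2) \<partial>lborel) * indicator {0..1::real} s \<partial>lborel)"
  proof (rule nn_integral_cong)
    fix s :: real
    have "(\<integral>\<^sup>+x. ennreal (indicator {0..1} s * (k (x + s *\<^sub>R h))\<^sup>2) \<partial>lborel) = indicator {0..1} s * (\<integral>\<^sup>+x. ennreal ((k (x + s *\<^sub>R h))\<^sup>2) \<partial>lborel)"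
      by (auto simp: indicator_def)
    also have "(\<integral>\<^sup>+x. ennreal ((k (x + s *\<^sub>R h))\<^sup>2) \<partial>lborel) = (\<integral>\<^sup>+x. ennreal ((k x)\<^sup>2) \<partial>lborel)"
      by (rule nn_integral_lborel_shift) measurable
    finally show "(\<integral>\<^sup>+x. ennreal (indicator {0..1} s * (k (x + s *\<^sub>R h))\<^sup>2) \<partial>lborel) = (\<integral>\<^sup>+x. ennreal ((k x)\<^sup>2) \<partial>lborel) * indicator {0..1} s"
      by (simp add: mult.commute)
  qed
  also have "\<dots> = (\<integral>\<^sup>+x. ennreal ((k x)\<^sup>2) \<partial>lborel)" by (simp add: nn_integral_cmult_indicator)
  also have "\<dots> = ennreal (\<integral>x. (k x)\<^sup>2 \<partial>lborel)"
    using k by (intro nn_integral_eq_integral) (auto simp: L2_on_def)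
  finally show ?thesis .
qed

lemma dir_square_le:
  fixes h :: pt assumes "\<bar>h$1\<bar> \<le> d" "\<bar>h$2\<bar> \<le> d"
  shows "(h$1 * a + h$2 * b)\<^sup>2 \<le> 2 * d\<^sup>2 * (a\<^sup>2 + b\<^sup>2)"
proof -
  have "(h$1 * a + h$2 * b)\<^sup>2 \<le> 2 * ((h$1 * a)\<^sup>2 + (h$2 * b)\<^sup>2)"
    using zero_le_power2[of "h$1 * a - h$2 * b"] by (simp add: power2_eq_square algebra_simps)
  also have "\<dots> \<le> 2 * (d\<^sup>2 * a\<^sup>2 + d\<^sup>2 * b\<^sup>2)"
    unfolding power_mult_distrib
    using assms by (intro mult_left_mono add_mono mult_right_mono abs_le_square_iff[THEN iffD1]) auto
  finally show ?thesis by (simp add: algebra_simps)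
qed

lemma L2_on_sum_dir:
  assumes "L2_on U g1" "L2_on U g2" shows "L2_on U (\<lambda>x. a * g1 x + b * g2 x)"
  using assms by (intro L2_on_add L2_on_cmult)

text \<open>For a function of mean zero, the integral of \<open>(f x - f y)\<^sup>2\<close> over pairs of points of \<open>U\<close> is twice the
measure of \<open>U\<close> times the integral of \<open>f\<^sup>2\<close>. Grouped by the difference \<open>h = y - x\<close>, the same integral is
bounded by \<open>translation_energy_le\<close> for each \<open>h\<close>, and all differences lie in a square of side \<open>2 * d\<close>.\<close>

theorem poincare_convex:
  assumes U: "open U" "convex U" "bounded U"
    and d: "\<And>x y i. x \<in> U \<Longrightarrow> y \<in> U \<Longrightarrow> \<bar>x$i - y$i\<bar> \<le> d"
    and f: "L2_on U f" and g: "L2_on U g1" "L2_on U g2"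
    and w: "weak_partial U 1 f g1" "weak_partial U 2 f g2" and mean: "(\<integral>x. f x \<partial>lborel) = 0"
  shows "measure lborel U * (\<integral>x. (f x)\<^sup>2 \<partial>lborel)
     \<le> 4 * d^4 * ((\<integral>x. (g1 x)\<^sup>2 \<partial>lborel) + (\<integral>x. (g2 x)\<^sup>2 \<partial>lborel))"
proof (cases "U = {}")
  case True
  then have "f = (\<lambda>x. 0)" "g1 = (\<lambda>x. 0)" "g2 = (\<lambda>x. 0)" using f g by (auto simp: L2_on_def)
  then show ?thesis by simp
next
  case False
  then have d0: "d \<ge> 0" using d by (metis abs_ge_zero ex_in_conv order_trans)
  have [measurable]: "f \<in> borel_measurable borel" "U \<in> sets borel"
    using f U by (auto simp: L2_on_def)
  note i = L2_on_integrable[OF f U(1,3)] L2_on_integrable[OF g(1) U(1,3)] L2_on_integrable[OF g(2) U(1,3)]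
  have i2: "integrable lborel (\<lambda>x. (f x)\<^sup>2)" "integrable lborel (\<lambda>x. (g1 x)\<^sup>2)" "integrable lborel (\<lambda>x. (g2 x)\<^sup>2)"
    using f g by (auto simp: L2_on_def)
  have off: "f x = 0" if "x \<notin> U" for x using f that by (auto simp: L2_on_def)
  have fin: "emeasure lborel U < \<infinity>" using U(3) by (rule emeasure_bounded_finite)
  have iU: "integrable lborel (indicator U :: pt \<Rightarrow> real)" using fin by (intro integrable_real_indicator) auto
  let ?u = "indicator U :: pt \<Rightarrow> real"
  let ?N = "(\<integral>x. (g1 x)\<^sup>2 \<partial>lborel) + (\<integral>x. (g2 x)\<^sup>2 \<partial>lborel)"
  let ?F = "\<integral>x. (f x)\<^sup>2 \<partial>lborel" and ?m = "measure lborel U"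
  have N0: "0 \<le> ?N" by simp
  \<comment> \<open>computed in two ways: by expanding the square, and by the substitution \<open>y = h + x\<close>\<close>
  let ?A = "\<lambda>x y. ennreal (?u x * ?u y * (f x - f y)\<^sup>2)"
  have eq: "?u x * ?u y * (f x - f y)\<^sup>2 = (f x)\<^sup>2 * ?u y - 2 * f x * f y + ?u x * (f y)\<^sup>2" for x y
    using off[of x] off[of y] by (auto simp: indicator_def power2_diff)
  have "(\<integral>\<^sup>+x. (\<integral>\<^sup>+y. ?A x y \<partial>lborel) \<partial>lborel) = (\<integral>\<^sup>+x. ennreal ((f x)\<^sup>2 * ?m + ?u x * ?F) \<partial>lborel)"
  proof (rule nn_integral_cong)
    fix x :: pt
    have "(\<integral>\<^sup>+y. ?A x y \<partial>lborel) = ennreal (\<integral>y. (f x)\<^sup>2 * ?u y - 2 * f x * f y + ?u x * (f y)\<^sup>2 \<partial>lborel)"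
      unfolding eq[symmetric] by (rule nn_integral_eq_integral, unfold eq, use i i2 iU in simp, unfold eq[symmetric], simp)
    also have "(\<integral>y. (f x)\<^sup>2 * ?u y - 2 * f x * f y + ?u x * (f y)\<^sup>2 \<partial>lborel) = (f x)\<^sup>2 * ?m + ?u x * ?F"
      using i i2 iU mean by simp
    finally show "(\<integral>\<^sup>+y. ?A x y \<partial>lborel) = ennreal ((f x)\<^sup>2 * ?m + ?u x * ?F)" .
  qed
  also have "\<dots> = ennreal (\<integral>x. (f x)\<^sup>2 * ?m + ?u x * ?F \<partial>lborel)"
    using i2 iU by (intro nn_integral_eq_integral) auto
  also have "(\<integral>x. (f x)\<^sup>2 * ?m + ?u x * ?F \<partial>lborel) = 2 * ?m * ?F"
    using i2 iU by simp
  finally have 1: "(\<integral>\<^sup>+x. (\<integral>\<^sup>+y. ?A x y \<partial>lborel) \<partial>lborel) = ennreal (2 * ?m * ?F)" .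
  let ?b = "(\<chi> i. d) :: pt"
  have "(\<integral>\<^sup>+x. (\<integral>\<^sup>+y. ?A x y \<partial>lborel) \<partial>lborel) = (\<integral>\<^sup>+x. (\<integral>\<^sup>+h. ?A x (h + x) \<partial>lborel) \<partial>lborel)"
    by (intro nn_integral_cong nn_integral_lborel_shift[symmetric]) measurable
  also have "\<dots> = (\<integral>\<^sup>+h. (\<integral>\<^sup>+x. ?A x (h + x) \<partial>lborel) \<partial>lborel)"
    by (rule lborel_pair.Fubini') measurable
  also have "\<dots> \<le> (\<integral>\<^sup>+h. ennreal (2 * d\<^sup>2 * ?N) * indicator (cbox (- ?b) ?b) h \<partial>lborel)"
  proof (rule nn_integral_mono)
    fix h :: pt
    show "(\<integral>\<^sup>+x. ?A x (h + x) \<partial>lborel) \<le> ennreal (2 * d\<^sup>2 * ?N) * indicator (cbox (- ?b) ?b) h"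
    proof (cases "h \<in> cbox (- ?b) ?b")
      case True
      then have h: "\<bar>h$1\<bar> \<le> d" "\<bar>h$2\<bar> \<le> d" by (auto simp: mem_box_cart forall_2)
      have w': "weak_dir U h f (\<lambda>x. h$1 * g1 x + h$2 * g2 x)" by (intro weak_dirI w i)
      have "(\<integral>\<^sup>+x. ?A x (h + x) \<partial>lborel) = (\<integral>\<^sup>+x. indicator {x \<in> U. x + h \<in> U} x * ennreal ((f (x + h) - f x)\<^sup>2) \<partial>lborel)"
        by (intro nn_integral_cong) (auto simp: indicator_def add.commute power2_commute)
      also have "\<dots> \<le> ennreal (\<integral>x. (h$1 * g1 x + h$2 * g2 x)\<^sup>2 \<partial>lborel)"
        by (rule translation_energy_le[OF U f L2_on_sum_dir[OF g] w'])
      also have "\<dots> \<le> ennreal (\<integral>x. 2 * d\<^sup>2 * ((g1 x)\<^sup>2 + (g2 x)\<^sup>2) \<partial>lborel)"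
        using dir_square_le[OF h] L2_on_sum_dir[OF g, of "h$1" "h$2"] i2
        by (intro ennreal_leI integral_mono) (auto simp: L2_on_def)
      also have "\<dots> = ennreal (2 * d\<^sup>2 * ?N)" using i2 by simp
      finally show ?thesis using True by simp
    next
      case False
      have "?u x * ?u (h + x) = 0" for x
      proof (rule ccontr)
        assume "?u x * ?u (h + x) \<noteq> 0"
        then have "x \<in> U" "h + x \<in> U" by (auto simp: indicator_def split: if_splits)
        from d[OF this(2,1)] have "\<bar>h$i\<bar> \<le> d" for i by simp
        then have "h \<in> cbox (- ?b) ?b" by (auto simp: mem_box_cart abs_le_iff minus_le_iff)
        with False show False by simp
      qed
      then have 0: "?A x (h + x) = 0" for x by simp
      show ?thesis by (simp only: 0 nn_integral_const mult_zero_left zero_le)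
    qed
  qed
  also have "\<dots> = ennreal (2 * d\<^sup>2 * ?N) * emeasure lborel (cbox (- ?b) ?b)"
    by (rule nn_integral_cmult_indicator) simp
  also have "emeasure lborel (cbox (- ?b) ?b) = ennreal ((2 * d) * (2 * d))"
    using d0 by (subst emeasure_eq_ennreal_measure)
      (auto simp: content_cbox_if_cart UNIV_2 interval_eq_empty_cart emeasure_lborel_cbox_eq not_less)
  also have "ennreal (2 * d\<^sup>2 * ?N) * ennreal ((2 * d) * (2 * d)) = ennreal (8 * d^4 * ?N)"
    using d0 N0 by (subst ennreal_mult[symmetric]) (auto simp: power2_eq_square power4_eq_xxxx algebra_simps)
  finally have "ennreal (2 * ?m * ?F) \<le> ennreal (8 * d^4 * ?N)" using 1 by simp
  then have "2 * ?m * ?F \<le> 8 * d^4 * ?N"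
    using d0 N0 by (subst (asm) ennreal_le_iff) auto
  then show ?thesis by simp
qed

text \<open>The Jacobian of a dilation of the plane is \<open>s\<^sup>2\<close>, which is precisely the square of the weight in the
remainder of \<open>weak_taylor_2\<close>.\<close>

lemma nn_integral_dilation:
  fixes f :: "pt \<Rightarrow> ennreal"
  assumes [measurable]: "f \<in> borel_measurable borel" and s: "s > 0"
  shows "ennreal (s\<^sup>2) * (\<integral>\<^sup>+h. f (x + s *\<^sub>R h) \<partial>lborel) = (\<integral>\<^sup>+z. f z \<partial>lborel)"
proof -
  have "(\<integral>\<^sup>+z. f z \<partial>lborel) = (\<integral>\<^sup>+z. f z \<partial>density (distr lborel borel (\<lambda>h. x + s *\<^sub>R h)) (\<lambda>_. ennreal (\<bar>s\<bar>^DIM(pt))))"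
    using lborel_affine[of s x] s by simp
  also have "\<dots> = ennreal (s\<^sup>2) * (\<integral>\<^sup>+h. f (x + s *\<^sub>R h) \<partial>lborel)"
    using s by (subst nn_integral_density) (auto simp: nn_integral_distr nn_integral_cmult)
  finally show ?thesis by simp
qed

text \<open>The value \<open>f x\<close> is expressed by \<open>weak_taylor_2\<close> through the values of \<open>f\<close> and its first derivatives at
\<open>x + h\<close> and the second derivatives on the segment between \<open>x\<close> and \<open>x + h\<close>. Squaring and integrating over
all \<open>h\<close> with \<open>x + h\<close> in \<open>U\<close> gives the bound: the remainder is finite because its squared weight \<open>s\<^sup>2\<close>
cancels the Jacobian of the dilation \<open>h \<mapsto> x + s *\<^sub>R h\<close>.\<close>

theorem sobolev_sup_convex:
  assumes U: "open U" "convex U" "bounded U"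
    and d: "\<And>x y i. x \<in> U \<Longrightarrow> y \<in> U \<Longrightarrow> \<bar>x$i - y$i\<bar> \<le> d"
    and f: "L2_on U f" and g: "L2_on U g1" "L2_on U g2" and gg: "L2_on U g11" "L2_on U g12" "L2_on U g22"
    and w: "weak_partial U 1 f g1" "weak_partial U 2 f g2"
    and ww: "weak_partial U 1 g1 g11" "weak_partial U 2 g1 g12" "weak_partial U 1 g2 g12" "weak_partial U 2 g2 g22"
  shows "AE x in lborel. x \<in> U \<longrightarrow> measure lborel U * (f x)\<^sup>2
     \<le> 3 * (\<integral>x. (f x)\<^sup>2 \<partial>lborel) + 6 * d\<^sup>2 * (\<integral>x. (g1 x)\<^sup>2 + (g2 x)\<^sup>2 \<partial>lborel)
       + 24 * d^4 * (\<integral>x. (g11 x)\<^sup>2 + (g12 x)\<^sup>2 + (g22 x)\<^sup>2 \<partial>lborel)"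
proof -
  have [measurable]: "f \<in> borel_measurable borel" "g1 \<in> borel_measurable borel" "g2 \<in> borel_measurable borel"
    "g11 \<in> borel_measurable borel" "g12 \<in> borel_measurable borel" "g22 \<in> borel_measurable borel" "U \<in> sets borel"
    using f g gg U by (auto simp: L2_on_def)
  note i = L2_on_integrable[OF f U(1,3)] L2_on_integrable[OF g(1) U(1,3)] L2_on_integrable[OF g(2) U(1,3)]
    L2_on_integrable[OF gg(1) U(1,3)] L2_on_integrable[OF gg(2) U(1,3)] L2_on_integrable[OF gg(3) U(1,3)]
  have i2: "integrable lborel (\<lambda>x. (f x)\<^sup>2)" "integrable lborel (\<lambda>x. (g1 x)\<^sup>2)" "integrable lborel (\<lambda>x. (g2 x)\<^sup>2)"
    "integrable lborel (\<lambda>x. (g11 x)\<^sup>2)" "integrable lborel (\<lambda>x. (g12 x)\<^sup>2)" "integrable lborel (\<lambda>x. (g22 x)\<^sup>2)"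
    using f g gg by (auto simp: L2_on_def)
  define G where "G x = (g1 x)\<^sup>2 + (g2 x)\<^sup>2" for x
  define H where "H x = (g11 x)\<^sup>2 + (g12 x)\<^sup>2 + (g22 x)\<^sup>2" for x
  have [measurable]: "G \<in> borel_measurable borel" "H \<in> borel_measurable borel"
    unfolding G_def H_def by measurable
  have GH0: "G x \<ge> 0" "H x \<ge> 0" for x by (auto simp: G_def H_def)
  define J where "J h x = (\<integral>\<^sup>+s. ennreal (indicator {0..1::real} s * (s\<^sup>2 * H (x + s *\<^sub>R h))) \<partial>lborel)" for h x
  have Jm [measurable]: "case_prod J \<in> borel_measurable (borel \<Otimes>\<^sub>M borel)"
    unfolding J_def[abs_def] by measurable
  let ?R = "\<lambda>h x. ennreal (3 * (f (x + h))\<^sup>2 + 6 * d\<^sup>2 * G (x + h)) + ennreal (24 * d^4) * J h x"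
  let ?P = "\<lambda>h x. x \<in> U \<longrightarrow> x + h \<in> U \<longrightarrow> ennreal ((f x)\<^sup>2) \<le> ?R h x"
  have "AE x in lborel. ?P h x" for h
  proof (cases "\<bar>h$1\<bar> \<le> d \<and> \<bar>h$2\<bar> \<le> d")
    case True
    let ?k = "\<lambda>x. h$1 * g1 x + h$2 * g2 x"
    let ?k1 = "\<lambda>x. h$1 * g11 x + h$2 * g12 x" and ?k2 = "\<lambda>x. h$1 * g12 x + h$2 * g22 x"
    let ?kk = "\<lambda>x. h$1 * ?k1 x + h$2 * ?k2 x"
    have L: "L2_on U ?k" "L2_on U ?k1" "L2_on U ?k2" "L2_on U ?kk" by (intro L2_on_sum_dir g gg)+
    have w1: "weak_dir U h f ?k" by (intro weak_dirI w i)
    have "weak_partial U 1 ?k ?k1" "weak_partial U 2 ?k ?k2"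
      using i by (auto intro!: weak_partial_add weak_partial_cmult ww)
    then have w2: "weak_dir U h ?k ?kk"
      by (intro weak_dirI L2_on_integrable[OF L(1) U(1,3)] L2_on_integrable[OF L(2) U(1,3)] L2_on_integrable[OF L(3) U(1,3)])
    have kk: "(?kk z)\<^sup>2 \<le> 8 * d^4 * H z" for z
    proof -
      have "(?kk z)\<^sup>2 \<le> 2 * d\<^sup>2 * ((?k1 z)\<^sup>2 + (?k2 z)\<^sup>2)" using True by (intro dir_square_le) auto
      also have "\<dots> \<le> 2 * d\<^sup>2 * (2 * d\<^sup>2 * ((g11 z)\<^sup>2 + (g12 z)\<^sup>2) + 2 * d\<^sup>2 * ((g12 z)\<^sup>2 + (g22 z)\<^sup>2))"
        using True by (intro mult_left_mono add_mono dir_square_le) auto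
      also have "\<dots> = 4 * d^4 * ((g11 z)\<^sup>2 + 2 * (g12 z)\<^sup>2 + (g22 z)\<^sup>2)"
        by (simp add: power2_eq_square power4_eq_xxxx algebra_simps)
      also have "\<dots> \<le> 4 * d^4 * (2 * H z)" by (intro mult_left_mono) (auto simp: H_def)
      finally show ?thesis by simp
    qed
    show ?thesis
      using weak_taylor_2[OF U f L(1,4) w1 w2]
    proof eventually_elim
      case (elim x)
      show ?case
      proof (intro impI)
        assume x: "x \<in> U" "x + h \<in> U"
        define q where "q = (\<integral>s. indicator {0..1} s * (s * ?kk (x + s *\<^sub>R h)) \<partial>lborel)"
        have fx: "f x = f (x + h) - ?k (x + h) + q" using elim x by (simp add: q_def)
        have sq: "(a - b + c)\<^sup>2 \<le> 3 * a\<^sup>2 + 3 * b\<^sup>2 + 3 * c\<^sup>2" for a b c :: real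
          using zero_le_power2[of "a + b"] zero_le_power2[of "a - c"] zero_le_power2[of "b + c"]
          by (simp add: power2_eq_square algebra_simps)
        have "ennreal (q\<^sup>2) \<le> (\<integral>\<^sup>+s. ennreal (indicator {0..1} s * (s * ?kk (x + s *\<^sub>R h))\<^sup>2) \<partial>lborel)"
          unfolding q_def by (rule square_integral_unit_interval_le) measurable
        also have "\<dots> \<le> (\<integral>\<^sup>+s. ennreal (8 * d^4) * ennreal (indicator {0..1} s * (s\<^sup>2 * H (x + s *\<^sub>R h))) \<partial>lborel)"
        proof (rule nn_integral_mono)
          fix s :: real
          have "(s * ?kk (x + s *\<^sub>R h))\<^sup>2 \<le> s\<^sup>2 * (8 * d^4 * H (x + s *\<^sub>R h))"
            unfolding power_mult_distrib by (intro mult_left_mono kk) auto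
          then have "indicator {0..1} s * (s * ?kk (x + s *\<^sub>R h))\<^sup>2 \<le> (8 * d^4) * (indicator {0..1} s * (s\<^sup>2 * H (x + s *\<^sub>R h)))"
            by (auto simp: indicator_def algebra_simps)
          then show "ennreal (indicator {0..1} s * (s * ?kk (x + s *\<^sub>R h))\<^sup>2) \<le> ennreal (8 * d^4) * ennreal (indicator {0..1} s * (s\<^sup>2 * H (x + s *\<^sub>R h)))"
            using GH0 by (subst ennreal_mult[symmetric]) (auto intro!: ennreal_leI)
        qed
        also have "\<dots> = ennreal (8 * d^4) * J h x" unfolding J_def by (rule nn_integral_cmult) measurable
        finally have q: "ennreal (q\<^sup>2) \<le> ennreal (8 * d^4) * J h x" .
        have "(f x)\<^sup>2 \<le> 3 * (f (x + h))\<^sup>2 + 3 * (?k (x + h))\<^sup>2 + 3 * q\<^sup>2" unfolding fx by (rule sq)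
        also have "\<dots> \<le> 3 * (f (x + h))\<^sup>2 + 6 * d\<^sup>2 * G (x + h) + 3 * q\<^sup>2"
          using dir_square_le[of h d "g1 (x+h)" "g2 (x+h)"] True by (auto simp: G_def)
        finally have "ennreal ((f x)\<^sup>2) \<le> ennreal (3 * (f (x + h))\<^sup>2 + 6 * d\<^sup>2 * G (x + h)) + ennreal 3 * ennreal (q\<^sup>2)"
          using GH0 by (subst ennreal_mult[symmetric]) (auto simp: ennreal_plus[symmetric] simp del: ennreal_plus intro!: ennreal_leI)
        also have "\<dots> \<le> ennreal (3 * (f (x + h))\<^sup>2 + 6 * d\<^sup>2 * G (x + h)) + ennreal 3 * (ennreal (8 * d^4) * J h x)"
          using q by (intro add_left_mono mult_left_mono) auto
        also have "ennreal 3 * (ennreal (8 * d^4) * J h x) = ennreal (24 * d^4) * J h x"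
        proof -
          have "ennreal (24 * d^4) = ennreal 3 * ennreal (8 * d^4)" by (subst ennreal_mult[symmetric]) auto
          then show ?thesis by (simp only: mult.assoc)
        qed
        finally show "ennreal ((f x)\<^sup>2) \<le> ?R h x" .
      qed
    qed
  next
    case False
    have "?P h x" for x using False d[of "x + h" x 1] d[of "x + h" x 2] by auto
    then show ?thesis by simp
  qed
  \<comment> \<open>the Taylor formula holds for almost all \<open>x\<close>, with an exceptional set that depends on \<open>h\<close>; for the
    average over \<open>h\<close> at a fixed \<open>x\<close> the two quantifiers have to be exchanged\<close>
  then have "AE h in lborel. AE x in lborel. ?P h x" by (rule AE_I2)
  then have "AE x in lborel. AE h in lborel. ?P h x"
  proof (subst lborel_pair.AE_commute)
    have [measurable]: "(\<lambda>p. J (snd p) (fst p)) \<in> borel_measurable (borel \<Otimes>\<^sub>M borel)"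
      using measurable_compose[OF measurable_Pair[OF measurable_snd measurable_fst] Jm] by simp
    have m1: "(\<lambda>p. ennreal ((f (fst p))\<^sup>2)) \<in> borel_measurable (borel \<Otimes>\<^sub>M borel :: (pt \<times> pt) measure)" by measurable
    have m2: "(\<lambda>p. ?R (snd p) (fst p)) \<in> borel_measurable (borel \<Otimes>\<^sub>M borel)" by measurable
    have m3: "Measurable.pred (borel \<Otimes>\<^sub>M borel :: (pt \<times> pt) measure) (\<lambda>p. fst p \<in> U)" by measurable
    have m4: "Measurable.pred (borel \<Otimes>\<^sub>M borel :: (pt \<times> pt) measure) (\<lambda>p. fst p + snd p \<in> U)" by measurable
    have "Measurable.pred (borel \<Otimes>\<^sub>M borel) (\<lambda>p. ?P (snd p) (fst p))"
      by (intro pred_intros_logic m3 m4 borel_measurable_le[OF m1 m2, folded pred_def])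
    then show "{p \<in> space (lborel \<Otimes>\<^sub>M lborel). ?P (snd p) (fst p)} \<in> sets (lborel \<Otimes>\<^sub>M lborel)"
      by (simp add: pred_def sets_pair_measure_cong[of lborel borel lborel borel] space_pair_measure)
  qed
  then show ?thesis
  proof eventually_elim
    case (elim x)
    show ?case
    proof
      assume x: "x \<in> U"
      let ?u = "\<lambda>h. indicator U (x + h) :: ennreal"
      have fin: "emeasure lborel U < \<infinity>" using U(3) by (rule emeasure_bounded_finite)
      have iH: "(\<integral>\<^sup>+z. ennreal (H z) \<partial>lborel) = ennreal (\<integral>z. H z \<partial>lborel)"
        unfolding H_def using i2 by (intro nn_integral_eq_integral) auto
      have iG: "(\<integral>\<^sup>+z. ennreal (3 * (f z)\<^sup>2 + 6 * d\<^sup>2 * G z) \<partial>lborel) = ennreal (\<integral>z. 3 * (f z)\<^sup>2 + 6 * d\<^sup>2 * G z \<partial>lborel)"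
        unfolding G_def using i2 by (intro nn_integral_eq_integral) auto
      have "ennreal (measure lborel U * (f x)\<^sup>2) = ennreal ((f x)\<^sup>2) * emeasure lborel U"
        using fin by (simp add: emeasure_eq_ennreal_measure less_top ennreal_mult mult.commute)
      also have "emeasure lborel U = (\<integral>\<^sup>+z. indicator U z \<partial>lborel)" by simp
      also have "\<dots> = (\<integral>\<^sup>+h. ?u h \<partial>lborel)"
        using nn_integral_lborel_shift[of "indicator U :: pt \<Rightarrow> ennreal" x] by (simp add: add.commute)
      also have "ennreal ((f x)\<^sup>2) * \<dots> = (\<integral>\<^sup>+h. ennreal ((f x)\<^sup>2) * ?u h \<partial>lborel)"
        by (rule nn_integral_cmult[symmetric]) measurable
      also have "\<dots> \<le> (\<integral>\<^sup>+h. ?R h x \<partial>lborel)"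
      proof (rule nn_integral_mono_AE)
        show "AE h in lborel. ennreal ((f x)\<^sup>2) * ?u h \<le> ?R h x"
          using elim by eventually_elim (use x in \<open>auto simp: indicator_def\<close>)
      qed
      also have "\<dots> = (\<integral>\<^sup>+h. ennreal (3 * (f (x + h))\<^sup>2 + 6 * d\<^sup>2 * G (x + h)) \<partial>lborel) + (\<integral>\<^sup>+h. ennreal (24 * d^4) * J h x \<partial>lborel)"
        by (rule nn_integral_add) measurable
      also have "(\<integral>\<^sup>+h. ennreal (3 * (f (x + h))\<^sup>2 + 6 * d\<^sup>2 * G (x + h)) \<partial>lborel) = (\<integral>\<^sup>+z. ennreal (3 * (f z)\<^sup>2 + 6 * d\<^sup>2 * G z) \<partial>lborel)"
        using nn_integral_lborel_shift[of "\<lambda>z. ennreal (3 * (f z)\<^sup>2 + 6 * d\<^sup>2 * G z)" x] by (simp add: add.commute)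
      also note iG
      also have "(\<integral>\<^sup>+h. ennreal (24 * d^4) * J h x \<partial>lborel) = ennreal (24 * d^4) * (\<integral>\<^sup>+h. J h x \<partial>lborel)"
        by (rule nn_integral_cmult) measurable
      also have "(\<integral>\<^sup>+h. J h x \<partial>lborel) = (\<integral>\<^sup>+s. (\<integral>\<^sup>+h. ennreal (indicator {0..1} s * (s\<^sup>2 * H (x + s *\<^sub>R h))) \<partial>lborel) \<partial>lborel)"
        unfolding J_def by (rule lborel_pair.Fubini') measurable
      also have "\<dots> \<le> (\<integral>\<^sup>+s. ennreal (\<integral>z. H z \<partial>lborel) * indicator {0..1::real} s \<partial>lborel)"
      proof (rule nn_integral_mono)
        fix s :: real
        show "(\<integral>\<^sup>+h. ennreal (indicator {0..1} s * (s\<^sup>2 * H (x + s *\<^sub>R h))) \<partial>lborel) \<le> ennreal (\<integral>z. H z \<partial>lborel) * indicator {0..1} s"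
        proof (cases "0 < s \<and> s \<le> 1")
          case True
          have "(\<integral>\<^sup>+h. ennreal (indicator {0..1} s * (s\<^sup>2 * H (x + s *\<^sub>R h))) \<partial>lborel) = (\<integral>\<^sup>+h. ennreal (s\<^sup>2) * ennreal (H (x + s *\<^sub>R h)) \<partial>lborel)"
            using True GH0 by (simp add: ennreal_mult)
          also have "\<dots> = ennreal (s\<^sup>2) * (\<integral>\<^sup>+h. ennreal (H (x + s *\<^sub>R h)) \<partial>lborel)"
            by (rule nn_integral_cmult) measurable
          also have "\<dots> = ennreal (\<integral>z. H z \<partial>lborel)"
            using nn_integral_dilation[of "\<lambda>z. ennreal (H z)" s x] True iH by simp
          finally show ?thesis using True by simp
        next
          case False
          then have 0: "indicator {0..1} s * (s\<^sup>2 * r) = 0" for r :: real by (auto simp: indicator_def)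
          show ?thesis by (simp only: 0 ennreal_0 nn_integral_const mult_zero_left zero_le)
        qed
      qed
      also have "\<dots> = ennreal (\<integral>z. H z \<partial>lborel)" by (simp add: nn_integral_cmult_indicator)
      finally have "ennreal (measure lborel U * (f x)\<^sup>2) \<le> ennreal (\<integral>z. 3 * (f z)\<^sup>2 + 6 * d\<^sup>2 * G z \<partial>lborel) + ennreal (24 * d^4) * ennreal (\<integral>z. H z \<partial>lborel)"
        by (auto simp: mult_left_mono add_left_mono)
      also have "\<dots> = ennreal ((\<integral>z. 3 * (f z)\<^sup>2 + 6 * d\<^sup>2 * G z \<partial>lborel) + 24 * d^4 * (\<integral>z. H z \<partial>lborel))"
        using GH0 by (simp add: ennreal_mult ennreal_plus integral_nonneg)
      finally have "measure lborel U * (f x)\<^sup>2 \<le> (\<integral>z. 3 * (f z)\<^sup>2 + 6 * d\<^sup>2 * G z \<partial>lborel) + 24 * d^4 * (\<integral>z. H z \<partial>lborel)"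
        using GH0 by (subst (asm) ennreal_le_iff) (auto intro!: add_nonneg_nonneg mult_nonneg_nonneg integral_nonneg)
      also have "(\<integral>z. 3 * (f z)\<^sup>2 + 6 * d\<^sup>2 * G z \<partial>lborel) = 3 * (\<integral>z. (f z)\<^sup>2 \<partial>lborel) + 6 * d\<^sup>2 * (\<integral>z. G z \<partial>lborel)"
        unfolding G_def using i2 by simp
      finally show "measure lborel U * (f x)\<^sup>2
     \<le> 3 * (\<integral>x. (f x)\<^sup>2 \<partial>lborel) + 6 * d\<^sup>2 * (\<integral>x. (g1 x)\<^sup>2 + (g2 x)\<^sup>2 \<partial>lborel)
       + 24 * d^4 * (\<integral>x. (g11 x)\<^sup>2 + (g12 x)\<^sup>2 + (g22 x)\<^sup>2 \<partial>lborel)"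
        by (simp add: G_def[abs_def] H_def[abs_def])
    qed
  qed
qed

lemma AE_not_in_open_imp_empty:
  assumes "open (S :: pt set)" "AE x in lborel. x \<notin> S"
  shows "S = {}"
proof (rule ccontr)
  assume "S \<noteq> {}"
  then have "\<not> negligible S" using assms(1) open_not_negligible by blast
  moreover have "S \<in> null_sets lborel" using assms by (simp add: AE_iff_null_sets)
  ultimately show False
    using assms(1) by (simp add: negligible_iff_null_sets null_sets_completion_iff)
qed

text \<open>The bound follows from \<open>weak_taylor_1\<close> for almost every base point; continuity extends it to every base
point, since an open set of measure zero is empty. The factor \<open>2\<close> is a crude bound for
\<open>\<bar>h$1\<bar> + \<bar>h$2\<bar>\<close>.\<close>

theorem lipschitz_of_bounded_weak_gradient:
  assumes U: "open U" "convex U" "bounded U" and f: "L2_on U f" and g: "L2_on U g1" "L2_on U g2"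
    and w: "weak_partial U 1 f g1" "weak_partial U 2 f g2" and cont: "continuous_on U f"
    and M: "AE x in lborel. \<bar>g1 x\<bar> \<le> M" "AE x in lborel. \<bar>g2 x\<bar> \<le> M" and xy: "x \<in> U" "y \<in> U"
  shows "\<bar>f y - f x\<bar> \<le> 2 * M * norm (y - x)"
proof -
  have [measurable]: "f \<in> borel_measurable borel" "g1 \<in> borel_measurable borel" "g2 \<in> borel_measurable borel" "U \<in> sets borel"
    using f g U by (auto simp: L2_on_def)
  note i = L2_on_integrable[OF f U(1,3)] L2_on_integrable[OF g(1) U(1,3)] L2_on_integrable[OF g(2) U(1,3)]
  define h where "h = y - x"
  let ?k = "\<lambda>x. h$1 * g1 x + h$2 * g2 x"
  let ?V = "{x \<in> U. x + h \<in> U}"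
  have w1: "weak_dir U h f ?k" by (intro weak_dirI w i)
  have "AE z in lborel. \<bar>?k z\<bar> \<le> 2 * M * norm h"
    using M
  proof eventually_elim
    fix z assume z: "\<bar>g1 z\<bar> \<le> M" "\<bar>g2 z\<bar> \<le> M"
    have "\<bar>?k z\<bar> \<le> \<bar>h$1\<bar> * \<bar>g1 z\<bar> + \<bar>h$2\<bar> * \<bar>g2 z\<bar>" unfolding abs_mult[symmetric] by (rule abs_triangle_ineq)
    also have "\<dots> \<le> norm h * M + norm h * M"
      using z component_le_norm_cart[of h] by (intro add_mono mult_mono) auto
    finally show "\<bar>?k z\<bar> \<le> 2 * M * norm h" by simp
  qed
  then have "AE z in lborel. \<bar>?k (z + s *\<^sub>R h)\<bar> \<le> 2 * M * norm h" for s
    by (rule AE_lborel_shift) measurable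
  then have "AE s in (lborel :: real measure). AE z in lborel. \<bar>?k (z + s *\<^sub>R h)\<bar> \<le> 2 * M * norm h" by (rule AE_I2)
  then have "AE z in lborel. AE s in (lborel :: real measure). \<bar>?k (z + s *\<^sub>R h)\<bar> \<le> 2 * M * norm h"
    by (subst lborel_pair.AE_commute) measurable
  with weak_taylor_1[OF U f L2_on_sum_dir[OF g] w1]
  have "AE z in lborel. z \<in> ?V \<longrightarrow> \<bar>f (z + h) - f z\<bar> \<le> 2 * M * norm h"
  proof eventually_elim
    case (elim z)
    show ?case
    proof
      assume "z \<in> ?V"
      then have eq: "f (z + h) - f z = (\<integral>s. indicator {0..1} s * ?k (z + s *\<^sub>R h) \<partial>lborel)" using elim by blast
      let ?f = "\<lambda>s. indicator {0..1} s * ?k (z + s *\<^sub>R h)"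
      let ?g = "\<lambda>s. indicator {0..1::real} s * (2 * M * norm h)"
      have le: "AE s in lborel. norm (?f s) \<le> ?g s"
        using elim(2) by eventually_elim (auto simp: indicator_def)
      have g: "integrable lborel ?g" by simp
      have f: "integrable lborel ?f"
      proof (rule Bochner_Integration.integrable_bound[OF g])
        show "AE s in lborel. norm (?f s) \<le> norm (?g s)"
          using le by eventually_elim (use abs_ge_self order_trans in auto)
      qed measurable
      have "norm (\<integral>s. ?f s \<partial>lborel) \<le> (\<integral>s. norm (?f s) \<partial>lborel)" by (rule integral_norm_bound)
      also have "\<dots> \<le> (\<integral>s. ?g s \<partial>lborel)" using f g le by (intro integral_mono_AE) auto
      finally have "norm (\<integral>s. ?f s \<partial>lborel) \<le> (\<integral>s. ?g s \<partial>lborel)" .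
      then show "\<bar>f (z + h) - f z\<bar> \<le> 2 * M * norm h" unfolding eq by simp
    qed
  qed
  then have AE: "AE z in lborel. z \<notin> {z \<in> ?V. 2 * M * norm h < \<bar>f (z + h) - f z\<bar>}"
    by eventually_elim auto
  have "open (?V \<inter> (\<lambda>z. \<bar>f (z + h) - f z\<bar>) -` {2 * M * norm h <..})"
  proof (rule continuous_open_preimage)
    show "open ?V" by (rule open_overlap[OF U(1)])
    have "continuous_on ?V (\<lambda>z. f (z + h))"
      by (rule continuous_on_compose2[OF cont]) (auto intro!: continuous_intros)
    moreover have "continuous_on ?V f" using cont by (rule continuous_on_subset) auto
    ultimately show "continuous_on ?V (\<lambda>z. \<bar>f (z + h) - f z\<bar>)" by (intro continuous_intros)
  qed simp
  also have "?V \<inter> (\<lambda>z. \<bar>f (z + h) - f z\<bar>) -` {2 * M * norm h <..} = {z \<in> ?V. 2 * M * norm h < \<bar>f (z + h) - f z\<bar>}"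
    by auto
  finally have "{z \<in> ?V. 2 * M * norm h < \<bar>f (z + h) - f z\<bar>} = {}"
    using AE by (intro AE_not_in_open_imp_empty)
  moreover have "x \<in> ?V" using xy by (simp add: h_def)
  ultimately have "\<bar>f (x + h) - f x\<bar> \<le> 2 * M * norm h" by (auto simp: not_less)
  then show ?thesis by (simp add: h_def)
qed

section \<open>Sobolev functions as jets of weak derivatives\<close>

text \<open>A family \<open>G\<close> of functions of which each is a first order weak derivative of its predecessors; \<open>G \<alpha>\<close>
plays the role of the weak derivative of order \<open>\<alpha>\<close> of \<open>G (0, 0)\<close>. First order steps are all that the
Poincare and Sobolev inequalities need.\<close>

definition jet :: "pt set \<Rightarrow> nat \<Rightarrow> (mindex \<Rightarrow> pt \<Rightarrow> real) \<Rightarrow> bool" where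
  "jet U m G \<longleftrightarrow> (\<forall>i j. i + j \<le> m \<longrightarrow> L2_on U (G (i, j))) \<and>
     (\<forall>i j. i + j < m \<longrightarrow> weak_partial U 1 (G (i, j)) (G (Suc i, j)) \<and> weak_partial U 2 (G (i, j)) (G (i, Suc j)))"

definition energy :: "nat \<Rightarrow> (mindex \<Rightarrow> pt \<Rightarrow> real) \<Rightarrow> real" where
  "energy l G = (\<Sum>\<alpha>\<in>mindices l. \<integral>x. (G \<alpha> x)\<^sup>2 \<partial>lborel)"

lemma mindices_eq: "mindices l = (\<lambda>i. (i, l - i)) ` {..l}"
  by (auto simp: mindices_def image_iff)

lemma finite_mindices [simp]: "finite (mindices l)"
  by (simp add: mindices_eq)

lemma finite_mindices_upto [simp]: "finite (mindices_upto m)"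
proof -
  have "mindices_upto m \<subseteq> {..m} \<times> {..m}" by (auto simp: mindices_upto_def)
  then show ?thesis using finite_subset by blast
qed

lemma test_function_funpow_partial: "test_function U \<phi> \<Longrightarrow> test_function U ((partial k ^^ n) \<phi>)"
  by (induction n) (auto intro: test_function_partial)

lemma smooth_funpow_partial: "smooth \<phi> \<Longrightarrow> smooth ((partial k ^^ n) \<phi>)"
  by (induction n) (auto intro: smooth_partial)

text \<open>The derivatives in \<open>mderiv\<close> are taken in a fixed order, so appending one in the first direction means
commuting it past those in the second.\<close>

lemma mderiv_partial_1:
  assumes "smooth \<phi>" shows "mderiv (i, j) (partial 1 \<phi>) = mderiv (Suc i, j) \<phi>"
proof -
  have "(partial 2 ^^ j) (partial 1 \<phi>) = partial 1 ((partial 2 ^^ j) \<phi>)"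
    using assms
  proof (induction j)
    case (Suc j)
    then have "(partial 2 ^^ Suc j) (partial 1 \<phi>) = partial 2 (partial 1 ((partial 2 ^^ j) \<phi>))" by simp
    also have "\<dots> = partial 1 (partial 2 ((partial 2 ^^ j) \<phi>))"
      using partial_commute[OF smooth_funpow_partial[OF assms]] by blast
    finally show ?case by simp
  qed simp
  then show ?thesis by (simp add: mderiv_def funpow_swap1)
qed

lemma mderiv_partial_2: "mderiv (i, j) (partial 2 \<phi>) = mderiv (i, Suc j) \<phi>"
  by (simp add: mderiv_def funpow_swap1)

lemma jet_pairing:
  assumes G: "jet U m G" and \<phi>: "test_function U \<phi>" and ij: "i + j \<le> m"
  shows "(\<integral>x. G (0, 0) x * mderiv (i, j) \<phi> x \<partial>lborel) = (-1) ^ (i + j) * (\<integral>x. G (i, j) x * \<phi> x \<partial>lborel)"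
proof -
  have 1: "(\<integral>x. G (a, b) x * (partial 1 ^^ i) \<psi> x \<partial>lborel) = (-1) ^ i * (\<integral>x. G (a + i, b) x * \<psi> x \<partial>lborel)"
    if "test_function U \<psi>" "a + i + b \<le> m" for a b i \<psi>
    using that
  proof (induction i arbitrary: a)
    case (Suc i)
    have "(\<integral>x. G (a, b) x * (partial 1 ^^ Suc i) \<psi> x \<partial>lborel) = - (\<integral>x. G (Suc a, b) x * (partial 1 ^^ i) \<psi> x \<partial>lborel)"
      using G test_function_funpow_partial[OF Suc.prems(1)] Suc.prems(2) unfolding jet_def weak_partial_def by simp
    also have "\<dots> = - ((-1) ^ i * (\<integral>x. G (Suc a + i, b) x * \<psi> x \<partial>lborel))"
      using Suc.IH[of "Suc a"] Suc.prems by simp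
    finally show ?case by simp
  qed simp
  have 2: "(\<integral>x. G (a, b) x * (partial 2 ^^ j) \<psi> x \<partial>lborel) = (-1) ^ j * (\<integral>x. G (a, b + j) x * \<psi> x \<partial>lborel)"
    if "test_function U \<psi>" "a + j + b \<le> m" for a b j \<psi>
    using that
  proof (induction j arbitrary: b)
    case (Suc j)
    have "(\<integral>x. G (a, b) x * (partial 2 ^^ Suc j) \<psi> x \<partial>lborel) = - (\<integral>x. G (a, Suc b) x * (partial 2 ^^ j) \<psi> x \<partial>lborel)"
      using G test_function_funpow_partial[OF Suc.prems(1)] Suc.prems(2) unfolding jet_def weak_partial_def by simp
    also have "\<dots> = - ((-1) ^ j * (\<integral>x. G (a, Suc b + j) x * \<psi> x \<partial>lborel))"
      using Suc.IH[of "Suc b"] Suc.prems by simp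
    finally show ?case by simp
  qed simp
  show ?thesis
    using 1[OF test_function_funpow_partial[OF \<phi>, where k=2 and n=j], where a=0 and b=0 and i=i] 2[OF \<phi>, where a=i and b=0 and j=j] ij
    by (simp add: mderiv_def power_add)
qed

lemma integral_lebesgue_eq_lborel:
  fixes f :: "pt \<Rightarrow> real"
  shows "f \<in> borel_measurable borel \<Longrightarrow> integral\<^sup>L lebesgue f = integral\<^sup>L lborel f"
  by (intro integral_completion) simp

lemma integrable_lebesgue_iff_lborel:
  fixes f :: "pt \<Rightarrow> real"
  shows "f \<in> borel_measurable borel \<Longrightarrow> integrable lebesgue f \<longleftrightarrow> integrable lborel f"
  by (intro integrable_completion) simp

lemma borel_measurable_zext:
  assumes "open U" "continuous_on U f" shows "zext U f \<in> borel_measurable borel"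
proof -
  have "(\<lambda>x. indicator U x *\<^sub>R f x) \<in> borel_measurable borel"
    using assms by (intro borel_measurable_continuous_on_indicator) auto
  also have "(\<lambda>x. indicator U x *\<^sub>R f x) = zext U f" by (auto simp: zext_def indicator_def fun_eq_iff)
  finally show ?thesis .
qed

text \<open>An open set is a countable union of closed boxes, and on the finite unions of these the function is
measurable because it is integrable there.\<close>

lemma locally_integrable_measurable:
  assumes U: "open U" and g: "locally_integrable U g"
  shows "set_borel_measurable lebesgue U g"
proof -
  obtain D where D: "countable D" "\<And>X. X \<in> D \<Longrightarrow> \<exists>a b. X = cbox a b" "\<Union>D = U"
    using open_countable_Union_open_cbox[OF U] by metis
  show ?thesis
  proof (cases "D = {}")
    case True then show ?thesis using D by (auto simp: set_borel_measurable_def)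
  next
    case False
    define C where "C n = (\<Union>k\<le>n. from_nat_into D k)" for n
    have DC: "from_nat_into D k \<in> D" for k using False by (rule from_nat_into)
    have "compact (C n)" "C n \<subseteq> U" for n
      unfolding C_def using DC D(2,3) by (auto intro!: compact_UN) (metis compact_cbox)
    then have "set_integrable lebesgue (C n) g" for n using g by (auto simp: locally_integrable_def)
    then have m: "(\<lambda>x. indicator (C n) x * g x) \<in> borel_measurable lebesgue" for n
      unfolding set_integrable_def using borel_measurable_integrable by fastforce
    have lim: "(\<lambda>n. indicator (C n) x * g x) \<longlonglongrightarrow> indicator U x * g x" for x
    proof (cases "x \<in> U")
      case True
      then obtain X where "X \<in> D" "x \<in> X" using D(3) by blast
      then obtain k where "x \<in> from_nat_into D k" using D(1) from_nat_into_surj by metis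
      then have "x \<in> C n" if "n \<ge> k" for n using that by (auto simp: C_def)
      then show ?thesis using True
        by (intro tendsto_eventually eventually_sequentiallyI[of k]) auto
    next
      case False
      then have "x \<notin> C n" for n using \<open>\<And>n. C n \<subseteq> U\<close> by blast
      then show ?thesis using False by simp
    qed
    have "(\<lambda>x. indicator U x * g x) \<in> borel_measurable lebesgue"
      by (rule borel_measurable_LIMSEQ_real[OF lim m])
    then show ?thesis by (simp add: set_borel_measurable_def)
  qed
qed

lemma borel_representative:
  fixes g :: "pt \<Rightarrow> real"
  assumes U: "open U" and g: "set_borel_measurable lebesgue U g"
  obtains G where "G \<in> borel_measurable borel" "\<And>x. x \<notin> U \<Longrightarrow> G x = 0" "AE x in lebesgue. G x = indicator U x * g x"
proof -
  from g have "(\<lambda>x. indicator U x * g x) \<in> borel_measurable (completion lborel)"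
    by (simp add: set_borel_measurable_def)
  from completion_ex_borel_measurable_real[OF this] obtain g' where
    g': "g' \<in> borel_measurable lborel" "AE x in lborel. indicator U x * g x = g' x" by blast
  have "(\<lambda>x. indicator U x * g' x) \<in> borel_measurable borel" using g'(1) U by auto
  moreover have "AE x in lborel. indicator U x * g' x = indicator U x * g x"
    using g'(2) by eventually_elim (auto simp: indicator_def)
  then have "AE x in lebesgue. indicator U x * g' x = indicator U x * g x"
    by (rule AE_completion)
  ultimately show thesis using that[of "\<lambda>x. indicator U x * g' x"] by simp
qed

lemma integral_representative:
  fixes g :: "pt \<Rightarrow> real"
  assumes G: "G \<in> borel_measurable borel" "AE x in lebesgue. G x = indicator U x * g x"
    and g: "set_borel_measurable lebesgue U g" and \<phi>: "\<phi> \<in> borel_measurable borel"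
  shows "(LINT x:U|lebesgue. g x * \<phi> x) = (\<integral>x. G x * \<phi> x \<partial>lborel)"
proof -
  have [measurable]: "\<phi> \<in> borel_measurable lebesgue" "G \<in> borel_measurable lebesgue"
    using \<phi> G(1) by (auto intro: measurable_completion)
  have [measurable]: "(\<lambda>x. indicator U x * g x) \<in> borel_measurable lebesgue"
    using g by (simp add: set_borel_measurable_def)
  have "(LINT x:U|lebesgue. g x * \<phi> x) = (\<integral>x. (indicator U x * g x) * \<phi> x \<partial>lebesgue)"
    by (simp add: set_lebesgue_integral_def mult.assoc)
  also have "\<dots> = (\<integral>x. G x * \<phi> x \<partial>lebesgue)"
  proof (rule integral_cong_AE)
    show "AE x in lebesgue. indicator U x * g x * \<phi> x = G x * \<phi> x" using G(2) by eventually_elim simp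
  qed measurable
  also have "\<dots> = (\<integral>x. G x * \<phi> x \<partial>lborel)"
    using G(1) \<phi> by (intro integral_lebesgue_eq_lborel) auto
  finally show ?thesis .
qed

text \<open>Passes from Lebesgue to Borel functions: the weak derivative agrees almost everywhere with a Borel
function that vanishes outside \<open>U\<close>, and integrals cannot tell the two apart.\<close>

lemma has_weak_deriv_representative:
  assumes U: "open U" and w: "has_weak_deriv U \<alpha> u g" and sq: "square_integrable U g"
  obtains G where "L2_on U G"
    "\<And>\<phi>. test_function U \<phi> \<Longrightarrow> (\<integral>x. G x * \<phi> x \<partial>lborel) = (- 1) ^ (fst \<alpha> + snd \<alpha>) * (LINT x:U|lebesgue. u x * mderiv \<alpha> \<phi> x)"
proof -
  have g: "set_borel_measurable lebesgue U g" using sq by (simp add: square_integrable_def)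
  from borel_representative[OF U g] obtain G where
    G: "G \<in> borel_measurable borel" "\<And>x. x \<notin> U \<Longrightarrow> G x = 0" "AE x in lebesgue. G x = indicator U x * g x" by blast
  have mG: "(\<lambda>x. (G x)\<^sup>2) \<in> borel_measurable borel" using G(1) by simp
  have mL: "(\<lambda>x. (G x)\<^sup>2) \<in> borel_measurable lebesgue" using mG by (auto intro: measurable_completion)
  have "integrable lebesgue (\<lambda>x. indicator U x * (g x)\<^sup>2)"
    using sq by (simp add: square_integrable_def set_integrable_def)
  then have "integrable lebesgue (\<lambda>x. (G x)\<^sup>2)"
  proof (rule integrable_cong_AE_imp)
    show "AE x in lebesgue. indicator U x * (g x)\<^sup>2 = (G x)\<^sup>2"
      using G(3) by eventually_elim (auto simp: indicator_def)
  qed (rule mL)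
  then have "integrable lborel (\<lambda>x. (G x)\<^sup>2)" using integrable_lebesgue_iff_lborel[OF mG] by simp
  then have "L2_on U G" using G by (simp add: L2_on_def)
  moreover have "(\<integral>x. G x * \<phi> x \<partial>lborel) = (- 1) ^ (fst \<alpha> + snd \<alpha>) * (LINT x:U|lebesgue. u x * mderiv \<alpha> \<phi> x)"
    if \<phi>: "test_function U \<phi>" for \<phi>
  proof -
    have "(LINT x:U|lebesgue. u x * mderiv \<alpha> \<phi> x) = (- 1) ^ (fst \<alpha> + snd \<alpha>) * (LINT x:U|lebesgue. g x * \<phi> x)"
      using w \<phi> by (simp add: has_weak_deriv_def)
    also have "(LINT x:U|lebesgue. g x * \<phi> x) = (\<integral>x. G x * \<phi> x \<partial>lborel)"
      by (rule integral_representative[OF G(1,3) g test_function_measurable[OF \<phi>]])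
    finally show ?thesis by (simp add: mult.assoc[symmetric] power_mult_distrib[symmetric])
  qed
  ultimately show thesis using that by blast
qed

lemma zext_integrable_cbox:
  assumes "open U" "continuous_on U f" "cbox a b \<subseteq> U"
  shows "integrable lborel (\<lambda>x. indicator (cbox a b) x * zext U f x)"
proof -
  have "continuous_on (cbox a b) (zext U f)"
    by (rule continuous_on_eq[OF continuous_on_subset[OF assms(2,3)]]) (use assms(3) in \<open>auto simp: zext_def\<close>)
  from borel_integrable_compact[OF compact_cbox this] show ?thesis by simp
qed

text \<open>Uniqueness, in the form needed here: a function that tests like a continuous one is equal to it almost
everywhere.\<close>

lemma weak_eq_classical:
  assumes U: "open U" and f: "continuous_on U f" and G: "integrable lborel G" "\<And>x. x \<notin> U \<Longrightarrow> G x = 0"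
    and eq: "\<And>\<phi>. test_function U \<phi> \<Longrightarrow> (\<integral>x. G x * \<phi> x \<partial>lborel) = (\<integral>x. zext U f x * \<phi> x \<partial>lborel)"
  shows "AE x in lborel. G x = zext U f x"
proof -
  have "AE x in lborel. x \<in> U \<longrightarrow> G x - zext U f x = 0"
  proof (rule fundamental_lemma_variations[OF U])
    show "(\<lambda>x. G x - zext U f x) \<in> borel_measurable borel"
      using borel_measurable_zext[OF U f] G(1) by auto
    show "integrable lborel (\<lambda>x. indicator (cbox a b) x * (G x - zext U f x))" if "cbox a b \<subseteq> U" for a b
      using zext_integrable_cbox[OF U f that] integrable_indicator_mult[OF G(1), of "cbox a b"]
      by (simp add: right_diff_distrib)
    show "(\<integral>x. (G x - zext U f x) * \<phi> x \<partial>lborel) = 0" if "test_function U \<phi>" for \<phi>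
      using eq[OF that] integrable_mult_test[OF G(1) that] integrable_zext_mult_test[OF U f that]
      by (simp add: left_diff_distrib)
  qed
  then show ?thesis by eventually_elim (use G(2) in \<open>auto simp: zext_def\<close>)
qed

text \<open>Membership in the Sobolev space asserts that each derivative of \<open>u\<close> exists separately. They fit
together to a jet because a derivative of order \<open>\<alpha> + e\<close> of a test function is the derivative of order
\<open>\<alpha>\<close> of its partial derivative, which is again a test function.\<close>

theorem sobolev_imp_jet:
  assumes U: "open U" "bounded U" and u: "u \<in> sobolev m U" and c: "continuous_on U u"
  obtains G where "jet U m G" "AE x in lborel. G (0, 0) x = zext U u x"
proof -
  define Q where "Q \<alpha> G \<longleftrightarrow> L2_on U G \<and> (\<forall>\<phi>. test_function U \<phi> \<longrightarrow>
      (\<integral>x. G x * \<phi> x \<partial>lborel) = (- 1) ^ (fst \<alpha> + snd \<alpha>) * (LINT x:U|lebesgue. u x * mderiv \<alpha> \<phi> x))"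
    for \<alpha> G
  have "\<exists>G. Q \<alpha> G" if "\<alpha> \<in> mindices_upto m" for \<alpha>
  proof -
    from u that obtain g where "has_weak_deriv U \<alpha> u g" "square_integrable U g" unfolding sobolev_def by blast
    from has_weak_deriv_representative[OF U(1) this] show ?thesis unfolding Q_def by metis
  qed
  then have "\<forall>\<alpha>\<in>mindices_upto m. \<exists>G. Q \<alpha> G" by blast
  then have "\<exists>G. \<forall>\<alpha>\<in>mindices_upto m. Q \<alpha> (G \<alpha>)" by (rule bchoice)
  then obtain G where G0: "\<forall>\<alpha>\<in>mindices_upto m. Q \<alpha> (G \<alpha>)" by blast
  have G: "\<And>\<alpha>. \<alpha> \<in> mindices_upto m \<Longrightarrow> L2_on U (G \<alpha>)"
    "\<And>\<alpha> \<phi>. \<alpha> \<in> mindices_upto m \<Longrightarrow> test_function U \<phi> \<Longrightarrow>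
      (\<integral>x. G \<alpha> x * \<phi> x \<partial>lborel) = (- 1) ^ (fst \<alpha> + snd \<alpha>) * (LINT x:U|lebesgue. u x * mderiv \<alpha> \<phi> x)"
    using G0 unfolding Q_def by blast+
  have "jet U m G"
    unfolding jet_def weak_partial_def
  proof (intro conjI allI impI)
    show "L2_on U (G (i, j))" if "i + j \<le> m" for i j using G(1)[of "(i, j)"] that by (simp add: mindices_upto_def)
    fix i j \<phi> assume ij: "i + j < m" and \<phi>: "test_function U \<phi>"
    then have sm: "smooth \<phi>" using test_function_iff by blast
    have m: "(i, j) \<in> mindices_upto m" "(Suc i, j) \<in> mindices_upto m" "(i, Suc j) \<in> mindices_upto m"
      using ij by (auto simp: mindices_upto_def)
    show "(\<integral>x. G (i, j) x * partial 1 \<phi> x \<partial>lborel) = - (\<integral>x. G (Suc i, j) x * \<phi> x \<partial>lborel)"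
      using G(2)[OF m(1) test_function_partial[OF \<phi>, of 1]] G(2)[OF m(2) \<phi>] mderiv_partial_1[OF sm] by simp
    show "(\<integral>x. G (i, j) x * partial 2 \<phi> x \<partial>lborel) = - (\<integral>x. G (i, Suc j) x * \<phi> x \<partial>lborel)"
      using G(2)[OF m(1) test_function_partial[OF \<phi>, of 2]] G(2)[OF m(3) \<phi>] mderiv_partial_2 by simp
  qed
  moreover have "AE x in lborel. G (0, 0) x = zext U u x"
  proof (rule weak_eq_classical[OF U(1) c])
    have 0: "(0, 0) \<in> mindices_upto m" by (simp add: mindices_upto_def)
    from G(1)[OF 0] show "integrable lborel (G (0, 0))" using L2_on_integrable U by blast
    show "G (0, 0) x = 0" if "x \<notin> U" for x using G(1)[OF 0] that by (simp add: L2_on_def)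
    fix \<phi> assume \<phi>: "test_function U \<phi>"
    have m: "zext U u \<in> borel_measurable borel" by (rule borel_measurable_zext[OF U(1) c])
    have "(\<integral>x. G (0, 0) x * \<phi> x \<partial>lborel) = (LINT x:U|lebesgue. u x * \<phi> x)"
      using G(2)[OF 0 \<phi>] by (simp add: mderiv_def)
    also have "\<dots> = (\<integral>x. zext U u x * \<phi> x \<partial>lebesgue)"
      unfolding set_lebesgue_integral_def
      by (intro Bochner_Integration.integral_cong) (auto simp: zext_def indicator_def)
    also have "\<dots> = (\<integral>x. zext U u x * \<phi> x \<partial>lborel)"
      using m test_function_measurable[OF \<phi>] by (intro integral_lebesgue_eq_lborel) auto
    finally show "(\<integral>x. G (0, 0) x * \<phi> x \<partial>lborel) = (\<integral>x. zext U u x * \<phi> x \<partial>lborel)" .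
  qed
  ultimately show thesis using that by blast
qed

lemma locally_integrable_if_integrable:
  assumes "G \<in> borel_measurable borel" "integrable lborel G" shows "locally_integrable U G"
  unfolding locally_integrable_def set_integrable_def
proof (intro allI impI)
  fix C assume "compact C \<and> C \<subseteq> U"
  then have [measurable]: "C \<in> sets borel" by (simp add: borel_compact)
  have "integrable lborel (\<lambda>x. indicator C x *\<^sub>R G x)"
    by (rule integrable_mult_indicator[OF _ assms(2)]) simp
  then show "integrable lebesgue (\<lambda>x. indicator C x *\<^sub>R G x)"
    using assms(1) by (subst integrable_lebesgue_iff_lborel) auto
qed

lemma locally_integrable_continuous:
  assumes "continuous_on U f" shows "locally_integrable U f"
  unfolding locally_integrable_def set_integrable_def
proof (intro allI impI)
  fix C assume C: "compact C \<and> C \<subseteq> U"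
  then have "continuous_on C f" using assms continuous_on_subset by blast
  with C have "integrable lborel (\<lambda>x. indicator C x *\<^sub>R f x)" by (intro borel_integrable_compact) auto
  then show "integrable lebesgue (\<lambda>x. indicator C x *\<^sub>R f x)"
    using integrable_lebesgue_iff_lborel borel_measurable_integrable by force
qed

text \<open>The seminorm is defined by an arbitrary choice of weak derivatives. By the fundamental lemma any two
choices agree almost everywhere, so the members of a jet may be used instead.\<close>

theorem sobolev_seminorm_jet:
  assumes U: "open U" "bounded U" "interior K = U" and G: "jet U m G" and eq: "AE x in lborel. G (0, 0) x = zext U f x"
    and c: "continuous_on U f" and l: "l \<le> m"
  shows "sobolev_seminorm l K f = sqrt (energy l G)"
proof -
  have "(LINT x:U|lebesgue. (weak_deriv U \<alpha> f x)\<^sup>2) = (\<integral>x. (G \<alpha> x)\<^sup>2 \<partial>lborel)" if \<alpha>l: "\<alpha> \<in> mindices l" for \<alpha>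
  proof -
    obtain i j where \<alpha>: "\<alpha> = (i, j)" "i + j \<le> m" using \<alpha>l l by (cases \<alpha>) (auto simp: mindices_def)
    have L: "L2_on U (G \<alpha>)" using G \<alpha> by (simp add: jet_def)
    have [measurable]: "G \<alpha> \<in> borel_measurable borel" using L by (simp add: L2_on_def)
    have iG: "integrable lborel (G \<alpha>)" by (rule L2_on_integrable[OF L U(1,2)])
    have L0: "L2_on U (G (0, 0))" using G by (simp add: jet_def)
    have m0: "zext U f \<in> borel_measurable borel" by (rule borel_measurable_zext[OF U(1) c])
    have f\<phi>: "(LINT x:U|lebesgue. f x * \<phi> x) = (\<integral>x. G (0, 0) x * \<phi> x \<partial>lborel)" if [measurable]: "\<phi> \<in> borel_measurable borel" for \<phi>
    proof -
      have "(LINT x:U|lebesgue. f x * \<phi> x) = (\<integral>x. zext U f x * \<phi> x \<partial>lebesgue)"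
        unfolding set_lebesgue_integral_def
        by (intro Bochner_Integration.integral_cong) (auto simp: zext_def indicator_def)
      also have "\<dots> = (\<integral>x. zext U f x * \<phi> x \<partial>lborel)"
        using m0 by (intro integral_lebesgue_eq_lborel) auto
      also have "\<dots> = (\<integral>x. G (0, 0) x * \<phi> x \<partial>lborel)"
      proof (rule integral_cong_AE)
        show "AE x in lborel. zext U f x * \<phi> x = G (0, 0) x * \<phi> x" using eq by eventually_elim simp
      qed (use m0 L0 in \<open>auto simp: L2_on_def\<close>)
      finally show ?thesis .
    qed
    have G\<phi>: "(LINT x:U|lebesgue. G \<alpha> x * \<phi> x) = (\<integral>x. G \<alpha> x * \<phi> x \<partial>lborel)" if [measurable]: "\<phi> \<in> borel_measurable borel" for \<phi>
    proof -
      have "(LINT x:U|lebesgue. G \<alpha> x * \<phi> x) = (\<integral>x. G \<alpha> x * \<phi> x \<partial>lebesgue)"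
        unfolding set_lebesgue_integral_def using L
        by (intro Bochner_Integration.integral_cong) (auto simp: L2_on_def indicator_def)
      then show ?thesis by (simp add: integral_lebesgue_eq_lborel)
    qed
    have "has_weak_deriv U \<alpha> f (G \<alpha>)"
      unfolding has_weak_deriv_def
    proof (intro conjI allI impI)
      show "locally_integrable U f" by (rule locally_integrable_continuous[OF c])
      show "locally_integrable U (G \<alpha>)" by (rule locally_integrable_if_integrable[OF _ iG]) simp
      fix \<phi> assume \<phi>: "test_function U \<phi>"
      have "test_function U (mderiv \<alpha> \<phi>)" unfolding mderiv_def by (intro test_function_funpow_partial \<phi>)
      then show "(LINT x:U|lebesgue. f x * mderiv \<alpha> \<phi> x) = (- 1) ^ (fst \<alpha> + snd \<alpha>) * (LINT x:U|lebesgue. G \<alpha> x * \<phi> x)"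
        using jet_pairing[OF G \<phi> \<alpha>(2)] f\<phi>[OF test_function_measurable] G\<phi>[OF test_function_measurable[OF \<phi>]] \<alpha> by simp
    qed
    then have w: "has_weak_deriv U \<alpha> f (weak_deriv U \<alpha> f)" unfolding weak_deriv_def by (rule someI[of "has_weak_deriv U \<alpha> f"])
    define g where "g = weak_deriv U \<alpha> f"
    have lg: "locally_integrable U g" using w by (simp add: has_weak_deriv_def g_def)
    have mg: "set_borel_measurable lebesgue U g" by (rule locally_integrable_measurable[OF U(1) lg])
    from borel_representative[OF U(1) mg] obtain H where
      H: "H \<in> borel_measurable borel" "\<And>x. x \<notin> U \<Longrightarrow> H x = 0" "AE x in lebesgue. H x = indicator U x * g x" by blast
    note [measurable] = H(1)
    have Hi: "integrable lborel (\<lambda>x. indicator C x * H x)" if C: "compact C" "C \<subseteq> U" for C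
    proof -
      have [measurable]: "C \<in> sets borel" using C by (simp add: borel_compact)
      have mm: "(\<lambda>x. indicator C x * H x) \<in> borel_measurable borel" by measurable
      have "integrable lebesgue (\<lambda>x. indicator C x * g x)" using lg C by (simp add: locally_integrable_def set_integrable_def)
      then have "integrable lebesgue (\<lambda>x. indicator C x * H x)"
      proof (rule integrable_cong_AE_imp)
        show "AE x in lebesgue. indicator C x * g x = indicator C x * H x"
          using H(3) by eventually_elim (use C(2) in \<open>auto simp: indicator_def\<close>)
      qed (use mm in \<open>auto intro: measurable_completion\<close>)
      then show ?thesis using integrable_lebesgue_iff_lborel[OF mm] by simp
    qed
    have "AE x in lborel. x \<in> U \<longrightarrow> H x - G \<alpha> x = 0"
    proof (rule fundamental_lemma_variations[OF U(1)])
      show "integrable lborel (\<lambda>x. indicator (cbox a b) x * (H x - G \<alpha> x))" if "cbox a b \<subseteq> U" for a b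
        using Hi[OF compact_cbox that] integrable_indicator_mult[OF iG, of "cbox a b"] by (simp add: right_diff_distrib)
      fix \<phi> assume \<phi>: "test_function U \<phi>"
      then obtain C where C: "compact C" "C \<subseteq> U" "\<And>x. x \<notin> C \<Longrightarrow> \<phi> x = 0" unfolding test_function_iff by blast
      have "(\<lambda>x. (indicator C x * H x) * \<phi> x) = (\<lambda>x. H x * \<phi> x)" using C(3) by (force simp: indicator_def)
      then have iH: "integrable lborel (\<lambda>x. H x * \<phi> x)" using integrable_mult_test[OF Hi[OF C(1,2)] \<phi>] by simp
      have tm: "test_function U (mderiv \<alpha> \<phi>)" unfolding mderiv_def by (intro test_function_funpow_partial \<phi>)
      have "(LINT x:U|lebesgue. f x * mderiv \<alpha> \<phi> x) = (- 1) ^ (i + j) * (LINT x:U|lebesgue. g x * \<phi> x)"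
        using w \<phi> \<alpha>(1) unfolding has_weak_deriv_def g_def by simp
      then have "(- 1) ^ (i + j) * (LINT x:U|lebesgue. g x * \<phi> x) = (- 1) ^ (i + j) * (\<integral>x. G \<alpha> x * \<phi> x \<partial>lborel)"
        using jet_pairing[OF G \<phi> \<alpha>(2)] f\<phi>[OF test_function_measurable[OF tm]] \<alpha>(1) by simp
      then have "(\<integral>x. H x * \<phi> x \<partial>lborel) = (\<integral>x. G \<alpha> x * \<phi> x \<partial>lborel)"
        using integral_representative[OF H(1,3) mg test_function_measurable[OF \<phi>]] by simp
      then show "(\<integral>x. (H x - G \<alpha> x) * \<phi> x \<partial>lborel) = 0"
        using iH integrable_mult_test[OF iG \<phi>] by (simp add: left_diff_distrib)
    qed measurable
    then have HG: "AE x in lborel. H x = G \<alpha> x"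
      by eventually_elim (use L H(2) in \<open>auto simp: L2_on_def\<close>)
    have "(LINT x:U|lebesgue. (g x)\<^sup>2) = (\<integral>x. (indicator U x * g x)\<^sup>2 \<partial>lebesgue)"
      unfolding set_lebesgue_integral_def by (intro Bochner_Integration.integral_cong) (auto simp: indicator_def)
    also have "\<dots> = (\<integral>x. (G \<alpha> x)\<^sup>2 \<partial>lebesgue)"
    proof (rule integral_cong_AE)
      have "(\<lambda>x. indicator U x * g x) \<in> borel_measurable lebesgue"
        using mg by (simp add: set_borel_measurable_def)
      then show "(\<lambda>x. (indicator U x * g x)\<^sup>2) \<in> borel_measurable lebesgue" by (rule borel_measurable_power)
      have "(\<lambda>x. (G \<alpha> x)\<^sup>2) \<in> borel_measurable borel" by measurable
      then show "(\<lambda>x. (G \<alpha> x)\<^sup>2) \<in> borel_measurable lebesgue" by (auto intro: measurable_completion)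
      from AE_completion[OF HG] H(3) show "AE x in lebesgue. (indicator U x * g x)\<^sup>2 = (G \<alpha> x)\<^sup>2"
        by eventually_elim simp
    qed
    also have "\<dots> = (\<integral>x. (G \<alpha> x)\<^sup>2 \<partial>lborel)" by (rule integral_lebesgue_eq_lborel) measurable
    finally show ?thesis by (simp add: g_def)
  qed
  then show ?thesis by (simp add: sobolev_seminorm_def energy_def U(3))
qed

section \<open>Bivariate quintics in affine coordinates\<close>

lemma mindices_upto_Sigma: "mindices_upto m = (SIGMA i:{..m}. {..m - i})"
  by (auto simp: mindices_upto_def)

lemma sum_mindices_upto_5:
  "(\<Sum>\<alpha>\<in>mindices_upto 5. f \<alpha> :: real) =
     f (0,0) + f (0,1) + f (0,2) + f (0,3) + f (0,4) + f (0,5) + f (1,0) + f (1,1) + f (1,2) + f (1,3) + f (1,4)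
     + f (2,0) + f (2,1) + f (2,2) + f (2,3) + f (3,0) + f (3,1) + f (3,2) + f (4,0) + f (4,1) + f (5,0)"
  using sum.Sigma[of "{..5}" "\<lambda>i. {..5 - i}" "\<lambda>i j. f (i, j)"]
  unfolding mindices_upto_Sigma by (simp add: eval_nat_numeral)

lemma mindices_upto_5_cases:
  assumes "\<alpha> \<in> mindices_upto 5"
  shows "\<alpha> \<in> {(0,0), (0,1), (0,2), (0,3), (0,4), (0,5), (1,0), (1,1), (1,2), (1,3), (1,4),
     (2,0), (2,1), (2,2), (2,3), (3,0), (3,1), (3,2), (4,0), (4,1), (5,0)}"
proof -
  obtain i j where ij: "\<alpha> = (i, j)" "i + j \<le> 5" using assms by (cases \<alpha>) (simp add: mindices_upto_def)
  then have "i \<in> {0,1,2,3,4,5}" "j \<in> {0,1,2,3,4,5}" by auto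
  then show ?thesis using ij(2) unfolding ij(1) by (elim insertE emptyE) simp_all
qed

lemma mindices_upto_2: "mindices_upto 2 = {(0,0), (0,1), (0,2), (1,0), (1,1), (2,0)}"
  unfolding mindices_upto_Sigma by (auto simp: eval_nat_numeral le_Suc_eq)

definition bipoly :: "(mindex \<Rightarrow> real) \<Rightarrow> real \<Rightarrow> real \<Rightarrow> real" where
  "bipoly c s t = (\<Sum>\<alpha>\<in>mindices_upto 5. c \<alpha> * s ^ fst \<alpha> * t ^ snd \<alpha>)"

text \<open>The derivatives of \<open>bipoly\<close> with respect to its two arguments, as operations on coefficients. The
cut at total degree \<open>5\<close> keeps them within the index set of a quintic whatever the values of \<open>c\<close>
outside it.\<close>

definition coeff_ds :: "(mindex \<Rightarrow> real) \<Rightarrow> mindex \<Rightarrow> real" where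
  "coeff_ds c \<alpha> = (if fst \<alpha> + snd \<alpha> < 5 then real (fst \<alpha> + 1) * c (fst \<alpha> + 1, snd \<alpha>) else 0)"

definition coeff_dt :: "(mindex \<Rightarrow> real) \<Rightarrow> mindex \<Rightarrow> real" where
  "coeff_dt c \<alpha> = (if fst \<alpha> + snd \<alpha> < 5 then real (snd \<alpha> + 1) * c (fst \<alpha>, snd \<alpha> + 1) else 0)"

text \<open>A quintic in the affine coordinates \<open>(x - a) \<bullet> p\<close> and \<open>(x - a) \<bullet> q\<close>.\<close>

definition chart :: "pt \<Rightarrow> pt \<Rightarrow> pt \<Rightarrow> (mindex \<Rightarrow> real) \<Rightarrow> pt \<Rightarrow> real" where
  "chart a p q c x = bipoly c ((x - a) \<bullet> p) ((x - a) \<bullet> q)"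

definition coeff_partial :: "pt \<Rightarrow> pt \<Rightarrow> 2 \<Rightarrow> (mindex \<Rightarrow> real) \<Rightarrow> mindex \<Rightarrow> real" where
  "coeff_partial p q k c \<alpha> = p$k * coeff_ds c \<alpha> + q$k * coeff_dt c \<alpha>"

lemma bipoly_linear: "bipoly (\<lambda>\<alpha>. x * c \<alpha> + y * d \<alpha>) s t = x * bipoly c s t + y * bipoly d s t"
  unfolding bipoly_def sum_distrib_left by (simp add: sum.distrib[symmetric] algebra_simps)

lemma coeff_ds_linear: "coeff_ds (\<lambda>\<alpha>. x * c \<alpha> + y * d \<alpha>) = (\<lambda>\<alpha>. x * coeff_ds c \<alpha> + y * coeff_ds d \<alpha>)"
  and coeff_dt_linear: "coeff_dt (\<lambda>\<alpha>. x * c \<alpha> + y * d \<alpha>) = (\<lambda>\<alpha>. x * coeff_dt c \<alpha> + y * coeff_dt d \<alpha>)"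
  by (auto simp: coeff_ds_def coeff_dt_def fun_eq_iff algebra_simps)

lemma coeff_ds_dt: "coeff_ds (coeff_dt c) = coeff_dt (coeff_ds c)"
  by (auto simp: coeff_ds_def coeff_dt_def fun_eq_iff)

lemma has_derivative_chart:
  "(chart a p q c has_derivative
     (\<lambda>h. (h \<bullet> p) * chart a p q (coeff_ds c) x + (h \<bullet> q) * chart a p q (coeff_dt c) x)) (at x)"
proof -
  let ?s = "(x - a) \<bullet> p" and ?t = "(x - a) \<bullet> q"
  have s: "((\<lambda>x. (x - a) \<bullet> p) has_derivative (\<lambda>h. h \<bullet> p)) (at x)" for p
    by (auto intro!: derivative_eq_intros)
  have "((\<lambda>x. \<Sum>\<alpha>\<in>mindices_upto 5. c \<alpha> * ((x - a) \<bullet> p) ^ fst \<alpha> * ((x - a) \<bullet> q) ^ snd \<alpha>) has_derivative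
    (\<lambda>h. \<Sum>\<alpha>\<in>mindices_upto 5. c \<alpha> * (real (fst \<alpha>) * (h \<bullet> p) * ?s ^ (fst \<alpha> - 1)) * ?t ^ snd \<alpha>
       + c \<alpha> * ?s ^ fst \<alpha> * (real (snd \<alpha>) * (h \<bullet> q) * ?t ^ (snd \<alpha> - 1)))) (at x)"
    by (rule has_derivative_sum) (auto intro!: derivative_eq_intros s simp: algebra_simps)
  moreover have "(\<Sum>\<alpha>\<in>mindices_upto 5. c \<alpha> * (real (fst \<alpha>) * (h \<bullet> p) * ?s ^ (fst \<alpha> - 1)) * ?t ^ snd \<alpha>
       + c \<alpha> * ?s ^ fst \<alpha> * (real (snd \<alpha>) * (h \<bullet> q) * ?t ^ (snd \<alpha> - 1)))
     = (h \<bullet> p) * chart a p q (coeff_ds c) x + (h \<bullet> q) * chart a p q (coeff_dt c) x" for h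
    unfolding chart_def bipoly_def sum_mindices_upto_5
    by (simp add: coeff_ds_def coeff_dt_def numeral_2_eq_2[symmetric] distrib_left distrib_right mult_ac)
  ultimately show ?thesis unfolding chart_def[abs_def] bipoly_def by (simp add: fun_eq_iff)
qed

lemma partial_chart: "partial k (chart a p q c) = chart a p q (coeff_partial p q k c)"
proof
  fix x
  have "partial k (chart a p q c) x = p$k * chart a p q (coeff_ds c) x + q$k * chart a p q (coeff_dt c) x"
    unfolding partial_has_derivative[OF has_derivative_chart] by (simp add: inner_axis inner_commute)
  then show "partial k (chart a p q c) x = chart a p q (coeff_partial p q k c) x"
    by (simp add: chart_def coeff_partial_def[abs_def] bipoly_linear)
qed

lemma smooth_chart: "smooth (chart a p q c)"
  by (rule smooth_coinduct[of _ "range (chart a p q)"])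
    (auto simp: partial_chart intro: differentiableI[OF has_derivative_chart])

lemma mderiv_chart:
  "mderiv \<alpha> (chart a p q c) = chart a p q ((coeff_partial p q 1 ^^ fst \<alpha>) ((coeff_partial p q 2 ^^ snd \<alpha>) c))"
proof -
  have "(partial k ^^ n) (chart a p q c) = chart a p q ((coeff_partial p q k ^^ n) c)" for k n c
    by (induction n) (auto simp: partial_chart)
  then show ?thesis by (simp add: mderiv_def)
qed

text \<open>Polynomials of total degree at most \<open>m\<close> in two functions \<open>s\<close> and \<open>t\<close>; for the two Cartesian coordinates
these are the spaces \<open>polys m\<close>. The generality serves the change of coordinates below.\<close>

definition coord_polys :: "nat \<Rightarrow> (pt \<Rightarrow> real) \<Rightarrow> (pt \<Rightarrow> real) \<Rightarrow> (pt \<Rightarrow> real) set" where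
  "coord_polys m s t = {f. \<exists>c. f = (\<lambda>x. \<Sum>\<alpha>\<in>mindices_upto m. c \<alpha> * s x ^ fst \<alpha> * t x ^ snd \<alpha>)}"

lemma coord_polysI:
  "f = (\<lambda>x. \<Sum>\<alpha>\<in>mindices_upto m. c \<alpha> * s x ^ fst \<alpha> * t x ^ snd \<alpha>) \<Longrightarrow> f \<in> coord_polys m s t"
  unfolding coord_polys_def by (rule CollectI, rule exI)

lemma polys_eq_coord_polys: "polys m = coord_polys m (\<lambda>x. x$1) (\<lambda>x. x$2)"
  by (simp add: polys_def coord_polys_def)

lemma coord_polys_5_eq: "coord_polys 5 (\<lambda>x. (x - a) \<bullet> p) (\<lambda>x. (x - a) \<bullet> q) = range (chart a p q)"
  by (auto simp: coord_polys_def chart_def[abs_def] bipoly_def)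

lemma coord_polys_add:
  assumes "f \<in> coord_polys m s t" "g \<in> coord_polys m s t"
  shows "(\<lambda>x. f x + g x) \<in> coord_polys m s t"
proof -
  obtain c d where "f = (\<lambda>x. \<Sum>\<alpha>\<in>mindices_upto m. c \<alpha> * s x ^ fst \<alpha> * t x ^ snd \<alpha>)"
    "g = (\<lambda>x. \<Sum>\<alpha>\<in>mindices_upto m. d \<alpha> * s x ^ fst \<alpha> * t x ^ snd \<alpha>)"
    using assms unfolding coord_polys_def by blast
  then have "(\<lambda>x. f x + g x) = (\<lambda>x. \<Sum>\<alpha>\<in>mindices_upto m. (c \<alpha> + d \<alpha>) * s x ^ fst \<alpha> * t x ^ snd \<alpha>)"
    by (simp add: sum.distrib distrib_right)
  then show ?thesis by (rule coord_polysI)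
qed

lemma coord_polys_cmult:
  assumes "f \<in> coord_polys m s t" shows "(\<lambda>x. k * f x) \<in> coord_polys m s t"
proof -
  obtain c where "f = (\<lambda>x. \<Sum>\<alpha>\<in>mindices_upto m. c \<alpha> * s x ^ fst \<alpha> * t x ^ snd \<alpha>)"
    using assms unfolding coord_polys_def by blast
  then have "(\<lambda>x. k * f x) = (\<lambda>x. \<Sum>\<alpha>\<in>mindices_upto m. (k * c \<alpha>) * s x ^ fst \<alpha> * t x ^ snd \<alpha>)"
    by (simp add: sum_distrib_left mult_ac)
  then show ?thesis by (rule coord_polysI)
qed

lemma coord_polys_0: "(\<lambda>x. 0) \<in> coord_polys m s t"
  by (rule coord_polysI[of _ "\<lambda>_. 0"]) simp

lemma coord_polys_sum:
  "finite I \<Longrightarrow> (\<And>i. i \<in> I \<Longrightarrow> f i \<in> coord_polys m s t) \<Longrightarrow> (\<lambda>x. \<Sum>i\<in>I. f i x) \<in> coord_polys m s t"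
  by (induction I rule: finite_induct) (auto intro: coord_polys_0 coord_polys_add)

lemma coord_polys_monomial:
  assumes "i + j \<le> m" shows "(\<lambda>x. s x ^ i * t x ^ j) \<in> coord_polys m s t"
proof -
  have "(\<Sum>\<alpha>\<in>mindices_upto m. (if \<alpha> = (i, j) then 1 else 0) * s x ^ fst \<alpha> * t x ^ snd \<alpha>) = s x ^ i * t x ^ j" for x
    using assms by (subst sum.remove[of _ "(i, j)"]) (auto simp: mindices_upto_def[of m] finite_mindices_upto[of m, unfolded mindices_upto_def] intro!: sum.neutral)
  then have "(\<lambda>x. s x ^ i * t x ^ j) = (\<lambda>x. \<Sum>\<alpha>\<in>mindices_upto m. (if \<alpha> = (i, j) then 1 else 0) * s x ^ fst \<alpha> * t x ^ snd \<alpha>)"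
    by presburger
  then show ?thesis by (rule coord_polysI)
qed

lemma coord_polys_mult_affine:
  assumes f: "f \<in> coord_polys m s t"
  shows "(\<lambda>x. (k0 + k1 * s x + k2 * t x) * f x) \<in> coord_polys (Suc m) s t"
proof -
  obtain c where c: "f = (\<lambda>x. \<Sum>\<alpha>\<in>mindices_upto m. c \<alpha> * s x ^ fst \<alpha> * t x ^ snd \<alpha>)"
    using assms unfolding coord_polys_def by blast
  have "(\<lambda>x. \<Sum>\<alpha>\<in>mindices_upto m. c \<alpha> * (k0 * (s x ^ fst \<alpha> * t x ^ snd \<alpha>) + (k1 * (s x ^ Suc (fst \<alpha>) * t x ^ snd \<alpha>)
      + k2 * (s x ^ fst \<alpha> * t x ^ Suc (snd \<alpha>))))) \<in> coord_polys (Suc m) s t"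
    by (intro coord_polys_sum coord_polys_cmult coord_polys_add coord_polys_monomial finite_mindices_upto)
      (auto simp: mindices_upto_def)
  also have "(\<lambda>x. \<Sum>\<alpha>\<in>mindices_upto m. c \<alpha> * (k0 * (s x ^ fst \<alpha> * t x ^ snd \<alpha>) + (k1 * (s x ^ Suc (fst \<alpha>) * t x ^ snd \<alpha>)
      + k2 * (s x ^ fst \<alpha> * t x ^ Suc (snd \<alpha>))))) = (\<lambda>x. (k0 + k1 * s x + k2 * t x) * f x)"
    unfolding c sum_distrib_left by (simp add: algebra_simps)
  finally show ?thesis .
qed

lemma coord_polys_mono:
  assumes "f \<in> coord_polys m s t" "m \<le> n" shows "f \<in> coord_polys n s t"
proof -
  obtain c where c: "f = (\<lambda>x. \<Sum>\<alpha>\<in>mindices_upto m. c \<alpha> * s x ^ fst \<alpha> * t x ^ snd \<alpha>)"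
    using assms unfolding coord_polys_def by blast
  have "(\<lambda>x. \<Sum>\<alpha>\<in>mindices_upto m. c \<alpha> * (s x ^ fst \<alpha> * t x ^ snd \<alpha>)) \<in> coord_polys n s t"
    using assms(2) by (intro coord_polys_sum coord_polys_cmult coord_polys_monomial finite_mindices_upto)
      (auto simp: mindices_upto_def)
  then show ?thesis unfolding c by (simp add: mult.assoc)
qed

text \<open>Total degree is invariant under affine substitutions: each factor of a monomial is an affine function
of the new coordinates and raises the degree by at most one.\<close>

lemma coord_polys_change:
  assumes \<sigma>: "\<And>x. \<sigma> x = k0 + k1 * s x + k2 * t x" and \<tau>: "\<And>x. \<tau> x = l0 + l1 * s x + l2 * t x"
  shows "coord_polys m \<sigma> \<tau> \<subseteq> coord_polys m s t"
proof
  fix f assume "f \<in> coord_polys m \<sigma> \<tau>"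
  then obtain c where c: "f = (\<lambda>x. \<Sum>\<alpha>\<in>mindices_upto m. c \<alpha> * \<sigma> x ^ fst \<alpha> * \<tau> x ^ snd \<alpha>)"
    unfolding coord_polys_def by blast
  have t: "(\<lambda>x. \<tau> x ^ j) \<in> coord_polys j s t" for j
  proof (induction j)
    case 0 show ?case using coord_polys_monomial[of 0 0] by simp
  next
    case (Suc j) then show ?case using coord_polys_mult_affine[OF Suc, of l0 l1 l2] by (simp add: \<tau>[symmetric])
  qed
  have "(\<lambda>x. \<sigma> x ^ i * \<tau> x ^ j) \<in> coord_polys (i + j) s t" for i j
  proof (induction i)
    case 0 show ?case using t by simp
  next
    case (Suc i) then show ?case
      using coord_polys_mult_affine[OF Suc, of k0 k1 k2] by (simp add: \<sigma>[symmetric] mult.assoc)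
  qed
  then have m: "(\<lambda>x. \<sigma> x ^ i * \<tau> x ^ j) \<in> coord_polys m s t" if "i + j \<le> m" for i j
    using that coord_polys_mono by blast
  have "(\<lambda>x. \<Sum>\<alpha>\<in>mindices_upto m. c \<alpha> * (\<sigma> x ^ fst \<alpha> * \<tau> x ^ snd \<alpha>)) \<in> coord_polys m s t"
    by (intro coord_polys_sum coord_polys_cmult m finite_mindices_upto) (auto simp: mindices_upto_def)
  then show "f \<in> coord_polys m s t" unfolding c by (simp add: mult.assoc)
qed

text \<open>The vectors \<open>p\<close> and \<open>q\<close> are the gradients of the affine coordinates in which the triangle with edge
vectors \<open>B\<close> and \<open>C\<close> becomes the reference triangle with vertices \<open>(0, 0)\<close>, \<open>(1, 0)\<close> and \<open>(0, 1)\<close>.\<close>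

definition dual_coords :: "pt \<Rightarrow> pt \<Rightarrow> pt \<Rightarrow> pt \<Rightarrow> bool" where
  "dual_coords B C p q \<longleftrightarrow> B \<bullet> p = 1 \<and> B \<bullet> q = 0 \<and> C \<bullet> p = 0 \<and> C \<bullet> q = 1"

lemma inner_pt: "(x::pt) \<bullet> y = x$1 * y$1 + x$2 * y$2"
  by (simp add: inner_vec_def sum_2)

lemma dual_coords_identity:
  assumes "dual_coords B C p q"
  shows "B$1 * p$1 + C$1 * q$1 = 1" "B$2 * p$2 + C$2 * q$2 = 1" "B$1 * p$2 + C$1 * q$2 = 0" "B$2 * p$1 + C$2 * q$1 = 0"
proof -
  have d: "B$1 * p$1 + B$2 * p$2 = 1" "B$1 * q$1 + B$2 * q$2 = 0" "C$1 * p$1 + C$2 * p$2 = 0" "C$1 * q$1 + C$2 * q$2 = 1"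
    using assms by (auto simp: dual_coords_def inner_pt)
  show "B$1 * p$1 + C$1 * q$1 = 1" "B$2 * p$2 + C$2 * q$2 = 1" "B$1 * p$2 + C$1 * q$2 = 0" "B$2 * p$1 + C$2 * q$1 = 0"
    using d by algebra+
qed

lemma polys_5_eq_range_chart:
  assumes "dual_coords B C p q" shows "polys 5 = range (chart a p q)"
proof -
  note d = dual_coords_identity[OF assms]
  have x1: "x$1 = a$1 + B$1 * ((x - a) \<bullet> p) + C$1 * ((x - a) \<bullet> q)" for x
    using d(1,3) unfolding inner_pt vector_minus_component by algebra
  have x2: "x$2 = a$2 + B$2 * ((x - a) \<bullet> p) + C$2 * ((x - a) \<bullet> q)" for x
    using d(2,4) unfolding inner_pt vector_minus_component by algebra
  have s: "(x - a) \<bullet> r = - (a \<bullet> r) + r$1 * x$1 + r$2 * x$2" for x r :: pt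
    by (simp add: inner_pt algebra_simps)
  show ?thesis unfolding polys_eq_coord_polys coord_polys_5_eq[symmetric]
    using coord_polys_change[of "\<lambda>x. x$1" _ _ "\<lambda>x. (x - a) \<bullet> p" _ "\<lambda>x. (x - a) \<bullet> q" "\<lambda>x. x$2", OF x1 x2, of 5]
      coord_polys_change[of "\<lambda>x. (x - a) \<bullet> p" _ _ "\<lambda>x. x$1" _ "\<lambda>x. x$2" "\<lambda>x. (x - a) \<bullet> q", OF s s, of 5] by blast
qed

section \<open>Unisolvence of the Argyris element\<close>

text \<open>The derivatives of a quintic in the reference coordinates. The reference data of a quintic are those of
order at most two at the three reference vertices and one transversal derivative at the midpoint of
each side, in the direction of \<open>t\<close>, of \<open>s\<close> and of \<open>s + t\<close>.\<close>

definition second_jet_at :: "(mindex \<Rightarrow> real) \<Rightarrow> real \<Rightarrow> real \<Rightarrow> mindex \<Rightarrow> real" where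
  "second_jet_at c s t \<alpha> = bipoly ((coeff_ds ^^ fst \<alpha>) ((coeff_dt ^^ snd \<alpha>) c)) s t"

lemma second_jet_at_simps:
  "second_jet_at c s t (0,0) = bipoly c s t"
  "second_jet_at c s t (Suc 0,0) = bipoly (coeff_ds c) s t"
  "second_jet_at c s t (0,Suc 0) = bipoly (coeff_dt c) s t"
  "second_jet_at c s t (2,0) = bipoly (coeff_ds (coeff_ds c)) s t"
  "second_jet_at c s t (Suc 0,Suc 0) = bipoly (coeff_ds (coeff_dt c)) s t"
  "second_jet_at c s t (0,2) = bipoly (coeff_dt (coeff_dt c)) s t"
  by (simp_all add: second_jet_at_def numeral_2_eq_2)

lemmas bipoly_expand = bipoly_def sum_mindices_upto_5 coeff_ds_def coeff_dt_def

text \<open>Explicit elimination. The data at \<open>(0, 0)\<close> give the coefficients of degree at most two. On the side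
\<open>t = 0\<close> the quintic is determined by Hermite data at both ends, and its derivative in \<open>t\<close> is a quartic
determined by its values and slopes at both ends and its value at the midpoint; the side \<open>s = 0\<close> is
similar. This leaves the coefficients of \<open>s\<^sup>2 t\<^sup>2\<close>, \<open>s\<^sup>3 t\<^sup>2\<close> and \<open>s\<^sup>2 t\<^sup>3\<close>. One second derivative at each of
\<open>(1, 0)\<close> and \<open>(0, 1)\<close> and the transversal derivative on the third side give three equations for them
with determinant \<open>- 1 / 8\<close>. The constants are generous.\<close>

lemma reference_coefficient_bound:
  assumes v: "\<And>\<alpha> s t. \<alpha> \<in> mindices_upto 2 \<Longrightarrow> (s, t) \<in> {(0,0), (1,0), (0,1)} \<Longrightarrow> \<bar>second_jet_at c s t \<alpha>\<bar> \<le> M"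
    and e1: "\<bar>bipoly (coeff_dt c) (1/2) 0\<bar> \<le> M" and e2: "\<bar>bipoly (coeff_ds c) 0 (1/2)\<bar> \<le> M"
    and e3: "\<bar>bipoly (coeff_ds c) (1/2) (1/2) + bipoly (coeff_dt c) (1/2) (1/2)\<bar> \<le> M"
    and \<alpha>: "\<alpha> \<in> mindices_upto 5"
  shows "\<bar>c \<alpha>\<bar> \<le> 100000 * M"
proof -
  have M: "0 \<le> M" using e1 by linarith
  let ?J0 = "second_jet_at c 0 0" and ?J1 = "second_jet_at c 1 0" and ?J2 = "second_jet_at c 0 1"
  have b: "\<bar>second_jet_at c s t (0,0)\<bar> \<le> M" "\<bar>second_jet_at c s t (1,0)\<bar> \<le> M" "\<bar>second_jet_at c s t (0,1)\<bar> \<le> M"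
    "\<bar>second_jet_at c s t (2,0)\<bar> \<le> M" "\<bar>second_jet_at c s t (1,1)\<bar> \<le> M" "\<bar>second_jet_at c s t (0,2)\<bar> \<le> M"
    if "(s, t) \<in> {(0,0), (1,0), (0,1)}" for s t
    by (rule v[OF _ that]; simp add: mindices_upto_2)+
  note b0 = b[of 0 0, simplified] and b1 = b[of 1 0, simplified] and b2 = b[of 0 1, simplified]
  note ex = second_jet_at_simps second_jet_at_simps[folded One_nat_def] bipoly_expand power_divide numeral_2_eq_2[symmetric]
  have q0: "c (0,0) = ?J0 (0,0)" "c (1,0) = ?J0 (Suc 0,0)" "c (0,1) = ?J0 (0,Suc 0)" "2 * c (2,0) = ?J0 (2,0)"
    "c (1,1) = ?J0 (Suc 0,Suc 0)" "2 * c (0,2) = ?J0 (0,2)"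
    by (simp_all add: ex)
  have 0: "\<bar>c (0,0)\<bar> \<le> M" "\<bar>c (1,0)\<bar> \<le> M" "\<bar>c (0,1)\<bar> \<le> M" "\<bar>c (2,0)\<bar> \<le> M" "\<bar>c (1,1)\<bar> \<le> M" "\<bar>c (0,2)\<bar> \<le> M"
    using b0[THEN abs_le_D1] b0[THEN abs_le_D2] q0 M by - (rule abs_leI; linarith)+
  have q1: "c (3,0) = 10 * ?J1 (0,0) - 4 * ?J1 (Suc 0,0) + ?J1 (2,0) / 2 - 10 * c (0,0) - 6 * c (1,0) - 3 * c (2,0)"
    "c (4,0) = -15 * ?J1 (0,0) + 7 * ?J1 (Suc 0,0) - ?J1 (2,0) + 15 * c (0,0) + 8 * c (1,0) + 3 * c (2,0)"
    "c (5,0) = 6 * ?J1 (0,0) - 3 * ?J1 (Suc 0,0) + ?J1 (2,0) / 2 - 6 * c (0,0) - 3 * c (1,0) - c (2,0)"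
    "c (0,3) = 10 * ?J2 (0,0) - 4 * ?J2 (0,Suc 0) + ?J2 (0,2) / 2 - 10 * c (0,0) - 6 * c (0,1) - 3 * c (0,2)"
    "c (0,4) = -15 * ?J2 (0,0) + 7 * ?J2 (0,Suc 0) - ?J2 (0,2) + 15 * c (0,0) + 8 * c (0,1) + 3 * c (0,2)"
    "c (0,5) = 6 * ?J2 (0,0) - 3 * ?J2 (0,Suc 0) + ?J2 (0,2) / 2 - 6 * c (0,0) - 3 * c (0,1) - c (0,2)"
    by (simp_all add: ex add_divide_distrib)
  have 1: "\<bar>c (3,0)\<bar> \<le> 100 * M" "\<bar>c (4,0)\<bar> \<le> 100 * M" "\<bar>c (5,0)\<bar> \<le> 100 * M"
    using q1(1-3) 0(1,2,4)[THEN abs_le_D1] 0(1,2,4)[THEN abs_le_D2] b1(1,2,4)[THEN abs_le_D1] b1(1,2,4)[THEN abs_le_D2] M by - (rule abs_leI; linarith)+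
  have o1: "\<bar>c (0,3)\<bar> \<le> 100 * M" "\<bar>c (0,4)\<bar> \<le> 100 * M" "\<bar>c (0,5)\<bar> \<le> 100 * M"
    using q1(4-6) 0(1,3,6)[THEN abs_le_D1] 0(1,3,6)[THEN abs_le_D2] b2(1,3,6)[THEN abs_le_D1] b2(1,3,6)[THEN abs_le_D2] M by - (rule abs_leI; linarith)+
  let ?E1 = "bipoly (coeff_dt c) (1/2) 0" and ?E2 = "bipoly (coeff_ds c) 0 (1/2)"
  let ?E3 = "bipoly (coeff_ds c) (1/2) (1/2) + bipoly (coeff_dt c) (1/2) (1/2)"
  have q2: "c (2,1) = 16 * ?E1 - 5 * ?J1 (0,Suc 0) + ?J1 (Suc 0,Suc 0) - 11 * c (0,1) - 4 * c (1,1)"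
    "c (3,1) = 14 * ?J1 (0,Suc 0) - 3 * ?J1 (Suc 0,Suc 0) - 32 * ?E1 + 18 * c (0,1) + 5 * c (1,1)"
    "c (4,1) = -8 * ?J1 (0,Suc 0) + 2 * ?J1 (Suc 0,Suc 0) + 16 * ?E1 - 8 * c (0,1) - 2 * c (1,1)"
    by (simp_all add: ex)
  have q3: "c (1,2) = 16 * ?E2 - 5 * ?J2 (Suc 0,0) + ?J2 (Suc 0,Suc 0) - 11 * c (1,0) - 4 * c (1,1)"
    "c (1,3) = 14 * ?J2 (Suc 0,0) - 3 * ?J2 (Suc 0,Suc 0) - 32 * ?E2 + 18 * c (1,0) + 5 * c (1,1)"
    "c (1,4) = -8 * ?J2 (Suc 0,0) + 2 * ?J2 (Suc 0,Suc 0) + 16 * ?E2 - 8 * c (1,0) - 2 * c (1,1)"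
    by (simp_all add: ex)
  have 2: "\<bar>c (2,1)\<bar> \<le> 200 * M" "\<bar>c (3,1)\<bar> \<le> 200 * M" "\<bar>c (4,1)\<bar> \<le> 200 * M"
    using q2 0(3,5)[THEN abs_le_D1] 0(3,5)[THEN abs_le_D2] b1(3,5)[THEN abs_le_D1] b1(3,5)[THEN abs_le_D2] e1[THEN abs_le_D1] e1[THEN abs_le_D2] M by - (rule abs_leI; linarith)+
  have o2: "\<bar>c (1,2)\<bar> \<le> 200 * M" "\<bar>c (1,3)\<bar> \<le> 200 * M" "\<bar>c (1,4)\<bar> \<le> 200 * M"
    using q3 0(2,5)[THEN abs_le_D1] 0(2,5)[THEN abs_le_D2] b2(2,5)[THEN abs_le_D1] b2(2,5)[THEN abs_le_D2] e2[THEN abs_le_D1] e2[THEN abs_le_D2] M by - (rule abs_leI; linarith)+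
  \<comment> \<open>the remaining equations read: \<open>A\<close> and \<open>B\<close> are known, and
    \<open>c (2,2) / 2 + 5 / 16 * (c (3,2) + c (2,3))\<close> is the third transversal derivative minus \<open>W\<close>\<close>
  define A where "A = c (2,2) + c (3,2)"
  define B where "B = c (2,2) + c (2,3)"
  define W where "W = c (1,0) + c (0,1) + c (2,0) + c (1,1) + c (0,2) + 3/4 * (c (3,0) + c (2,1) + c (1,2) + c (0,3))
    + 1/2 * (c (4,0) + c (3,1) + c (1,3) + c (0,4)) + 5/16 * (c (5,0) + c (4,1) + c (1,4) + c (0,5))"
  have qA: "A = ?J1 (0,2) / 2 - c (0,2) - c (1,2)" and qB: "B = ?J2 (2,0) / 2 - c (2,0) - c (2,1)"
    by (simp_all add: A_def B_def ex add_divide_distrib)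
  have A: "\<bar>A\<bar> \<le> 300 * M" using qA 0(6)[THEN abs_le_D1] 0(6)[THEN abs_le_D2] o2(1)[THEN abs_le_D1] o2(1)[THEN abs_le_D2] b1(6)[THEN abs_le_D1] b1(6)[THEN abs_le_D2] M by - (rule abs_leI; linarith)
  have B: "\<bar>B\<bar> \<le> 300 * M" using qB 0(4)[THEN abs_le_D1] 0(4)[THEN abs_le_D2] 2(1)[THEN abs_le_D1] 2(1)[THEN abs_le_D2] b2(4)[THEN abs_le_D1] b2(4)[THEN abs_le_D2] M by - (rule abs_leI; linarith)
  have W: "\<bar>W\<bar> \<le> 2000 * M"
  proof -
    have "\<bar>c (3,0) + c (2,1) + c (1,2) + c (0,3)\<bar> \<le> 600 * M" using 1(1)[THEN abs_le_D1] 1(1)[THEN abs_le_D2] o1(1)[THEN abs_le_D1] o1(1)[THEN abs_le_D2] 2(1)[THEN abs_le_D1] 2(1)[THEN abs_le_D2] o2(1)[THEN abs_le_D1] o2(1)[THEN abs_le_D2] by - (rule abs_leI; linarith)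
    moreover have "\<bar>c (4,0) + c (3,1) + c (1,3) + c (0,4)\<bar> \<le> 600 * M" using 1(2)[THEN abs_le_D1] 1(2)[THEN abs_le_D2] o1(2)[THEN abs_le_D1] o1(2)[THEN abs_le_D2] 2(2)[THEN abs_le_D1] 2(2)[THEN abs_le_D2] o2(2)[THEN abs_le_D1] o2(2)[THEN abs_le_D2] by - (rule abs_leI; linarith)
    moreover have "\<bar>c (5,0) + c (4,1) + c (1,4) + c (0,5)\<bar> \<le> 600 * M" using 1(3)[THEN abs_le_D1] 1(3)[THEN abs_le_D2] o1(3)[THEN abs_le_D1] o1(3)[THEN abs_le_D2] 2(3)[THEN abs_le_D1] 2(3)[THEN abs_le_D2] o2(3)[THEN abs_le_D1] o2(3)[THEN abs_le_D2] by - (rule abs_leI; linarith)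
    moreover have "\<bar>c (1,0) + c (0,1) + c (2,0) + c (1,1) + c (0,2)\<bar> \<le> 5 * M" using 0[THEN abs_le_D1] 0[THEN abs_le_D2] by - (rule abs_leI; linarith)
    moreover have "\<bar>e + 3/4 * x + 1/2 * y + 5/16 * z\<bar> \<le> 2000 * M"
      if "\<bar>x\<bar> \<le> 600 * M" "\<bar>y\<bar> \<le> 600 * M" "\<bar>z\<bar> \<le> 600 * M" "\<bar>e\<bar> \<le> 5 * M" for e x y z
      using that M by (simp add: abs_le_iff)
    ultimately show ?thesis unfolding W_def by blast
  qed
  have q5: "2 * c (2,2) = 16 * W - 16 * ?E3 + 5 * A + 5 * B"
    by (simp add: W_def A_def B_def ex add_divide_distrib)
  have "\<bar>r\<bar> \<le> 50000 * M" if "\<bar>e\<bar> \<le> M" "\<bar>w\<bar> \<le> 2000 * M" "\<bar>x\<bar> \<le> 300 * M" "\<bar>y\<bar> \<le> 300 * M"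
      "2 * r = 16 * w - 16 * e + 5 * x + 5 * y" for e w x y r
    using that M by (simp add: abs_le_iff)
  from this[OF e3 W A B q5] have 3: "\<bar>c (2,2)\<bar> \<le> 50000 * M" .
  have 4: "\<bar>c (2,3)\<bar> \<le> 60000 * M" "\<bar>c (3,2)\<bar> \<le> 60000 * M"
    using A[THEN abs_le_D1] A[THEN abs_le_D2] B[THEN abs_le_D1] B[THEN abs_le_D2] 3[THEN abs_le_D1] 3[THEN abs_le_D2] M unfolding A_def B_def by - (rule abs_leI; linarith)+
  have "M \<le> 100000 * M" "100 * M \<le> 100000 * M" "200 * M \<le> 100000 * M" "50000 * M \<le> 100000 * M" "60000 * M \<le> 100000 * M"
    using M by auto
  note le = this[THEN order_trans[rotated]]
  note all = 0[THEN le(1)] 1[THEN le(2)] o1[THEN le(2)] 2[THEN le(3)] o2[THEN le(3)] 3[THEN le(4)] 4[THEN le(5)]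
  from mindices_upto_5_cases[OF \<alpha>] show ?thesis
    by (elim insertE emptyE) (simp_all only: all)
qed

text \<open>The elimination of \<open>reference_coefficient_bound\<close>, read backwards as a definition of the coefficients.\<close>

lemma reference_interpolation_exists:
  obtains c where
    "\<And>\<alpha>. \<alpha> \<in> mindices_upto 2 \<Longrightarrow> second_jet_at c 0 0 \<alpha> = V0 \<alpha>"
    "\<And>\<alpha>. \<alpha> \<in> mindices_upto 2 \<Longrightarrow> second_jet_at c 1 0 \<alpha> = V1 \<alpha>"
    "\<And>\<alpha>. \<alpha> \<in> mindices_upto 2 \<Longrightarrow> second_jet_at c 0 1 \<alpha> = V2 \<alpha>"
    "bipoly (coeff_dt c) (1/2) 0 = E1" "bipoly (coeff_ds c) 0 (1/2) = E2"
    "bipoly (coeff_ds c) (1/2) (1/2) + bipoly (coeff_dt c) (1/2) (1/2) = E3"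
proof -
  define k00 k10 k01 k20 k11 k02 where k0:
    "k00 = V0 (0,0)" "k10 = V0 (1,0)" "k01 = V0 (0,1)" "k20 = V0 (2,0) / 2" "k11 = V0 (1,1)" "k02 = V0 (0,2) / 2"
  define r0 r1 r2 where r: "r0 = V1 (0,0) - k00 - k10 - k20" "r1 = V1 (1,0) - k10 - 2 * k20" "r2 = V1 (2,0) - 2 * k20"
  define k30 k40 k50 where k1: "k30 = 10 * r0 - 4 * r1 + r2 / 2" "k40 = -15 * r0 + 7 * r1 - r2" "k50 = 6 * r0 - 3 * r1 + r2 / 2"
  define s0 s1 s2 where s: "s0 = V2 (0,0) - k00 - k01 - k02" "s1 = V2 (0,1) - k01 - 2 * k02" "s2 = V2 (0,2) - 2 * k02"
  define k03 k04 k05 where k2: "k03 = 10 * s0 - 4 * s1 + s2 / 2" "k04 = -15 * s0 + 7 * s1 - s2" "k05 = 6 * s0 - 3 * s1 + s2 / 2"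
  define t0 t1 t2 where t: "t0 = V1 (0,1) - k01 - k11" "t1 = V1 (1,1) - k11" "t2 = E1 - k01 - k11 / 2"
  define k21 k31 k41 where k3: "k21 = 16 * t2 - 5 * t0 + t1" "k31 = 14 * t0 - 3 * t1 - 32 * t2" "k41 = - 8 * t0 + 2 * t1 + 16 * t2"
  define u0 u1 u2 where u: "u0 = V2 (1,0) - k10 - k11" "u1 = V2 (1,1) - k11" "u2 = E2 - k10 - k11 / 2"
  define k12 k13 k14 where k4: "k12 = 16 * u2 - 5 * u0 + u1" "k13 = 14 * u0 - 3 * u1 - 32 * u2" "k14 = - 8 * u0 + 2 * u1 + 16 * u2"
  define A where A: "A = V1 (0,2) / 2 - k02 - k12"
  define B where B: "B = V2 (2,0) / 2 - k20 - k21"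
  define w where w: "w = E3 - (k10 + k01 + (k20 + k11 + k02) + 3/4 * (k30 + k21 + k12 + k03)
     + 1/2 * (k40 + k31 + k13 + k04) + 5/16 * (k50 + k41 + k14 + k05))"
  define k22 k32 k23 where k5: "k22 = -8 * w + 5/2 * (A + B)" "k32 = A - k22" "k23 = B - k22"
  define c where "c \<alpha> = (if \<alpha> = (0,0) then k00 else if \<alpha> = (0,1) then k01 else if \<alpha> = (0,2) then k02 else if \<alpha> = (0,3) then k03 else if \<alpha> = (0,4) then k04 else if \<alpha> = (0,5) then k05 else if \<alpha> = (1,0) then k10 else if \<alpha> = (1,1) then k11 else if \<alpha> = (1,2) then k12 else if \<alpha> = (1,3) then k13 else if \<alpha> = (1,4) then k14 else if \<alpha> = (2,0) then k20 else if \<alpha> = (2,1) then k21 else if \<alpha> = (2,2) then k22 else if \<alpha> = (2,3) then k23 else if \<alpha> = (3,0) then k30 else if \<alpha> = (3,1) then k31 else if \<alpha> = (3,2) then k32 else if \<alpha> = (4,0) then k40 else if \<alpha> = (4,1) then k41 else if \<alpha> = (5,0) then k50 else 0)" for \<alpha> :: mindex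
  have 0: "second_jet_at c 0 0 \<alpha> = V0 \<alpha>" if "\<alpha> \<in> mindices_upto 2" for \<alpha>
    using that unfolding mindices_upto_2
    by (elim insertE emptyE) (simp_all add: second_jet_at_simps second_jet_at_simps[folded One_nat_def] bipoly_expand c_def k0 numeral_2_eq_2[symmetric])
  have 1: "second_jet_at c 1 0 \<alpha> = V1 \<alpha>" if "\<alpha> \<in> mindices_upto 2" for \<alpha>
    using that unfolding mindices_upto_2
    by (elim insertE emptyE) (simp_all add: second_jet_at_simps second_jet_at_simps[folded One_nat_def] bipoly_expand c_def r k1 t k3 A k5 add_divide_distrib diff_divide_distrib numeral_2_eq_2[symmetric])
  have 2: "second_jet_at c 0 1 \<alpha> = V2 \<alpha>" if "\<alpha> \<in> mindices_upto 2" for \<alpha>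
    using that unfolding mindices_upto_2
    by (elim insertE emptyE) (simp_all add: second_jet_at_simps second_jet_at_simps[folded One_nat_def] bipoly_expand c_def s k2 u k4 B k5 add_divide_distrib diff_divide_distrib numeral_2_eq_2[symmetric])
  have "bipoly (coeff_dt c) (1/2) 0 = E1"
    by (simp add: bipoly_expand c_def t k3 add_divide_distrib diff_divide_distrib power_divide numeral_2_eq_2[symmetric])
  moreover have "bipoly (coeff_ds c) 0 (1/2) = E2"
    by (simp add: bipoly_expand c_def u k4 add_divide_distrib diff_divide_distrib power_divide numeral_2_eq_2[symmetric])
  moreover have "bipoly (coeff_ds c) (1/2) (1/2) + bipoly (coeff_dt c) (1/2) (1/2) = E3"
    by (simp add: bipoly_expand c_def power_divide numeral_2_eq_2[symmetric]) (simp add: w k5 add_divide_distrib diff_divide_distrib)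
  ultimately show thesis using that 0 1 2 by blast
qed

text \<open>Twice the signed area of the triangle with sides \<open>x\<close> and \<open>y\<close>.\<close>

definition cross :: "pt \<Rightarrow> pt \<Rightarrow> real" where "cross x y = x$1 * y$2 - x$2 * y$1"

lemma lagrange_identity_pt: "(x \<bullet> y)\<^sup>2 + (cross x y)\<^sup>2 = (norm x)\<^sup>2 * (norm y)\<^sup>2"
  unfolding power2_norm_eq_inner inner_pt cross_def by (simp add: power2_eq_square algebra_simps)

lemma abs_cross_le: "\<bar>cross x y\<bar> \<le> norm x * norm y"
proof -
  have "(cross x y)\<^sup>2 \<le> (norm x * norm y)\<^sup>2"
    using lagrange_identity_pt[of x y] zero_le_power2[of "x \<bullet> y"] unfolding power_mult_distrib by linarith
  then show ?thesis by (simp add: abs_le_square_iff[symmetric])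
qed

text \<open>In the plane, two vectors orthogonal to the same side are parallel.\<close>

lemma abs_inner_unit_normal:
  fixes n B q :: pt
  assumes n: "norm n = 1" "n \<bullet> B = 0" and B: "B \<noteq> 0" and q: "q \<bullet> B = 0"
  shows "\<bar>q \<bullet> n\<bar> = norm q"
proof -
  have "cross q n * B$1 = 0" "cross q n * B$2 = 0"
    using n(2) q unfolding inner_pt cross_def by algebra+
  moreover have "B$1 \<noteq> 0 \<or> B$2 \<noteq> 0" using B by (auto simp: vec_eq_iff forall_2)
  ultimately have "cross q n = 0" by auto
  then have "(q \<bullet> n)\<^sup>2 = (norm q)\<^sup>2" using lagrange_identity_pt[of q n] n(1) by simp
  then show ?thesis by (simp add: power2_eq_iff abs_if) (smt (verit) norm_ge_zero)
qed

lemma dual_coords_exist: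
  assumes "cross B C \<noteq> 0"
  obtains p q where "dual_coords B C p q" "norm p = norm C / \<bar>cross B C\<bar>" "norm q = norm B / \<bar>cross B C\<bar>"
    "norm (p + q) = norm (C - B) / \<bar>cross B C\<bar>"
proof -
  define J :: "pt \<Rightarrow> pt" where "J x = vector [x$2, - x$1]" for x
  have J: "J x $ 1 = x$2" "J x $ 2 = - x$1" for x by (simp_all add: J_def)
  have nJ: "norm (J x) = norm x" for x
    by (simp add: norm_eq_sqrt_inner inner_pt J add.commute)
  define d where "d = cross B C"
  define p q where "p = (1 / d) *\<^sub>R J C" and "q = (- 1 / d) *\<^sub>R J B"
  have "dual_coords B C p q"
    using assms by (simp add: dual_coords_def inner_pt p_def q_def J d_def[symmetric] cross_def field_simps)
      (simp add: d_def cross_def field_simps)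
  moreover have "p + q = (1 / d) *\<^sub>R J (C - B)"
    by (simp add: vec_eq_iff forall_2 p_def q_def J algebra_simps diff_divide_distrib)
  then have "norm (p + q) = norm (C - B) / \<bar>d\<bar>" by (simp add: nJ)
  moreover have "norm p = norm C / \<bar>d\<bar>" "norm q = norm B / \<bar>d\<bar>" by (simp_all add: p_def q_def nJ)
  ultimately show thesis using that by (simp add: d_def)
qed

lemma chart_at:
  assumes "dual_coords (b - a) (c - a) p q"
  shows "chart a p q k a = bipoly k 0 0" "chart a p q k b = bipoly k 1 0" "chart a p q k c = bipoly k 0 1"
    "chart a p q k ((1/2) *\<^sub>R (a + b)) = bipoly k (1/2) 0" "chart a p q k ((1/2) *\<^sub>R (a + c)) = bipoly k 0 (1/2)"
    "chart a p q k ((1/2) *\<^sub>R (b + c)) = bipoly k (1/2) (1/2)"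
proof -
  have e: "(1/2) *\<^sub>R (a + b) - a = (1/2) *\<^sub>R (b - a)" "(1/2) *\<^sub>R (a + c) - a = (1/2) *\<^sub>R (c - a)"
    "(1/2) *\<^sub>R (b + c) - a = (1/2) *\<^sub>R (b - a) + (1/2) *\<^sub>R (c - a)"
    by (simp_all add: vec_eq_iff field_simps)
  show "chart a p q k a = bipoly k 0 0" "chart a p q k b = bipoly k 1 0" "chart a p q k c = bipoly k 0 1"
    "chart a p q k ((1/2) *\<^sub>R (a + b)) = bipoly k (1/2) 0" "chart a p q k ((1/2) *\<^sub>R (a + c)) = bipoly k 0 (1/2)"
    "chart a p q k ((1/2) *\<^sub>R (b + c)) = bipoly k (1/2) (1/2)"
    using assms unfolding chart_def e inner_add_left inner_scaleR_left by (simp_all add: dual_coords_def)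
qed

text \<open>The chain rule for an affine change of coordinates; \<open>jet_of_mderivs\<close> is its inverse.\<close>

lemma mderiv_chart_jet:
  fixes x a p q :: pt and k :: "mindex \<Rightarrow> real"
  defines "J \<equiv> second_jet_at k ((x - a) \<bullet> p) ((x - a) \<bullet> q)"
  shows "mderiv (0,0) (chart a p q k) x = J (0,0)"
    "mderiv (1,0) (chart a p q k) x = p$1 * J (1,0) + q$1 * J (0,1)"
    "mderiv (0,1) (chart a p q k) x = p$2 * J (1,0) + q$2 * J (0,1)"
    "mderiv (2,0) (chart a p q k) x = (p$1)\<^sup>2 * J (2,0) + 2 * p$1 * q$1 * J (1,1) + (q$1)\<^sup>2 * J (0,2)"
    "mderiv (1,1) (chart a p q k) x = p$1 * p$2 * J (2,0) + (p$1 * q$2 + q$1 * p$2) * J (1,1) + q$1 * q$2 * J (0,2)"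
    "mderiv (0,2) (chart a p q k) x = (p$2)\<^sup>2 * J (2,0) + 2 * p$2 * q$2 * J (1,1) + (q$2)\<^sup>2 * J (0,2)"
  unfolding mderiv_chart J_def chart_def
  by (simp_all add: second_jet_at_def numeral_2_eq_2 coeff_partial_def[abs_def] coeff_ds_linear coeff_dt_linear
      bipoly_linear coeff_ds_dt)
    (simp_all add: algebra_simps)

lemma grad_chart:
  "grad (chart a p q k) x \<bullet> n = (p \<bullet> n) * chart a p q (coeff_ds k) x + (q \<bullet> n) * chart a p q (coeff_dt k) x"
  by (simp add: grad_def inner_pt partial_chart coeff_partial_def[abs_def] chart_def bipoly_linear algebra_simps)

lemma jet_of_mderivs:
  fixes x a p q B C :: pt and k :: "mindex \<Rightarrow> real"
  assumes "dual_coords B C p q"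
  defines "J \<equiv> second_jet_at k ((x - a) \<bullet> p) ((x - a) \<bullet> q)" and "m \<equiv> \<lambda>\<alpha>. mderiv \<alpha> (chart a p q k) x"
  shows "J (0,0) = m (0,0)" "J (1,0) = B$1 * m (1,0) + B$2 * m (0,1)" "J (0,1) = C$1 * m (1,0) + C$2 * m (0,1)"
    "J (2,0) = (B$1)\<^sup>2 * m (2,0) + 2 * B$1 * B$2 * m (1,1) + (B$2)\<^sup>2 * m (0,2)"
    "J (1,1) = B$1 * C$1 * m (2,0) + (B$1 * C$2 + B$2 * C$1) * m (1,1) + B$2 * C$2 * m (0,2)"
    "J (0,2) = (C$1)\<^sup>2 * m (2,0) + 2 * C$1 * C$2 * m (1,1) + (C$2)\<^sup>2 * m (0,2)"
proof -
  have d: "B$1 * p$1 + B$2 * p$2 = 1" "B$1 * q$1 + B$2 * q$2 = 0" "C$1 * p$1 + C$2 * p$2 = 0" "C$1 * q$1 + C$2 * q$2 = 1"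
    using assms by (auto simp: dual_coords_def inner_pt)
  note e = mderiv_chart_jet[where k=k and x=x and a=a and p=p and q=q, folded J_def]
  have bil: "b1 * c1 * (p1\<^sup>2 * x + 2 * p1 * q1 * y + q1\<^sup>2 * z) + (b1 * c2 + b2 * c1) * (p1 * p2 * x + (p1 * q2 + q1 * p2) * y + q1 * q2 * z)
      + b2 * c2 * (p2\<^sup>2 * x + 2 * p2 * q2 * y + q2\<^sup>2 * z)
    = (b1 * p1 + b2 * p2) * (c1 * p1 + c2 * p2) * x + ((b1 * p1 + b2 * p2) * (c1 * q1 + c2 * q2) + (b1 * q1 + b2 * q2) * (c1 * p1 + c2 * p2)) * y
      + (b1 * q1 + b2 * q2) * (c1 * q1 + c2 * q2) * z" for b1 b2 c1 c2 p1 p2 q1 q2 x y z :: real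
    by (simp add: power2_eq_square algebra_simps)
  have lin: "b1 * (p1 * x + q1 * y) + b2 * (p2 * x + q2 * y) = (b1 * p1 + b2 * p2) * x + (b1 * q1 + b2 * q2) * y"
    for b1 b2 p1 p2 q1 q2 x y :: real by (simp add: algebra_simps)
  show "J (0,0) = m (0,0)" unfolding m_def e ..
  show "J (1,0) = B$1 * m (1,0) + B$2 * m (0,1)" "J (0,1) = C$1 * m (1,0) + C$2 * m (0,1)"
    unfolding m_def e lin d by simp_all
  show "J (1,1) = B$1 * C$1 * m (2,0) + (B$1 * C$2 + B$2 * C$1) * m (1,1) + B$2 * C$2 * m (0,2)"
    unfolding m_def e bil d by simp
  have "J (2,0) = B$1 * B$1 * m (2,0) + (B$1 * B$2 + B$2 * B$1) * m (1,1) + B$2 * B$2 * m (0,2)"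
    "J (0,2) = C$1 * C$1 * m (2,0) + (C$1 * C$2 + C$2 * C$1) * m (1,1) + C$2 * C$2 * m (0,2)"
    unfolding m_def e bil d by simp_all
  then show "J (2,0) = (B$1)\<^sup>2 * m (2,0) + 2 * B$1 * B$2 * m (1,1) + (B$2)\<^sup>2 * m (0,2)"
    "J (0,2) = (C$1)\<^sup>2 * m (2,0) + 2 * C$1 * C$2 * m (1,1) + (C$2)\<^sup>2 * m (0,2)"
    by (simp_all add: power2_eq_square)
qed

text \<open>On each side of the reference triangle a quintic restricts to a quintic in one variable, and the
derivative of the latter at the midpoint is a fixed combination of the six Hermite data at the ends.
Hence the tangential derivatives at the midpoints are determined by the vertex data.\<close>

lemma edge_hermite:
  "bipoly (coeff_ds k) (1/2) 0 = 15/8 * (second_jet_at k 1 0 (0,0) - second_jet_at k 0 0 (0,0))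
     - 7/16 * (second_jet_at k 0 0 (1,0) + second_jet_at k 1 0 (1,0)) + 1/32 * (second_jet_at k 1 0 (2,0) - second_jet_at k 0 0 (2,0))"
  "bipoly (coeff_dt k) 0 (1/2) = 15/8 * (second_jet_at k 0 1 (0,0) - second_jet_at k 0 0 (0,0))
     - 7/16 * (second_jet_at k 0 0 (0,1) + second_jet_at k 0 1 (0,1)) + 1/32 * (second_jet_at k 0 1 (0,2) - second_jet_at k 0 0 (0,2))"
  "bipoly (coeff_dt k) (1/2) (1/2) - bipoly (coeff_ds k) (1/2) (1/2) = 15/8 * (second_jet_at k 0 1 (0,0) - second_jet_at k 1 0 (0,0))
     - 7/16 * ((second_jet_at k 1 0 (0,1) - second_jet_at k 1 0 (1,0)) + (second_jet_at k 0 1 (0,1) - second_jet_at k 0 1 (1,0)))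
     + 1/32 * ((second_jet_at k 0 1 (2,0) - 2 * second_jet_at k 0 1 (1,1) + second_jet_at k 0 1 (0,2))
             - (second_jet_at k 1 0 (2,0) - 2 * second_jet_at k 1 0 (1,1) + second_jet_at k 1 0 (0,2)))"
  unfolding second_jet_at_simps[folded One_nat_def]
  by (simp_all add: bipoly_expand power_divide numeral_2_eq_2[symmetric] add_divide_distrib diff_divide_distrib)

text \<open>All that the analysis on a cell has to know about its triangle: a length \<open>h\<close> that bounds the sides, an
area comparable to \<open>h\<^sup>2\<close>, and unit normals. For a peripheral cell the triangle is the straight one
contained in it, while \<open>h\<close> stands for the diameter of the cell itself.\<close>

definition argyris_cell ::
  "(pt set \<Rightarrow> pt set) \<Rightarrow> (pt set \<Rightarrow> pt) \<Rightarrow> pt set \<Rightarrow> pt \<Rightarrow> pt \<Rightarrow> pt \<Rightarrow> real \<Rightarrow> real \<Rightarrow> bool" where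
  "argyris_cell vert nrm K a b c h \<sigma> \<longleftrightarrow> vert K = {a, b, c} \<and> 0 < \<sigma> \<and> \<sigma> \<le> 1 \<and> 0 < h \<and>
     norm (b - a) \<le> h \<and> norm (c - a) \<le> h \<and> norm (c - b) \<le> h \<and> \<sigma> * h\<^sup>2 \<le> \<bar>cross (b - a) (c - a)\<bar> \<and>
     norm (nrm {a, b}) = 1 \<and> nrm {a, b} \<bullet> (b - a) = 0 \<and> norm (nrm {a, c}) = 1 \<and> nrm {a, c} \<bullet> (c - a) = 0 \<and>
     norm (nrm {b, c}) = 1 \<and> nrm {b, c} \<bullet> (c - b) = 0"

text \<open>The order of differentiation. Multiplying a degree of freedom by this power of the diameter makes all
of them scale alike.\<close>

fun dof_order :: "dof \<Rightarrow> nat" where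
  "dof_order (Vertex_Dof a \<alpha>) = fst \<alpha> + snd \<alpha>"
| "dof_order (Edge_Dof e) = 1"

lemma argyris_cell_distinct:
  assumes "argyris_cell vert nrm K a b c h \<sigma>"
  shows "a \<noteq> b" "a \<noteq> c" "b \<noteq> c" "cross (b - a) (c - a) \<noteq> 0"
proof -
  have "0 < \<sigma> * h\<^sup>2" using assms by (auto simp: argyris_cell_def)
  then have "0 < \<bar>cross (b - a) (c - a)\<bar>" using assms unfolding argyris_cell_def by linarith
  then show "cross (b - a) (c - a) \<noteq> 0" by simp
  then show "a \<noteq> b" "a \<noteq> c" "b \<noteq> c" by (auto simp: cross_def)
qed

lemma cell_dofs_eq:
  assumes "vert K = {a, b, c}" "a \<noteq> b" "a \<noteq> c" "b \<noteq> c"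
  shows "cell_dofs vert K = {Vertex_Dof v \<alpha> | v \<alpha>. v \<in> {a, b, c} \<and> \<alpha> \<in> mindices_upto 2} \<union>
    {Edge_Dof {a, b}, Edge_Dof {a, c}, Edge_Dof {b, c}}"
proof -
  have "edges vert K = {{a, b}, {a, c}, {b, c}}"
    using assms unfolding edges_def card_2_iff by (auto simp: insert_commute doubleton_eq_iff)
  then show ?thesis unfolding cell_dofs_def assms(1) by auto
qed

lemma finite_cell_dofs:
  assumes "finite (vert K)" shows "finite (cell_dofs vert K)"
proof -
  have "{Vertex_Dof a \<alpha> | a \<alpha>. a \<in> vert K \<and> \<alpha> \<in> mindices_upto 2} = (\<lambda>(a, \<alpha>). Vertex_Dof a \<alpha>) ` (vert K \<times> mindices_upto 2)"
    by auto
  moreover have "finite (edges vert K)"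
    using assms by (auto simp: edges_def intro: finite_subset[of _ "Pow (vert K)"])
  ultimately show ?thesis unfolding cell_dofs_def using assms by simp
qed

lemma edge_midpoint_pair: "a \<noteq> b \<Longrightarrow> edge_midpoint {a, b} = (1/2) *\<^sub>R (a + b)"
  by (simp add: edge_midpoint_def)

text \<open>A normal derivative \<open>g\<close> is split into the tangential derivative \<open>\<tau>\<close> and the transversal derivative \<open>X\<close>.
Shape regularity bounds the coefficient of the latter from below, so \<open>X\<close> is controlled by \<open>g\<close> and \<open>\<tau>\<close>.\<close>

lemma transversal_bound:
  fixes g A \<tau> T X h \<sigma> M :: real
  assumes g: "g = A * \<tau> + T * X" and T: "1 \<le> 2 * h * \<bar>T\<bar>" and A: "\<sigma> * \<bar>A\<bar> \<le> 2 * \<bar>T\<bar>"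
    and gM: "\<bar>g\<bar> * h \<le> M" and \<tau>: "\<bar>\<tau>\<bar> \<le> 9 * M" and s: "0 < \<sigma>" "\<sigma> \<le> 1" "0 < h"
  shows "\<bar>X\<bar> \<le> 20 / \<sigma> * M"
proof -
  have M: "0 \<le> M" using gM s by (meson abs_ge_zero less_imp_le mult_nonneg_nonneg order_trans)
  have Tp: "0 < \<bar>T\<bar>" using T by (cases "T = 0") auto
  have "\<bar>g\<bar> \<le> \<bar>g\<bar> * (2 * h * \<bar>T\<bar>)" using T by (simp add: mult_le_cancel_left1)
  also have "\<dots> = 2 * \<bar>T\<bar> * (\<bar>g\<bar> * h)" by simp
  also have "\<dots> \<le> 2 * \<bar>T\<bar> * M" using gM by (intro mult_left_mono) auto
  finally have 1: "\<bar>g\<bar> \<le> 2 * \<bar>T\<bar> * M" .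
  have "\<sigma> * \<bar>T * X\<bar> = \<sigma> * \<bar>g - A * \<tau>\<bar>" using g by simp
  also have "\<dots> \<le> \<sigma> * (\<bar>g\<bar> + \<bar>A\<bar> * \<bar>\<tau>\<bar>)"
    using s abs_triangle_ineq4[of g "A * \<tau>"] by (intro mult_left_mono) (auto simp: abs_mult)
  also have "\<dots> = \<sigma> * \<bar>g\<bar> + (\<sigma> * \<bar>A\<bar>) * \<bar>\<tau>\<bar>" by (simp add: algebra_simps)
  also have "\<dots> \<le> 1 * (2 * \<bar>T\<bar> * M) + (2 * \<bar>T\<bar>) * (9 * M)"
    using mult_mono[OF s(2) 1] mult_mono[OF A \<tau>] M by (intro add_mono) auto
  finally have "\<sigma> * \<bar>X\<bar> * \<bar>T\<bar> \<le> 20 * M * \<bar>T\<bar>" by (simp add: abs_mult mult_ac)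
  then have "\<sigma> * \<bar>X\<bar> \<le> 20 * M" using Tp by (simp only: mult_le_cancel_right)
  then show ?thesis using s by (simp add: field_simps)
qed

lemma abs_prod_le: "\<bar>x::real\<bar> \<le> h \<Longrightarrow> \<bar>y\<bar> * h \<le> M \<Longrightarrow> \<bar>x * y\<bar> \<le> M"
  using mult_right_mono[of "\<bar>x\<bar>" h "\<bar>y\<bar>"] by (simp add: abs_mult mult.commute)

lemma abs_prod_le2:
  assumes "\<bar>x::real\<bar> \<le> h" "\<bar>y\<bar> \<le> h" "\<bar>z\<bar> * h\<^sup>2 \<le> M" shows "\<bar>x * y * z\<bar> \<le> M"
proof -
  have "\<bar>x * y\<bar> \<le> h\<^sup>2" unfolding abs_mult power2_eq_square using assms by (intro mult_mono) auto
  then show ?thesis using assms(3) by (rule abs_prod_le)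
qed

text \<open>Vertex data are transformed to reference data by the chain rule, with factors bounded by powers of \<open>h\<close>.
At a midpoint, \<open>edge_hermite\<close> bounds the tangential derivative and \<open>transversal_bound\<close> the transversal
one. Then \<open>reference_coefficient_bound\<close> applies. On the side from \<open>b\<close> to \<open>c\<close>, where \<open>s + t = 1\<close>, the
tangential derivative is that in \<open>t\<close> minus that in \<open>s\<close>, and \<open>p + q\<close> is orthogonal to the side.\<close>

theorem argyris_coefficient_bound:
  assumes cell: "argyris_cell vert nrm K a b c h \<sigma>" and pq: "dual_coords (b - a) (c - a) p q"
    and np: "norm p = norm (c - a) / \<bar>cross (b - a) (c - a)\<bar>" "norm q = norm (b - a) / \<bar>cross (b - a) (c - a)\<bar>"
      "norm (p + q) = norm (c - b) / \<bar>cross (b - a) (c - a)\<bar>"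
    and dofs: "\<And>d. d \<in> cell_dofs vert K \<Longrightarrow> \<bar>dof_value nrm d (chart a p q k)\<bar> * h ^ dof_order d \<le> M"
    and \<alpha>: "\<alpha> \<in> mindices_upto 5"
  shows "\<bar>k \<alpha>\<bar> \<le> 2000000 / \<sigma> * M"
proof -
  let ?B = "b - a" and ?C = "c - a" and ?P = "chart a p q k"
  define D where "D = \<bar>cross ?B ?C\<bar>"
  note ne = argyris_cell_distinct[OF cell]
  have vK: "vert K = {a, b, c}" and s: "0 < \<sigma>" "\<sigma> \<le> 1" "0 < h" and n: "norm ?B \<le> h" "norm ?C \<le> h" "norm (c - b) \<le> h"
    and D: "\<sigma> * h\<^sup>2 \<le> D" using cell by (auto simp: argyris_cell_def D_def)
  have D0: "0 < D" using ne(4) by (simp add: D_def)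
  note cd = cell_dofs_eq[of vert K a b c, OF vK ne(1-3)]
  have m: "\<bar>mderiv \<alpha> ?P v\<bar> * h ^ (fst \<alpha> + snd \<alpha>) \<le> M" if "v \<in> {a, b, c}" "\<alpha> \<in> mindices_upto 2" for v \<alpha>
  proof -
    have "Vertex_Dof v \<alpha> \<in> cell_dofs vert K" using that unfolding cd by blast
    from dofs[OF this] show ?thesis by simp
  qed
  have e: "\<bar>grad ?P (edge_midpoint e) \<bullet> nrm e\<bar> * h \<le> M" if "e \<in> {{a, b}, {a, c}, {b, c}}" for e
    using dofs[of "Edge_Dof e"] that unfolding cd by auto
  have M: "0 \<le> M" using e[of "{a, b}"] s by (meson abs_ge_zero insertI1 less_imp_le mult_nonneg_nonneg order_trans)
  have Bi: "\<bar>?B$i\<bar> \<le> h" "\<bar>?C$i\<bar> \<le> h" for i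
    using n component_le_norm_cart[of ?B i] component_le_norm_cart[of ?C i] by linarith+
  have vm: "\<bar>mderiv (0,0) ?P v\<bar> \<le> M" "\<bar>mderiv (1,0) ?P v\<bar> * h \<le> M" "\<bar>mderiv (0,1) ?P v\<bar> * h \<le> M"
    "\<bar>mderiv (2,0) ?P v\<bar> * h\<^sup>2 \<le> M" "\<bar>mderiv (1,1) ?P v\<bar> * h\<^sup>2 \<le> M" "\<bar>mderiv (0,2) ?P v\<bar> * h\<^sup>2 \<le> M"
    if "v \<in> {a, b, c}" for v
    using m[OF that, of "(0,0)"] m[OF that, of "(1,0)"] m[OF that, of "(0,1)"] m[OF that, of "(2,0)"]
      m[OF that, of "(1,1)"] m[OF that, of "(0,2)"]
    by (simp_all add: mindices_upto_def power2_eq_square)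
  have jet: "\<bar>J (0,0)\<bar> \<le> M \<and> \<bar>J (1,0)\<bar> \<le> 2 * M \<and> \<bar>J (0,1)\<bar> \<le> 2 * M \<and> \<bar>J (2,0)\<bar> \<le> 4 * M \<and> \<bar>J (1,1)\<bar> \<le> 4 * M \<and> \<bar>J (0,2)\<bar> \<le> 4 * M"
    if v: "v \<in> {a, b, c}" and J: "J = second_jet_at k ((v - a) \<bullet> p) ((v - a) \<bullet> q)" for v J
  proof -
    note j = jet_of_mderivs[OF pq, where k=k and x=v and a=a, folded J]
    note t1 = abs_prod_le[OF Bi(1) vm(2)[OF v]] abs_prod_le[OF Bi(1) vm(3)[OF v]] abs_prod_le[OF Bi(2) vm(2)[OF v]] abs_prod_le[OF Bi(2) vm(3)[OF v]]
    have tr: "\<bar>x + y\<bar> \<le> 2 * M" if "\<bar>x\<bar> \<le> M" "\<bar>y\<bar> \<le> M" for x y :: real using that by linarith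
    have tr4: "\<bar>x + (y + z) + w\<bar> \<le> 4 * M" if "\<bar>x\<bar> \<le> M" "\<bar>y\<bar> \<le> M" "\<bar>z\<bar> \<le> M" "\<bar>w\<bar> \<le> M" for x y z w :: real using that by linarith
    have "J (2,0) = ?B$1 * ?B$1 * mderiv (2,0) ?P v + (?B$1 * ?B$2 * mderiv (1,1) ?P v + ?B$1 * ?B$2 * mderiv (1,1) ?P v) + ?B$2 * ?B$2 * mderiv (0,2) ?P v"
      unfolding j by (simp add: power2_eq_square algebra_simps)
    also have "\<bar>\<dots>\<bar> \<le> 4 * M" by (intro tr4 abs_prod_le2[OF Bi(1) Bi(1)] vm v)
    finally have j20: "\<bar>J (2,0)\<bar> \<le> 4 * M" .
    have "J (1,1) = ?B$1 * ?C$1 * mderiv (2,0) ?P v + (?B$1 * ?C$2 * mderiv (1,1) ?P v + ?B$2 * ?C$1 * mderiv (1,1) ?P v) + ?B$2 * ?C$2 * mderiv (0,2) ?P v"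
      unfolding j by (simp add: power2_eq_square algebra_simps)
    also have "\<bar>\<dots>\<bar> \<le> 4 * M" by (intro tr4 abs_prod_le2[OF Bi(1) Bi(2)] vm v)
    finally have j11: "\<bar>J (1,1)\<bar> \<le> 4 * M" .
    have "J (0,2) = ?C$1 * ?C$1 * mderiv (2,0) ?P v + (?C$1 * ?C$2 * mderiv (1,1) ?P v + ?C$1 * ?C$2 * mderiv (1,1) ?P v) + ?C$2 * ?C$2 * mderiv (0,2) ?P v"
      unfolding j by (simp add: power2_eq_square algebra_simps)
    also have "\<bar>\<dots>\<bar> \<le> 4 * M" by (intro tr4 abs_prod_le2[OF Bi(2) Bi(2)] vm v)
    finally have j02: "\<bar>J (0,2)\<bar> \<le> 4 * M" .
    show ?thesis
      using j20 j11 j02 vm(1)[OF v] tr[OF t1(1) t1(2), of 1 2] tr[OF t1(3) t1(4), of 1 2] unfolding j(1-3) by blast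
  qed
  have pt: "(a - a) \<bullet> p = 0" "(a - a) \<bullet> q = 0" "(b - a) \<bullet> p = 1" "(b - a) \<bullet> q = 0" "(c - a) \<bullet> p = 0" "(c - a) \<bullet> q = 1"
    using pq by (auto simp: dual_coords_def)
  note j0 = jet[of a, unfolded pt, OF _ refl, simplified] and j1 = jet[of b, unfolded pt, OF _ refl, simplified]
    and j2 = jet[of c, unfolded pt, OF _ refl, simplified]
  \<comment> \<open>the weights of \<open>edge_hermite\<close>: \<open>(60 + 60 + 4 * 14 + 4 * 14 + 16 + 16) / 32 \<le> 9\<close>\<close>
  have lin6: "\<bar>15/8 * (x1 - x0) - 7/16 * (y0 + y1) + 1/32 * (z1 - z0)\<bar> \<le> 9 * M"
    if "\<bar>x0\<bar> \<le> M" "\<bar>x1\<bar> \<le> M" "\<bar>y0\<bar> \<le> 4 * M" "\<bar>y1\<bar> \<le> 4 * M" "\<bar>z0\<bar> \<le> 16 * M" "\<bar>z1\<bar> \<le> 16 * M" for x0 x1 y0 y1 z0 z1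
  proof -
    have eq: "15/8 * (x1 - x0) - 7/16 * (y0 + y1) + 1/32 * (z1 - z0) = (60 * x1 - 60 * x0 - 14 * y0 - 14 * y1 + z1 - z0) / 32"
      by (simp add: field_simps)
    have n: "\<bar>60 * x1 - 60 * x0 - 14 * y0 - 14 * y1 + z1 - z0\<bar> \<le> 288 * M"
      using that[THEN abs_le_D1] that[THEN abs_le_D2] by - (rule abs_leI; linarith)
    show ?thesis unfolding eq abs_divide using n by simp
  qed
  have t1: "\<bar>bipoly (coeff_ds k) (1/2) 0\<bar> \<le> 9 * M" unfolding edge_hermite
    using j0 j1 M by (intro lin6) auto
  have t2: "\<bar>bipoly (coeff_dt k) 0 (1/2)\<bar> \<le> 9 * M" unfolding edge_hermite
    using j0 j2 M by (intro lin6) auto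
  have d2: "\<bar>x - y\<bar> \<le> 4 * M" if "\<bar>x\<bar> \<le> 2 * M" "\<bar>y\<bar> \<le> 2 * M" for x y :: real using that by linarith
  have d3: "\<bar>x - 2 * y + z\<bar> \<le> 16 * M" if "\<bar>x\<bar> \<le> 4 * M" "\<bar>y\<bar> \<le> 4 * M" "\<bar>z\<bar> \<le> 4 * M" for x y z :: real using that by linarith
  have t3: "\<bar>bipoly (coeff_dt k) (1/2) (1/2) - bipoly (coeff_ds k) (1/2) (1/2)\<bar> \<le> 9 * M" unfolding edge_hermite
    using j1 j2 by (intro lin6 d2 d3) auto
  have nr: "norm (nrm {a, b}) = 1" "nrm {a, b} \<bullet> ?B = 0" "norm (nrm {a, c}) = 1" "nrm {a, c} \<bullet> ?C = 0"
     "norm (nrm {b, c}) = 1" "nrm {b, c} \<bullet> (c - b) = 0" using cell by (auto simp: argyris_cell_def)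
  have cb: "\<bar>cross ?B (c - b)\<bar> = D" by (simp add: D_def cross_def algebra_simps)
  have DBC: "D \<le> norm ?B * norm ?C" "D \<le> norm ?B * norm (c - b)"
    using abs_cross_le[of ?B ?C] abs_cross_le[of ?B "c - b"] cb by (auto simp: D_def)
  have lower: "\<sigma> * h \<le> x" if "D \<le> y * x" "y \<le> h" "0 \<le> x" for x y
  proof -
    have "y * x \<le> h * x" using that by (intro mult_right_mono)
    then have "\<sigma> * h * h \<le> x * h" using D that by (simp add: power2_eq_square mult_ac)
    then show ?thesis using s by simp
  qed
  have lo: "\<sigma> * h \<le> norm ?B" "\<sigma> * h \<le> norm ?C" "\<sigma> * h \<le> norm (c - b)"
    using lower[of "norm ?C" "norm ?B"] lower[of "norm ?B" "norm ?C"] lower[of "norm ?B" "norm (c - b)"] DBC n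
    by (auto simp: mult.commute)
  have ip: "\<bar>x \<bullet> nn\<bar> \<le> norm x" if "norm nn = 1" for x nn :: pt
    using Cauchy_Schwarz_ineq2[of x nn] that by simp
  have q1: "\<bar>q \<bullet> nrm {a, b}\<bar> = norm ?B / D"
    using abs_inner_unit_normal[OF nr(1,2), of q] pq ne np(2) by (auto simp: dual_coords_def inner_commute D_def)
  have p2: "\<bar>p \<bullet> nrm {a, c}\<bar> = norm ?C / D"
    using abs_inner_unit_normal[OF nr(3,4), of p] pq ne np(1) by (auto simp: dual_coords_def inner_commute D_def)
  have "(p + q) \<bullet> (c - b) = (c - a) \<bullet> p - (b - a) \<bullet> p + ((c - a) \<bullet> q - (b - a) \<bullet> q)"
    by (simp add: inner_commute inner_diff_left inner_diff_right inner_add_left inner_add_right algebra_simps)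
  then have "(p + q) \<bullet> (c - b) = 0" using pt by simp
  then have pq3: "\<bar>(p + q) \<bullet> nrm {b, c}\<bar> = norm (c - b) / D"
    using abs_inner_unit_normal[OF nr(5,6), of "p + q"] ne np(3) by (auto simp: D_def)
  have e1: "\<bar>bipoly (coeff_dt k) (1/2) 0\<bar> \<le> 20 / \<sigma> * M"
  proof (rule transversal_bound[OF _ _ _ _ t1 s])
    show "grad ?P (edge_midpoint {a, b}) \<bullet> nrm {a, b} = (p \<bullet> nrm {a, b}) * bipoly (coeff_ds k) (1/2) 0 + (q \<bullet> nrm {a, b}) * bipoly (coeff_dt k) (1/2) 0"
      unfolding grad_chart edge_midpoint_pair[OF ne(1)] chart_at[OF pq] ..
    have "D \<le> norm ?B * h" using DBC(1) n(2) by (meson mult_left_mono norm_ge_zero order_trans)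
    then show "1 \<le> 2 * h * \<bar>q \<bullet> nrm {a, b}\<bar>" unfolding q1 using D0 by (simp add: field_simps)
    have "\<sigma> * \<bar>p \<bullet> nrm {a, b}\<bar> \<le> \<sigma> * (norm ?C / D)" using mult_left_mono[OF ip[OF nr(1), of p], of \<sigma>] s np(1) by (simp add: D_def)
    also have "\<dots> \<le> \<sigma> * h / D" using n D0 s by (simp add: divide_right_mono)
    also have "\<dots> \<le> norm ?B / D" using lo D0 by (simp add: divide_right_mono)
    finally show "\<sigma> * \<bar>p \<bullet> nrm {a, b}\<bar> \<le> 2 * \<bar>q \<bullet> nrm {a, b}\<bar>" unfolding q1 using divide_nonneg_pos[OF norm_ge_zero[of ?B] D0] by linarith
    show "\<bar>grad ?P (edge_midpoint {a, b}) \<bullet> nrm {a, b}\<bar> * h \<le> M" using e by blast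
  qed
  have e2: "\<bar>bipoly (coeff_ds k) 0 (1/2)\<bar> \<le> 20 / \<sigma> * M"
  proof (rule transversal_bound[OF _ _ _ _ t2 s])
    show "grad ?P (edge_midpoint {a, c}) \<bullet> nrm {a, c} = (q \<bullet> nrm {a, c}) * bipoly (coeff_dt k) 0 (1/2) + (p \<bullet> nrm {a, c}) * bipoly (coeff_ds k) 0 (1/2)"
      unfolding grad_chart edge_midpoint_pair[OF ne(2)] chart_at[OF pq] by simp
    have "D \<le> h * norm ?C" using DBC(1) n(1) by (meson mult_right_mono norm_ge_zero order_trans)
    then show "1 \<le> 2 * h * \<bar>p \<bullet> nrm {a, c}\<bar>" unfolding p2 using D0 by (simp add: field_simps)
    have "\<sigma> * \<bar>q \<bullet> nrm {a, c}\<bar> \<le> \<sigma> * (norm ?B / D)" using mult_left_mono[OF ip[OF nr(3), of q], of \<sigma>] s np(2) by (simp add: D_def)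
    also have "\<dots> \<le> \<sigma> * h / D" using n D0 s by (simp add: divide_right_mono)
    also have "\<dots> \<le> norm ?C / D" using lo D0 by (simp add: divide_right_mono)
    finally show "\<sigma> * \<bar>q \<bullet> nrm {a, c}\<bar> \<le> 2 * \<bar>p \<bullet> nrm {a, c}\<bar>" unfolding p2 using divide_nonneg_pos[OF norm_ge_zero[of ?C] D0] by linarith
    show "\<bar>grad ?P (edge_midpoint {a, c}) \<bullet> nrm {a, c}\<bar> * h \<le> M" using e by blast
  qed
  have e3: "\<bar>bipoly (coeff_ds k) (1/2) (1/2) + bipoly (coeff_dt k) (1/2) (1/2)\<bar> \<le> 20 / \<sigma> * M"
  proof (rule transversal_bound[OF _ _ _ _ t3 s])
    let ?n = "nrm {b, c}"
    show "grad ?P (edge_midpoint {b, c}) \<bullet> ?n = ((q - p) \<bullet> ?n / 2) * (bipoly (coeff_dt k) (1/2) (1/2) - bipoly (coeff_ds k) (1/2) (1/2))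
       + ((p + q) \<bullet> ?n / 2) * (bipoly (coeff_ds k) (1/2) (1/2) + bipoly (coeff_dt k) (1/2) (1/2))"
      unfolding grad_chart edge_midpoint_pair[OF ne(3)] chart_at[OF pq]
      by (simp add: inner_diff_left inner_add_left field_simps)
    have "D \<le> h * norm (c - b)" using DBC(2) n(1) by (meson mult_right_mono norm_ge_zero order_trans)
    then show "1 \<le> 2 * h * \<bar>(p + q) \<bullet> ?n / 2\<bar>" unfolding abs_divide pq3 using D0 by (simp add: field_simps)
    have "\<bar>(q - p) \<bullet> ?n\<bar> \<le> norm q + norm p" using ip[OF nr(5), of "q - p"] norm_triangle_ineq4[of q p] by linarith
    also have "\<dots> \<le> h / D + h / D" unfolding np D_def[symmetric] using n D0 by (intro add_mono divide_right_mono) auto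
    finally have "\<sigma> * \<bar>(q - p) \<bullet> ?n\<bar> \<le> \<sigma> * (h / D + h / D)" using s by (intro mult_left_mono) auto
    also have "\<dots> = 2 * (\<sigma> * h / D)" by (simp add: algebra_simps)
    also have "\<dots> \<le> 2 * (norm (c - b) / D)" using lo D0 by (intro mult_left_mono divide_right_mono) auto
    finally show "\<sigma> * \<bar>(q - p) \<bullet> ?n / 2\<bar> \<le> 2 * \<bar>(p + q) \<bullet> ?n / 2\<bar>" unfolding abs_divide pq3 by (simp add: mult.commute)
    show "\<bar>grad ?P (edge_midpoint {b, c}) \<bullet> ?n\<bar> * h \<le> M" using e by blast
  qed
  have all: "\<bar>J \<beta>\<bar> \<le> 4 * M"
    if "\<bar>J (0,0)\<bar> \<le> M \<and> \<bar>J (1,0)\<bar> \<le> 2 * M \<and> \<bar>J (0,1)\<bar> \<le> 2 * M \<and> \<bar>J (2,0)\<bar> \<le> 4 * M \<and> \<bar>J (1,1)\<bar> \<le> 4 * M \<and> \<bar>J (0,2)\<bar> \<le> 4 * M"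
      "\<beta> \<in> mindices_upto 2" for J :: "mindex \<Rightarrow> real" and \<beta>
    using that(2) unfolding mindices_upto_2
    by (elim insertE emptyE; hypsubst; use that(1) M in linarith)
  have sM: "4 * M \<le> 20 / \<sigma> * M"
    using s M by (intro mult_right_mono) (auto simp: field_simps)
  have "\<bar>k \<alpha>\<bar> \<le> 100000 * (20 / \<sigma> * M)"
  proof (rule reference_coefficient_bound[OF _ e1 e2 e3 \<alpha>])
    fix \<beta> s t assume \<beta>: "\<beta> \<in> mindices_upto 2" and "(s, t) \<in> {(0::real, 0::real), (1, 0), (0, 1)}"
    then consider "s = 0" "t = 0" | "s = 1" "t = 0" | "s = 0" "t = 1" by auto
    then have "\<bar>second_jet_at k s t \<beta>\<bar> \<le> 4 * M"
    proof cases
      case 1 show ?thesis unfolding 1 by (rule all[OF _ \<beta>]) (use j0 in simp)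
    next
      case 2 show ?thesis unfolding 2 by (rule all[OF _ \<beta>]) (use j1 in simp)
    next
      case 3 show ?thesis unfolding 3 by (rule all[OF _ \<beta>]) (use j2 in simp)
    qed
    then show "\<bar>second_jet_at k s t \<beta>\<bar> \<le> 20 / \<sigma> * M" using sM by linarith
  qed
  then show ?thesis by simp
qed

lemma coeff_partial_bound:
  assumes k: "\<And>\<alpha>. \<alpha> \<in> mindices_upto 5 \<Longrightarrow> \<bar>k \<alpha>\<bar> \<le> K" and r: "\<bar>p$i\<bar> \<le> r" "\<bar>q$i\<bar> \<le> r" and \<alpha>: "\<alpha> \<in> mindices_upto 5"
  shows "\<bar>coeff_partial p q i k \<alpha>\<bar> \<le> 10 * r * K"
proof -
  have K: "0 \<le> K" using k[OF \<alpha>] by linarith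
  have st: "\<bar>coeff_ds k \<alpha>\<bar> \<le> 5 * K" "\<bar>coeff_dt k \<alpha>\<bar> \<le> 5 * K"
    using K k[of "(fst \<alpha> + 1, snd \<alpha>)"] k[of "(fst \<alpha>, snd \<alpha> + 1)"]
    by (auto simp: coeff_ds_def coeff_dt_def mindices_upto_def abs_mult intro!: mult_mono)
  have "\<bar>coeff_partial p q i k \<alpha>\<bar> \<le> \<bar>p$i\<bar> * \<bar>coeff_ds k \<alpha>\<bar> + \<bar>q$i\<bar> * \<bar>coeff_dt k \<alpha>\<bar>"
    unfolding coeff_partial_def abs_mult[symmetric] by (rule abs_triangle_ineq)
  also have "\<dots> \<le> r * (5 * K) + r * (5 * K)"
    using r st by (intro add_mono mult_mono) auto
  finally show ?thesis by (simp add: mult_ac)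
qed

lemma coeff_partials_bound:
  assumes k: "\<And>\<alpha>. \<alpha> \<in> mindices_upto 5 \<Longrightarrow> \<bar>k \<alpha>\<bar> \<le> K" and r: "norm p \<le> r" "norm q \<le> r" and \<alpha>: "\<alpha> \<in> mindices_upto 5"
  shows "\<bar>((coeff_partial p q 1 ^^ i) ((coeff_partial p q 2 ^^ j) k)) \<alpha>\<bar> \<le> (10 * r) ^ (i + j) * K"
proof -
  have pw: "\<bar>((coeff_partial p q l ^^ n) k') \<alpha>\<bar> \<le> (10 * r) ^ n * K'"
    if "\<And>\<alpha>. \<alpha> \<in> mindices_upto 5 \<Longrightarrow> \<bar>k' \<alpha>\<bar> \<le> K'" "\<alpha> \<in> mindices_upto 5" for l n k' K' \<alpha>
    using that(2)
  proof (induction n arbitrary: \<alpha>)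
    case 0 then show ?case using that(1) by simp
  next
    case (Suc n)
    have "\<bar>coeff_partial p q l ((coeff_partial p q l ^^ n) k') \<alpha>\<bar> \<le> 10 * r * ((10 * r) ^ n * K')"
      using r component_le_norm_cart[of p l] component_le_norm_cart[of q l]
      by (intro coeff_partial_bound Suc) auto
    then show ?case by (simp add: mult_ac)
  qed
  show ?thesis using pw[OF pw[OF k, where l=2 and n=j] \<alpha>, where l=1 and n=i] by (simp add: power_add mult_ac)
qed

lemma bipoly_bound:
  assumes k: "\<And>\<alpha>. \<alpha> \<in> mindices_upto 5 \<Longrightarrow> \<bar>k \<alpha>\<bar> \<le> K" and R: "\<bar>s\<bar> \<le> R" "\<bar>t\<bar> \<le> R" "1 \<le> R"
  shows "\<bar>bipoly k s t\<bar> \<le> 21 * R ^ 5 * K"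
proof -
  have "\<bar>bipoly k s t\<bar> \<le> (\<Sum>\<alpha>\<in>mindices_upto 5. \<bar>k \<alpha> * s ^ fst \<alpha> * t ^ snd \<alpha>\<bar>)"
    unfolding bipoly_def by (rule sum_abs)
  also have "\<dots> \<le> (\<Sum>\<alpha>\<in>mindices_upto 5. K * R ^ 5)"
  proof (rule sum_mono)
    fix \<alpha> assume \<alpha>: "\<alpha> \<in> mindices_upto 5"
    have "\<bar>s\<bar> ^ fst \<alpha> * \<bar>t\<bar> ^ snd \<alpha> \<le> R ^ fst \<alpha> * R ^ snd \<alpha>"
      using R by (intro mult_mono power_mono) auto
    also have "\<dots> \<le> R ^ 5" using \<alpha> R unfolding power_add[symmetric] by (intro power_increasing) (auto simp: mindices_upto_def)
    finally have "\<bar>k \<alpha>\<bar> * (\<bar>s\<bar> ^ fst \<alpha> * \<bar>t\<bar> ^ snd \<alpha>) \<le> K * R ^ 5"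
      using k[OF \<alpha>] by (intro mult_mono) auto
    then show "\<bar>k \<alpha> * s ^ fst \<alpha> * t ^ snd \<alpha>\<bar> \<le> K * R ^ 5" by (simp add: abs_mult power_abs mult.assoc)
  qed
  also have "\<dots> = 21 * R ^ 5 * K" unfolding sum_mindices_upto_5 by simp
  finally show ?thesis .
qed

definition argyris_const :: "real \<Rightarrow> real" where
  "argyris_const \<sigma> = 21 * (1 / \<sigma>) ^ 5 * (10 / \<sigma>) ^ 6 * (2000000 / \<sigma>)"

lemma argyris_dual_coords:
  assumes cell: "argyris_cell vert nrm K a b c h \<sigma>"
  obtains p q where "dual_coords (b - a) (c - a) p q" "norm p = norm (c - a) / \<bar>cross (b - a) (c - a)\<bar>"
    "norm q = norm (b - a) / \<bar>cross (b - a) (c - a)\<bar>" "norm (p + q) = norm (c - b) / \<bar>cross (b - a) (c - a)\<bar>"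
    "norm p \<le> 1 / (\<sigma> * h)" "norm q \<le> 1 / (\<sigma> * h)"
proof -
  obtain p q where pq: "dual_coords (b - a) (c - a) p q" "norm p = norm (c - a) / \<bar>cross (b - a) (c - a)\<bar>"
    "norm q = norm (b - a) / \<bar>cross (b - a) (c - a)\<bar>" "norm (p + q) = norm (c - a - (b - a)) / \<bar>cross (b - a) (c - a)\<bar>"
    using dual_coords_exist[OF argyris_cell_distinct(4)[OF cell]] by blast
  have s: "0 < \<sigma>" "0 < h" "norm (b - a) \<le> h" "norm (c - a) \<le> h" "\<sigma> * h\<^sup>2 \<le> \<bar>cross (b - a) (c - a)\<bar>"
    using cell by (auto simp: argyris_cell_def)
  have "x / \<bar>cross (b - a) (c - a)\<bar> \<le> 1 / (\<sigma> * h)" if "0 \<le> x" "x \<le> h" for x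
  proof -
    have "x / \<bar>cross (b - a) (c - a)\<bar> \<le> h / (\<sigma> * h\<^sup>2)" using that s by (intro frac_le) auto
    also have "\<dots> = 1 / (\<sigma> * h)" using s by (simp add: field_simps power2_eq_square)
    finally show ?thesis .
  qed
  then have "norm p \<le> 1 / (\<sigma> * h)" "norm q \<le> 1 / (\<sigma> * h)" using s unfolding pq by simp_all
  then show thesis using that[OF pq(1-3)] pq(4) by simp
qed

text \<open>Each derivative costs a factor \<open>norm p\<close> or \<open>norm q\<close>, hence \<open>1 / (\<sigma> * h)\<close>; the powers of \<open>h\<close> cancel.
Points at distance at most \<open>h\<close> from \<open>a\<close> have affine coordinates bounded by \<open>1 / \<sigma>\<close>, which covers a curved
cell that reaches beyond its triangle.\<close>

theorem argyris_estimate: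
  assumes cell: "argyris_cell vert nrm K a b c h \<sigma>" and P: "P \<in> polys 5"
    and dofs: "\<And>d. d \<in> cell_dofs vert K \<Longrightarrow> \<bar>dof_value nrm d P\<bar> * h ^ dof_order d \<le> M"
    and x: "norm (x - a) \<le> h" and \<alpha>: "fst \<alpha> + snd \<alpha> \<le> 6"
  shows "\<bar>mderiv \<alpha> P x\<bar> * h ^ (fst \<alpha> + snd \<alpha>) \<le> argyris_const \<sigma> * M"
proof -
  obtain p q where pq: "dual_coords (b - a) (c - a) p q" "norm p = norm (c - a) / \<bar>cross (b - a) (c - a)\<bar>"
    "norm q = norm (b - a) / \<bar>cross (b - a) (c - a)\<bar>" "norm (p + q) = norm (c - b) / \<bar>cross (b - a) (c - a)\<bar>"
    and r: "norm p \<le> 1 / (\<sigma> * h)" "norm q \<le> 1 / (\<sigma> * h)"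
    using argyris_dual_coords[OF cell] by blast
  obtain k where k: "P = chart a p q k" using P unfolding polys_5_eq_range_chart[OF pq(1), of a] by blast
  have s: "0 < \<sigma>" "\<sigma> \<le> 1" "0 < h" using cell by (auto simp: argyris_cell_def)
  have kb: "\<bar>k \<beta>\<bar> \<le> 2000000 / \<sigma> * M" if "\<beta> \<in> mindices_upto 5" for \<beta>
    by (rule argyris_coefficient_bound[OF cell pq dofs[unfolded k] that])
  have M: "0 \<le> 2000000 / \<sigma> * M" using kb[of "(0,0)"] by (simp add: mindices_upto_def)
  let ?l = "fst \<alpha> + snd \<alpha>"
  have st: "\<bar>(x - a) \<bullet> y\<bar> \<le> 1 / \<sigma>" if "norm y \<le> 1 / (\<sigma> * h)" for y
  proof -
    have "\<bar>(x - a) \<bullet> y\<bar> \<le> norm (x - a) * norm y" by (rule Cauchy_Schwarz_ineq2)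
    also have "\<dots> \<le> h * (1 / (\<sigma> * h))" using x that s by (intro mult_mono) auto
    finally show ?thesis using s by simp
  qed
  have "\<bar>mderiv \<alpha> P x\<bar> \<le> 21 * (1 / \<sigma>) ^ 5 * ((10 * (1 / (\<sigma> * h))) ^ ?l * (2000000 / \<sigma> * M))"
    unfolding k mderiv_chart chart_def
    by (rule bipoly_bound[OF coeff_partials_bound[OF kb r] st[OF r(1)] st[OF r(2)]]) (use s in auto)
  then have "\<bar>mderiv \<alpha> P x\<bar> * h ^ ?l \<le> 21 * (1 / \<sigma>) ^ 5 * ((10 * (1 / (\<sigma> * h))) ^ ?l * (2000000 / \<sigma> * M)) * h ^ ?l"
    using s by (intro mult_right_mono) auto
  also have "\<dots> = 21 * (1 / \<sigma>) ^ 5 * ((10 * (1 / (\<sigma> * h)) * h) ^ ?l * (2000000 / \<sigma> * M))"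
    by (simp only: power_mult_distrib mult_ac)
  also have "10 * (1 / (\<sigma> * h)) * h = 10 / \<sigma>" using s by simp
  also have "21 * (1 / \<sigma>) ^ 5 * ((10 / \<sigma>) ^ ?l * (2000000 / \<sigma> * M)) \<le> 21 * (1 / \<sigma>) ^ 5 * ((10 / \<sigma>) ^ 6 * (2000000 / \<sigma> * M))"
    using s \<alpha> M by (intro mult_left_mono mult_right_mono power_increasing) auto
  finally show ?thesis by (simp add: argyris_const_def mult_ac)
qed

lemma smooth_polys: "P \<in> polys 5 \<Longrightarrow> smooth P"
proof -
  have "dual_coords (axis 1 1) (axis 2 1) (axis 1 1) (axis 2 1)"
    by (simp add: dual_coords_def inner_pt axis_def)
  from polys_5_eq_range_chart[OF this, of 0] show "P \<in> polys 5 \<Longrightarrow> smooth P" using smooth_chart by auto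
qed

lemma polys_linear:
  assumes "P \<in> polys m" "Q \<in> polys m" shows "(\<lambda>x. k * P x + l * Q x) \<in> polys m"
  using assms unfolding polys_eq_coord_polys by (intro coord_polys_add coord_polys_cmult)

lemma polys_sum:
  assumes "finite I" "\<And>i. i \<in> I \<Longrightarrow> f i \<in> polys m" shows "(\<lambda>x. \<Sum>i\<in>I. k i * f i x) \<in> polys m"
  using assms unfolding polys_eq_coord_polys by (intro coord_polys_sum coord_polys_cmult) auto

lemma partial_linear:
  assumes "smooth f" "smooth g"
  shows "partial i (\<lambda>x. k * f x + l * g x) = (\<lambda>x. k * partial i f x + l * partial i g x)"
proof
  fix x
  have "(\<lambda>x. k * f x) differentiable (at x)" "(\<lambda>x. l * g x) differentiable (at x)"
    using assms smooth_differentiable by auto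
  then show "partial i (\<lambda>x. k * f x + l * g x) x = k * partial i f x + l * partial i g x"
    using assms smooth_differentiable by (simp add: partial_add partial_cmult)
qed

lemma mderiv_linear:
  assumes "smooth f" "smooth g"
  shows "mderiv \<alpha> (\<lambda>x. k * f x + l * g x) = (\<lambda>x. k * mderiv \<alpha> f x + l * mderiv \<alpha> g x)"
proof -
  have *: "(partial i ^^ n) (\<lambda>x. k * f x + l * g x) = (\<lambda>x. k * (partial i ^^ n) f x + l * (partial i ^^ n) g x)"
    if "smooth f" "smooth g" for f g i n
    using that by (induction n) (auto simp: partial_linear smooth_funpow_partial)
  show ?thesis unfolding mderiv_def using assms by (simp add: * smooth_funpow_partial)
qed

lemma dof_value_linear:
  assumes "smooth f" "smooth g"
  shows "dof_value nrm d (\<lambda>x. k * f x + l * g x) = k * dof_value nrm d f + l * dof_value nrm d g"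
proof (cases d)
  case (Vertex_Dof a \<alpha>) then show ?thesis using mderiv_linear[OF assms] by simp
next
  case (Edge_Dof e) then show ?thesis
    by (simp add: grad_def inner_pt partial_linear[OF assms] algebra_simps)
qed

lemma dof_value_sum:
  assumes "finite I" "\<And>i. i \<in> I \<Longrightarrow> smooth (f i)"
  shows "dof_value nrm d (\<lambda>x. \<Sum>i\<in>I. k i * f i x) = (\<Sum>i\<in>I. k i * dof_value nrm d (f i)) \<and> smooth (\<lambda>x. \<Sum>i\<in>I. k i * f i x)"
  using assms
proof (induction I rule: finite_induct)
  case empty
  have "dof_value nrm d (\<lambda>x. 0 * 0 + 0 * 0) = 0" by (subst dof_value_linear) (auto intro: smooth_const)
  then show ?case using smooth_const by simp
next
  case (insert i I)
  then show ?case
    using dof_value_linear[of "f i" "\<lambda>x. \<Sum>i\<in>I. k i * f i x" nrm d "k i" 1]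
      smooth_add[OF smooth_mult[OF smooth_const[of "k i"]], of "f i" "\<lambda>x. \<Sum>i\<in>I. k i * f i x"] by simp
qed

text \<open>Vanishing degrees of freedom allow the bound \<open>0\<close> in \<open>argyris_coefficient_bound\<close>.\<close>

theorem argyris_unique:
  assumes cell: "argyris_cell vert nrm K a b c h \<sigma>" and PQ: "P \<in> polys 5" "Q \<in> polys 5"
    and eq: "\<And>d. d \<in> cell_dofs vert K \<Longrightarrow> dof_value nrm d P = dof_value nrm d Q"
  shows "P = Q"
proof -
  obtain p q where pq: "dual_coords (b - a) (c - a) p q" "norm p = norm (c - a) / \<bar>cross (b - a) (c - a)\<bar>"
    "norm q = norm (b - a) / \<bar>cross (b - a) (c - a)\<bar>" "norm (p + q) = norm (c - b) / \<bar>cross (b - a) (c - a)\<bar>"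
    using argyris_dual_coords[OF cell] by blast
  have "(\<lambda>x. 1 * P x + (-1) * Q x) \<in> polys 5" by (rule polys_linear[OF PQ])
  then obtain k where k: "(\<lambda>x. 1 * P x + (-1) * Q x) = chart a p q k"
    unfolding polys_5_eq_range_chart[OF pq(1), of a] by blast
  have "\<bar>dof_value nrm d (chart a p q k)\<bar> * h ^ dof_order d \<le> 0" if "d \<in> cell_dofs vert K" for d
    unfolding k[symmetric] dof_value_linear[OF PQ[THEN smooth_polys]] using eq[OF that] by simp
  then have "\<bar>k \<alpha>\<bar> \<le> 2000000 / \<sigma> * 0" if "\<alpha> \<in> mindices_upto 5" for \<alpha>
    by (rule argyris_coefficient_bound[OF cell pq _ that])
  then have "chart a p q k = (\<lambda>x. 0)" by (simp add: chart_def[abs_def] bipoly_def)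
  then have "1 * P x + (-1) * Q x = 0" for x using k by metis
  then show ?thesis by (simp add: fun_eq_iff)
qed

text \<open>The prescribed data are transformed to reference data, where \<open>reference_interpolation_exists\<close> applies:
the vertex data by the inverse chain rule, and the normal derivatives by subtracting the tangential
parts, which \<open>edge_hermite\<close> computes beforehand from the vertex data.\<close>

theorem argyris_exists:
  assumes cell: "argyris_cell vert nrm K a b c h \<sigma>"
  obtains P where "P \<in> polys 5" "\<And>d. d \<in> cell_dofs vert K \<Longrightarrow> dof_value nrm d P = D d"
proof -
  let ?B = "b - a" and ?C = "c - a"
  obtain p q where pq: "dual_coords ?B ?C p q" and np: "norm p = norm ?C / \<bar>cross ?B ?C\<bar>"
    "norm q = norm ?B / \<bar>cross ?B ?C\<bar>" "norm (p + q) = norm (c - b) / \<bar>cross ?B ?C\<bar>"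
    using argyris_dual_coords[OF cell] by blast
  note ne = argyris_cell_distinct[OF cell]
  have vK: "vert K = {a, b, c}" using cell by (auto simp: argyris_cell_def)
  define W where "W v = (\<lambda>\<alpha>::mindex.
     if \<alpha> = (0,0) then D (Vertex_Dof v (0,0)) else
     if \<alpha> = (1,0) then ?B$1 * D (Vertex_Dof v (1,0)) + ?B$2 * D (Vertex_Dof v (0,1)) else
     if \<alpha> = (0,1) then ?C$1 * D (Vertex_Dof v (1,0)) + ?C$2 * D (Vertex_Dof v (0,1)) else
     if \<alpha> = (2,0) then ?B$1 * ?B$1 * D (Vertex_Dof v (2,0)) + (?B$1 * ?B$2 + ?B$2 * ?B$1) * D (Vertex_Dof v (1,1)) + ?B$2 * ?B$2 * D (Vertex_Dof v (0,2)) else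
     if \<alpha> = (1,1) then ?B$1 * ?C$1 * D (Vertex_Dof v (2,0)) + (?B$1 * ?C$2 + ?B$2 * ?C$1) * D (Vertex_Dof v (1,1)) + ?B$2 * ?C$2 * D (Vertex_Dof v (0,2)) else
     ?C$1 * ?C$1 * D (Vertex_Dof v (2,0)) + (?C$1 * ?C$2 + ?C$2 * ?C$1) * D (Vertex_Dof v (1,1)) + ?C$2 * ?C$2 * D (Vertex_Dof v (0,2)))" for v
  have W: "W v (0,0) = D (Vertex_Dof v (0,0))"
    "W v (1,0) = ?B$1 * D (Vertex_Dof v (1,0)) + ?B$2 * D (Vertex_Dof v (0,1))"
    "W v (0,1) = ?C$1 * D (Vertex_Dof v (1,0)) + ?C$2 * D (Vertex_Dof v (0,1))"
    "W v (2,0) = ?B$1 * ?B$1 * D (Vertex_Dof v (2,0)) + (?B$1 * ?B$2 + ?B$2 * ?B$1) * D (Vertex_Dof v (1,1)) + ?B$2 * ?B$2 * D (Vertex_Dof v (0,2))"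
    "W v (1,1) = ?B$1 * ?C$1 * D (Vertex_Dof v (2,0)) + (?B$1 * ?C$2 + ?B$2 * ?C$1) * D (Vertex_Dof v (1,1)) + ?B$2 * ?C$2 * D (Vertex_Dof v (0,2))"
    "W v (0,2) = ?C$1 * ?C$1 * D (Vertex_Dof v (2,0)) + (?C$1 * ?C$2 + ?C$2 * ?C$1) * D (Vertex_Dof v (1,1)) + ?C$2 * ?C$2 * D (Vertex_Dof v (0,2))" for v
    by (simp_all add: W_def)
  \<comment> \<open>the tangential derivatives at the three midpoints that the vertex data enforce\<close>
  define h1 where "h1 = 15/8 * (W b (0,0) - W a (0,0)) - 7/16 * (W a (1,0) + W b (1,0)) + 1/32 * (W b (2,0) - W a (2,0))"
  define h2 where "h2 = 15/8 * (W c (0,0) - W a (0,0)) - 7/16 * (W a (0,1) + W c (0,1)) + 1/32 * (W c (0,2) - W a (0,2))"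
  define h3 where "h3 = 15/8 * (W c (0,0) - W b (0,0)) - 7/16 * ((W b (0,1) - W b (1,0)) + (W c (0,1) - W c (1,0)))
     + 1/32 * ((W c (2,0) - 2 * W c (1,1) + W c (0,2)) - (W b (2,0) - 2 * W b (1,1) + W b (0,2)))"
  let ?n1 = "nrm {a, b}" and ?n2 = "nrm {a, c}" and ?n3 = "nrm {b, c}"
  \<comment> \<open>division by zero does not occur: the denominators are inner products of parallel nonzero vectors\<close>
  define E1 where "E1 = (D (Edge_Dof {a, b}) - (p \<bullet> ?n1) * h1) / (q \<bullet> ?n1)"
  define E2 where "E2 = (D (Edge_Dof {a, c}) - (q \<bullet> ?n2) * h2) / (p \<bullet> ?n2)"
  define E3 where "E3 = (2 * D (Edge_Dof {b, c}) - ((q - p) \<bullet> ?n3) * h3) / ((p + q) \<bullet> ?n3)"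
  obtain k where k: "\<And>\<alpha>. \<alpha> \<in> mindices_upto 2 \<Longrightarrow> second_jet_at k 0 0 \<alpha> = W a \<alpha>"
    "\<And>\<alpha>. \<alpha> \<in> mindices_upto 2 \<Longrightarrow> second_jet_at k 1 0 \<alpha> = W b \<alpha>"
    "\<And>\<alpha>. \<alpha> \<in> mindices_upto 2 \<Longrightarrow> second_jet_at k 0 1 \<alpha> = W c \<alpha>"
    "bipoly (coeff_dt k) (1/2) 0 = E1" "bipoly (coeff_ds k) 0 (1/2) = E2"
    "bipoly (coeff_ds k) (1/2) (1/2) + bipoly (coeff_dt k) (1/2) (1/2) = E3"
    using reference_interpolation_exists[of "W a" "W b" "W c" E1 E2 E3] by blast
  let ?P = "chart a p q k"
  have mi: "(0,0) \<in> mindices_upto 2" "(1,0) \<in> mindices_upto 2" "(0,1) \<in> mindices_upto 2" "(2,0) \<in> mindices_upto 2"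
    "(1,1) \<in> mindices_upto 2" "(0,2) \<in> mindices_upto 2" by (auto simp: mindices_upto_def)
  have pt: "(a - a) \<bullet> p = 0" "(a - a) \<bullet> q = 0" "(b - a) \<bullet> p = 1" "(b - a) \<bullet> q = 0" "(c - a) \<bullet> p = 0" "(c - a) \<bullet> q = 1"
    using pq by (auto simp: dual_coords_def)
  note id = dual_coords_identity[OF pq]
  have vertex: "mderiv \<alpha> ?P v = D (Vertex_Dof v \<alpha>)" if v: "v \<in> {a, b, c}" and \<alpha>: "\<alpha> \<in> mindices_upto 2" for v \<alpha>
  proof -
    have J: "second_jet_at k ((v - a) \<bullet> p) ((v - a) \<bullet> q) \<alpha> = W v \<alpha>" if "\<alpha> \<in> mindices_upto 2" for \<alpha>
      using v k(1-3)[OF that] pt by auto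
    note e = mderiv_chart_jet[where k=k and x=v and a=a and p=p and q=q, unfolded J[OF mi(1)] J[OF mi(2)] J[OF mi(3)] J[OF mi(4)] J[OF mi(5)] J[OF mi(6)] W]
    have id': "p$1 * ?B$1 + q$1 * ?C$1 = 1" "p$2 * ?B$2 + q$2 * ?C$2 = 1" "p$1 * ?B$2 + q$1 * ?C$2 = 0" "p$2 * ?B$1 + q$2 * ?C$1 = 0"
      using id by (auto simp: mult.commute)
    have lin: "p1 * (b1 * x + b2 * y) + q1 * (c1 * x + c2 * y) = (p1 * b1 + q1 * c1) * x + (p1 * b2 + q1 * c2) * y"
      for p1 q1 b1 b2 c1 c2 x y :: real by (simp add: algebra_simps)
    have bil: "p1 * p2 * (b1 * b1 * x + (b1 * b2 + b2 * b1) * y + b2 * b2 * z) + (p1 * q2 + q1 * p2) * (b1 * c1 * x + (b1 * c2 + b2 * c1) * y + b2 * c2 * z)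
       + q1 * q2 * (c1 * c1 * x + (c1 * c2 + c2 * c1) * y + c2 * c2 * z)
      = (p1 * b1 + q1 * c1) * (p2 * b1 + q2 * c1) * x + ((p1 * b1 + q1 * c1) * (p2 * b2 + q2 * c2) + (p1 * b2 + q1 * c2) * (p2 * b1 + q2 * c1)) * y
       + (p1 * b2 + q1 * c2) * (p2 * b2 + q2 * c2) * z" for p1 p2 q1 q2 b1 b2 c1 c2 x y z :: real
      by (simp add: algebra_simps)
    have sq: "r\<^sup>2 * x + 2 * r * s * y + s\<^sup>2 * z = r * r * x + (r * s + s * r) * y + s * s * z" for r s x y z :: real
      by (simp add: power2_eq_square)
    have e20: "mderiv (2,0) ?P v = D (Vertex_Dof v (2,0))" unfolding e(4) sq[of "p$1" _ "q$1"] bil id' by simp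
    have e02: "mderiv (0,2) ?P v = D (Vertex_Dof v (0,2))" unfolding e(6) sq[of "p$2" _ "q$2"] bil id' by simp
    have e11: "mderiv (1,1) ?P v = D (Vertex_Dof v (1,1))" unfolding e(5) bil id' by simp
    have e10: "mderiv (1,0) ?P v = D (Vertex_Dof v (1,0))" unfolding e(2) lin id' by simp
    have e01: "mderiv (0,1) ?P v = D (Vertex_Dof v (0,1))" unfolding e(3) lin id' by simp
    show ?thesis using \<alpha> unfolding mindices_upto_2
      by (elim insertE emptyE) (simp_all only: e(1) e20 e02 e11 e10 e01)
  qed
  have nr: "norm ?n1 = 1" "?n1 \<bullet> ?B = 0" "norm ?n2 = 1" "?n2 \<bullet> ?C = 0" "norm ?n3 = 1" "?n3 \<bullet> (c - b) = 0"
    using cell by (auto simp: argyris_cell_def)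
  have q1: "q \<bullet> ?n1 \<noteq> 0"
    using abs_inner_unit_normal[OF nr(1,2), of q] pq ne np(2) by (auto simp: dual_coords_def inner_commute)
  have p2: "p \<bullet> ?n2 \<noteq> 0"
    using abs_inner_unit_normal[OF nr(3,4), of p] pq ne np(1) by (auto simp: dual_coords_def inner_commute)
  have "(p + q) \<bullet> (c - b) = (c - a) \<bullet> p - (b - a) \<bullet> p + ((c - a) \<bullet> q - (b - a) \<bullet> q)"
    by (simp add: inner_commute inner_diff_left inner_diff_right inner_add_left inner_add_right algebra_simps)
  then have "(p + q) \<bullet> (c - b) = 0" using pt by simp
  then have pq3: "(p + q) \<bullet> ?n3 \<noteq> 0"
    using abs_inner_unit_normal[OF nr(5,6), of "p + q"] ne np(3) by auto
  have t: "bipoly (coeff_ds k) (1/2) 0 = h1" "bipoly (coeff_dt k) 0 (1/2) = h2"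
    "bipoly (coeff_dt k) (1/2) (1/2) - bipoly (coeff_ds k) (1/2) (1/2) = h3"
    unfolding edge_hermite h1_def h2_def h3_def k(1)[OF mi(1)] k(1)[OF mi(2)] k(1)[OF mi(3)] k(1)[OF mi(4)] k(1)[OF mi(5)] k(1)[OF mi(6)]
      k(2)[OF mi(1)] k(2)[OF mi(2)] k(2)[OF mi(3)] k(2)[OF mi(4)] k(2)[OF mi(5)] k(2)[OF mi(6)]
      k(3)[OF mi(1)] k(3)[OF mi(2)] k(3)[OF mi(3)] k(3)[OF mi(4)] k(3)[OF mi(5)] k(3)[OF mi(6)] by simp_all
  have g1: "grad ?P (edge_midpoint {a, b}) \<bullet> ?n1 = D (Edge_Dof {a, b})"
    unfolding grad_chart edge_midpoint_pair[OF ne(1)] chart_at[OF pq] t k E1_def using q1 by simp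
  have g2: "grad ?P (edge_midpoint {a, c}) \<bullet> ?n2 = D (Edge_Dof {a, c})"
    unfolding grad_chart edge_midpoint_pair[OF ne(2)] chart_at[OF pq] t k E2_def using p2 by simp
  have "grad ?P (edge_midpoint {b, c}) \<bullet> ?n3 = ((q - p) \<bullet> ?n3 / 2) * (bipoly (coeff_dt k) (1/2) (1/2) - bipoly (coeff_ds k) (1/2) (1/2))
       + ((p + q) \<bullet> ?n3 / 2) * (bipoly (coeff_ds k) (1/2) (1/2) + bipoly (coeff_dt k) (1/2) (1/2))"
    unfolding grad_chart edge_midpoint_pair[OF ne(3)] chart_at[OF pq]
    by (simp add: inner_diff_left inner_add_left field_simps)
  also have "\<dots> = D (Edge_Dof {b, c})" unfolding t k E3_def using pq3 by (simp add: field_simps)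
  finally have g3: "grad ?P (edge_midpoint {b, c}) \<bullet> ?n3 = D (Edge_Dof {b, c})" .
  have "dof_value nrm d ?P = D d" if "d \<in> cell_dofs vert K" for d
    using that unfolding cell_dofs_eq[of vert K a b c, OF vK ne(1-3)]
    using vertex g1 g2 g3 by (elim UnE insertE emptyE CollectE exE conjE) simp_all
  moreover have "?P \<in> polys 5" unfolding polys_5_eq_range_chart[OF pq, of a] by blast
  ultimately show thesis using that by blast
qed

lemma local_basis_dual:
  assumes cell: "argyris_cell vert nrm K a b c h \<sigma>" and d: "d \<in> cell_dofs vert K"
  shows "local_basis vert nrm K d \<in> polys 5"
    and "\<And>d'. d' \<in> cell_dofs vert K \<Longrightarrow> dof_value nrm d' (local_basis vert nrm K d) = (if d' = d then 1 else 0)"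
proof -
  define R where "R P \<longleftrightarrow> P \<in> polys 5 \<and> (\<forall>d'\<in>cell_dofs vert K. dof_value nrm d' P = (if d' = d then 1 else 0))" for P
  obtain P where P: "P \<in> polys 5" "\<And>d'. d' \<in> cell_dofs vert K \<Longrightarrow> dof_value nrm d' P = (if d' = d then 1 else 0)"
    by (rule argyris_exists[OF cell, of "\<lambda>d'. if d' = d then 1 else 0"]) auto
  then have "R P" by (simp add: R_def)
  moreover have "Q = P" if "R Q" for Q
    by (rule argyris_unique[OF cell]) (use that P in \<open>auto simp: R_def\<close>)
  ultimately have "R (THE P. R P)" by (rule theI)
  moreover have "local_basis vert nrm K d = (THE P. R P)" using d by (simp add: local_basis_def R_def)
  ultimately have "R (local_basis vert nrm K d)" by simp
  then show "local_basis vert nrm K d \<in> polys 5"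
    and "\<And>d'. d' \<in> cell_dofs vert K \<Longrightarrow> dof_value nrm d' (local_basis vert nrm K d) = (if d' = d then 1 else 0)"
    by (auto simp: R_def)
qed

text \<open>The local interpolant with prescribed degrees of freedom, written in the dual basis.\<close>

theorem local_basis_combination:
  assumes cell: "argyris_cell vert nrm K a b c h \<sigma>"
  shows "(\<lambda>x. \<Sum>d\<in>cell_dofs vert K. D d * local_basis vert nrm K d x) \<in> polys 5"
    and "d \<in> cell_dofs vert K \<Longrightarrow> dof_value nrm d (\<lambda>x. \<Sum>d\<in>cell_dofs vert K. D d * local_basis vert nrm K d x) = D d"
proof -
  have fin: "finite (cell_dofs vert K)"
    using cell by (intro finite_cell_dofs) (auto simp: argyris_cell_def)
  note lb = local_basis_dual[OF cell]
  show "(\<lambda>x. \<Sum>d\<in>cell_dofs vert K. D d * local_basis vert nrm K d x) \<in> polys 5"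
    by (intro polys_sum fin lb)
  assume d: "d \<in> cell_dofs vert K"
  have "dof_value nrm d (\<lambda>x. \<Sum>d\<in>cell_dofs vert K. D d * local_basis vert nrm K d x)
      = (\<Sum>e\<in>cell_dofs vert K. D e * dof_value nrm d (local_basis vert nrm K e))"
    using dof_value_sum[OF fin, of "local_basis vert nrm K" nrm d D] lb smooth_polys by blast
  also have "\<dots> = (\<Sum>e\<in>cell_dofs vert K. if d = e then D e else 0)"
    by (intro sum.cong refl) (simp add: lb(2)[OF _ d])
  also have "\<dots> = D d" using fin d by simp
  finally show "dof_value nrm d (\<lambda>x. \<Sum>d\<in>cell_dofs vert K. D d * local_basis vert nrm K d x) = D d" .
qed

section \<open>Geometry of the mesh\<close>

text \<open>A lower bound for the ratio of the cross product of two sides of the triangle in a cell to the square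
of the diameter of the cell. No triangle has all its angles at least \<open>pi / 2\<close>; the default value \<open>1\<close>
keeps the number positive in all cases.\<close>

definition mesh_sigma :: "real \<Rightarrow> real \<Rightarrow> real" where
  "mesh_sigma \<theta> \<kappa> = (if 0 < \<theta> \<and> \<theta> < pi / 2 then sin \<theta> / (2 * (max \<kappa> 1)\<^sup>2) else 1)"

lemma mesh_sigma_bounds: "0 < mesh_sigma \<theta> \<kappa>" "mesh_sigma \<theta> \<kappa> \<le> 1"
proof -
  have m: "1 \<le> (max \<kappa> 1)\<^sup>2" by simp
  then show "0 < mesh_sigma \<theta> \<kappa>" by (auto simp: mesh_sigma_def sin_gt_zero)
  have "sin \<theta> / (2 * (max \<kappa> 1)\<^sup>2) \<le> 1"
  proof -
    have "sin \<theta> \<le> 2 * (max \<kappa> 1)\<^sup>2" "0 < 2 * (max \<kappa> 1)\<^sup>2" using m sin_le_one[of \<theta>] by linarith+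
    then show ?thesis by (simp only: divide_le_eq_1_pos)
  qed
  then show "mesh_sigma \<theta> \<kappa> \<le> 1" by (simp add: mesh_sigma_def)
qed

text \<open>The angle at an end of a longest side is acute, so its sine is at least \<open>sin \<theta>\<close>, and the second side is
assumed to have at least half the length of the longest one.\<close>

lemma cross_ge_of_longest_side:
  fixes a b c :: pt
  assumes ab: "a \<noteq> b" "a \<noteq> c" "norm (c - b) \<le> norm (b - a)" "norm (b - a) \<le> 2 * norm (c - a)"
    and \<theta>: "\<theta> > 0" and ang: "vertex_angle a b c \<ge> \<theta>"
  shows "\<theta> < pi / 2" "sin \<theta> * (norm (b - a))\<^sup>2 / 2 \<le> \<bar>cross (b - a) (c - a)\<bar>"
proof -
  let ?e = "b - a" and ?f = "c - a"
  have n0: "0 < norm ?e" "0 < norm ?f" using ab by auto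
  define r where "r = (?e \<bullet> ?f) / (norm ?e * norm ?f)"
  have "(norm (c - b))\<^sup>2 = (norm ?e)\<^sup>2 + (norm ?f)\<^sup>2 - 2 * (?e \<bullet> ?f)"
    unfolding power2_norm_eq_inner by (simp add: inner_diff_left inner_diff_right inner_commute algebra_simps)
  moreover have "(norm (c - b))\<^sup>2 \<le> (norm ?e)\<^sup>2" using ab(3) by (intro power_mono) auto
  moreover have "0 < (norm ?f)\<^sup>2" using n0 by simp
  ultimately have ef: "0 < ?e \<bullet> ?f" by linarith
  then have r0: "0 < r" using n0 by (simp add: r_def)
  have r1: "r \<le> 1" using n0 norm_cauchy_schwarz[of ?e ?f] by (simp add: r_def)
  have ac: "\<theta> \<le> arccos r" using ang by (simp add: vertex_angle_def r_def)
  have "r \<le> cos \<theta>"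
    using cos_monotone_0_pi_le[of \<theta> "arccos r"] \<theta> ac r0 r1 arccos_ubound[of r] by simp
  moreover have "arccos r < pi / 2" using arccos_less_arccos[of 0 r] r0 r1 by simp
  ultimately show th: "\<theta> < pi / 2" using ac by linarith
  have s0: "0 < sin \<theta>" using th \<theta> by (intro sin_gt_zero) auto
  have "r\<^sup>2 \<le> (cos \<theta>)\<^sup>2" using \<open>r \<le> cos \<theta>\<close> r0 by (intro power_mono) auto
  then have "(sin \<theta>)\<^sup>2 \<le> 1 - r\<^sup>2" by (simp add: sin_squared_eq)
  moreover have "(?e \<bullet> ?f)\<^sup>2 = r\<^sup>2 * ((norm ?e)\<^sup>2 * (norm ?f)\<^sup>2)"
    using n0 by (simp add: r_def power_divide power_mult_distrib)
  then have "(cross ?e ?f)\<^sup>2 = (1 - r\<^sup>2) * ((norm ?e)\<^sup>2 * (norm ?f)\<^sup>2)"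
    using lagrange_identity_pt[of ?e ?f] by (simp add: algebra_simps)
  ultimately have "(sin \<theta>)\<^sup>2 * ((norm ?e)\<^sup>2 * (norm ?f)\<^sup>2) \<le> (cross ?e ?f)\<^sup>2"
    by (simp add: mult_right_mono)
  then have "(sin \<theta> * norm ?e * norm ?f)\<^sup>2 \<le> (cross ?e ?f)\<^sup>2"
    by (simp add: power_mult_distrib mult.assoc)
  then have "\<bar>sin \<theta> * norm ?e * norm ?f\<bar> \<le> \<bar>cross ?e ?f\<bar>" by (simp only: abs_le_square_iff)
  then have 1: "sin \<theta> * norm ?e * norm ?f \<le> \<bar>cross ?e ?f\<bar>" by linarith
  have "sin \<theta> * norm ?e * (norm ?e / 2) \<le> sin \<theta> * norm ?e * norm ?f"
    using s0 ab(4) by (intro mult_left_mono) auto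
  with 1 show "sin \<theta> * (norm ?e)\<^sup>2 / 2 \<le> \<bar>cross ?e ?f\<bar>" by (simp add: power2_eq_square)
qed

text \<open>Let \<open>u\<close> and \<open>v\<close> be the ends of a longest side. By the triangle inequality one of the other two sides is at
least half as long; its common vertex with the longest side is taken as \<open>a\<close>.\<close>

theorem mesh_argyris_cell:
  assumes mesh: "conforming_mesh \<Omega> T vert" and reg: "regular_mesh \<theta> \<kappa> \<gamma> c0 T vert" and nrm: "edge_normals T vert nrm"
    and K: "K \<in> T" and \<theta>: "\<theta> > 0"
  obtains a b c where "argyris_cell vert nrm K a b c (diameter K) (mesh_sigma \<theta> \<kappa>)"
proof -
  have shape: "card (vert K) = 3" "\<not> collinear (vert K)" "compact K" "convex K" "convex hull (vert K) \<subseteq> K"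
    using mesh K by (auto simp: conforming_mesh_def cell_shape_def)
  have fin: "finite (vert K)" "vert K \<noteq> {}" using shape(1) card.infinite by fastforce+
  obtain u v where uv: "u \<in> vert K" "v \<in> vert K"
    and max: "\<And>x y. x \<in> convex hull (vert K) \<Longrightarrow> y \<in> convex hull (vert K) \<Longrightarrow> norm (x - y) \<le> norm (u - v)"
    using simplex_extremal_le[OF fin] by blast
  obtain w1 w2 where w12: "w1 \<in> vert K" "w2 \<in> vert K" "w1 \<noteq> w2"
    using shape(1) by (auto simp: card_3_iff)
  have hull: "x \<in> convex hull (vert K)" if "x \<in> vert K" for x using that by (rule hull_inc)
  have "norm (w1 - w2) \<le> norm (u - v)" using max hull w12 by blast
  then have "u \<noteq> v" using w12 by auto
  then have "card (vert K - {u, v}) = 1" using shape(1) uv fin by (simp add: card_Diff_subset)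
  then obtain w where "vert K - {u, v} = {w}" by (auto simp: card_1_singleton_iff)
  then have w: "vert K = {u, v, w}" "w \<noteq> u" "w \<noteq> v" using uv by auto
  obtain a b c where abc: "vert K = {a, b, c}" "a \<noteq> b" "a \<noteq> c" "b \<noteq> c" and L: "norm (b - a) = norm (u - v)" "norm (b - a) \<le> 2 * norm (c - a)"
  proof (cases "norm (u - v) \<le> 2 * norm (w - v)")
    case True
    have "vert K = {v, u, w}" using w(1) by (simp add: insert_commute)
    from that[OF this] show thesis using True w(2,3) \<open>u \<noteq> v\<close> by metis
  next
    case False
    have "norm (u - v) \<le> norm (w - v) + norm (w - u)" using norm_triangle_ineq4[of "w - v" "w - u"] by simp
    then have "norm (v - u) \<le> 2 * norm (w - u)" using False by (simp add: norm_minus_commute[of v u])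
    from that[OF w(1) _ _ _ _ this] show thesis using w(2,3) \<open>u \<noteq> v\<close> by (metis norm_minus_commute)
  qed
  let ?d = "diameter K"
  have bK: "bounded K" using shape(3) by (rule compact_imp_bounded)
  have inK: "x \<in> K" if "x \<in> {a, b, c}" for x using that shape(5) hull abc(1) by blast
  have dd: "norm (x - y) \<le> ?d" if "x \<in> {a, b, c}" "y \<in> {a, b, c}" for x y
    using diameter_bounded_bound[OF bK inK[OF that(1)] inK[OF that(2)]] by (simp add: dist_norm)
  have ba: "norm (b - a) \<le> ?d" "norm (c - a) \<le> ?d" "norm (c - b) \<le> ?d" by (rule dd; simp)+
  have d0: "0 < ?d" using ba abc(2) by (metis eq_iff_diff_eq_0 less_le_trans zero_less_norm_iff)
  have cb: "norm (c - b) \<le> norm (b - a)" unfolding L using max hull abc(1) by simp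
  have ang: "vertex_angle a b c \<ge> \<theta>" using reg K abc(1) by (auto simp: regular_mesh_def)
  note cr = cross_ge_of_longest_side[OF abc(2,3) cb L(2) \<theta> ang]
  have "diameter (convex hull (vert K)) \<le> norm (b - a)"
    using max L by (intro diameter_le) (auto simp: dist_norm)
  moreover have "?d \<le> \<kappa> * diameter (convex hull (vert K))" using reg K by (auto simp: regular_mesh_def)
  moreover have h0: "0 \<le> diameter (convex hull (vert K))"
    by (rule diameter_ge_0) (use fin in \<open>simp add: bounded_convex_hull finite_imp_bounded\<close>)
  moreover have "\<kappa> * diameter (convex hull (vert K)) \<le> max \<kappa> 1 * diameter (convex hull (vert K))" using h0 by (intro mult_right_mono) auto
  moreover have "max \<kappa> 1 * diameter (convex hull (vert K)) \<le> max \<kappa> 1 * norm (b - a)"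
    using \<open>diameter (convex hull (vert K)) \<le> norm (b - a)\<close> by (intro mult_left_mono) auto
  ultimately have dk: "?d \<le> max \<kappa> 1 * norm (b - a)" by linarith
  have s0: "0 < sin \<theta>" using cr(1) \<theta> by (intro sin_gt_zero) auto
  have "?d\<^sup>2 \<le> (max \<kappa> 1)\<^sup>2 * (norm (b - a))\<^sup>2"
    using dk d0 unfolding power_mult_distrib[symmetric] by (intro power_mono) auto
  then have "sin \<theta> / (2 * (max \<kappa> 1)\<^sup>2) * ?d\<^sup>2 \<le> sin \<theta> / (2 * (max \<kappa> 1)\<^sup>2) * ((max \<kappa> 1)\<^sup>2 * (norm (b - a))\<^sup>2)"
    using s0 by (intro mult_left_mono) auto
  also have "\<dots> = sin \<theta> * (norm (b - a))\<^sup>2 / 2"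
  proof -
    have "max \<kappa> 1 \<noteq> 0" by (auto simp: max_def)
    then show ?thesis by simp
  qed
  also note cr(2)
  finally have "mesh_sigma \<theta> \<kappa> * ?d\<^sup>2 \<le> \<bar>cross (b - a) (c - a)\<bar>" using cr(1) \<theta> by (simp add: mesh_sigma_def)
  moreover have "norm (nrm {x, y}) = 1 \<and> nrm {x, y} \<bullet> (y - x) = 0" if "x \<in> vert K" "y \<in> vert K" "x \<noteq> y" for x y
    using nrm K that unfolding edge_normals_def by blast
  ultimately have "argyris_cell vert nrm K a b c ?d (mesh_sigma \<theta> \<kappa>)"
    using abc ba d0 mesh_sigma_bounds by (simp add: argyris_cell_def)
  then show thesis using that by blast
qed

lemma cell_area_ge:
  assumes cell: "argyris_cell vert nrm K a b c h \<sigma>" and K: "compact K" "convex K" "convex hull (vert K) \<subseteq> K"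
  shows "\<sigma> / 2 * h\<^sup>2 \<le> measure lborel (interior K)"
proof -
  have vK: "vert K = {a, b, c}" and D: "\<sigma> * h\<^sup>2 \<le> \<bar>cross (b - a) (c - a)\<bar>" using cell by (auto simp: argyris_cell_def)
  have "measure lborel (convex hull {a, b, c}) = \<bar>cross (b - a) (c - a)\<bar> / 2"
    unfolding content_triangle cross_def by (simp add: algebra_simps abs_minus_commute)
  then have "\<sigma> / 2 * h\<^sup>2 \<le> measure lborel (convex hull {a, b, c})" using D by simp
  also have "\<dots> = measure lebesgue (convex hull {a, b, c})"
    by (rule measure_completion[symmetric]) (simp add: borel_compact compact_convex_hull finite_imp_compact)
  also have "\<dots> \<le> measure lebesgue K"
    using K by (intro measure_mono_fmeasurable) (auto simp: vK lmeasurable_compact compact_imp_bounded compact_convex_hull finite_imp_compact fmeasurableD)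
  also have "\<dots> = measure lebesgue (interior K)"
    using K by (intro measure_interior[symmetric]) (auto simp: compact_imp_bounded negligible_convex_frontier)
  also have "\<dots> = measure lborel (interior K)" by (rule measure_completion) simp
  finally show ?thesis .
qed

text \<open>A convex set with nonempty interior is contained in the closure of its interior, so an open set that
meets one of its points also meets its interior.\<close>

lemma interior_cell_unique:
  assumes mesh: "conforming_mesh \<Omega> T vert" and K: "K \<in> T" "K' \<in> T" "x \<in> interior K" "x \<in> K'"
    and ne: "interior K' \<noteq> {}"
  shows "K' = K"
proof (rule ccontr)
  assume "K' \<noteq> K"
  then have disj: "interior K \<inter> interior K' = {}" using mesh K unfolding conforming_mesh_def by blast
  have "convex K'" using mesh K by (auto simp: conforming_mesh_def cell_shape_def)
  then have "closure (interior K') = closure K'" using ne by (rule convex_closure_interior)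
  then have "x \<in> closure (interior K')" using K(4) closure_subset by blast
  then show False using disj K(3) open_interior by (metis IntI closure_iff_nhds_not_empty empty_iff interior_subset open_Int_closure_eq_empty)
qed

lemma barycentric_in_hull:
  assumes D: "cross (b - a) (c - a) \<noteq> 0"
    and "0 \<le> cross (y - a) (c - a) / cross (b - a) (c - a)" "0 \<le> cross (b - a) (y - a) / cross (b - a) (c - a)"
      "cross (y - a) (c - a) / cross (b - a) (c - a) + cross (b - a) (y - a) / cross (b - a) (c - a) \<le> 1"
  shows "y \<in> convex hull {a, b, c}"
proof -
  let ?D = "cross (b - a) (c - a)"
  have "?D *\<^sub>R (y - a) = cross (y - a) (c - a) *\<^sub>R (b - a) + cross (b - a) (y - a) *\<^sub>R (c - a)"
    by (simp add: vec_eq_iff forall_2 cross_def algebra_simps)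
  then have "(1 / ?D) *\<^sub>R (?D *\<^sub>R (y - a)) = (1 / ?D) *\<^sub>R (cross (y - a) (c - a) *\<^sub>R (b - a) + cross (b - a) (y - a) *\<^sub>R (c - a))" by simp
  then have "y - a = (cross (y - a) (c - a) / ?D) *\<^sub>R (b - a) + (cross (b - a) (y - a) / ?D) *\<^sub>R (c - a)"
    using D by (simp add: scaleR_add_right)
  then have "y = a + (cross (y - a) (c - a) / ?D) *\<^sub>R (b - a) + (cross (b - a) (y - a) / ?D) *\<^sub>R (c - a)"
    by (simp add: algebra_simps)
  then show ?thesis unfolding convex_hull_3_alt using assms by blast
qed

lemma cross_scale: "cross (k *\<^sub>R x) y = k * cross x y" "cross x (k *\<^sub>R x) = 0"
  by (simp_all add: cross_def algebra_simps)

text \<open>Of the three inequalities between barycentric coordinates that describe the triangle, two hold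
strictly at an interior point of the side from \<open>a\<close> to \<open>b\<close>, hence in a disc around it; the third describes
the half plane.\<close>

lemma half_disc_in_triangle:
  assumes D: "cross (b - a) (c - a) \<noteq> 0" and \<tau>: "0 < \<tau>" "\<tau> < 1"
  shows "\<exists>r>0. \<forall>y\<in>ball ((1 - \<tau>) *\<^sub>R a + \<tau> *\<^sub>R b) r. 0 \<le> cross (b - a) (y - a) * cross (b - a) (c - a) \<longrightarrow> y \<in> convex hull {a, b, c}"
proof -
  let ?D = "cross (b - a) (c - a)" and ?x = "(1 - \<tau>) *\<^sub>R a + \<tau> *\<^sub>R b"
  let ?s = "\<lambda>y. cross (y - a) (c - a) / ?D" and ?t = "\<lambda>y. cross (b - a) (y - a) / ?D"
  have x: "?x - a = \<tau> *\<^sub>R (b - a)" by (simp add: algebra_simps)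
  have sx: "?s ?x = \<tau>" and tx: "?t ?x = 0" unfolding x using D by (simp_all add: cross_scale)
  have cs: "continuous_on UNIV ?s" "continuous_on UNIV (\<lambda>y. ?s y + ?t y)"
    unfolding cross_def using D unfolding cross_def by (auto intro!: continuous_intros)
  have "open {y. 0 < ?s y}" "open {y. ?s y + ?t y < 1}"
    using cs by (auto intro!: open_Collect_less continuous_intros)
  then have "open ({y. 0 < ?s y} \<inter> {y. ?s y + ?t y < 1})" by (rule open_Int)
  moreover have "?x \<in> {y. 0 < ?s y} \<inter> {y. ?s y + ?t y < 1}"
    unfolding Int_iff mem_Collect_eq sx tx using \<tau> by simp
  ultimately obtain r where r: "r > 0" "ball ?x r \<subseteq> {y. 0 < ?s y} \<inter> {y. ?s y + ?t y < 1}"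
    by (meson open_contains_ball)
  have "y \<in> convex hull {a, b, c}" if "y \<in> ball ?x r" "0 \<le> cross (b - a) (y - a) * ?D" for y
  proof (rule barycentric_in_hull[OF D])
    show "0 \<le> ?t y" using that(2) by (simp add: zero_le_mult_iff zero_le_divide_iff)
  qed (use r that(1) in \<open>auto intro: less_imp_le\<close>)
  then show ?thesis using r(1) by blast
qed

text \<open>The two triangles lie on opposite sides of a common edge, since otherwise their interiors would
overlap. So the half discs of \<open>half_disc_in_triangle\<close> fill a disc around the point.\<close>

theorem open_edge_in_domain:
  assumes mesh: "conforming_mesh \<Omega> T vert" and K: "K \<in> T" "K' \<in> T" "K \<noteq> K'"
    and ab: "a \<in> vert K \<inter> vert K'" "b \<in> vert K \<inter> vert K'" "a \<noteq> b" and \<tau>: "0 < \<tau>" "\<tau> < 1"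
  shows "(1 - \<tau>) *\<^sub>R a + \<tau> *\<^sub>R b \<in> \<Omega>"
proof -
  let ?x = "(1 - \<tau>) *\<^sub>R a + \<tau> *\<^sub>R b"
  have third: "\<exists>c. vert L = {a, b, c} \<and> cross (b - a) (c - a) \<noteq> 0 \<and> convex hull {a, b, c} \<subseteq> L"
    if L: "L \<in> T" "a \<in> vert L" "b \<in> vert L" for L
  proof -
    have shape: "card (vert L) = 3" "\<not> collinear (vert L)" "convex hull (vert L) \<subseteq> L"
      using mesh L by (auto simp: conforming_mesh_def cell_shape_def)
    then have "finite (vert L)" using card.infinite by fastforce
    then have "card (vert L - {a, b}) = 1" using shape(1) L(2,3) ab(3) by (simp add: card_Diff_subset)
    then obtain c where "vert L - {a, b} = {c}" by (auto simp: card_1_singleton_iff)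
    then have c: "vert L = {a, b, c}" using L by auto
    have "cross (b - a) (c - a) \<noteq> 0"
    proof
      assume 0: "cross (b - a) (c - a) = 0"
      have "b - a \<noteq> 0" using ab(3) by simp
      then have n: "(b - a) \<bullet> (b - a) \<noteq> 0" by simp
      have "((b - a) \<bullet> (b - a)) *\<^sub>R (c - a) = ((c - a) \<bullet> (b - a)) *\<^sub>R (b - a)"
        using 0 by (simp add: vec_eq_iff forall_2 inner_pt cross_def) algebra
      then have "(1 / ((b - a) \<bullet> (b - a))) *\<^sub>R (((b - a) \<bullet> (b - a)) *\<^sub>R (c - a)) = (((c - a) \<bullet> (b - a)) / ((b - a) \<bullet> (b - a))) *\<^sub>R (b - a)"
        by simp
      then have "c - a = (((c - a) \<bullet> (b - a)) / ((b - a) \<bullet> (b - a))) *\<^sub>R (b - a)" using n by simp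
      then have "\<exists>t. c - a = t *\<^sub>R (b - a)" by blast
      then have "collinear {0, b - a, c - a}" by (simp add: collinear_lemma)
      then have "collinear {b, a, c}" by (subst collinear_3) (auto simp: NO_MATCH_def)
      then have "collinear {a, b, c}" by (simp add: insert_commute)
      then show False using shape(2) c by simp
    qed
    then show ?thesis using c shape(3) by auto
  qed
  obtain c where c: "vert K = {a, b, c}" "cross (b - a) (c - a) \<noteq> 0" "convex hull {a, b, c} \<subseteq> K"
    using third K ab by blast
  obtain c' where c': "vert K' = {a, b, c'}" "cross (b - a) (c' - a) \<noteq> 0" "convex hull {a, b, c'} \<subseteq> K'"
    using third K ab by blast
  let ?D = "cross (b - a) (c - a)" and ?D' = "cross (b - a) (c' - a)"
  obtain r where r: "r > 0" "\<And>y. y \<in> ball ?x r \<Longrightarrow> 0 \<le> cross (b - a) (y - a) * ?D \<Longrightarrow> y \<in> convex hull {a, b, c}"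
    using half_disc_in_triangle[OF c(2) \<tau>] by blast
  obtain r' where r': "r' > 0" "\<And>y. y \<in> ball ?x r' \<Longrightarrow> 0 \<le> cross (b - a) (y - a) * ?D' \<Longrightarrow> y \<in> convex hull {a, b, c'}"
    using half_disc_in_triangle[OF c'(2) \<tau>] by blast
  let ?r = "min r r'"
  have "?D * ?D' < 0"
  proof (rule ccontr)
    assume "\<not> ?D * ?D' < 0"
    then have pos: "0 < ?D * ?D'" using c(2) c'(2) by (simp add: not_less order.strict_iff_order)
    let ?S = "ball ?x ?r \<inter> {y. 0 < cross (b - a) (y - a) * ?D}"
    have op: "open ?S" unfolding cross_def by (intro open_Int open_ball open_Collect_less continuous_intros)
    have "?S \<subseteq> K"
      using r(2) c(3) by auto
    moreover have "?S \<subseteq> K'"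
    proof
      fix y assume y: "y \<in> ?S"
      then have "0 < (cross (b - a) (y - a) * ?D) * (?D * ?D')" using pos by simp
      then have "0 < (cross (b - a) (y - a) * ?D') * ?D\<^sup>2" by (simp add: power2_eq_square mult_ac)
      then have "0 < cross (b - a) (y - a) * ?D'" using c(2) by (simp add: zero_less_mult_iff)
      then have "y \<in> convex hull {a, b, c'}" using r'(2)[of y] y by auto
      then show "y \<in> K'" using c'(3) by blast
    qed
    ultimately have "?S \<subseteq> interior K \<inter> interior K'" using op by (simp add: interior_maximal)
    moreover have "interior K \<inter> interior K' = {}" using mesh K unfolding conforming_mesh_def by blast
    moreover have "?S \<noteq> {}"
    proof -
      define e where "e = ?r / (2 * (norm (c - a) + 1))"
      have np: "norm (c - a) + 1 > 0" by (smt (verit) norm_ge_zero)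
      have e0: "e > 0" using r(1) r'(1) np by (simp add: e_def)
      have "norm (e *\<^sub>R (c - a)) < ?r"
      proof -
        have "norm (e *\<^sub>R (c - a)) = e * norm (c - a)" using e0 by simp
        also have "\<dots> < e * (2 * (norm (c - a) + 1))" using e0 by (intro mult_strict_left_mono) (smt (verit) norm_ge_zero)+
        also have "\<dots> = ?r" using np by (simp add: e_def)
        finally show ?thesis .
      qed
      then have "?x + e *\<^sub>R (c - a) \<in> ball ?x ?r" by (simp add: dist_norm)
      moreover have "cross (b - a) (?x + e *\<^sub>R (c - a) - a) = e * ?D" by (simp add: cross_def algebra_simps)
      then have "0 < cross (b - a) (?x + e *\<^sub>R (c - a) - a) * ?D"
        using e0 c(2) by (simp add: mult.assoc power2_eq_square[symmetric])
      ultimately show ?thesis by blast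
    qed
    ultimately show False by blast
  qed
  \<comment> \<open>the third vertices are separated by the line through \<open>a\<close> and \<open>b\<close>\<close>
  then have opp: "?D > 0 \<and> ?D' < 0 \<or> ?D < 0 \<and> ?D' > 0" by (simp add: mult_less_0_iff)
  have "ball ?x ?r \<subseteq> \<Union>T"
  proof
    fix y assume y: "y \<in> ball ?x ?r"
    have "0 \<le> cross (b - a) (y - a) * ?D \<or> 0 \<le> cross (b - a) (y - a) * ?D'"
      using opp by (auto simp: zero_le_mult_iff)
    then have "y \<in> K \<or> y \<in> K'" using r(2)[of y] r'(2)[of y] y c(3) c'(3) by auto
    then show "y \<in> \<Union>T" using K by blast
  qed
  moreover have "?x \<in> ball ?x ?r" using r(1) r'(1) by simp
  ultimately have "?x \<in> interior (\<Union>T)" by (meson interiorI open_ball)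
  then show ?thesis using mesh by (simp add: conforming_mesh_def)
qed

section \<open>Polynomial approximation on one cell\<close>

text \<open>The jet of a smooth function on \<open>U\<close>, extended by zero.\<close>

definition smooth_jet :: "pt set \<Rightarrow> (pt \<Rightarrow> real) \<Rightarrow> mindex \<Rightarrow> pt \<Rightarrow> real" where
  "smooth_jet U q \<alpha> = zext U (mderiv \<alpha> q)"

lemma smooth_mderiv: "smooth q \<Longrightarrow> smooth (mderiv \<alpha> q)"
  unfolding mderiv_def by (intro smooth_funpow_partial)

lemma partial_1_mderiv: "partial 1 (mderiv (i, j) q) = mderiv (Suc i, j) q"
  by (simp add: mderiv_def)

lemma partial_2_mderiv:
  assumes "smooth q" shows "partial 2 (mderiv (i, j) q) = mderiv (i, Suc j) q"
proof (induction i)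
  case 0 show ?case by (simp add: mderiv_def)
next
  case (Suc i)
  have "partial 2 (mderiv (Suc i, j) q) = partial 1 (partial 2 (mderiv (i, j) q))"
    unfolding partial_1_mderiv[symmetric] using partial_commute[OF smooth_mderiv[OF assms]] by blast
  then show ?case unfolding Suc by (simp add: mderiv_def)
qed

lemma L2_on_zext:
  assumes U: "open U" "bounded U" and f: "continuous_on UNIV f"
  shows "L2_on U (zext U f)"
proof -
  have m: "zext U f \<in> borel_measurable borel" by (rule borel_measurable_zext[OF U(1) continuous_on_subset[OF f]]) simp
  have "compact (f ` closure U)" using U continuous_on_subset[OF f] by (intro compact_continuous_image) (auto simp: compact_closure)
  then obtain B where B: "\<And>x. x \<in> closure U \<Longrightarrow> \<bar>f x\<bar> \<le> B"
    using compact_imp_bounded bounded_iff by (metis image_eqI real_norm_def)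
  have "integrable lborel (\<lambda>x. (zext U f x)\<^sup>2)"
  proof (rule Bochner_Integration.integrable_bound)
    have "emeasure lborel U < \<infinity>" using U(2) by (rule emeasure_bounded_finite)
    then show "integrable lborel (\<lambda>x. B\<^sup>2 * indicator U x)" using U(1) by (intro integrable_mult_right integrable_real_indicator) auto
    show "AE x in lborel. norm ((zext U f x)\<^sup>2) \<le> norm (B\<^sup>2 * indicator U x)"
    proof (rule AE_I2)
      fix x
      show "norm ((zext U f x)\<^sup>2) \<le> norm (B\<^sup>2 * indicator U x)"
      proof (cases "x \<in> U")
        case True
        then have "\<bar>f x\<bar> \<le> \<bar>B\<bar>" using B closure_subset by fastforce
        then show ?thesis using True by (simp add: zext_def abs_le_square_iff)
      qed (simp add: zext_def)
    qed
  qed (use m in simp)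
  then show ?thesis using m by (simp add: L2_on_def zext_def)
qed

lemma jet_smooth_jet:
  assumes U: "open U" "bounded U" and q: "smooth q"
  shows "jet U m (smooth_jet U q)"
proof -
  have "weak_partial U k (zext U f) (zext U (partial k f))" if "smooth f" for f k
    using that by (intro weak_partial_classical U smooth_differentiable smooth_continuous smooth_partial)
  then have "weak_partial U 1 (smooth_jet U q (i, j)) (smooth_jet U q (Suc i, j))"
    "weak_partial U 2 (smooth_jet U q (i, j)) (smooth_jet U q (i, Suc j))" for i j
    using smooth_mderiv[OF q] unfolding smooth_jet_def partial_1_mderiv[symmetric] partial_2_mderiv[OF q, symmetric] by blast+
  moreover have "L2_on U (smooth_jet U q \<alpha>)" for \<alpha>
    unfolding smooth_jet_def by (intro L2_on_zext U smooth_continuous smooth_mderiv q)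
  ultimately show ?thesis by (simp add: jet_def)
qed

lemma jet_diff:
  assumes U: "open U" "bounded U" and G: "jet U m G" and H: "jet U m H"
  shows "jet U m (\<lambda>\<alpha> x. G \<alpha> x - H \<alpha> x)"
proof -
  have L: "L2_on U (G (i, j))" "L2_on U (H (i, j))" if "i + j \<le> m" for i j
    using G H that by (auto simp: jet_def)
  have "L2_on U (\<lambda>x. G (i, j) x - H (i, j) x)" if "i + j \<le> m" for i j
    using L2_on_add[OF L(1)[OF that] L2_on_cmult[OF L(2)[OF that], of "-1"]] by simp
  moreover have "weak_partial U k (\<lambda>x. G (i, j) x - H (i, j) x) (\<lambda>x. G (i', j') x - H (i', j') x)"
    if "weak_partial U k (G (i, j)) (G (i', j'))" "weak_partial U k (H (i, j)) (H (i', j'))" "i + j \<le> m" "i' + j' \<le> m" for i j i' j' k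
  proof -
    note i = L2_on_integrable[OF _ U]
    have "weak_partial U k (\<lambda>x. G (i, j) x + (-1) * H (i, j) x) (\<lambda>x. G (i', j') x + (-1) * H (i', j') x)"
      using that by (intro weak_partial_add weak_partial_cmult integrable_mult_right i L) auto
    then show ?thesis by simp
  qed
  ultimately show ?thesis using G H by (simp add: jet_def)
qed

text \<open>Monomials divided by factorials, which differentiation maps to one another without constants.\<close>

definition monomial :: "mindex \<Rightarrow> pt \<Rightarrow> real" where
  "monomial \<alpha> x = (x$1) ^ fst \<alpha> * (x$2) ^ snd \<alpha> / (fact (fst \<alpha>) * fact (snd \<alpha>))"

lemma monomial_polys: "\<alpha> \<in> mindices_upto m \<Longrightarrow> monomial \<alpha> \<in> polys m"
  using coord_polys_cmult[OF coord_polys_monomial[of "fst \<alpha>" "snd \<alpha>" m "\<lambda>x. x$1" "\<lambda>x. x$2"], of "1 / (fact (fst \<alpha>) * fact (snd \<alpha>))"]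
  by (simp add: polys_eq_coord_polys monomial_def[abs_def] mindices_upto_def)

lemma has_derivative_monomial:
  "(monomial (i, j) has_derivative (\<lambda>h. h$1 * (if i = 0 then 0 else monomial (i - 1, j) x) + h$2 * (if j = 0 then 0 else monomial (i, j - 1) x))) (at x)"
proof -
  have n: "((\<lambda>x::pt. x$k) has_derivative (\<lambda>h. h$k)) (at x)" for k
    by (rule bounded_linear_imp_has_derivative[OF bounded_linear_vec_nth])
  have "((\<lambda>x. ((x$1) ^ i * (x$2) ^ j) * (1 / (fact i * fact j))) has_derivative
     (\<lambda>h. ((x$1) ^ i * (real j * (h$2) * (x$2) ^ (j - 1)) + (real i * (h$1) * (x$1) ^ (i - 1)) * (x$2) ^ j) * (1 / (fact i * fact j)))) (at x)"
    by (intro has_derivative_mult_left has_derivative_mult has_derivative_power n)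
  moreover have "((x$1) ^ i * (real j * (h$2) * (x$2) ^ (j - 1)) + (real i * (h$1) * (x$1) ^ (i - 1)) * (x$2) ^ j) * (1 / (fact i * fact j))
    = h$1 * (if i = 0 then 0 else monomial (i - 1, j) x) + h$2 * (if j = 0 then 0 else monomial (i, j - 1) x)" for h :: pt
  proof -
    have e: "real n * y * s ^ (n - 1) / fact n = (if n = 0 then 0 else y * (s ^ (n - 1) / fact (n - 1)))" for n and y s :: real
      by (cases n) (simp_all del: of_nat_Suc)
    have "((x$1) ^ i * (real j * (h$2) * (x$2) ^ (j - 1)) + (real i * (h$1) * (x$1) ^ (i - 1)) * (x$2) ^ j) * (1 / (fact i * fact j))
      = (x$1) ^ i / fact i * (real j * (h$2) * (x$2) ^ (j - 1) / fact j) + (real i * (h$1) * (x$1) ^ (i - 1) / fact i) * ((x$2) ^ j / fact j)"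
      by (simp add: add_divide_distrib)
    then show ?thesis unfolding e by (simp add: monomial_def mult_ac)
  qed
  ultimately show ?thesis by (simp add: monomial_def[abs_def])
qed

lemma smooth_monomial: "smooth (monomial \<alpha>)"
  unfolding smooth_def monomial_def[abs_def] divide_inverse
  by (auto intro!: Ck_on_mult Ck_on_power Ck_on_nth)

lemma partial_monomial:
  "partial 1 (monomial (i, j)) = (if i = 0 then (\<lambda>x. 0) else monomial (i - 1, j))"
  "partial 2 (monomial (i, j)) = (if j = 0 then (\<lambda>x. 0) else monomial (i, j - 1))"
  using partial_has_derivative[OF has_derivative_monomial] by (auto simp: fun_eq_iff axis_def)

lemma mderiv_monomial:
  "mderiv (k, l) (monomial (i, j)) = (if k \<le> i \<and> l \<le> j then monomial (i - k, j - l) else (\<lambda>x. 0))"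
proof -
  have z: "(partial m ^^ n) (\<lambda>x. 0) = (\<lambda>x. 0)" for m n by (induction n) auto
  have 1: "(partial 1 ^^ k) (monomial (i, j)) = (if k \<le> i then monomial (i - k, j) else (\<lambda>x. 0))" for i j
  proof (induction k)
    case (Suc k) then show ?case by (auto simp: partial_monomial Suc_le_eq)
  qed simp
  have 2: "(partial 2 ^^ l) (monomial (i, j)) = (if l \<le> j then monomial (i, j - l) else (\<lambda>x. 0))" for i j
  proof (induction l)
    case (Suc l) then show ?case by (auto simp: partial_monomial Suc_le_eq)
  qed simp
  show ?thesis unfolding mderiv_def by (simp add: 1 2 z)
qed

lemma mderiv_sum:
  assumes "finite I" "\<And>i. i \<in> I \<Longrightarrow> smooth (f i)"
  shows "mderiv \<alpha> (\<lambda>x. \<Sum>i\<in>I. k i * f i x) x = (\<Sum>i\<in>I. k i * mderiv \<alpha> (f i) x)"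
  using dof_value_sum[OF assms, where nrm="\<lambda>_. 0" and d="Vertex_Dof x \<alpha>" and k=k] by simp

lemma mderiv_polys_high:
  assumes q: "q \<in> polys m" and \<alpha>: "m < fst \<alpha> + snd \<alpha>"
  shows "mderiv \<alpha> q x = 0"
proof -
  obtain c where c: "q = (\<lambda>x. \<Sum>\<beta>\<in>mindices_upto m. c \<beta> * (x$1) ^ fst \<beta> * (x$2) ^ snd \<beta>)"
    using q unfolding polys_def by blast
  have "q = (\<lambda>x. \<Sum>\<beta>\<in>mindices_upto m. (c \<beta> * (fact (fst \<beta>) * fact (snd \<beta>))) * monomial \<beta> x)"
    unfolding c by (simp add: monomial_def mult.assoc)
  then have "mderiv \<alpha> q x = (\<Sum>\<beta>\<in>mindices_upto m. (c \<beta> * (fact (fst \<beta>) * fact (snd \<beta>))) * mderiv \<alpha> (monomial \<beta>) x)"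
    using mderiv_sum[OF finite_mindices_upto smooth_monomial] by simp
  also have "\<dots> = 0"
  proof (rule sum.neutral, rule ballI)
    fix \<beta> assume "\<beta> \<in> mindices_upto m"
    then have "\<not> (fst \<alpha> \<le> fst \<beta> \<and> snd \<alpha> \<le> snd \<beta>)" using \<alpha> by (auto simp: mindices_upto_def)
    then show "(c \<beta> * (fact (fst \<beta>) * fact (snd \<beta>))) * mderiv \<alpha> (monomial \<beta>) x = 0"
      using mderiv_monomial[of "fst \<alpha>" "snd \<alpha>" "fst \<beta>" "snd \<beta>"] by auto
  qed
  finally show ?thesis .
qed

text \<open>The matrix that maps coefficients to moments of derivatives is triangular with respect to the degree:
monomials of degree \<open>k\<close> have no derivatives of higher order, and those of order \<open>k\<close> are constants. So the
moments are matched from order five downwards.\<close>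

theorem moment_polynomial:
  assumes U: "open U" "bounded U" "0 < measure lborel U"
  obtains q where "q \<in> polys 5" "\<And>\<alpha>. \<alpha> \<in> mindices_upto 5 \<Longrightarrow> (\<integral>x. smooth_jet U q \<alpha> x \<partial>lborel) = g \<alpha>"
proof -
  let ?I = "\<lambda>q \<alpha>. \<integral>x. smooth_jet U q \<alpha> x \<partial>lborel"
  have int: "integrable lborel (smooth_jet U q \<alpha>)" if "smooth q" for q \<alpha>
    unfolding smooth_jet_def
    by (intro L2_on_integrable[OF L2_on_zext] U smooth_continuous smooth_mderiv that)
  \<comment> \<open>after \<open>n\<close> steps the moments of order greater than \<open>5 - n\<close> are matched; at \<open>n = 6\<close> truncated
    subtraction gives \<open>0\<close> as for \<open>n = 5\<close>, and the summand \<open>1\<close> lets the order \<open>0\<close> in\<close>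
  have "\<exists>q\<in>polys 5. \<forall>\<alpha>. 5 - n < fst \<alpha> + snd \<alpha> + (if n = 6 then 1 else 0) \<and> fst \<alpha> + snd \<alpha> \<le> 5 \<longrightarrow> ?I q \<alpha> = g \<alpha>" if "n \<le> 6" for n
    using that
  proof (induction n)
    case 0
    have "(\<lambda>x. 0 * monomial (0,0) x + 0 * monomial (0,0) x) \<in> polys 5"
      by (intro polys_linear monomial_polys) (auto simp: mindices_upto_def)
    then show ?case by auto
  next
    case (Suc n)
    then obtain q where q: "q \<in> polys 5" "\<And>\<alpha>. 5 - n < fst \<alpha> + snd \<alpha> \<Longrightarrow> fst \<alpha> + snd \<alpha> \<le> 5 \<Longrightarrow> ?I q \<alpha> = g \<alpha>"
      by auto
    define k where "k = 5 - n"
    have k5: "k \<le> 5" by (simp add: k_def)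
    have sq: "smooth q" using q(1) by (rule smooth_polys)
    define \<mu> where "\<mu> = measure lborel U"
    define c where "c \<alpha> = (g \<alpha> - ?I q \<alpha>) / \<mu>" for \<alpha>
    define r where "r = (\<lambda>x. \<Sum>\<alpha>\<in>mindices k. c \<alpha> * monomial \<alpha> x)"
    have rp: "r \<in> polys 5" unfolding r_def
      using k5 by (intro polys_sum finite_mindices monomial_polys) (auto simp: mindices_def mindices_upto_def)
    define q' where "q' = (\<lambda>x. 1 * q x + 1 * r x)"
    have q': "q' \<in> polys 5" unfolding q'_def by (rule polys_linear[OF q(1) rp])
    have D: "mderiv \<beta> q' x = mderiv \<beta> q x + (\<Sum>\<alpha>\<in>mindices k. c \<alpha> * mderiv \<beta> (monomial \<alpha>) x)" for \<beta> x
      unfolding q'_def mderiv_linear[OF sq smooth_polys[OF rp]]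
      using mderiv_sum[OF finite_mindices smooth_monomial, where \<alpha>=\<beta> and k=c and x=x] by (simp add: r_def)
    have hi: "mderiv \<beta> (monomial \<alpha>) x = (if \<alpha> = \<beta> then 1 else 0)" if "k \<le> fst \<beta> + snd \<beta>" "\<alpha> \<in> mindices k" for \<alpha> \<beta> x
    proof -
      have "fst \<alpha> + snd \<alpha> = k" using that(2) by (simp add: mindices_def)
      then have "(fst \<beta> \<le> fst \<alpha> \<and> snd \<beta> \<le> snd \<alpha>) \<longleftrightarrow> \<alpha> = \<beta>" using that(1) by (auto simp: prod_eq_iff)
      then show ?thesis
        using mderiv_monomial[of "fst \<beta>" "snd \<beta>" "fst \<alpha>" "snd \<alpha>"] by (auto simp: monomial_def)
    qed
    have "?I q' \<beta> = g \<beta>" if \<beta>: "k \<le> fst \<beta> + snd \<beta>" "fst \<beta> + snd \<beta> \<le> 5" for \<beta>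
    proof (cases "k < fst \<beta> + snd \<beta>")
      case True
      have "mderiv \<beta> q' x = mderiv \<beta> q x" for x
        unfolding D using True hi[OF \<beta>(1)] by (auto intro!: sum.neutral simp: mindices_def)
      then have "smooth_jet U q' \<beta> = smooth_jet U q \<beta>" by (auto simp: smooth_jet_def zext_def fun_eq_iff)
      then show ?thesis using q(2) True \<beta>(2) by (simp add: k_def)
    next
      case False
      then have mem: "\<beta> \<in> mindices k" using \<beta> by (simp add: mindices_def)
      have "mderiv \<beta> q' x = mderiv \<beta> q x + c \<beta>" for x
      proof -
        have "(\<Sum>\<alpha>\<in>mindices k. c \<alpha> * mderiv \<beta> (monomial \<alpha>) x) = (\<Sum>\<alpha>\<in>mindices k. if \<alpha> = \<beta> then c \<alpha> else 0)"
          using hi[OF \<beta>(1)] by (intro sum.cong) auto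
        then show ?thesis unfolding D using mem by simp
      qed
      then have "smooth_jet U q' \<beta> x = smooth_jet U q \<beta> x + c \<beta> * indicator U x" for x
        by (simp add: smooth_jet_def zext_def indicator_def)
      moreover have "integrable lborel (indicator U :: pt \<Rightarrow> real)"
        using U emeasure_bounded_finite[OF U(2)] by (intro integrable_real_indicator) auto
      ultimately have "?I q' \<beta> = ?I q \<beta> + c \<beta> * \<mu>" using int[OF sq, of \<beta>] by (simp add: \<mu>_def)
      then show ?thesis using U(3) by (simp add: c_def \<mu>_def)
    qed
    then have "?I q' \<beta> = g \<beta>" if "5 - Suc n < fst \<beta> + snd \<beta> + (if Suc n = 6 then 1 else 0)" "fst \<beta> + snd \<beta> \<le> 5" for \<beta>
      using that Suc.prems by (auto simp: k_def split: if_splits)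
    then show ?case using q' by blast
  qed
  from this[of 6] obtain q where "q \<in> polys 5" "\<And>\<alpha>. fst \<alpha> + snd \<alpha> \<le> 5 \<Longrightarrow> ?I q \<alpha> = g \<alpha>" by auto
  then show thesis using that by (auto simp: mindices_upto_def)
qed

lemma integral_le_energy:
  assumes "\<alpha> \<in> mindices l" shows "(\<integral>x. (W \<alpha> x)\<^sup>2 \<partial>lborel) \<le> energy l W"
  unfolding energy_def by (rule member_le_sum[OF assms]) auto

lemma energy_nonneg: "0 \<le> energy l W"
  unfolding energy_def by (intro sum_nonneg) auto

text \<open>Every derivative of order \<open>Suc l\<close> arises from at most one of order \<open>l\<close> by each of the two partial
derivatives, which accounts for the factor \<open>8\<close> in place of the \<open>4\<close> of \<open>poincare_convex\<close>.\<close>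

lemma energy_poincare_step:
  assumes U: "open U" "convex U" "bounded U" and d: "\<And>x y i. x \<in> U \<Longrightarrow> y \<in> U \<Longrightarrow> \<bar>x$i - y$i\<bar> \<le> d" "0 < d"
    and \<mu>: "0 < \<mu>" "\<mu> * d\<^sup>2 \<le> measure lborel U" and W: "jet U m W" and l: "l < m"
    and mean: "\<And>\<alpha>. \<alpha> \<in> mindices l \<Longrightarrow> (\<integral>x. W \<alpha> x \<partial>lborel) = 0"
  shows "energy l W \<le> (8 / \<mu> * d\<^sup>2) * energy (Suc l) W"
proof -
  let ?s = "\<lambda>\<alpha>. \<integral>x. (W (Suc (fst \<alpha>), snd \<alpha>) x)\<^sup>2 \<partial>lborel" and ?t = "\<lambda>\<alpha>. \<integral>x. (W (fst \<alpha>, Suc (snd \<alpha>)) x)\<^sup>2 \<partial>lborel"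
  have step: "(\<integral>x. (W \<alpha> x)\<^sup>2 \<partial>lborel) \<le> 4 / \<mu> * d\<^sup>2 * (?s \<alpha> + ?t \<alpha>)" if \<alpha>: "\<alpha> \<in> mindices l" for \<alpha>
  proof -
    obtain i j where ij: "\<alpha> = (i, j)" "i + j = l" using \<alpha> by (cases \<alpha>) (simp add: mindices_def)
    have "measure lborel U * (\<integral>x. (W (i, j) x)\<^sup>2 \<partial>lborel)
       \<le> 4 * d ^ 4 * ((\<integral>x. (W (Suc i, j) x)\<^sup>2 \<partial>lborel) + (\<integral>x. (W (i, Suc j) x)\<^sup>2 \<partial>lborel))"
      by (rule poincare_convex[OF U d(1)]) (use W ij l mean[OF \<alpha>] in \<open>auto simp: jet_def\<close>)
    then have "measure lborel U * (\<integral>x. (W \<alpha> x)\<^sup>2 \<partial>lborel) \<le> 4 * d ^ 4 * (?s \<alpha> + ?t \<alpha>)" using ij by simp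
    moreover have "\<mu> * d\<^sup>2 * (\<integral>x. (W \<alpha> x)\<^sup>2 \<partial>lborel) \<le> measure lborel U * (\<integral>x. (W \<alpha> x)\<^sup>2 \<partial>lborel)"
      using \<mu> by (intro mult_right_mono) auto
    ultimately have "\<mu> * d\<^sup>2 * (\<integral>x. (W \<alpha> x)\<^sup>2 \<partial>lborel) \<le> 4 * d ^ 4 * (?s \<alpha> + ?t \<alpha>)" by linarith
    also have "\<dots> = \<mu> * d\<^sup>2 * (4 / \<mu> * d\<^sup>2 * (?s \<alpha> + ?t \<alpha>))" using \<mu> by (simp add: power2_eq_square power4_eq_xxxx)
    finally show ?thesis using \<mu>(1) d(2) by (simp only: mult_le_cancel_left) (auto simp: mult_le_0_iff)
  qed
  have s: "(\<Sum>\<alpha>\<in>mindices l. ?s \<alpha>) \<le> energy (Suc l) W"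
  proof -
    have "(\<Sum>\<alpha>\<in>mindices l. ?s \<alpha>) = (\<Sum>\<alpha>\<in>(\<lambda>\<alpha>. (Suc (fst \<alpha>), snd \<alpha>)) ` mindices l. \<integral>x. (W \<alpha> x)\<^sup>2 \<partial>lborel)"
      by (subst sum.reindex) (auto simp: inj_on_def prod_eq_iff)
    also have "\<dots> \<le> energy (Suc l) W"
      unfolding energy_def by (intro sum_mono2) (auto simp: mindices_def[of "Suc l"] mindices_def[of l] finite_mindices[unfolded mindices_def])
    finally show ?thesis .
  qed
  have t: "(\<Sum>\<alpha>\<in>mindices l. ?t \<alpha>) \<le> energy (Suc l) W"
  proof -
    have "(\<Sum>\<alpha>\<in>mindices l. ?t \<alpha>) = (\<Sum>\<alpha>\<in>(\<lambda>\<alpha>. (fst \<alpha>, Suc (snd \<alpha>))) ` mindices l. \<integral>x. (W \<alpha> x)\<^sup>2 \<partial>lborel)"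
      by (subst sum.reindex) (auto simp: inj_on_def prod_eq_iff)
    also have "\<dots> \<le> energy (Suc l) W"
      unfolding energy_def by (intro sum_mono2) (auto simp: mindices_def[of "Suc l"] mindices_def[of l] finite_mindices[unfolded mindices_def])
    finally show ?thesis .
  qed
  have "energy l W \<le> (\<Sum>\<alpha>\<in>mindices l. 4 / \<mu> * d\<^sup>2 * (?s \<alpha> + ?t \<alpha>))"
    unfolding energy_def by (rule sum_mono[OF step])
  also have "\<dots> = 4 / \<mu> * d\<^sup>2 * ((\<Sum>\<alpha>\<in>mindices l. ?s \<alpha>) + (\<Sum>\<alpha>\<in>mindices l. ?t \<alpha>))"
    by (simp add: sum_distrib_left sum.distrib distrib_left)
  also have "\<dots> \<le> 4 / \<mu> * d\<^sup>2 * (energy (Suc l) W + energy (Suc l) W)"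
    using s t \<mu>(1) by (intro mult_left_mono add_mono) auto
  finally show ?thesis by simp
qed

lemma energy_poincare:
  assumes U: "open U" "convex U" "bounded U" and d: "\<And>x y i. x \<in> U \<Longrightarrow> y \<in> U \<Longrightarrow> \<bar>x$i - y$i\<bar> \<le> d" "0 < d"
    and \<mu>: "0 < \<mu>" "\<mu> * d\<^sup>2 \<le> measure lborel U" and W: "jet U 6 W"
    and mean: "\<And>\<alpha>. \<alpha> \<in> mindices_upto 5 \<Longrightarrow> (\<integral>x. W \<alpha> x \<partial>lborel) = 0" and l: "l \<le> 6"
  shows "energy l W \<le> (8 / \<mu> * d\<^sup>2) ^ (6 - l) * energy 6 W"
  using l
proof (induction l rule: inc_induct)
  case base show ?case by simp
next
  case (step l)
  have "energy l W \<le> (8 / \<mu> * d\<^sup>2) * energy (Suc l) W"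
    by (rule energy_poincare_step[OF U d \<mu> W]) (use step mean in \<open>auto simp: mindices_def mindices_upto_def\<close>)
  also have "\<dots> \<le> (8 / \<mu> * d\<^sup>2) * ((8 / \<mu> * d\<^sup>2) ^ (6 - Suc l) * energy 6 W)"
    using step \<mu>(1) by (intro mult_left_mono) auto
  also have "\<dots> = (8 / \<mu> * d\<^sup>2) ^ (6 - l) * energy 6 W"
    using step by (simp add: Suc_diff_Suc[symmetric] mult.assoc)
  finally show ?case .
qed

text \<open>The number \<open>87 = 3 + 6 * 2 + 24 * 3\<close> collects the terms of \<open>sobolev_sup_convex\<close> with two first and three
second derivatives, each of which is bounded by the same quantity.\<close>

definition sup_const :: "real \<Rightarrow> real" where "sup_const \<mu> = 87 * (8 / \<mu>) ^ 6 / \<mu>"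

text \<open>The Sobolev inequality involves two further derivatives, so the order is limited to four. The three
integrals in it scale alike after insertion of \<open>energy_poincare\<close>, and the area in front of the square is
responsible for the loss of one power of \<open>d\<close>.\<close>

lemma jet_sup_bound:
  assumes U: "open U" "convex U" "bounded U" and d: "\<And>x y i. x \<in> U \<Longrightarrow> y \<in> U \<Longrightarrow> \<bar>x$i - y$i\<bar> \<le> d" "0 < d"
    and \<mu>: "0 < \<mu>" "\<mu> \<le> 1" "\<mu> * d\<^sup>2 \<le> measure lborel U" and W: "jet U 6 W"
    and mean: "\<And>\<alpha>. \<alpha> \<in> mindices_upto 5 \<Longrightarrow> (\<integral>x. W \<alpha> x \<partial>lborel) = 0" and ij: "i + j \<le> 4"
  shows "AE x in lborel. \<bar>W (i, j) x\<bar> \<le> sqrt (sup_const \<mu> * energy 6 W) * d ^ (5 - (i + j))"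
proof -
  define g where "g = i + j"
  let ?A = "8 / \<mu>" and ?E = "energy 6 W"
  have A: "1 \<le> ?A" using \<mu> by (simp add: field_simps)
  have E: "0 \<le> ?E" by (rule energy_nonneg)
  have en: "energy l W \<le> ?A ^ 6 * (d\<^sup>2) ^ (6 - l) * ?E" if "l \<le> 6" for l
  proof -
    have "energy l W \<le> (?A * d\<^sup>2) ^ (6 - l) * ?E" by (rule energy_poincare[OF U d \<mu>(1,3) W mean that])
    also have "\<dots> = ?A ^ (6 - l) * ((d\<^sup>2) ^ (6 - l) * ?E)" by (simp only: power_mult_distrib mult.assoc)
    also have "\<dots> \<le> ?A ^ 6 * ((d\<^sup>2) ^ (6 - l) * ?E)"
      using A E by (intro mult_right_mono power_increasing) auto
    finally show ?thesis by (simp add: mult.assoc)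
  qed
  have L: "L2_on U (W \<alpha>)" if "fst \<alpha> + snd \<alpha> \<le> 6" for \<alpha> using W that by (cases \<alpha>) (simp add: jet_def)
  have ig: "integrable lborel (\<lambda>x. (W \<alpha> x)\<^sup>2)" if "fst \<alpha> + snd \<alpha> \<le> 6" for \<alpha> using L[OF that] by (simp add: L2_on_def)
  have le: "(\<integral>x. (W \<alpha> x)\<^sup>2 \<partial>lborel) \<le> ?A ^ 6 * (d\<^sup>2) ^ (6 - l) * ?E" if "fst \<alpha> + snd \<alpha> = l" "l \<le> 6" for \<alpha> l
    using integral_le_energy[of \<alpha> l W] en[OF that(2)] that(1) by (simp add: mindices_def)
  define X where "X = ?A ^ 6 * (d\<^sup>2) ^ (6 - g) * ?E"
  have n0: "(\<integral>x. (W (i, j) x)\<^sup>2 \<partial>lborel) \<le> X" using le[of "(i, j)" g] ij by (simp add: g_def X_def)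
  have d1: "d\<^sup>2 * (?A ^ 6 * (d\<^sup>2) ^ (6 - Suc g) * ?E) = X"
    using ij by (simp add: X_def g_def[symmetric] Suc_diff_Suc[symmetric])
  have d2: "d ^ 4 * (?A ^ 6 * (d\<^sup>2) ^ (6 - Suc (Suc g)) * ?E) = X"
    unfolding d1[symmetric] using ij by (simp add: g_def[symmetric] Suc_diff_Suc[symmetric] power2_eq_square power4_eq_xxxx)
  have "(\<integral>x. (W (Suc i, j) x)\<^sup>2 + (W (i, Suc j) x)\<^sup>2 \<partial>lborel) \<le> 2 * (?A ^ 6 * (d\<^sup>2) ^ (6 - Suc g) * ?E)"
    using le[of "(Suc i, j)" "Suc g"] le[of "(i, Suc j)" "Suc g"] ij ig[of "(Suc i, j)"] ig[of "(i, Suc j)"] by (simp add: g_def)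
  then have "d\<^sup>2 * (\<integral>x. (W (Suc i, j) x)\<^sup>2 + (W (i, Suc j) x)\<^sup>2 \<partial>lborel) \<le> d\<^sup>2 * (2 * (?A ^ 6 * (d\<^sup>2) ^ (6 - Suc g) * ?E))"
    by (rule mult_left_mono) simp
  then have n1: "d\<^sup>2 * (\<integral>x. (W (Suc i, j) x)\<^sup>2 + (W (i, Suc j) x)\<^sup>2 \<partial>lborel) \<le> 2 * X" using d1 by simp
  have "(\<integral>x. (W (Suc (Suc i), j) x)\<^sup>2 + (W (Suc i, Suc j) x)\<^sup>2 + (W (i, Suc (Suc j)) x)\<^sup>2 \<partial>lborel) \<le> 3 * (?A ^ 6 * (d\<^sup>2) ^ (6 - Suc (Suc g)) * ?E)"
    using le[of "(Suc (Suc i), j)" "Suc (Suc g)"] le[of "(Suc i, Suc j)" "Suc (Suc g)"] le[of "(i, Suc (Suc j))" "Suc (Suc g)"] ij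
      ig[of "(Suc (Suc i), j)"] ig[of "(Suc i, Suc j)"] ig[of "(i, Suc (Suc j))"] by (simp add: g_def)
  then have "d ^ 4 * (\<integral>x. (W (Suc (Suc i), j) x)\<^sup>2 + (W (Suc i, Suc j) x)\<^sup>2 + (W (i, Suc (Suc j)) x)\<^sup>2 \<partial>lborel) \<le> d ^ 4 * (3 * (?A ^ 6 * (d\<^sup>2) ^ (6 - Suc (Suc g)) * ?E))"
    by (rule mult_left_mono) simp
  then have n2: "d ^ 4 * (\<integral>x. (W (Suc (Suc i), j) x)\<^sup>2 + (W (Suc i, Suc j) x)\<^sup>2 + (W (i, Suc (Suc j)) x)\<^sup>2 \<partial>lborel) \<le> 3 * X" using d2 by simp
  have "AE x in lborel. x \<in> U \<longrightarrow> measure lborel U * (W (i, j) x)\<^sup>2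
     \<le> 3 * (\<integral>x. (W (i, j) x)\<^sup>2 \<partial>lborel) + 6 * d\<^sup>2 * (\<integral>x. (W (Suc i, j) x)\<^sup>2 + (W (i, Suc j) x)\<^sup>2 \<partial>lborel)
       + 24 * d^4 * (\<integral>x. (W (Suc (Suc i), j) x)\<^sup>2 + (W (Suc i, Suc j) x)\<^sup>2 + (W (i, Suc (Suc j)) x)\<^sup>2 \<partial>lborel)"
    by (rule sobolev_sup_convex[OF U d(1)]) (use W ij in \<open>auto simp: jet_def\<close>)
  then show ?thesis
  proof eventually_elim
    case (elim x)
    show ?case
    proof (cases "x \<in> U")
      case True
      have "\<mu> * d\<^sup>2 * (W (i, j) x)\<^sup>2 \<le> measure lborel U * (W (i, j) x)\<^sup>2" using \<mu>(3) by (rule mult_right_mono) simp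
      also have "\<dots> \<le> 87 * X" using elim True n0 n1 n2 by linarith
      also have "\<dots> = \<mu> * d\<^sup>2 * (sup_const \<mu> * ?E * (d ^ (5 - g))\<^sup>2)"
        unfolding d1[symmetric] using \<mu>(1) by (simp add: sup_const_def power_mult[symmetric] mult_ac)
      finally have "(W (i, j) x)\<^sup>2 \<le> sup_const \<mu> * ?E * (d ^ (5 - g))\<^sup>2"
        using \<mu>(1) d(2) by (simp only: mult_le_cancel_left) (auto simp: mult_le_0_iff)
      then have "sqrt ((W (i, j) x)\<^sup>2) \<le> sqrt (sup_const \<mu> * ?E * (d ^ (5 - g))\<^sup>2)" by (rule real_sqrt_le_mono)
      then show ?thesis using d(2) by (simp add: real_sqrt_mult g_def)
    next
      case False
      then have "W (i, j) x = 0" using L[of "(i, j)"] ij by (auto simp: L2_on_def)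
      then show ?thesis using E \<mu>(1) d(2) by (simp add: sup_const_def)
    qed
  qed
qed

lemma islimpt_open_closure:
  fixes z :: pt assumes "open U" "z \<in> closure U" shows "z islimpt U"
  using assms interior_limit_point[of z U] by (auto simp: closure_def interior_open)

lemma continuous_bound_of_AE:
  assumes U: "open U" and f: "continuous_on U f" and le: "AE x in lborel. \<bar>zext U f x\<bar> \<le> B" and x: "x \<in> U"
  shows "\<bar>f x\<bar> \<le> B"
proof -
  have "open (U \<inter> (\<lambda>x. \<bar>f x\<bar>) -` {B<..})"
    by (rule continuous_open_preimage) (use U f in \<open>auto intro!: continuous_intros\<close>)
  moreover have "AE x in lborel. x \<notin> U \<inter> (\<lambda>x. \<bar>f x\<bar>) -` {B<..}"
    using le by eventually_elim (auto simp: zext_def)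
  ultimately have "U \<inter> (\<lambda>x. \<bar>f x\<bar>) -` {B<..} = {}" by (rule AE_not_in_open_imp_empty)
  then show ?thesis using x by (auto simp: not_less)
qed

lemma weak_partial_AE_cong:
  assumes "weak_partial U k f g" "AE x in lborel. f x = f' x" "f \<in> borel_measurable borel" "f' \<in> borel_measurable borel"
  shows "weak_partial U k f' g"
  unfolding weak_partial_def
proof (intro allI impI)
  fix \<phi> assume \<phi>: "test_function U \<phi>"
  have "(\<integral>x. f' x * partial k \<phi> x \<partial>lborel) = (\<integral>x. f x * partial k \<phi> x \<partial>lborel)"
  proof (rule integral_cong_AE)
    show "AE x in lborel. f' x * partial k \<phi> x = f x * partial k \<phi> x" using assms(2) by eventually_elim simp
  qed (use assms test_function_measurable[OF test_function_partial[OF \<phi>]] in auto)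
  then show "(\<integral>x. f' x * partial k \<phi> x \<partial>lborel) = - (\<integral>x. g x * \<phi> x \<partial>lborel)"
    using assms(1) \<phi> by (simp add: weak_partial_def)
qed

text \<open>The next derivatives are bounded by \<open>jet_sup_bound\<close>, so the function is Lipschitz, hence uniformly
continuous, and extends to the closure. The function \<open>f\<close> is a continuous representative of a member of the
jet; in the application it is a classical derivative.\<close>

theorem jet_trace:
  assumes U: "open U" "convex U" "bounded U" and d: "\<And>x y i. x \<in> U \<Longrightarrow> y \<in> U \<Longrightarrow> \<bar>x$i - y$i\<bar> \<le> d" "0 < d"
    and \<mu>: "0 < \<mu>" "\<mu> \<le> 1" "\<mu> * d\<^sup>2 \<le> measure lborel U" and W: "jet U 6 W"
    and mean: "\<And>\<alpha>. \<alpha> \<in> mindices_upto 5 \<Longrightarrow> (\<integral>x. W \<alpha> x \<partial>lborel) = 0" and ij: "i + j \<le> 3"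
    and f: "continuous_on U f" "AE x in lborel. W (i, j) x = zext U f x" and z: "z \<in> closure U"
  obtains t where "(f \<longlongrightarrow> t) (at z within U)" "\<bar>t\<bar> \<le> sqrt (sup_const \<mu> * energy 6 W) * d ^ (5 - (i + j))"
proof -
  let ?B = "sqrt (sup_const \<mu> * energy 6 W)"
  note sup = jet_sup_bound[OF U d \<mu> W mean]
  have LW: "L2_on U (W (i, j))" "L2_on U (W (Suc i, j))" "L2_on U (W (i, Suc j))" using W ij by (auto simp: jet_def)
  have mz: "zext U f \<in> borel_measurable borel" by (rule borel_measurable_zext[OF U(1) f(1)])
  have mW: "W (i, j) \<in> borel_measurable borel" using LW by (simp add: L2_on_def)
  have Lz: "L2_on U (zext U f)"
  proof -
    have "integrable lborel (\<lambda>x. (W (i, j) x)\<^sup>2)" using LW by (simp add: L2_on_def)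
    then have "integrable lborel (\<lambda>x. (zext U f x)\<^sup>2)"
    proof (rule integrable_cong_AE_imp)
      show "AE x in lborel. (W (i, j) x)\<^sup>2 = (zext U f x)\<^sup>2" using f(2) by eventually_elim simp
    qed (use mz in simp)
    then show ?thesis using mz by (simp add: L2_on_def zext_def)
  qed
  have wp: "weak_partial U 1 (zext U f) (W (Suc i, j))" "weak_partial U 2 (zext U f) (W (i, Suc j))"
    using W ij by (auto intro!: weak_partial_AE_cong[OF _ f(2) mW mz] simp: jet_def)
  have cz: "continuous_on U (zext U f)" by (rule continuous_on_eq[OF f(1)]) (simp add: zext_def)
  let ?M = "?B * d ^ (4 - (i + j))"
  have M: "AE x in lborel. \<bar>W (Suc i, j) x\<bar> \<le> ?M" "AE x in lborel. \<bar>W (i, Suc j) x\<bar> \<le> ?M"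
    using sup[of "Suc i" j] sup[of i "Suc j"] ij by auto
  have lip: "\<bar>f y - f x\<bar> \<le> 2 * ?M * norm (y - x)" if "x \<in> U" "y \<in> U" for x y
    using lipschitz_of_bounded_weak_gradient[OF U Lz LW(2,3) wp cz M that] that by (simp add: zext_def)
  have M0: "0 \<le> ?M" using d(2) \<mu>(1) energy_nonneg[of 6 W] by (simp add: sup_const_def)
  have "uniformly_continuous_on U f"
    unfolding uniformly_continuous_on_def
  proof (intro allI impI)
    fix e :: real assume e: "0 < e"
    show "\<exists>\<delta>>0. \<forall>x\<in>U. \<forall>y\<in>U. dist y x < \<delta> \<longrightarrow> dist (f y) (f x) < e"
    proof (intro exI[of _ "e / (2 * ?M + 1)"] conjI ballI impI)
      show "0 < e / (2 * ?M + 1)" using e M0 by simp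
      fix x y assume xy: "x \<in> U" "y \<in> U" "dist y x < e / (2 * ?M + 1)"
      have "\<bar>f y - f x\<bar> \<le> 2 * ?M * norm (y - x)" by (rule lip[OF xy(1,2)])
      also have "\<dots> \<le> (2 * ?M + 1) * norm (y - x)" using M0 by (intro mult_right_mono) auto
      also have "\<dots> < e" using xy(3) M0 by (simp add: dist_norm pos_less_divide_eq mult.commute)
      finally show "dist (f y) (f x) < e" by (simp add: dist_real_def)
    qed
  qed
  from uniformly_continuous_on_extension_at_closure[OF this z] obtain t where t: "(f \<longlongrightarrow> t) (at z within U)" .
  have "AE x in lborel. \<bar>zext U f x\<bar> \<le> ?B * d ^ (5 - (i + j))"
    using sup[of i j] f(2) ij by (auto elim: eventually_elim2)
  then have b: "\<bar>f x\<bar> \<le> ?B * d ^ (5 - (i + j))" if "x \<in> U" for x using continuous_bound_of_AE[OF U(1) f(1) _ that] by blast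
  have "\<bar>t\<bar> \<le> ?B * d ^ (5 - (i + j))"
  proof (rule tendsto_upperbound)
    show "((\<lambda>x. \<bar>f x\<bar>) \<longlongrightarrow> \<bar>t\<bar>) (at z within U)" by (rule tendsto_rabs[OF t])
    show "\<forall>\<^sub>F x in at z within U. \<bar>f x\<bar> \<le> ?B * d ^ (5 - (i + j))" using b by (auto simp: eventually_at_filter)
    show "at z within U \<noteq> bot" using islimpt_open_closure[OF U(1) z] by (simp add: trivial_limit_within)
  qed
  with t show thesis using that by blast
qed

lemma jet_classical_step:
  assumes U: "open U" "bounded U" and G: "weak_partial U k g g'" "L2_on U g" "L2_on U g'" and eq: "AE x in lborel. g x = zext U f x"
    and f: "\<And>x. x \<in> U \<Longrightarrow> f differentiable (at x)" "continuous_on U (partial k f)"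
  shows "AE x in lborel. g' x = zext U (partial k f) x"
proof (rule weak_eq_classical[OF U(1) f(2)])
  show "integrable lborel g'" by (rule L2_on_integrable[OF G(3) U])
  show "g' x = 0" if "x \<notin> U" for x using G(3) that by (simp add: L2_on_def)
  fix \<phi> assume \<phi>: "test_function U \<phi>"
  have fc: "continuous_on U f"
    using f(1) by (intro continuous_at_imp_continuous_on ballI differentiable_imp_continuous_within)
  have "weak_partial U k (zext U f) g'"
    by (rule weak_partial_AE_cong[OF G(1) eq L2_on_measurable[OF G(2)] borel_measurable_zext[OF U(1) fc]])
  then show "(\<integral>x. g' x * \<phi> x \<partial>lborel) = (\<integral>x. zext U (partial k f) x * \<phi> x \<partial>lborel)"
    using weak_partial_classical[OF U(1) f] \<phi> by (simp add: weak_partial_def)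
qed

text \<open>On \<open>U\<close> the classical derivatives of \<open>u\<close> are weak derivatives, so uniqueness identifies them with the
members of the jet, one order at a time.\<close>

lemma jet_classical:
  assumes U: "open U" "bounded U" and G: "jet U m G" "2 \<le> m" and eq: "AE x in lborel. G (0, 0) x = zext U u x"
    and u: "Ck_on 2 U u" and \<alpha>: "\<alpha> \<in> mindices_upto 2"
  shows "AE x in lborel. G \<alpha> x = zext U (mderiv \<alpha> u) x" "continuous_on U (mderiv \<alpha> u)"
proof -
  have u2: "u differentiable (at x)" "partial k u differentiable (at x)" if "x \<in> U" for x k
    using u that by (auto simp: numeral_2_eq_2)
  have c2: "continuous_on U (partial l (partial k u))" for k l using u by (simp add: numeral_2_eq_2)
  have c1: "continuous_on U (partial k u)" for k
    using u2(2) by (intro continuous_at_imp_continuous_on ballI differentiable_imp_continuous_within)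
  have c0: "continuous_on U u"
    using u2(1) by (intro continuous_at_imp_continuous_on ballI differentiable_imp_continuous_within)
  have L: "L2_on U (G (i, j))" if "i + j \<le> 2" for i j using G that by (simp add: jet_def)
  have w: "weak_partial U 1 (G (i, j)) (G (Suc i, j))" "weak_partial U 2 (G (i, j)) (G (i, Suc j))" if "i + j \<le> 1" for i j
    using G that by (simp_all add: jet_def)
  have 10: "AE x in lborel. G (Suc 0, 0) x = zext U (partial 1 u) x"
    by (rule jet_classical_step[OF U w(1) L L eq u2(1) c1]) auto
  have 01: "AE x in lborel. G (0, Suc 0) x = zext U (partial 2 u) x"
    by (rule jet_classical_step[OF U w(2) L L eq u2(1) c1]) auto
  have 20: "AE x in lborel. G (Suc (Suc 0), 0) x = zext U (partial 1 (partial 1 u)) x"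
    by (rule jet_classical_step[OF U w(1) L L 10 u2(2) c2]) auto
  have 11: "AE x in lborel. G (Suc 0, Suc 0) x = zext U (partial 1 (partial 2 u)) x"
    by (rule jet_classical_step[OF U w(1) L L 01 u2(2) c2]) auto
  have 02: "AE x in lborel. G (0, Suc (Suc 0)) x = zext U (partial 2 (partial 2 u)) x"
    by (rule jet_classical_step[OF U w(2) L L 01 u2(2) c2]) auto
  have "(AE x in lborel. G \<alpha> x = zext U (mderiv \<alpha> u) x) \<and> continuous_on U (mderiv \<alpha> u)"
    using \<alpha> eq 10 01 20 11 02 c0 c1 c2 unfolding mindices_upto_2
    by (elim insertE emptyE) (simp_all add: mderiv_def numeral_2_eq_2)
  then show "AE x in lborel. G \<alpha> x = zext U (mderiv \<alpha> u) x" "continuous_on U (mderiv \<alpha> u)" by auto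
qed

section \<open>The interpolation error on one cell\<close>

text \<open>A degree of freedom of \<open>u\<close> seen from \<open>U\<close>. Nodes may lie on the boundary of the domain, where \<open>u\<close> need not
be differentiable, so limits from inside take the place of values.\<close>

fun trace_dof :: "(pt set \<Rightarrow> pt) \<Rightarrow> pt set \<Rightarrow> dof \<Rightarrow> (pt \<Rightarrow> real) \<Rightarrow> real" where
  "trace_dof nrm U (Vertex_Dof a \<alpha>) u = Lim (at a within U) (mderiv \<alpha> u)"
| "trace_dof nrm U (Edge_Dof e) u = (\<chi> k. Lim (at (edge_midpoint e) within U) (partial k u)) \<bullet> nrm e"

definition cell_const :: "real \<Rightarrow> real" where
  "cell_const \<sigma> = sqrt (2 * (16 / \<sigma>) ^ 6 + 224 * (argyris_const \<sigma>)\<^sup>2 * sup_const (\<sigma> / 2)) + 1"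

lemma partial_eq_mderiv: "partial k u = mderiv (if k = 1 then (1, 0) else (0, 1)) u"
  using exhaust_2[of k] by (auto simp: mderiv_def)

lemma energy_diff_le:
  assumes G: "jet U m G" and H: "jet U m H" and l: "l \<le> m"
  shows "energy l (\<lambda>\<alpha> x. G \<alpha> x - H \<alpha> x) \<le> 2 * energy l G + 2 * energy l H"
proof -
  have "(\<integral>x. (G \<alpha> x - H \<alpha> x)\<^sup>2 \<partial>lborel) \<le> 2 * (\<integral>x. (G \<alpha> x)\<^sup>2 \<partial>lborel) + 2 * (\<integral>x. (H \<alpha> x)\<^sup>2 \<partial>lborel)"
    if "\<alpha> \<in> mindices l" for \<alpha>
  proof -
    have L: "L2_on U (G \<alpha>)" "L2_on U (H \<alpha>)" using G H that l by (cases \<alpha>; auto simp: jet_def mindices_def)+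
    then have i: "integrable lborel (\<lambda>x. (G \<alpha> x)\<^sup>2)" "integrable lborel (\<lambda>x. (H \<alpha> x)\<^sup>2)"
      "integrable lborel (\<lambda>x. (G \<alpha> x - H \<alpha> x)\<^sup>2)"
      using L2_on_add[OF L(1) L2_on_cmult[OF L(2), of "-1"]] by (auto simp: L2_on_def)
    have "(a - b)\<^sup>2 \<le> 2 * a\<^sup>2 + 2 * b\<^sup>2" for a b :: real
      using zero_le_power2[of "a + b"] by (simp add: power2_eq_square algebra_simps)
    then have "(\<integral>x. (G \<alpha> x - H \<alpha> x)\<^sup>2 \<partial>lborel) \<le> (\<integral>x. 2 * (G \<alpha> x)\<^sup>2 + 2 * (H \<alpha> x)\<^sup>2 \<partial>lborel)"
      using i by (intro integral_mono) auto
    then show ?thesis using i by simp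
  qed
  then have "energy l (\<lambda>\<alpha> x. G \<alpha> x - H \<alpha> x) \<le> (\<Sum>\<alpha>\<in>mindices l. 2 * (\<integral>x. (G \<alpha> x)\<^sup>2 \<partial>lborel) + 2 * (\<integral>x. (H \<alpha> x)\<^sup>2 \<partial>lborel))"
    unfolding energy_def by (rule sum_mono)
  then show ?thesis by (simp add: energy_def sum.distrib sum_distrib_left)
qed

lemma measure_le_square:
  assumes U: "open (U :: pt set)" and d: "\<And>x y i. x \<in> U \<Longrightarrow> y \<in> U \<Longrightarrow> \<bar>x$i - y$i\<bar> \<le> d" "0 < d"
  shows "measure lborel U \<le> 4 * d\<^sup>2"
proof (cases "U = {}")
  case False
  then obtain z where z: "z \<in> U" by blast
  let ?b = "(\<chi> i. d) :: pt"
  have "U \<subseteq> cbox (z - ?b) (z + ?b)"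
  proof
    fix x assume "x \<in> U"
    then have "\<bar>x$i - z$i\<bar> \<le> d" for i using d(1) z by blast
    then have "z$i - d \<le> x$i \<and> x$i \<le> z$i + d" for i by (smt (verit))
    then show "x \<in> cbox (z - ?b) (z + ?b)" by (simp add: mem_box_cart)
  qed
  then have "measure lborel U \<le> measure lborel (cbox (z - ?b) (z + ?b))"
    using U by (intro measure_mono_fmeasurable) auto
  also have "\<dots> = 4 * d\<^sup>2"
    using d(2) by (subst content_cbox_if_cart) (auto simp: UNIV_2 interval_eq_empty_cart power2_eq_square not_less)
  finally show ?thesis .
qed simp

text \<open>With the quintic \<open>q\<close> of \<open>moment_polynomial\<close>, the error splits as \<open>u - P = W - R\<close> with \<open>W = u - q\<close> and
\<open>R = P - q\<close>. The first term is bounded by \<open>energy_poincare\<close>. The degrees of freedom of \<open>R\<close> are traces of \<open>W\<close>,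
which \<open>jet_trace\<close> bounds, and \<open>argyris_estimate\<close> passes from them to \<open>R\<close>. The traces of the derivatives
of \<open>u\<close> are those of the derivatives of \<open>W\<close> plus values of derivatives of \<open>q\<close>.\<close>

theorem cell_interpolation:
  assumes cell: "argyris_cell vert nrm K a b c (diameter K) \<sigma>"
    and K: "compact K" "convex K" "convex hull (vert K) \<subseteq> K"
    and u: "Ck_on 2 (interior K) u" "u \<in> sobolev 6 (interior K)"
  shows "\<And>z \<alpha>. z \<in> K \<Longrightarrow> \<alpha> \<in> mindices_upto 2 \<Longrightarrow> \<exists>t. (mderiv \<alpha> u \<longlongrightarrow> t) (at z within interior K)"
    and "\<And>P v l. P \<in> polys 5 \<Longrightarrow> (\<And>d. d \<in> cell_dofs vert K \<Longrightarrow> dof_value nrm d P = trace_dof nrm (interior K) d u) \<Longrightarrow>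
      (\<And>x. x \<in> interior K \<Longrightarrow> v x = P x) \<Longrightarrow> l \<le> 6 \<Longrightarrow>
      sobolev_seminorm l K (\<lambda>x. u x - v x) \<le> cell_const \<sigma> * diameter K ^ (6 - l) * sobolev_seminorm 6 K u"
proof -
  define U where "U = interior K"
  define h where "h = diameter K"
  define \<mu> where "\<mu> = \<sigma> / 2"
  have s: "0 < \<sigma>" "\<sigma> \<le> 1" "0 < h" and vK: "vert K = {a, b, c}" using cell by (auto simp: argyris_cell_def h_def)
  have bK: "bounded K" using K(1) by (rule compact_imp_bounded)
  have U: "open U" "convex U" "bounded U" unfolding U_def
    using K bK by (auto simp: convex_interior bounded_interior)
  have UK: "U \<subseteq> K" unfolding U_def by (rule interior_subset)
  have dK: "norm (x - y) \<le> h" if "x \<in> K" "y \<in> K" for x y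
    using diameter_bounded_bound[OF bK that] by (simp add: dist_norm h_def)
  have d: "\<And>x y i. x \<in> U \<Longrightarrow> y \<in> U \<Longrightarrow> \<bar>x$i - y$i\<bar> \<le> h" "0 < h"
    using dK UK component_le_norm_cart s(3) by (metis (no_types, opaque_lifting) order_trans subsetD vector_minus_component) (rule s(3))
  have \<mu>: "0 < \<mu>" "\<mu> \<le> 1" "\<mu> * h\<^sup>2 \<le> measure lborel U"
    using s cell_area_ge[OF cell K] by (auto simp: \<mu>_def U_def h_def)
  have mU: "0 < measure lborel U"
  proof -
    have "0 < \<mu> * h\<^sup>2" using \<mu>(1) s(3) by simp
    then show ?thesis using \<mu>(3) by linarith
  qed
  have clU: "closure U = K"
  proof -
    have "U \<noteq> {}" using mU by auto
    then show ?thesis unfolding U_def using convex_closure_interior[OF K(2)] K(1) by (simp add: compact_imp_closed)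
  qed
  have cu: "continuous_on U u" using u(1) Ck_on_imp_continuous by (simp add: U_def)
  obtain G where G: "jet U 6 G" "AE x in lborel. G (0, 0) x = zext U u x"
    using sobolev_imp_jet[OF U(1,3) u(2)[folded U_def] cu] by blast
  obtain q where q: "q \<in> polys 5" "\<And>\<alpha>. \<alpha> \<in> mindices_upto 5 \<Longrightarrow> (\<integral>x. smooth_jet U q \<alpha> x \<partial>lborel) = (\<integral>x. G \<alpha> x \<partial>lborel)"
    using moment_polynomial[OF U(1,3) mU, of "\<lambda>\<alpha>. \<integral>x. G \<alpha> x \<partial>lborel"] by blast
  have sq: "smooth q" using q(1) by (rule smooth_polys)
  define W where "W = (\<lambda>\<alpha> x. G \<alpha> x - smooth_jet U q \<alpha> x)"
  have Jq: "jet U 6 (smooth_jet U q)" by (rule jet_smooth_jet[OF U(1,3) sq])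
  have W: "jet U 6 W" unfolding W_def by (rule jet_diff[OF U(1,3) G(1) Jq])
  have mean: "(\<integral>x. W \<alpha> x \<partial>lborel) = 0" if \<alpha>5: "\<alpha> \<in> mindices_upto 5" for \<alpha>
  proof -
    obtain i j where ij: "\<alpha> = (i, j)" "i + j \<le> 6" using \<alpha>5 by (cases \<alpha>) (auto simp: mindices_upto_def)
    have "integrable lborel (G \<alpha>)" "integrable lborel (smooth_jet U q \<alpha>)"
      using G(1) Jq ij by (auto simp: jet_def intro!: L2_on_integrable[OF _ U(1,3)])
    then show ?thesis using q(2)[OF \<alpha>5] by (simp add: W_def)
  qed
  let ?E = "energy 6 W" and ?S = "sup_const \<mu>"
  \<comment> \<open>sixth derivatives of a quintic vanish\<close>
  have EG: "?E = energy 6 G"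
  proof -
    have "smooth_jet U q \<alpha> = (\<lambda>x. 0)" if "\<alpha> \<in> mindices 6" for \<alpha>
      using mderiv_polys_high[OF q(1), of \<alpha>] that by (auto simp: smooth_jet_def zext_def mindices_def)
    then show ?thesis by (simp add: energy_def W_def)
  qed
  have E0: "0 \<le> ?E" by (rule energy_nonneg)
  have S0: "0 \<le> ?S" using \<mu>(1) by (simp add: sup_const_def)
  let ?B = "sqrt (?S * ?E)"
  have trace: "\<exists>t. (mderiv \<alpha> u \<longlongrightarrow> t) (at z within U) \<and> \<bar>t - mderiv \<alpha> q z\<bar> \<le> ?B * h ^ (5 - (fst \<alpha> + snd \<alpha>))"
    if z: "z \<in> K" and \<alpha>: "\<alpha> \<in> mindices_upto 2" for z \<alpha>
  proof -
    obtain i j where ij: "\<alpha> = (i, j)" "i + j \<le> 2" using \<alpha> by (cases \<alpha>) (simp add: mindices_upto_def)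
    note cl = jet_classical[OF U(1,3) G(1) _ G(2) u(1)[folded U_def] \<alpha>, simplified]
    have cq: "continuous_on UNIV (mderiv \<alpha> q)" by (intro smooth_continuous smooth_mderiv sq)
    have ae: "AE x in lborel. W (i, j) x = zext U (\<lambda>x. mderiv \<alpha> u x - mderiv \<alpha> q x) x"
      using cl(1) by eventually_elim (auto simp: W_def smooth_jet_def zext_def ij(1))
    have co: "continuous_on U (\<lambda>x. mderiv \<alpha> u x - mderiv \<alpha> q x)"
      using cl(2) continuous_on_subset[OF cq] by (intro continuous_on_diff) auto
    have ij3: "i + j \<le> 3" and z': "z \<in> closure U" using ij(2) z clU by auto
    from jet_trace[OF U d \<mu> W mean ij3 co ae z'] obtain t where
      t: "((\<lambda>x. mderiv \<alpha> u x - mderiv \<alpha> q x) \<longlongrightarrow> t) (at z within U)" "\<bar>t\<bar> \<le> ?B * h ^ (5 - (i + j))"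
      by blast
    have "(mderiv \<alpha> q \<longlongrightarrow> mderiv \<alpha> q z) (at z within U)"
      using cq tendsto_within_subset[of "mderiv \<alpha> q" _ z UNIV U] by (simp add: continuous_on)
    from tendsto_add[OF t(1) this] have "(mderiv \<alpha> u \<longlongrightarrow> t + mderiv \<alpha> q z) (at z within U)" by simp
    then show ?thesis using t(2) ij(1) by (intro exI[of _ "t + mderiv \<alpha> q z"]) simp
  qed
  then show "\<And>z \<alpha>. z \<in> K \<Longrightarrow> \<alpha> \<in> mindices_upto 2 \<Longrightarrow> \<exists>t. (mderiv \<alpha> u \<longlongrightarrow> t) (at z within interior K)"
    unfolding U_def by blast
  have Lim: "\<bar>Lim (at z within U) (mderiv \<alpha> u) - mderiv \<alpha> q z\<bar> \<le> ?B * h ^ (5 - (fst \<alpha> + snd \<alpha>))"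
    if z: "z \<in> K" and \<alpha>: "\<alpha> \<in> mindices_upto 2" for z \<alpha>
  proof -
    have "at z within U \<noteq> bot"
      using islimpt_open_closure[OF U(1), of z] z clU by (simp add: trivial_limit_within)
    then show ?thesis using trace[OF z \<alpha>] tendsto_Lim by blast
  qed
  have inK: "x \<in> K" if "x \<in> convex hull {a, b, c}" for x using that K(3) vK by auto
  have vin: "v \<in> K" if "v \<in> {a, b, c}" for v using inK[OF hull_inc[OF that]] .
  fix P v l assume P: "P \<in> polys 5" and dofs: "\<And>d. d \<in> cell_dofs vert K \<Longrightarrow> dof_value nrm d P = trace_dof nrm (interior K) d u"
    and v: "\<And>x. x \<in> interior K \<Longrightarrow> v x = P x" and l: "l \<le> (6::nat)"
  have sP: "smooth P" using P by (rule smooth_polys)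
  define R where "R = (\<lambda>x. 1 * P x + (-1) * q x)"
  have R: "R \<in> polys 5" unfolding R_def by (rule polys_linear[OF P q(1)])
  have sR: "smooth R" using R by (rule smooth_polys)
  \<comment> \<open>bounds all scaled degrees of freedom of \<open>R\<close>; the factor \<open>2\<close> stems from the two components of a
    normal derivative\<close>
  define M where "M = 2 * ?B * h ^ 5"
  have Rdofs: "\<bar>dof_value nrm d R\<bar> * h ^ dof_order d \<le> M" if d: "d \<in> cell_dofs vert K" for d
  proof -
    have dv: "dof_value nrm d R = trace_dof nrm U d u - dof_value nrm d q"
      unfolding R_def dof_value_linear[OF sP sq] using dofs[OF d] by (simp add: U_def)
    have hh: "h ^ (5 - n) * h ^ n = h ^ 5" if "n \<le> 5" for n using that by (simp add: power_add[symmetric])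
    show ?thesis
    proof (cases d)
      case (Vertex_Dof w \<alpha>)
      then have w: "w \<in> {a, b, c}" "\<alpha> \<in> mindices_upto 2" using d vK by (auto simp: cell_dofs_def)
      have "\<bar>dof_value nrm d R\<bar> * h ^ dof_order d \<le> ?B * h ^ (5 - (fst \<alpha> + snd \<alpha>)) * h ^ (fst \<alpha> + snd \<alpha>)"
        unfolding dv using Lim[OF vin[OF w(1)] w(2)] s(3) Vertex_Dof by (simp add: mult_right_mono)
      also have "\<dots> = ?B * h ^ 5" using hh[of "fst \<alpha> + snd \<alpha>"] w(2) by (simp add: mindices_upto_def mult.assoc)
      also have "\<dots> \<le> M" using s(3) S0 E0 by (simp add: M_def)
      finally show ?thesis .
    next
      case (Edge_Dof e)
      then have e: "e \<subseteq> {a, b, c}" "card e = 2" using d vK by (auto simp: cell_dofs_def edges_def)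
      then obtain x y where xy: "e = {x, y}" "x \<noteq> y" by (auto simp: card_2_iff)
      let ?m = "edge_midpoint e"
      have "?m = (1/2) *\<^sub>R x + (1/2) *\<^sub>R y" using xy by (simp add: edge_midpoint_pair scaleR_add_right)
      moreover have "(1/2) *\<^sub>R x + (1/2) *\<^sub>R y \<in> K" using e(1) xy(1) vin K(2) by (intro convexD) auto
      ultimately have mK: "?m \<in> K" by simp
      have n1: "norm (nrm e) = 1"
        using cell e(1) xy unfolding argyris_cell_def by (auto simp: insert_commute)
      let ?w = "\<lambda>k. Lim (at ?m within U) (partial k u) - partial k q ?m"
      have wk: "\<bar>?w k\<bar> \<le> ?B * h ^ 4" for k
        unfolding partial_eq_mderiv using Lim[OF mK, of "if k = 1 then (1, 0) else (0, 1)"]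
        by (auto simp: mindices_upto_def split: if_splits)
      have nk: "\<bar>nrm e $ k\<bar> \<le> 1" for k using component_le_norm_cart[of "nrm e" k] n1 by simp
      have "dof_value nrm d R = ?w 1 * nrm e $ 1 + ?w 2 * nrm e $ 2"
        using dv by (simp add: Edge_Dof grad_def inner_pt algebra_simps)
      also have "\<bar>\<dots>\<bar> \<le> \<bar>?w 1\<bar> * \<bar>nrm e $ 1\<bar> + \<bar>?w 2\<bar> * \<bar>nrm e $ 2\<bar>"
        unfolding abs_mult[symmetric] by (rule abs_triangle_ineq)
      also have "\<dots> \<le> ?B * h ^ 4 * 1 + ?B * h ^ 4 * 1"
        using wk nk s(3) S0 E0 by (intro add_mono mult_mono) auto
      finally have "\<bar>dof_value nrm d R\<bar> \<le> 2 * ?B * h ^ 4" by (simp add: mult_ac)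
      then have "\<bar>dof_value nrm d R\<bar> * h \<le> (2 * ?B * h ^ 4) * h" using s(3) by (intro mult_right_mono) auto
      also have "\<dots> = M" by (simp add: M_def eval_nat_numeral)
      finally show ?thesis using Edge_Dof by simp
    qed
  qed
  let ?C = "argyris_const \<sigma>"
  have C0: "0 \<le> ?C" using s(1) by (simp add: argyris_const_def)
  have M0: "0 \<le> M" using s(3) S0 E0 by (simp add: M_def)
  have Rb: "\<bar>mderiv \<alpha> R x\<bar> * h ^ l \<le> ?C * M" if "x \<in> U" "\<alpha> \<in> mindices l" for x \<alpha>
    using argyris_estimate[OF cell R Rdofs[unfolded h_def], of x \<alpha>] dK[of x a] that vin[of a] UK l
    by (auto simp: h_def mindices_def)
  have JR: "jet U 6 (smooth_jet U R)" by (rule jet_smooth_jet[OF U(1,3) sR])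
  have eR: "energy l (smooth_jet U R) \<le> 112 * ?C\<^sup>2 * ?S * ?E * (h ^ (6 - l))\<^sup>2"
  proof -
    have iU: "integrable lborel (indicator U :: pt \<Rightarrow> real)"
      using U emeasure_bounded_finite[OF U(3)] by (intro integrable_real_indicator) auto
    have "(\<integral>x. (smooth_jet U R \<alpha> x)\<^sup>2 \<partial>lborel) \<le> (?C * M / h ^ l)\<^sup>2 * (4 * h\<^sup>2)" if \<alpha>: "\<alpha> \<in> mindices l" for \<alpha>
    proof -
      have "L2_on U (smooth_jet U R \<alpha>)" using JR \<alpha> l by (cases \<alpha>) (simp add: jet_def mindices_def)
      then have i: "integrable lborel (\<lambda>x. (smooth_jet U R \<alpha> x)\<^sup>2)" by (simp add: L2_on_def)
      have "(smooth_jet U R \<alpha> x)\<^sup>2 \<le> (?C * M / h ^ l)\<^sup>2 * indicator U x" for x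
      proof (cases "x \<in> U")
        case True
        have "\<bar>mderiv \<alpha> R x\<bar> \<le> ?C * M / h ^ l" using Rb[OF True \<alpha>] s(3) by (simp add: pos_le_divide_eq)
        then have "\<bar>mderiv \<alpha> R x\<bar>\<^sup>2 \<le> (?C * M / h ^ l)\<^sup>2" by (intro power_mono) auto
        then show ?thesis using True by (simp add: smooth_jet_def zext_def)
      qed (simp add: smooth_jet_def zext_def)
      then have "(\<integral>x. (smooth_jet U R \<alpha> x)\<^sup>2 \<partial>lborel) \<le> (\<integral>x. (?C * M / h ^ l)\<^sup>2 * indicator U x \<partial>lborel)"
        using i iU by (intro integral_mono) auto
      also have "\<dots> = (?C * M / h ^ l)\<^sup>2 * measure lborel U" using iU by simp
      also have "\<dots> \<le> (?C * M / h ^ l)\<^sup>2 * (4 * h\<^sup>2)"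
        by (intro mult_left_mono measure_le_square[OF U(1) d]) auto
      finally show ?thesis .
    qed
    then have "energy l (smooth_jet U R) \<le> (\<Sum>\<alpha>\<in>mindices l. (?C * M / h ^ l)\<^sup>2 * (4 * h\<^sup>2))"
      unfolding energy_def by (rule sum_mono)
    also have "\<dots> = real (l + 1) * ((?C * M / h ^ l)\<^sup>2 * (4 * h\<^sup>2))"
      by (simp add: mindices_eq card_image inj_on_def)
    also have "\<dots> \<le> 7 * ((?C * M / h ^ l)\<^sup>2 * (4 * h\<^sup>2))" using l by (intro mult_right_mono) auto
    also have "\<dots> = 28 * ?C\<^sup>2 * (M * h / h ^ l)\<^sup>2" by (simp add: power_mult_distrib power_divide)
    also have "M * h / h ^ l = 2 * ?B * h ^ (6 - l)"
    proof -
      have "h ^ (6 - l) * h ^ l = h ^ 6" using l by (simp add: power_add[symmetric])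
      then have "h ^ 6 / h ^ l = h ^ (6 - l)" using s(3) by (simp add: field_simps)
      moreover have "M * h / h ^ l = 2 * ?B * (h ^ 6 / h ^ l)" by (simp add: M_def eval_nat_numeral)
      ultimately show ?thesis by simp
    qed
    also have "28 * ?C\<^sup>2 * (2 * ?B * h ^ (6 - l))\<^sup>2 = 112 * ?C\<^sup>2 * ?B\<^sup>2 * (h ^ (6 - l))\<^sup>2" by (simp add: power_mult_distrib)
    also have "?B\<^sup>2 = ?S * ?E" using S0 E0 by simp
    finally show ?thesis by (simp add: mult.assoc)
  qed
  have eW: "energy l W \<le> (16 / \<sigma>) ^ 6 * ?E * (h ^ (6 - l))\<^sup>2"
  proof -
    have \<mu>8: "8 / \<mu> = 16 / \<sigma>" by (simp add: \<mu>_def)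
    have hsq: "(h\<^sup>2) ^ (6 - l) = (h ^ (6 - l))\<^sup>2" by (simp only: power_mult[symmetric] mult.commute)
    have "energy l W \<le> (8 / \<mu> * h\<^sup>2) ^ (6 - l) * ?E" by (rule energy_poincare[OF U d \<mu>(1,3) W mean l])
    also have "\<dots> = (16 / \<sigma>) ^ (6 - l) * (?E * (h ^ (6 - l))\<^sup>2)"
      by (simp only: \<mu>8 power_mult_distrib hsq mult.assoc mult.commute[of ?E])
    also have "\<dots> \<le> (16 / \<sigma>) ^ 6 * (?E * (h ^ (6 - l))\<^sup>2)"
      using s E0 by (intro mult_right_mono power_increasing) auto
    finally show ?thesis by (simp add: mult.assoc)
  qed
  have JP: "jet U 6 (smooth_jet U P)" by (rule jet_smooth_jet[OF U(1,3) sP])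
  have GP: "jet U 6 (\<lambda>\<alpha> x. G \<alpha> x - smooth_jet U P \<alpha> x)" by (rule jet_diff[OF U(1,3) G(1) JP])
  have WR: "(\<lambda>\<alpha> x. G \<alpha> x - smooth_jet U P \<alpha> x) = (\<lambda>\<alpha> x. W \<alpha> x - smooth_jet U R \<alpha> x)"
    unfolding W_def smooth_jet_def R_def mderiv_linear[OF sP sq] by (simp add: fun_eq_iff zext_def)
  let ?c = "2 * (16 / \<sigma>) ^ 6 + 224 * ?C\<^sup>2 * ?S"
  have "energy l (\<lambda>\<alpha> x. G \<alpha> x - smooth_jet U P \<alpha> x) \<le> 2 * energy l W + 2 * energy l (smooth_jet U R)"
    unfolding WR by (rule energy_diff_le[OF W JR l])
  also have "\<dots> \<le> 2 * ((16 / \<sigma>) ^ 6 * ?E * (h ^ (6 - l))\<^sup>2) + 2 * (112 * ?C\<^sup>2 * ?S * ?E * (h ^ (6 - l))\<^sup>2)"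
    using eW eR by linarith
  also have "\<dots> = ?c * ((h ^ (6 - l))\<^sup>2 * ?E)" by (simp add: algebra_simps)
  finally have en: "energy l (\<lambda>\<alpha> x. G \<alpha> x - smooth_jet U P \<alpha> x) \<le> ?c * ((h ^ (6 - l))\<^sup>2 * ?E)" .
  have cP: "continuous_on U P" using sP by (rule smooth_continuous)
  have cuv: "continuous_on U (\<lambda>x. u x - v x)"
    by (rule continuous_on_eq[OF continuous_on_diff[OF cu cP]]) (use v in \<open>simp add: U_def\<close>)
  have AE: "AE x in lborel. G (0, 0) x - smooth_jet U P (0, 0) x = zext U (\<lambda>x. u x - v x) x"
    using G(2) by eventually_elim (use v in \<open>auto simp: smooth_jet_def zext_def mderiv_def U_def\<close>)
  have "sobolev_seminorm l K (\<lambda>x. u x - v x) = sqrt (energy l (\<lambda>\<alpha> x. G \<alpha> x - smooth_jet U P \<alpha> x))"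
    by (rule sobolev_seminorm_jet[OF U(1,3) _ GP _ cuv l]) (use AE in \<open>auto simp: U_def\<close>)
  also have "\<dots> \<le> sqrt (?c * ((h ^ (6 - l))\<^sup>2 * ?E))" using en by (rule real_sqrt_le_mono)
  also have "\<dots> = sqrt ?c * (h ^ (6 - l) * sqrt ?E)" using s(3) by (simp only: real_sqrt_mult) simp
  also have "\<dots> \<le> cell_const \<sigma> * (h ^ (6 - l) * sqrt ?E)"
    unfolding cell_const_def \<mu>_def using s(3) E0 by (intro mult_right_mono) auto
  also have "sqrt ?E = sobolev_seminorm 6 K u"
    unfolding EG by (rule sobolev_seminorm_jet[OF U(1,3) _ G cu, symmetric]) (auto simp: U_def)
  finally show "sobolev_seminorm l K (\<lambda>x. u x - v x) \<le> cell_const \<sigma> * diameter K ^ (6 - l) * sobolev_seminorm 6 K u"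
    by (simp add: h_def mult.assoc)
qed

section \<open>Agreement of the traces of adjacent cells\<close>

text \<open>A limit from inside \<open>U\<close> is also the limit along points of the closure where the function is continuous,
because the values at such points are themselves limits from inside \<open>U\<close>.\<close>

lemma trace_along_closure:
  fixes f :: "pt \<Rightarrow> real"
  assumes U: "open U" and t: "(f \<longlongrightarrow> t) (at a within U)"
    and z: "\<And>n. z n \<in> closure U" "\<And>n. z n \<noteq> a" "\<And>n. isCont f (z n)" and lim: "z \<longlonglongrightarrow> a"
  shows "(\<lambda>n. f (z n)) \<longlonglongrightarrow> t"
proof (rule LIMSEQ_I)
  fix e :: real assume e: "0 < e"
  obtain \<delta> where \<delta>: "\<delta> > 0" "\<And>x. x \<in> U \<Longrightarrow> 0 < dist x a \<Longrightarrow> dist x a < \<delta> \<Longrightarrow> dist (f x) t < e / 2"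
    using t e unfolding Lim_within by (meson half_gt_zero)
  obtain N where N: "\<And>n. n \<ge> N \<Longrightarrow> dist (z n) a < \<delta>" using lim \<delta>(1) unfolding LIMSEQ_def by blast
  have "norm (f (z n) - t) < e" if n: "n \<ge> N" for n
  proof -
    have op: "open (ball a \<delta> - {a})" by (simp add: open_delete)
    have "z n \<in> ball a \<delta> - {a}" using N[OF n] z(2) by (simp add: dist_commute)
    then have "\<forall>\<^sub>F x in at (z n) within U. x \<in> ball a \<delta> - {a}"
      using op eventually_at_topological by blast
    moreover have "\<forall>\<^sub>F x in at (z n) within U. x \<in> U" by (simp add: eventually_at_filter)
    moreover have "\<bar>f x - t\<bar> \<le> e / 2" if "x \<in> ball a \<delta> - {a}" "x \<in> U" for x
      using \<delta>(2)[OF that(2)] that(1) by (simp add: dist_commute[of a] dist_real_def less_imp_le)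
    ultimately have "\<forall>\<^sub>F x in at (z n) within U. \<bar>f x - t\<bar> \<le> e / 2"
      by (auto elim: eventually_elim2)
    moreover have "((\<lambda>x. \<bar>f x - t\<bar>) \<longlongrightarrow> \<bar>f (z n) - t\<bar>) (at (z n) within U)"
      using z(3)[of n] by (intro tendsto_intros) (metis isCont_def tendsto_within_subset subset_UNIV)
    moreover have "at (z n) within U \<noteq> bot"
      using islimpt_open_closure[OF U z(1)] by (simp add: trivial_limit_within)
    ultimately have "\<bar>f (z n) - t\<bar> \<le> e / 2" by (intro tendsto_upperbound) auto
    then show ?thesis using e by simp
  qed
  then show "\<exists>N. \<forall>n\<ge>N. norm (f (z n) - t) < e" by blast
qed

lemma Ck_2_mderiv_continuous:
  assumes "Ck_on 2 \<Omega> u" "\<alpha> \<in> mindices_upto 2" shows "continuous_on \<Omega> (mderiv \<alpha> u)"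
proof -
  have "Ck_on (Suc (Suc 0)) \<Omega> u" using assms(1) by (simp add: numeral_2_eq_2)
  then have "Ck_on (Suc 0) \<Omega> (partial k u)" "Ck_on 0 \<Omega> (partial l (partial k u))" for k l by auto
  then have "continuous_on \<Omega> u" "continuous_on \<Omega> (partial k u)" "continuous_on \<Omega> (partial l (partial k u))" for k l
    using assms(1) Ck_on_imp_continuous by blast+
  then show ?thesis using assms(2) unfolding mindices_upto_2
    by (elim insertE emptyE) (simp_all add: mderiv_def numeral_2_eq_2)
qed

lemma trace_dof_interior:
  assumes mesh: "conforming_mesh \<Omega> T vert" and u: "Ck_on 2 \<Omega> u" and z: "z \<in> \<Omega>" "z \<in> closure U" and U: "open U"
    and \<alpha>: "\<alpha> \<in> mindices_upto 2"
  shows "Lim (at z within U) (mderiv \<alpha> u) = mderiv \<alpha> u z"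
proof (rule tendsto_Lim)
  show "at z within U \<noteq> bot" using islimpt_open_closure[OF U z(2)] by (simp add: trivial_limit_within)
  have "open \<Omega>" using mesh by (simp add: conforming_mesh_def)
  then have "isCont (mderiv \<alpha> u) z"
    using Ck_2_mderiv_continuous[OF u \<alpha>] z(1) by (simp add: continuous_on_eq_continuous_at)
  then show "(mderiv \<alpha> u \<longlongrightarrow> mderiv \<alpha> u z) (at z within U)"
    unfolding isCont_def by (rule tendsto_within_subset) simp
qed

text \<open>The common edge lies in the closure of both cells and, except for its ends, in \<open>\<Omega>\<close>. Both traces are
therefore limits along the edge.\<close>

lemma adjacent_vertex_trace:
  assumes mesh: "conforming_mesh \<Omega> T vert" and u: "Ck_on 2 \<Omega> u" and \<alpha>: "\<alpha> \<in> mindices_upto 2"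
    and K: "K \<in> T" "K' \<in> T" "adjacent vert K K'" "a \<in> vert K \<inter> vert K'"
    and t: "(mderiv \<alpha> u \<longlongrightarrow> t) (at a within interior K)" "(mderiv \<alpha> u \<longlongrightarrow> t') (at a within interior K')"
    and cl: "closure (interior K) = K" "closure (interior K') = K'"
  shows "t = t'"
proof -
  have ne: "K \<noteq> K'" "card (vert K \<inter> vert K') = 2" using K(3) by (auto simp: adjacent_def)
  then obtain x y where xy: "vert K \<inter> vert K' = {x, y}" "x \<noteq> y" by (auto simp: card_2_iff)
  obtain b where b: "b \<in> vert K \<inter> vert K'" "a \<noteq> b"
  proof (cases "a = x")
    case True then show thesis using that[of y] xy by auto
  next
    case False then show thesis using that[of x] xy by auto
  qed
  define s where "s n = 1 / real (n + 2)" for n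
  have s: "0 < s n" "s n < 1" for n by (simp_all add: s_def)
  define z where "z n = (1 - s n) *\<^sub>R a + s n *\<^sub>R b" for n
  have zO: "z n \<in> \<Omega>" for n unfolding z_def by (rule open_edge_in_domain[OF mesh K(1,2) ne(1) K(4) b s])
  have seg: "z n \<in> L" if "L \<in> T" "a \<in> vert L" "b \<in> vert L" for L n
  proof -
    have "convex hull (vert L) \<subseteq> L" "convex L" using mesh that(1) by (auto simp: conforming_mesh_def cell_shape_def)
    then have "a \<in> L" "b \<in> L" using that hull_subset[of "vert L" convex] by auto
    then show ?thesis unfolding z_def using s[of n] \<open>convex L\<close> by (intro convexD) auto
  qed
  have za: "z n \<noteq> a" for n
  proof
    assume "z n = a"
    then have "s n *\<^sub>R (b - a) = 0" by (simp add: z_def algebra_simps)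
    then show False using s(1)[of n] b(2) by auto
  qed
  have "s \<longlonglongrightarrow> 0" unfolding s_def by real_asymp
  then have "(\<lambda>n. (1 - s n) *\<^sub>R a + s n *\<^sub>R b) \<longlonglongrightarrow> (1 - 0) *\<^sub>R a + 0 *\<^sub>R b" by (intro tendsto_intros)
  then have za_lim: "z \<longlonglongrightarrow> a" by (simp add: z_def[abs_def])
  have "open \<Omega>" using mesh by (simp add: conforming_mesh_def)
  then have cont: "isCont (mderiv \<alpha> u) (z n)" for n
    using Ck_2_mderiv_continuous[OF u \<alpha>] zO by (simp add: continuous_on_eq_continuous_at)
  have "(\<lambda>n. mderiv \<alpha> u (z n)) \<longlonglongrightarrow> t"
    by (rule trace_along_closure[OF open_interior t(1) _ za cont za_lim]) (use cl seg K b in auto)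
  moreover have "(\<lambda>n. mderiv \<alpha> u (z n)) \<longlonglongrightarrow> t'"
    by (rule trace_along_closure[OF open_interior t(2) _ za cont za_lim]) (use cl seg K b in auto)
  ultimately show ?thesis by (rule LIMSEQ_unique)
qed

section \<open>The global interpolant\<close>

locale argyris_setting =
  fixes \<theta> \<kappa> \<gamma> c0 :: real and \<Omega> :: "pt set" and T :: "pt set set" and vert :: "pt set \<Rightarrow> pt set"
    and nrm :: "pt set \<Rightarrow> pt" and u :: "pt \<Rightarrow> real"
  assumes \<theta>: "0 < \<theta>" and mesh: "conforming_mesh \<Omega> T vert" and reg: "regular_mesh \<theta> \<kappa> \<gamma> c0 T vert"
    and nrm: "edge_normals T vert nrm" and u2: "Ck_on 2 \<Omega> u" and u6: "u \<in> broken_sobolev 6 T"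
begin

lemma cell_facts:
  assumes K: "K \<in> T"
  shows "compact K" "convex K" "convex hull (vert K) \<subseteq> K" "Ck_on 2 (interior K) u" "u \<in> sobolev 6 (interior K)"
    "interior K \<noteq> {}" "closure (interior K) = K" "finite (vert K)" "vert K \<noteq> {}"
proof -
  show 1: "compact K" "convex K" "convex hull (vert K) \<subseteq> K"
    using mesh K by (auto simp: conforming_mesh_def cell_shape_def)
  have "interior K \<subseteq> \<Omega>" using mesh K interior_mono[of K "\<Union>T"] by (auto simp: conforming_mesh_def)
  then show "Ck_on 2 (interior K) u" by (rule Ck_on_subset[OF u2])
  show "u \<in> sobolev 6 (interior K)" using u6 K by (simp add: broken_sobolev_def)
  obtain a b c where cell: "argyris_cell vert nrm K a b c (diameter K) (mesh_sigma \<theta> \<kappa>)"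
    using mesh_argyris_cell[OF mesh reg nrm K \<theta>] by blast
  then show "finite (vert K)" "vert K \<noteq> {}" by (auto simp: argyris_cell_def)
  have "0 < mesh_sigma \<theta> \<kappa> / 2 * (diameter K)\<^sup>2" using cell by (auto simp: argyris_cell_def)
  then have "0 < measure lborel (interior K)" using cell_area_ge[OF cell 1] by linarith
  then show ne: "interior K \<noteq> {}" by auto
  show "closure (interior K) = K" using convex_closure_interior[OF 1(2) ne] 1(1) by (simp add: compact_imp_closed)
qed

lemma vertex_in_cell: "K \<in> T \<Longrightarrow> a \<in> vert K \<Longrightarrow> a \<in> K"
  using cell_facts(3)[of K] hull_subset[of "vert K" convex] by auto

lemma trace_exists:
  assumes "K \<in> T" "z \<in> K" "\<alpha> \<in> mindices_upto 2"
  shows "\<exists>t. (mderiv \<alpha> u \<longlongrightarrow> t) (at z within interior K)"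
proof -
  obtain a b c where cell: "argyris_cell vert nrm K a b c (diameter K) (mesh_sigma \<theta> \<kappa>)"
    using mesh_argyris_cell[OF mesh reg nrm assms(1) \<theta>] by blast
  show ?thesis by (rule cell_interpolation(1)[OF cell cell_facts(1-5)[OF assms(1)] assms(2,3)])
qed

text \<open>At a vertex the equality of adjacent traces is propagated through the fan of cells around it. A midpoint
of a shared edge is an interior point of the domain.\<close>

lemma trace_dof_unique:
  assumes K: "K \<in> T" "K' \<in> T" and d: "d \<in> cell_dofs vert K" "d \<in> cell_dofs vert K'"
  shows "trace_dof nrm (interior K) d u = trace_dof nrm (interior K') d u"
proof (cases d)
  case (Vertex_Dof a \<alpha>)
  then have a: "a \<in> vert K" "a \<in> vert K'" and \<alpha>: "\<alpha> \<in> mindices_upto 2" using d by (auto simp: cell_dofs_def)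
  let ?R = "{(L, L'). L \<in> T \<and> L' \<in> T \<and> a \<in> vert L \<inter> vert L' \<and> adjacent vert L L'}"
  have Lim: "(mderiv \<alpha> u \<longlongrightarrow> Lim (at a within interior L) (mderiv \<alpha> u)) (at a within interior L)" if L: "L \<in> T" "a \<in> vert L" for L
  proof -
    obtain t where t: "(mderiv \<alpha> u \<longlongrightarrow> t) (at a within interior L)"
      using trace_exists[OF L(1) vertex_in_cell[OF L] \<alpha>] by blast
    moreover have "at a within interior L \<noteq> bot"
      using islimpt_open_closure[of "interior L" a] cell_facts(7)[OF L(1)] vertex_in_cell[OF L] by (simp add: trivial_limit_within)
    ultimately show ?thesis using tendsto_Lim by metis
  qed
  have "\<forall>a. \<forall>K\<in>T. \<forall>K'\<in>T. a \<in> vert K \<and> a \<in> vert K' \<longrightarrow>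
      (K, K') \<in> {(L, L'). L \<in> T \<and> L' \<in> T \<and> a \<in> vert L \<inter> vert L' \<and> adjacent vert L L'}\<^sup>*"
    using mesh unfolding conforming_mesh_def by (elim conjE)
  then have "(K, K') \<in> ?R\<^sup>*" using K a by simp
  then have "Lim (at a within interior K) (mderiv \<alpha> u) = Lim (at a within interior K') (mderiv \<alpha> u)"
  proof (induction rule: rtrancl_induct)
    case (step L L')
    then have L: "L \<in> T" "L' \<in> T" "a \<in> vert L" "a \<in> vert L'" "adjacent vert L L'" by auto
    have "Lim (at a within interior L) (mderiv \<alpha> u) = Lim (at a within interior L') (mderiv \<alpha> u)"
      by (rule adjacent_vertex_trace[OF mesh u2 \<alpha> L(1,2,5) _ Lim[OF L(1,3)] Lim[OF L(2,4)] cell_facts(7)[OF L(1)] cell_facts(7)[OF L(2)]])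
        (use L in simp)
    then show ?case using step.IH by simp
  qed simp
  then show ?thesis using Vertex_Dof by simp
next
  case (Edge_Dof e)
  show ?thesis
  proof (cases "K = K'")
    case False
    have e: "e \<subseteq> vert K" "e \<subseteq> vert K'" "card e = 2" using d Edge_Dof by (auto simp: cell_dofs_def edges_def)
    then obtain a b where ab: "e = {a, b}" "a \<noteq> b" by (auto simp: card_2_iff)
    have m: "edge_midpoint e = (1 - 1/2) *\<^sub>R a + (1/2) *\<^sub>R b"
      using ab by (simp add: edge_midpoint_pair scaleR_add_right)
    have mO: "edge_midpoint e \<in> \<Omega>"
      unfolding m by (rule open_edge_in_domain[OF mesh K False]) (use e ab in auto)
    have "Lim (at (edge_midpoint e) within interior L) (partial k u) = partial k u (edge_midpoint e)"
      if L: "L \<in> T" "e \<subseteq> vert L" for L k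
    proof -
      have "edge_midpoint e \<in> L" unfolding m
        using vertex_in_cell[OF L(1)] L(2) ab cell_facts(2)[OF L(1)] by (intro convexD) auto
      then have "edge_midpoint e \<in> closure (interior L)" using cell_facts(7)[OF L(1)] by simp
      then show ?thesis unfolding partial_eq_mderiv
        by (intro trace_dof_interior[OF mesh u2 mO]) (auto simp: mindices_upto_def)
    qed
    then show ?thesis using K e Edge_Dof by simp
  qed simp
qed

text \<open>The choice of the cell is immaterial by \<open>trace_dof_unique\<close>.\<close>

definition interpolant_dof :: "dof \<Rightarrow> real" where
  "interpolant_dof d = trace_dof nrm (interior (SOME K. K \<in> T \<and> d \<in> cell_dofs vert K)) d u"

lemma interpolant_dof_eq:
  assumes "K \<in> T" "d \<in> cell_dofs vert K"
  shows "interpolant_dof d = trace_dof nrm (interior K) d u"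
proof -
  have "(SOME K. K \<in> T \<and> d \<in> cell_dofs vert K) \<in> T \<and> d \<in> cell_dofs vert (SOME K. K \<in> T \<and> d \<in> cell_dofs vert K)"
    by (rule someI[of "\<lambda>K. K \<in> T \<and> d \<in> cell_dofs vert K"]) (use assms in blast)
  then show ?thesis unfolding interpolant_dof_def using trace_dof_unique assms by blast
qed

definition interpolant :: "pt \<Rightarrow> real" where
  "interpolant x = (\<Sum>d\<in>mesh_dofs T vert. interpolant_dof d * global_basis T vert nrm d x)"

lemma interpolant_in_space: "interpolant \<in> argyris_space T vert nrm"
  unfolding argyris_space_def interpolant_def[abs_def] by blast

text \<open>A point in the interior of \<open>K\<close> belongs to no other cell, so the global basis functions reduce to the
local ones of \<open>K\<close>, and those of degrees of freedom outside \<open>K\<close> vanish.\<close>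

lemma interpolant_on_cell:
  assumes K: "K \<in> T" and x: "x \<in> interior K"
  shows "interpolant x = (\<Sum>d\<in>cell_dofs vert K. interpolant_dof d * local_basis vert nrm K d x)"
proof -
  have xK: "x \<in> K" using x interior_subset by blast
  have "(SOME L. L \<in> T \<and> x \<in> L) \<in> T \<and> x \<in> (SOME L. L \<in> T \<and> x \<in> L)"
    by (rule someI[of "\<lambda>L. L \<in> T \<and> x \<in> L"]) (use K xK in blast)
  then have "(SOME L. L \<in> T \<and> x \<in> L) = K"
    using interior_cell_unique[OF mesh K _ x] cell_facts(6) by blast
  then have gb: "global_basis T vert nrm d x = local_basis vert nrm K d x" for d
    using K xK by (auto simp: global_basis_def)
  have "finite T" using mesh by (simp add: conforming_mesh_def)
  then have fin: "finite (mesh_dofs T vert)"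
    unfolding mesh_dofs_def using finite_cell_dofs cell_facts(8) by blast
  show ?thesis unfolding interpolant_def gb
    by (rule sum.mono_neutral_right[OF fin]) (use K in \<open>auto simp: mesh_dofs_def local_basis_def\<close>)
qed

theorem interpolation_error:
  assumes K: "K \<in> T" and l: "l \<le> 6"
  shows "sobolev_seminorm l K (\<lambda>x. u x - interpolant x)
    \<le> cell_const (mesh_sigma \<theta> \<kappa>) * diameter K ^ (6 - l) * sobolev_seminorm 6 K u"
proof -
  obtain a b c where cell: "argyris_cell vert nrm K a b c (diameter K) (mesh_sigma \<theta> \<kappa>)"
    using mesh_argyris_cell[OF mesh reg nrm K \<theta>] by blast
  show ?thesis
  proof (rule cell_interpolation(2)[OF cell cell_facts(1-5)[OF K] local_basis_combination(1)[OF cell] _ interpolant_on_cell[OF K] l])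
    show "dof_value nrm d (\<lambda>x. \<Sum>d\<in>cell_dofs vert K. interpolant_dof d * local_basis vert nrm K d x) = trace_dof nrm (interior K) d u"
      if "d \<in> cell_dofs vert K" for d
      using local_basis_combination(2)[OF cell that] interpolant_dof_eq[OF K that] by simp
  qed
qed

lemma cell_le_patch:
  assumes K: "K \<in> T"
  shows "diameter K \<le> patch_size T vert K" "sobolev_seminorm 6 K u \<le> patch_seminorm 6 T vert K u" "0 \<le> diameter K"
proof -
  have fin: "finite (patch T vert K)" using mesh by (simp add: patch_def conforming_mesh_def)
  have mem: "K \<in> patch T vert K" using K cell_facts(9)[OF K] by (simp add: patch_def)
  show "diameter K \<le> patch_size T vert K" unfolding patch_size_def using fin mem by (intro Max_ge) auto
  have nn: "0 \<le> sobolev_seminorm 6 K u"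
    unfolding sobolev_seminorm_def set_lebesgue_integral_def by (intro real_sqrt_ge_zero sum_nonneg integral_nonneg_AE AE_I2) auto
  have "(sobolev_seminorm 6 K u)\<^sup>2 \<le> (\<Sum>K'\<in>patch T vert K. (sobolev_seminorm 6 K' u)\<^sup>2)"
    by (rule member_le_sum[OF mem]) (use fin in auto)
  then show "sobolev_seminorm 6 K u \<le> patch_seminorm 6 T vert K u"
    unfolding patch_seminorm_def using nn by (simp add: real_le_rsqrt)
  show "0 \<le> diameter K" using cell_facts(1)[OF K] by (intro diameter_ge_0 compact_imp_bounded)
qed

end

lemma cell_const_pos: "0 < \<sigma> \<Longrightarrow> 0 < cell_const \<sigma>"
  unfolding cell_const_def by (intro add_nonneg_pos real_sqrt_ge_zero) (auto simp: sup_const_def)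

theorem theorem4:
  fixes \<theta> \<kappa> \<gamma> c0 :: real
  assumes "\<theta> > 0" and "c0 > 0"
  shows "\<exists>c>0. \<forall>(\<Omega> :: pt set) (T :: pt set set) (vert :: pt set \<Rightarrow> pt set)
            (nrm :: pt set \<Rightarrow> pt) (u :: pt \<Rightarrow> real).
     conforming_mesh \<Omega> T vert \<and> regular_mesh \<theta> \<kappa> \<gamma> c0 T vert \<and> edge_normals T vert nrm \<and>
     Ck_on 2 \<Omega> u \<and> u \<in> broken_sobolev 6 T \<longrightarrow>
     (\<exists>v\<in>argyris_space T vert nrm. \<forall>K\<in>T. \<forall>l\<le>6.
        sobolev_seminorm l K (\<lambda>x. u x - v x)
          \<le> c * patch_size T vert K ^ (6 - l) * patch_seminorm 6 T vert K u)"
proof (intro exI[of _ "cell_const (mesh_sigma \<theta> \<kappa>)"] conjI allI impI)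
  show pos: "0 < cell_const (mesh_sigma \<theta> \<kappa>)" by (intro cell_const_pos mesh_sigma_bounds)
  fix \<Omega> T vert nrm u
  assume "conforming_mesh \<Omega> T vert \<and> regular_mesh \<theta> \<kappa> \<gamma> c0 T vert \<and> edge_normals T vert nrm \<and>
     Ck_on 2 \<Omega> u \<and> u \<in> broken_sobolev 6 T"
  then interpret argyris_setting \<theta> \<kappa> \<gamma> c0 \<Omega> T vert nrm u
    using assms(1) by unfold_locales auto
  have "sobolev_seminorm l K (\<lambda>x. u x - interpolant x)
          \<le> cell_const (mesh_sigma \<theta> \<kappa>) * patch_size T vert K ^ (6 - l) * patch_seminorm 6 T vert K u"
    if "K \<in> T" "l \<le> 6" for K l
  proof -
    note p = cell_le_patch[OF that(1)]
    have nn: "0 \<le> patch_seminorm 6 T vert K u"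
      unfolding patch_seminorm_def by (intro real_sqrt_ge_zero sum_nonneg) auto
    have "sobolev_seminorm l K (\<lambda>x. u x - interpolant x)
        \<le> cell_const (mesh_sigma \<theta> \<kappa>) * diameter K ^ (6 - l) * sobolev_seminorm 6 K u"
      by (rule interpolation_error[OF that])
    also have "\<dots> \<le> cell_const (mesh_sigma \<theta> \<kappa>) * diameter K ^ (6 - l) * patch_seminorm 6 T vert K u"
      using p pos by (intro mult_left_mono) auto
    also have "\<dots> \<le> cell_const (mesh_sigma \<theta> \<kappa>) * patch_size T vert K ^ (6 - l) * patch_seminorm 6 T vert K u"
      using p pos nn by (intro mult_right_mono mult_left_mono power_mono) auto
    finally show ?thesis .
  qed
  then show "\<exists>v\<in>argyris_space T vert nrm. \<forall>K\<in>T. \<forall>l\<le>6.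
        sobolev_seminorm l K (\<lambda>x. u x - v x)
          \<le> cell_const (mesh_sigma \<theta> \<kappa>) * patch_size T vert K ^ (6 - l) * patch_seminorm 6 T vert K u"
    using interpolant_in_space by blast
qed

end
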